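(* Let $A=(A_1,\dots,A_N)\in\mathcal M_d(\mathbb R)^N$, let $\pi=(\pi_1,\dots,\pi_N)\in(0,1]^N$ be a probability vector, and define $M=\sum_{j=1}^N\pi_jA_j$. Let $P\in\mathcal M_N(\mathbb R)$ be the matrix with all rows equal to $\pi$ and $(\mu_n)_{n\in\mathbb N}$ be a sequence of positive numbers tending to $+\infty$. If $M$ satisfies condition (C) for $A$, then $$\lim_{n\to\infty}\lambda_{\mathrm p}(\pi,\mu_n,P,A)=\lambda(M).$$
   Context: $d,N$ are positive integers; $\mathcal M_d(\mathbb R)$ is the space of real $d\times d$ matrices; $\|\cdot\|$ is an operator norm induced by a norm on $\mathbb R^d$; $\lambda(M)$ is the spectral abscissa of $M$ (maximum of the real parts of its eigenvalues). For $\mu>0$, the Markov process $(\pi,\mu,P)$, $P=(p_{ij})$, is the continuous-time Markov chain $\sigma$ on $\{1,\dots,N\}$ with initial law $\pi$, transition matrix $P$ and jump rate $\mu$ (independent exponential inter-jump times of parameter $\mu$; at each jump, $i\to j$ with probability $p_{ij}$, trivial jumps allowed). $\Phi_\sigma(t)$ is the flow of $\dot x=A_{\sigma(t)}x$ with $\Phi_\sigma(0)=\mathrm{Id}$, and $\lambda_{\mathrm p}(\pi,\mu,P,A)=\limsup_{t\to+\infty}\frac1t\mathbb E[\log\|\Phi_\sigma(t)\|]$. Condition (C): for $M\in\mathcal M_d(\mathbb R)$, let $\xi_1>\dots>\xi_k$ be the distinct real parts of the eigenvalues of $M$, and for $j\in\{1,\dots,k\}$ let $E_j\subset\mathbb R^d$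 be the (real) space spanned by the generalized eigenvectors of $M$ corresponding to eigenvalues with real part $\xi_j$. For $B\in\mathcal M_d(\mathbb R)$, let $F_B(x)=Bx-(x\cdot Bx)x$, a vector field on the Euclidean unit sphere $S^{d-1}$. $M$ satisfies condition (C) for $A$ if, for every $j\in\{2,\dots,k\}$, there exists $i\in\{1,\dots,N\}$ such that, for every $\theta\in E_j\cap S^{d-1}$, one has $F_{A_i}(\theta)\notin\bigoplus_{r\geq j}E_r$. *)

theory Defs
  imports "HOL-Probability.Probability"
begin

section \<open>Norms and operator norms\<close>

definition is_norm :: "(real^'d \<Rightarrow> real) \<Rightarrow> bool" where
  "is_norm \<nu> \<longleftrightarrow>
     (\<forall>x. \<nu> x = 0 \<longleftrightarrow> x = 0) \<and>
     (\<forall>c x. \<nu> (c *\<^sub>R x) = \<bar>c\<bar> * \<nu> x) \<and>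
     (\<forall>x y. \<nu> (x + y) \<le> \<nu> x + \<nu> y)"

text \<open>As in \<^const>\<open>onorm\<close>, the value at the zero vector is \<open>0 / 0 = 0\<close>, which does not
  affect the supremum.\<close>

definition induced_norm :: "(real^'d \<Rightarrow> real) \<Rightarrow> real^'d^'d \<Rightarrow> real" where
  "induced_norm \<nu> M = (SUP x. \<nu> (M *v x) / \<nu> x)"

section \<open>Spectrum of a real matrix\<close>

definition complexify :: "real^'d^'d \<Rightarrow> complex^'d^'d" where
  "complexify M = (\<chi> i j. complex_of_real (M $ i $ j))"

definition complex_spectrum :: "real^'d^'d \<Rightarrow> complex set" where
  "complex_spectrum M = {z. \<exists>v. v \<noteq> 0 \<and> complexify M *v v = z *s v}"

definition spectral_abscissa :: "real^'d^'d \<Rightarrow> real" where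
  "spectral_abscissa M = Max (Re ` complex_spectrum M)"

definition generalized_eigenvector :: "real^'d^'d \<Rightarrow> complex \<Rightarrow> complex^'d \<Rightarrow> bool" where
  "generalized_eigenvector M z v \<longleftrightarrow>
     v \<noteq> 0 \<and> (\<exists>k. ((\<lambda>w. complexify M *v w - z *s w) ^^ k) v = 0)"

text \<open>The real space spanned by complex vectors is spanned by their real and imaginary parts.\<close>

definition real_part_space :: "real^'d^'d \<Rightarrow> real \<Rightarrow> (real^'d) set" where
  "real_part_space M \<xi> = span (\<Union>v\<in>{v. \<exists>z. Re z = \<xi> \<and> generalized_eigenvector M z v}.
     {\<chi> i. Re (v $ i), \<chi> i. Im (v $ i)})"

section \<open>Condition (C)\<close>

definition sphere_field :: "real^'d^'d \<Rightarrow> real^'d \<Rightarrow> real^'d" where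
  "sphere_field B x = B *v x - (x \<bullet> (B *v x)) *\<^sub>R x"

text \<open>The spaces \<open>E\<^sub>1, \<dots>, E\<^sub>k\<close> are indexed here by the real parts
  \<open>\<xi>\<^sub>1 > \<dots> > \<xi>\<^sub>k\<close> themselves, so \<open>j \<ge> 2\<close> becomes \<open>\<xi> \<noteq> \<xi>\<^sub>1\<close> and \<open>r \<ge> j\<close> becomes
  \<open>\<eta> \<le> \<xi>\<close>. The direct sum of the \<open>E\<^sub>r\<close> inside the ambient space is the span of their union.\<close>

definition condition_C :: "real^'d^'d \<Rightarrow> ('n::finite \<Rightarrow> real^'d^'d) \<Rightarrow> bool" where
  "condition_C M A \<longleftrightarrow>
     (\<forall>\<xi> \<in> Re ` complex_spectrum M. \<xi> \<noteq> spectral_abscissa M \<longrightarrow>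
       (\<exists>i. \<forall>\<theta> \<in> real_part_space M \<xi> \<inter> sphere 0 1.
          sphere_field (A i) \<theta> \<notin>
            span (\<Union>\<eta> \<in> {\<eta> \<in> Re ` complex_spectrum M. \<eta> \<le> \<xi>}. real_part_space M \<eta>)))"

section \<open>Continuous-time Markov chains\<close>

text \<open>A realization of the Markov process with initial law \<open>\<pi>\<close>, jump rate \<open>\<mu>\<close> and transition
  matrix \<open>P\<close>: \<open>X k\<close> is the state after \<open>k\<close> jumps and \<open>T k\<close> is the time spent there before the
  next jump, which may be a trivial one. The two sequences are independent of each other;
  \<^const>\<open>prob_space.indep_var\<close> would force them to take values in the same type.\<close>

locale markov_process = prob_space \<Omega> for \<Omega> :: "'w measure" +
  fixes X :: "nat \<Rightarrow> 'w \<Rightarrow> 'n::finite" and T :: "nat \<Rightarrow> 'w \<Rightarrow> real"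
    and \<pi> :: "real^'n" and \<mu> :: real and P :: "real^'n^'n"
  assumes rate_pos: "\<mu> > 0"
    and X_measurable [measurable]: "\<And>k. X k \<in> \<Omega> \<rightarrow>\<^sub>M count_space UNIV"
    and initial_law: "\<And>i. \<P>(\<omega> in \<Omega>. X 0 \<omega> = i) = \<pi> $ i"
    and transition: "\<And>m s j. \<P>(\<omega> in \<Omega>. \<forall>k\<le>m. X k \<omega> = s k) > 0 \<Longrightarrow>
          \<P>(\<omega> in \<Omega>. X (Suc m) \<omega> = j \<bar> \<forall>k\<le>m. X k \<omega> = s k) = P $ s m $ j"
    and T_exponential: "\<And>k. distributed \<Omega> lborel (T k) (exponential_density \<mu>)"
    and T_indep: "indep_vars (\<lambda>_. borel) T UNIV"
    and X_T_indep: "indep_set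
          (sets (vimage_algebra (space \<Omega>) (\<lambda>\<omega> k. X k \<omega>) (\<Pi>\<^sub>M k\<in>UNIV. count_space UNIV)))
          (sets (vimage_algebra (space \<Omega>) (\<lambda>\<omega> k. T k \<omega>) (\<Pi>\<^sub>M k\<in>UNIV. borel)))"

text \<open>The trajectory equals \<open>X k\<close> on the interval from \<open>T 0 + \<dots> + T (k - 1)\<close> (included) to
  \<open>T 0 + \<dots> + T k\<close> (excluded). Almost surely, the \<^const>\<open>Least\<close> below exists for every \<open>t\<close>.\<close>

definition trajectory ::
    "(nat \<Rightarrow> 'w \<Rightarrow> 'n) \<Rightarrow> (nat \<Rightarrow> 'w \<Rightarrow> real) \<Rightarrow> 'w \<Rightarrow> real \<Rightarrow> 'n" where
  "trajectory X T \<omega> t = X (LEAST k. t < (\<Sum>j\<le>k. T j \<omega>)) \<omega>"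

section \<open>Flow and Lyapunov exponent\<close>

text \<open>Since \<open>B\<close> is discontinuous at the jump times, the equation \<open>\<Phi>' = B \<Phi>\<close>, \<open>\<Phi> 0 = 1\<close> is
  understood in the Caratheodory sense, i.e. in integral form.\<close>

definition fundamental_solution ::
    "(real \<Rightarrow> real^'d^'d) \<Rightarrow> (real \<Rightarrow> real^'d^'d) \<Rightarrow> bool" where
  "fundamental_solution B \<Phi> \<longleftrightarrow> continuous_on {0..} \<Phi> \<and>
     (\<forall>t\<ge>0. ((\<lambda>s. B s ** \<Phi> s) has_integral (\<Phi> t - mat 1)) {0..t})"

text \<open>Fundamental solutions are unique on \<open>{0..}\<close> only, hence the description of the value at
  time \<open>t\<close>; it is meaningful for \<open>t \<ge> 0\<close>.\<close>

definition flow :: "(real \<Rightarrow> real^'d^'d) \<Rightarrow> real \<Rightarrow> real^'d^'d" where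
  "flow B t = (THE Y. \<exists>\<Phi>. fundamental_solution B \<Phi> \<and> \<Phi> t = Y)"

definition lyapunov_exponent ::
    "(real^'d \<Rightarrow> real) \<Rightarrow> ('n \<Rightarrow> real^'d^'d) \<Rightarrow> 'w measure \<Rightarrow>
      (nat \<Rightarrow> 'w \<Rightarrow> 'n) \<Rightarrow> (nat \<Rightarrow> 'w \<Rightarrow> real) \<Rightarrow> ereal" where
  "lyapunov_exponent \<nu> A \<Omega> X T =
     Limsup at_top (\<lambda>t::real. ereal (1 / t *
       (LINT \<omega>|\<Omega>. ln (induced_norm \<nu> (flow (\<lambda>s. A (trajectory X T \<omega> s)) t)))))"

end

theory Submission
  imports Defs "HOL-Computational_Algebra.Fundamental_Theorem_Algebra"
begin

text \<open>
  Let \<open>\<epsilon> = 1 / \<mu>\<close> be the mean time between jumps, and let \<open>y\<^sub>k\<close> be the state at the \<open>k\<close>-th jump of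
  the solution started at \<open>x\<close>, so that \<open>y\<^sub>k\<close> is a product of \<open>k\<close> random factors
  \<open>exp (T\<^sub>j A\<^bsub>X\<^sub>j\<^esub>)\<close>. Since all rows of the transition matrix are \<open>\<pi>\<close>, these factors are
  independent and \<open>y\<close> is a Markov chain; its one-step averaging operator is called \<open>K \<epsilon>\<close> below. The chain
  is observed over blocks of \<open>m \<approx> \<tau> / \<epsilon>\<close> jumps. After \<open>b\<close> blocks the elapsed time differs from
  \<open>b m \<epsilon>\<close> by \<open>O(sqrt (b m) \<epsilon>)\<close> in mean, which is negligible compared with \<open>b m \<epsilon>\<close>, so the
  exponent can be read off from \<open>E ln \<bar>y\<^bsub>bm\<^esub>\<bar>\<close>.

  \<^emph>\<open>Averaging.\<close> Over bounded times the chain follows the flow of the mean matrix: the fourth moment of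
  \<open>y\<^sub>k - exp (k \<epsilon> M) x\<close> is at most \<open>C \<epsilon>\<^sup>2 \<bar>x\<bar>\<^sup>4\<close> (\<open>fourth_moment\<close>). This alone gives
  \<open>E \<bar>y\<^bsub>bm\<^esub>\<bar> \<le> exp ((\<lambda>(M) + \<delta>) b m \<epsilon>) \<bar>x\<bar>\<close> for small \<open>\<epsilon>\<close>, and the upper bound on the exponent
  follows because the logarithm is concave.

  \<^emph>\<open>The lower bound\<close> needs the chain to spend most of its time in a cone around the top space \<open>E\<^sub>1\<close>, where one
  block multiplies the norm by at least \<open>exp ((\<lambda>(M) - \<delta>) m \<epsilon>)\<close> except with probability \<open>O(\<epsilon>\<^sup>2)\<close>.
  For the spectral projection \<open>U\<close> onto the eigenvalues with real part at least \<open>\<xi>\<close>, consider the ratio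
  \<open>\<bar>U y\<bar> / \<bar>y - U y\<bar>\<close>.
  \<^item> The flow of \<open>M\<close> multiplies the ratio by at least \<open>8\<close> per block, so a block of the chain doubles a ratio
    \<open>r\<close> unless its deviation from that flow is of the order of \<open>r \<bar>y\<bar>\<close>, an event of probability
    \<open>O(\<epsilon>\<^sup>2 / r\<^sup>4)\<close>. Hence a ratio \<open>R sqrt \<epsilon>\<close> with \<open>R\<close> large climbs to any fixed \<open>\<rho>\<close> with probability
    at least \<open>1/2\<close>, and a ratio \<open>\<rho>\<close> persists for \<open>O(1/\<epsilon>)\<close> blocks up to probability \<open>O(\<epsilon>)\<close> (\<open>drift\<close>, \<open>reach\<close>).
  \<^item> A smaller ratio is raised to \<open>R sqrt \<epsilon>\<close> by the noise. If \<open>U A\<^sub>j y\<close> is not small, the random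
    times accumulate in \<open>U y\<close> a fluctuation of size \<open>sqrt \<epsilon>\<close>, and some later blocks amplify it to \<open>R sqrt \<epsilon>\<close>,
    with probability bounded from below (\<open>kick\<close>).
  \<^item> Condition (C) says that \<open>U A\<^sub>j\<close> is bounded from below on \<open>E\<^sub>\<eta>\<close> if \<open>\<eta>\<close> is the real part that
    precedes \<open>\<xi>\<close>: the vector field differs from \<open>A\<^sub>j \<theta>\<close> by a multiple of \<open>\<theta>\<close>, which lies in the kernel of
    \<open>U\<close>. So the noise carries the chain from the cone of one projection into the cone of the next one
    (\<open>transversality\<close>, \<open>reaches_step\<close>).
  Climbing the finitely many real parts shows that from every starting point the top cone is occupied after
  \<open>O(1/\<epsilon>)\<close> blocks with a probability bounded from below. As it is left only with probability \<open>O(\<epsilon>)\<close> in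
  that time, the chain is eventually outside it with small probability, uniformly in \<open>x\<close> (\<open>mixing\<close>), and the
  Cauchy-Schwarz inequality bounds the loss of \<open>E ln \<bar>y\<bar>\<close> on the exceptional blocks
  (\<open>expected_log_lower\<close>).
\<close>

section \<open>Endomorphisms and their exponentials\<close>

text \<open>Bounded operators do not form a type of the class of normed algebras, because the domain and the
  codomain of \<open>'a \<Rightarrow>\<^sub>L 'b\<close> may differ. The copy made here does, with composition as product, so
  that \<^const>\<open>exp\<close> and its theory apply to it.\<close>

typedef (overloaded) 'a endo = "UNIV :: ('a::real_normed_vector \<Rightarrow>\<^sub>L 'a) set"
  morphisms blinfun_of_endo endo_of_blinfun by simp

setup_lifting type_definition_endo

instantiation endo :: (real_normed_vector) real_vector
begin
lift_definition zero_endo :: "'a endo" is 0 .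
lift_definition plus_endo :: "'a endo \<Rightarrow> 'a endo \<Rightarrow> 'a endo" is "(+)" .
lift_definition minus_endo :: "'a endo \<Rightarrow> 'a endo \<Rightarrow> 'a endo" is "(-)" .
lift_definition uminus_endo :: "'a endo \<Rightarrow> 'a endo" is "uminus" .
lift_definition scaleR_endo :: "real \<Rightarrow> 'a endo \<Rightarrow> 'a endo" is "(*\<^sub>R)" .
instance by standard (transfer; simp add: algebra_simps scaleR_add_left scaleR_add_right)+
end

instantiation endo :: (real_normed_vector) real_normed_vector
begin
lift_definition norm_endo :: "'a endo \<Rightarrow> real" is norm .
definition sgn_endo :: "'a endo \<Rightarrow> 'a endo" where "sgn_endo x = scaleR (inverse (norm x)) x"
definition dist_endo :: "'a endo \<Rightarrow> 'a endo \<Rightarrow> real" where "dist_endo x y = norm (x - y)"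
definition uniformity_endo :: "('a endo \<times> 'a endo) filter" where
  "uniformity_endo = (INF e\<in>{0 <..}. principal {(x, y). dist x y < e})"
definition open_endo :: "'a endo set \<Rightarrow> bool" where
  "open_endo S = (\<forall>x\<in>S. \<forall>\<^sub>F (x', y) in uniformity. x' = x \<longrightarrow> y \<in> S)"
instance
proof
  show "dist x y = norm (x - y)" for x y :: "'a endo" by (fact dist_endo_def)
  show "sgn x = scaleR (inverse (norm x)) x" for x :: "'a endo" by (fact sgn_endo_def)
  show "(uniformity :: ('a endo \<times> 'a endo) filter) = (INF e\<in>{0 <..}. principal {(x, y). dist x y < e})"
    by (fact uniformity_endo_def)
  show "open S = (\<forall>x\<in>S. \<forall>\<^sub>F (x', y) in uniformity. x' = x \<longrightarrow> y \<in> S)" for S :: "'a endo set"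
    by (fact open_endo_def)
  show "norm x = 0 \<longleftrightarrow> x = 0" for x :: "'a endo" by transfer simp
  show "norm (x + y) \<le> norm x + norm y" for x y :: "'a endo" by transfer (rule norm_triangle_ineq)
  show "norm (r *\<^sub>R x) = \<bar>r\<bar> * norm x" for r and x :: "'a endo" by transfer simp
qed
end

instantiation endo :: ("{real_normed_vector, perfect_space}") real_normed_algebra_1
begin
lift_definition one_endo :: "'a endo" is id_blinfun .
lift_definition times_endo :: "'a endo \<Rightarrow> 'a endo \<Rightarrow> 'a endo" is "(o\<^sub>L)" .
instance
proof
  fix a b c :: "'a endo" and r :: real
  show "(a * b) * c = a * (b * c)" by transfer (auto intro!: blinfun_eqI)
  show "(a + b) * c = a * c + b * c" by transfer (auto intro!: blinfun_eqI simp: blinfun.add_left)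
  show "a * (b + c) = a * b + a * c" by transfer (auto intro!: blinfun_eqI simp: blinfun.add_left blinfun.add_right)
  show "1 * a = a" "a * 1 = a" by (transfer, auto intro!: blinfun_eqI)+
  show "(r *\<^sub>R a) * b = r *\<^sub>R (a * b)" by transfer (auto intro!: blinfun_eqI simp: blinfun.scaleR_left)
  show "a * (r *\<^sub>R b) = r *\<^sub>R (a * b)"
    by transfer (auto intro!: blinfun_eqI simp: blinfun.scaleR_left blinfun.scaleR_right)
  show "norm (a * b) \<le> norm a * norm b" by transfer (rule norm_blinfun_compose)
  show n1: "norm (1 :: 'a endo) = 1" by transfer simp
  show "(0 :: 'a endo) \<noteq> 1"
  proof
    assume "(0 :: 'a endo) = 1"
    then have "norm (1 :: 'a endo) = norm (0 :: 'a endo)" by simp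
    then show False unfolding n1 by simp
  qed
qed
end

instance endo :: (banach) banach
proof
  fix X :: "nat \<Rightarrow> 'a endo" assume "Cauchy X"
  have d: "dist x y = dist (blinfun_of_endo x) (blinfun_of_endo y)" for x y :: "'a endo"
    unfolding dist_norm by transfer simp
  have "Cauchy (\<lambda>n. blinfun_of_endo (X n))"
    using \<open>Cauchy X\<close> unfolding Cauchy_def d .
  then obtain L where L: "(\<lambda>n. blinfun_of_endo (X n)) \<longlonglongrightarrow> L"
    using Cauchy_convergent_iff convergent_def by blast
  have "X \<longlonglongrightarrow> endo_of_blinfun L"
    using L unfolding tendsto_iff d by (simp add: endo_of_blinfun_inverse)
  then show "convergent X" by (auto simp: convergent_def)
qed

lift_definition app :: "'a endo \<Rightarrow> 'a \<Rightarrow> 'a::real_normed_vector" is blinfun_apply .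

lemma bounded_bilinear_app: "bounded_bilinear (app :: 'a endo \<Rightarrow> 'a::real_normed_vector \<Rightarrow> 'a)"
proof (rule bounded_bilinear.intro)
  show "app (a + a') b = app a b + app a' b" for a a' :: "'a endo" and b by transfer (rule blinfun.add_left)
  show "app a (b + b') = app a b + app a b'" for a :: "'a endo" and b b' by transfer (rule blinfun.add_right)
  show "app (r *\<^sub>R a) b = r *\<^sub>R app a b" for a :: "'a endo" and b r by transfer (rule blinfun.scaleR_left)
  show "app a (r *\<^sub>R b) = r *\<^sub>R app a b" for a :: "'a endo" and b r by transfer (rule blinfun.scaleR_right)
  have "norm (app a b) \<le> norm a * norm b * 1" for a :: "'a endo" and b by transfer (simp add: norm_blinfun)
  then show "\<exists>K. \<forall>a b. norm (app a b :: 'a) \<le> norm a * norm b * K" by blast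
qed

interpretation app: bounded_bilinear app by (rule bounded_bilinear_app)

lemma norm_app: "norm (app A x) \<le> norm A * norm x"
  by transfer (rule norm_blinfun)

lemma app_mult [simp]: "app (A * B) x = app A (app B x)"
  for A B :: "'a::{real_normed_vector, perfect_space} endo"
  by transfer simp

lemma app_one [simp]: "app 1 x = x" for x :: "'a::{real_normed_vector, perfect_space}"
  by transfer simp

lemmas app_simps = app.add_left app.add_right app.diff_left app.diff_right app.scaleR_left
  app.scaleR_right app.minus_left app.minus_right app.zero_left app.zero_right

lemma endo_eqI: "(\<And>x. app A x = app B x) \<Longrightarrow> A = B"
  by transfer (rule blinfun_eqI)

definition endo_of :: "('a \<Rightarrow> 'a) \<Rightarrow> 'a::real_normed_vector endo" where
  "endo_of f = endo_of_blinfun (Blinfun f)"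

lemma app_endo_of: "linear f \<Longrightarrow> app (endo_of f) = f" for f :: "'a \<Rightarrow> 'a::euclidean_space"
  unfolding endo_of_def app.rep_eq
  by (simp add: endo_of_blinfun_inverse bounded_linear_Blinfun_apply linear_conv_bounded_linear)

abbreviation expm :: "real \<Rightarrow> 'a endo \<Rightarrow> 'a::euclidean_space endo" where
  "expm t A \<equiv> exp (t *\<^sub>R A)"

lemma expm_add: "expm (s + t) A = expm s A * expm t A"
  by (simp add: scaleR_add_left exp_add_commuting)

lemma expm_inverse: "app (expm t A) (app (expm (- t) A) x) = x" "app (expm (- t) A) (app (expm t A) x) = x"
proof -
  have e: "expm t A * expm (- t) A = 1" "expm (- t) A * expm t A = 1"
    unfolding expm_add[symmetric] by simp_all
  show "app (expm t A) (app (expm (- t) A) x) = x" "app (expm (- t) A) (app (expm t A) x) = x"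
    unfolding app_mult[symmetric] e by simp_all
qed

lemma norm_expm: "norm (expm t A) \<le> exp (\<bar>t\<bar> * norm A)"
  using norm_exp[of "t *\<^sub>R A"] by simp

lemma norm_expm_app: "norm (app (expm t A) x) \<le> exp (\<bar>t\<bar> * norm A) * norm x"
  by (rule order_trans[OF norm_app mult_right_mono[OF norm_expm]]) simp

lemma norm_expm_app_lower: "exp (- \<bar>t\<bar> * norm A) * norm x \<le> norm (app (expm t A) x)"
proof -
  have "norm x \<le> exp (\<bar>t\<bar> * norm A) * norm (app (expm t A) x)"
    using norm_expm_app[of "-t" A "app (expm t A) x"] by (simp add: expm_inverse(2)[simplified])
  then show ?thesis by (simp add: exp_minus field_simps)
qed

lemma expm_has_vector_derivative:
  "((\<lambda>t. app (expm t A) x) has_vector_derivative app A (app (expm t A) x)) (at t within S)"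
proof -
  have "((\<lambda>t. expm t A) has_vector_derivative A * expm t A) (at t within S)"
    by (rule has_vector_derivative_at_within[OF exp_scaleR_has_vector_derivative_left])
  from bounded_linear.has_vector_derivative[OF app.bounded_linear_left this, of x] show ?thesis by simp
qed

lemma expm_commute:
  assumes "B * A = A * B" shows "B * expm t A = expm t A * B"
proof -
  have pow: "B * A ^ n = A ^ n * B" for n
    using power_commuting_commutes[OF assms[symmetric], of n] by simp
  have s: "(\<lambda>n. (t *\<^sub>R A) ^ n /\<^sub>R fact n) sums expm t A"
    by (rule exp_converges)
  have "(\<lambda>n. B * ((t *\<^sub>R A) ^ n /\<^sub>R fact n)) sums (B * expm t A)"
    by (rule bounded_linear.sums[OF bounded_linear_mult_right s])
  moreover have "(\<lambda>n. ((t *\<^sub>R A) ^ n /\<^sub>R fact n) * B) sums (expm t A * B)"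
    by (rule bounded_linear.sums[OF bounded_linear_mult_left s])
  moreover have "(\<lambda>n. B * ((t *\<^sub>R A) ^ n /\<^sub>R fact n)) = (\<lambda>n. ((t *\<^sub>R A) ^ n /\<^sub>R fact n) * B)"
    by (simp add: pow)
  ultimately show ?thesis by (simp add: sums_iff)
qed

lemma expm_app_commute: "app (expm t A) (app A x) = app A (app (expm t A) x)"
  by (simp flip: app_mult add: exp_times_scaleR_commute)

lemma continuous_on_expm [continuous_intros]:
  "continuous_on S f \<Longrightarrow> continuous_on S (\<lambda>x. expm (f x) A)"
proof -
  have "continuous_on UNIV (\<lambda>t. expm t A)"
    by (intro continuous_at_imp_continuous_on ballI)
       (rule has_vector_derivative_continuous[OF exp_scaleR_has_vector_derivative_left])
  then show "continuous_on S f \<Longrightarrow> continuous_on S (\<lambda>x. expm (f x) A)"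
    by (rule continuous_on_compose2) auto
qed

lemma continuous_on_app [continuous_intros]:
  "continuous_on S f \<Longrightarrow> continuous_on S g \<Longrightarrow> continuous_on S (\<lambda>x. app (f x) (g x))"
  by (rule app.continuous_on)

text \<open>By the mean value inequality, the derivative being \<open>A exp (s A) x\<close>.\<close>

lemma expm_first_order: "norm (app (expm t A) x - x) \<le> \<bar>t\<bar> * norm A * exp (\<bar>t\<bar> * norm A) * norm x"
proof -
  let ?S = "cball (0::real) \<bar>t\<bar>"
  have "norm (app (expm t A) x - app (expm 0 A) x) \<le> (norm A * exp (\<bar>t\<bar> * norm A) * norm x) * norm (t - 0)"
  proof (rule differentiable_bound[where S = ?S and f' = "\<lambda>s h. h *\<^sub>R app A (app (expm s A) x)"])
    show "((\<lambda>s. app (expm s A) x) has_derivative (\<lambda>h. h *\<^sub>R app A (app (expm s A) x))) (at s within ?S)" for s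
      using expm_has_vector_derivative[of A x s ?S] by (simp add: has_vector_derivative_def)
    fix s assume s: "s \<in> ?S"
    have "norm (app A (app (expm s A) x)) \<le> norm A * (exp (\<bar>s\<bar> * norm A) * norm x)"
      by (rule order_trans[OF norm_app mult_left_mono[OF norm_expm_app]]) simp
    also have "\<dots> \<le> norm A * (exp (\<bar>t\<bar> * norm A) * norm x)"
      using s by (intro mult_left_mono mult_right_mono) (auto intro!: mult_right_mono)
    finally show "onorm (\<lambda>h. h *\<^sub>R app A (app (expm s A) x)) \<le> norm A * exp (\<bar>t\<bar> * norm A) * norm x"
      by (intro onorm_le) (simp add: mult.commute mult_left_mono mult.left_commute)
  qed auto
  then show ?thesis by (simp add: mult_ac)
qed

lemma expm_second_order:
  "norm (app (expm t A) x - x - t *\<^sub>R app A x) \<le> t^2 * (norm A)^2 * exp (\<bar>t\<bar> * norm A) * norm x"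
proof -
  let ?S = "cball (0::real) \<bar>t\<bar>"
  let ?f = "\<lambda>s. app (expm s A) x - s *\<^sub>R app A x"
  have "norm (?f t - ?f 0) \<le> (\<bar>t\<bar> * (norm A)^2 * exp (\<bar>t\<bar> * norm A) * norm x) * norm (t - 0)"
  proof (rule differentiable_bound[where S = ?S and f' = "\<lambda>s h. h *\<^sub>R (app A (app (expm s A) x) - app A x)"])
    show "(?f has_derivative (\<lambda>h. h *\<^sub>R (app A (app (expm s A) x) - app A x))) (at s within ?S)" for s
      using expm_has_vector_derivative[of A x s ?S]
      by (auto simp: has_vector_derivative_def scaleR_diff_right intro!: derivative_eq_intros)
    fix s assume s: "s \<in> ?S"
    have "norm (app A (app (expm s A) x) - app A x) = norm (app A (app (expm s A) x - x))"
      by (simp add: app_simps)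
    also have "\<dots> \<le> norm A * (\<bar>s\<bar> * norm A * exp (\<bar>s\<bar> * norm A) * norm x)"
      by (rule order_trans[OF norm_app mult_left_mono[OF expm_first_order]]) simp
    also have "\<dots> \<le> norm A * (\<bar>t\<bar> * norm A * exp (\<bar>t\<bar> * norm A) * norm x)"
      using s by (intro mult_left_mono mult_right_mono mult_mono) (auto intro!: mult_right_mono)
    finally show "onorm (\<lambda>h. h *\<^sub>R (app A (app (expm s A) x) - app A x)) \<le> \<bar>t\<bar> * (norm A)^2 * exp (\<bar>t\<bar> * norm A) * norm x"
      by (intro onorm_le) (simp add: mult_ac mult_left_mono power2_eq_square)
  qed auto
  then show ?thesis by (simp add: mult_ac power2_eq_square algebra_simps)
qed

section \<open>Averaging over one jump\<close>

definition exp_law :: "real \<Rightarrow> real measure" where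
  "exp_law \<epsilon> = density lborel (exponential_density (1 / \<epsilon>))"

lemma sets_exp_law [measurable_cong, simp]: "sets (exp_law \<epsilon>) = sets borel"
  by (simp add: exp_law_def)

lemma space_exp_law [simp]: "space (exp_law \<epsilon>) = UNIV"
  by (simp add: exp_law_def)

lemma prob_space_exp_law: "\<epsilon> > 0 \<Longrightarrow> prob_space (exp_law \<epsilon>)"
  unfolding exp_law_def by (rule prob_space_erlang_density) simp

lemma AE_exp_law_nonneg: "AE s in exp_law \<epsilon>. 0 \<le> s"
  unfolding exp_law_def by (subst AE_density) (auto simp: exponential_density_def)

lemma has_bochner_integral_exp_law_power:
  assumes "\<epsilon> > 0"
  shows "has_bochner_integral (exp_law \<epsilon>) (\<lambda>s. s ^ i) (fact i * \<epsilon> ^ i)"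
proof -
  interpret prob_space "exp_law \<epsilon>" by (rule prob_space_exp_law[OF assms])
  have "distributed (exp_law \<epsilon>) lborel (\<lambda>s. s) (exponential_density (1 / \<epsilon>))"
    unfolding distributed_def by (auto simp: exp_law_def intro!: distr_id2)
  from has_bochner_integral_erlang_ith_moment[OF _ this, of i] assms show ?thesis
    by (simp add: power_divide)
qed

text \<open>A factor \<open>exp (\<kappa> s)\<close> with \<open>\<kappa> \<le> 1 / (2 \<epsilon>)\<close> at most doubles the mean of the law, at the price of a
  factor \<open>2\<close> in the density. This is how the exponentials in Taylor remainders are absorbed.\<close>

lemma nn_integral_exp_law_power_exp:
  assumes "\<epsilon> > 0" "0 \<le> \<kappa>" "\<kappa> * \<epsilon> \<le> 1 / 2"
  shows "(\<integral>\<^sup>+ s. ennreal (s ^ i * exp (\<kappa> * s)) \<partial>exp_law \<epsilon>) \<le> ennreal (2 * fact i * (2 * \<epsilon>) ^ i)"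
proof -
  have k: "\<kappa> \<le> 1 / (2 * \<epsilon>)" using assms by (simp add: field_simps)
  have pt: "exponential_density (1 / \<epsilon>) s * (s ^ i * exp (\<kappa> * s))
      \<le> 2 * (exponential_density (1 / (2 * \<epsilon>)) s * s ^ i)" for s
  proof (cases "s < 0")
    case False
    then have "\<kappa> * s \<le> 1 / (2 * \<epsilon>) * s" using k by (intro mult_right_mono) auto
    then have "exp (- s / \<epsilon>) * exp (\<kappa> * s) \<le> exp (- s / (2 * \<epsilon>))"
      unfolding exp_add[symmetric] using \<open>\<epsilon> > 0\<close> by (simp add: field_simps)
    then have "(exp (- s / \<epsilon>) * exp (\<kappa> * s)) * (s ^ i / \<epsilon>) \<le> exp (- s / (2 * \<epsilon>)) * (s ^ i / \<epsilon>)"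
      using False assms by (intro mult_right_mono) auto
    then show ?thesis using False by (simp add: exponential_density_def mult_ac)
  qed (simp add: exponential_density_def)
  have "(\<integral>\<^sup>+ s. ennreal (s ^ i * exp (\<kappa> * s)) \<partial>exp_law \<epsilon>)
      = (\<integral>\<^sup>+ s. ennreal (exponential_density (1 / \<epsilon>) s) * ennreal (s ^ i * exp (\<kappa> * s)) \<partial>lborel)"
    unfolding exp_law_def by (subst nn_integral_density) auto
  also have "\<dots> \<le> (\<integral>\<^sup>+ s. 2 * ennreal (exponential_density (1 / (2 * \<epsilon>)) s * s ^ i) \<partial>lborel)"
  proof (intro nn_integral_mono)
    fix s
    have "ennreal (exponential_density (1 / \<epsilon>) s) * ennreal (s ^ i * exp (\<kappa> * s))
        = ennreal (exponential_density (1 / \<epsilon>) s * (s ^ i * exp (\<kappa> * s)))"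
      using assms by (simp add: ennreal_mult')
    also have "\<dots> \<le> ennreal (2 * (exponential_density (1 / (2 * \<epsilon>)) s * s ^ i))"
      by (rule ennreal_leI[OF pt])
    also have "\<dots> = 2 * ennreal (exponential_density (1 / (2 * \<epsilon>)) s * s ^ i)"
      by (subst ennreal_mult') auto
    finally show "ennreal (exponential_density (1 / \<epsilon>) s) * ennreal (s ^ i * exp (\<kappa> * s))
        \<le> 2 * ennreal (exponential_density (1 / (2 * \<epsilon>)) s * s ^ i)" .
  qed
  also have "\<dots> = 2 * (fact (0 + i) / (fact 0 * (1 / (2 * \<epsilon>)) ^ i))"
    using nn_integral_erlang_ith_moment[of "1 / (2 * \<epsilon>)" 0 i] assms
    by (subst nn_integral_cmult) (auto simp: numeral_mult_ennreal)
  also have "\<dots> = ennreal (2 * fact i * (2 * \<epsilon>) ^ i)"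
    by (simp add: power_divide numeral_mult_ennreal mult.assoc)
  finally show ?thesis .
qed

lemma exp_law_power_exp:
  assumes "\<epsilon> > 0" "0 \<le> \<kappa>" "\<kappa> * \<epsilon> \<le> 1 / 2"
  shows "integrable (exp_law \<epsilon>) (\<lambda>s. s ^ i * exp (\<kappa> * s))"
    and "(\<integral>s. s ^ i * exp (\<kappa> * s) \<partial>exp_law \<epsilon>) \<le> 2 * fact i * (2 * \<epsilon>) ^ i"
proof -
  have ae: "AE s in exp_law \<epsilon>. 0 \<le> s ^ i * exp (\<kappa> * s)"
    using AE_exp_law_nonneg[of \<epsilon>] by eventually_elim auto
  show int: "integrable (exp_law \<epsilon>) (\<lambda>s. s ^ i * exp (\<kappa> * s))"
    using nn_integral_exp_law_power_exp[OF assms, of i]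
    by (intro integrableI_nonneg ae) (auto simp: le_less_trans[OF _ ennreal_less_top])
  show "(\<integral>s. s ^ i * exp (\<kappa> * s) \<partial>exp_law \<epsilon>) \<le> 2 * fact i * (2 * \<epsilon>) ^ i"
    using nn_integral_exp_law_power_exp[OF assms, of i] assms(1)
    by (subst (asm) nn_integral_eq_integral[OF int ae]) (simp add: ennreal_le_iff)
qed

lemma ennreal_integral_le_nn_integral:
  fixes G :: "'b \<Rightarrow> real"
  assumes "integrable N G" shows "ennreal (integral\<^sup>L N G) \<le> (\<integral>\<^sup>+x. ennreal (G x) \<partial>N)"
proof -
  have int: "integrable N (\<lambda>x. max 0 (G x))" using assms by simp
  have "ennreal (integral\<^sup>L N G) \<le> ennreal (integral\<^sup>L N (\<lambda>x. max 0 (G x)))"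
    using assms int by (intro ennreal_leI integral_mono) auto
  also have "\<dots> = (\<integral>\<^sup>+x. ennreal (max 0 (G x)) \<partial>N)"
    by (rule nn_integral_eq_integral[OF int, symmetric]) auto
  also have "\<dots> = (\<integral>\<^sup>+x. ennreal (G x) \<partial>N)"
    by (intro nn_integral_cong) (auto simp: max_def ennreal_neg)
  finally show ?thesis .
qed

lemma power2_add_le:
  fixes x y :: real shows "(x + y)^2 \<le> 2 * x^2 + 2 * y^2"
  using sum_squares_bound[of x y] by (simp add: power2_sum)

lemma power4_add_le:
  fixes x y :: real shows "(x + y) ^ 4 \<le> 8 * x ^ 4 + 8 * y ^ 4"
proof -
  have "(x + y)^2 \<le> 2 * x^2 + 2 * y^2" by (rule power2_add_le)
  then have "((x + y)^2)^2 \<le> (2 * x^2 + 2 * y^2)^2" by (intro power_mono) auto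
  also have "\<dots> \<le> 8 * x ^ 4 + 8 * y ^ 4"
    using sum_squares_bound[of "x^2" "y^2"] by (simp add: power2_eq_square power4_eq_xxxx algebra_simps)
  finally show ?thesis by simp
qed

lemma exp_lower_const:
  fixes \<gamma> t T :: real
  assumes "0 \<le> t" "t \<le> T" shows "exp (- (\<bar>\<gamma>\<bar> * T)) \<le> exp (\<gamma> * t)"
proof -
  have "- (\<gamma> * t) \<le> \<bar>\<gamma>\<bar> * t" using assms mult_right_mono[OF abs_ge_minus_self[of \<gamma>], of t] by simp
  also have "\<dots> \<le> \<bar>\<gamma>\<bar> * T" using assms by (intro mult_left_mono) auto
  finally show ?thesis by simp
qed

text \<open>The locale forgets the process and keeps the law of one factor: the matrix \<open>A i\<close> is chosen with
  probability \<open>p i\<close> and followed for an exponential time. The bound \<open>1 \<le> a\<close> makes powers of \<open>a\<close>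
  comparable.\<close>

locale switching =
  fixes A :: "'n::finite \<Rightarrow> 'a::euclidean_space endo" and p :: "'n \<Rightarrow> real" and a :: real
  assumes p_nonneg: "\<And>i. 0 \<le> p i" and p_sum: "(\<Sum>i\<in>UNIV. p i) = 1"
    and a_ge: "1 \<le> a" and norm_A: "\<And>i. norm (A i) \<le> a"
begin

definition M :: "'a endo" where "M = (\<Sum>i\<in>UNIV. p i *\<^sub>R A i)"

lemma norm_M: "norm M \<le> a"
proof -
  have "norm M \<le> (\<Sum>i\<in>UNIV. norm (p i *\<^sub>R A i))" unfolding M_def by (rule norm_sum)
  also have "\<dots> \<le> (\<Sum>i\<in>UNIV. p i * a)"
    by (intro sum_mono) (simp add: p_nonneg norm_A mult_left_mono)
  also have "\<dots> = a" by (simp add: p_sum flip: sum_distrib_right)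
  finally show ?thesis .
qed

lemma app_M: "app M x = (\<Sum>i\<in>UNIV. p i *\<^sub>R app (A i) x)"
  by (simp add: M_def app.sum_left app.scaleR_left)

text \<open>Functions with values in \<^typ>\<open>ennreal\<close> make all the integrals meaningful without integrability
  hypotheses, in particular for the iterates of \<open>K\<close>.\<close>

definition K :: "real \<Rightarrow> ('a \<Rightarrow> ennreal) \<Rightarrow> 'a \<Rightarrow> ennreal" where
  "K \<epsilon> f x = (\<Sum>i\<in>UNIV. ennreal (p i) * (\<integral>\<^sup>+ s. f (app (expm s (A i)) x) \<partial>exp_law \<epsilon>))"

lemma flow_measurable [measurable]: "(\<lambda>(x, s). app (expm s B) x) \<in> borel \<Otimes>\<^sub>M borel \<rightarrow>\<^sub>M borel"
  for B :: "'a endo"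
  unfolding borel_prod case_prod_beta
  by (intro borel_measurable_continuous_onI continuous_intros)

lemma app_measurable [measurable]: "(\<lambda>y. app L y) \<in> borel_measurable borel" for L :: "'a endo"
  by (intro borel_measurable_continuous_onI continuous_intros)

lemma flow_measurable1 [measurable]: "(\<lambda>s. app (expm s B) x) \<in> borel \<rightarrow>\<^sub>M borel"
  for B :: "'a endo"
  by (intro borel_measurable_continuous_onI continuous_intros)

lemma K_measurable [measurable]:
  assumes [measurable]: "f \<in> borel_measurable borel" and "\<epsilon> > 0"
  shows "K \<epsilon> f \<in> borel_measurable borel"
proof -
  interpret prob_space "exp_law \<epsilon>" by (rule prob_space_exp_law[OF \<open>\<epsilon> > 0\<close>])
  have [measurable]: "(\<lambda>(x, s). f (app (expm s B) x)) \<in> borel_measurable (borel \<Otimes>\<^sub>M exp_law \<epsilon>)" for B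
    using measurable_compose[OF flow_measurable assms(1), of B]
    by (simp add: case_prod_beta cong: measurable_cong_sets)
  show ?thesis unfolding K_def[abs_def] by measurable
qed

lemma K_mono: "(\<And>y. f y \<le> g y) \<Longrightarrow> K \<epsilon> f x \<le> K \<epsilon> g x"
  unfolding K_def by (intro sum_mono mult_left_mono nn_integral_mono) auto

lemma K_add:
  assumes [measurable]: "f \<in> borel_measurable borel" "g \<in> borel_measurable borel"
  shows "K \<epsilon> (\<lambda>y. f y + g y) x = K \<epsilon> f x + K \<epsilon> g x"
  unfolding K_def by (simp add: nn_integral_add distrib_left sum.distrib)

lemma K_cmult:
  assumes [measurable]: "f \<in> borel_measurable borel"
  shows "K \<epsilon> (\<lambda>y. c * f y) x = c * K \<epsilon> f x"
  unfolding K_def by (simp add: nn_integral_cmult sum_distrib_left mult.left_commute)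

lemma K_const: "\<epsilon> > 0 \<Longrightarrow> K \<epsilon> (\<lambda>y. c) x = c"
  using prob_space.emeasure_space_1[OF prob_space_exp_law, of \<epsilon>] p_sum
  unfolding K_def by (simp flip: sum_distrib_right add: sum_ennreal p_nonneg)

abbreviation E :: "real \<Rightarrow> nat \<Rightarrow> ('a \<Rightarrow> ennreal) \<Rightarrow> 'a \<Rightarrow> ennreal" where
  "E \<epsilon> k f x \<equiv> (K \<epsilon> ^^ k) f x"

lemma E_Suc: "E \<epsilon> (Suc k) f x = E \<epsilon> k (K \<epsilon> f) x"
  by (simp add: funpow_Suc_right del: funpow.simps)

lemma E_plus: "E \<epsilon> (j + k) f x = E \<epsilon> j (E \<epsilon> k f) x"
  by (simp add: funpow_add)

lemma E_measurable [measurable]: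
  "f \<in> borel_measurable borel \<Longrightarrow> \<epsilon> > 0 \<Longrightarrow> E \<epsilon> k f \<in> borel_measurable borel"
  by (induction k) (simp_all add: K_measurable)

lemma E_mono: "(\<And>y. f y \<le> g y) \<Longrightarrow> E \<epsilon> k f x \<le> E \<epsilon> k g x"
  by (induction k arbitrary: x) (simp_all add: K_mono)

lemma E_add:
  assumes "f \<in> borel_measurable borel" "g \<in> borel_measurable borel" "\<epsilon> > 0"
  shows "E \<epsilon> k (\<lambda>y. f y + g y) x = E \<epsilon> k f x + E \<epsilon> k g x"
proof (induction k arbitrary: x)
  case (Suc k)
  have "(K \<epsilon> ^^ k) (\<lambda>y. f y + g y) = (\<lambda>y. E \<epsilon> k f y + E \<epsilon> k g y)" using Suc by auto
  then show ?case using assms by (simp add: K_add E_measurable)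
qed simp

lemma E_cmult:
  assumes "f \<in> borel_measurable borel" "\<epsilon> > 0"
  shows "E \<epsilon> k (\<lambda>y. c * f y) x = c * E \<epsilon> k f x"
proof (induction k arbitrary: x)
  case (Suc k)
  have "(K \<epsilon> ^^ k) (\<lambda>y. c * f y) = (\<lambda>y. c * E \<epsilon> k f y)" using Suc by auto
  then show ?case using assms by (simp add: K_cmult E_measurable)
qed simp

lemma E_const: "\<epsilon> > 0 \<Longrightarrow> E \<epsilon> k (\<lambda>y. c) x = c"
proof (induction k arbitrary: x)
  case (Suc k)
  then have "(K \<epsilon> ^^ k) (\<lambda>y. c) = (\<lambda>y. c)" by auto
  then show ?case using Suc by (simp add: K_const)
qed simp

text \<open>The chain commutes with scalars, so probabilities of cones may be computed from unit vectors.\<close>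

lemma E_cone:
  assumes "\<And>y. f (c *\<^sub>R y) = f y" shows "E \<epsilon> k f (c *\<^sub>R x) = E \<epsilon> k f x"
proof (induction k arbitrary: x)
  case (Suc k)
  then show ?case by (simp add: K_def app.scaleR_right)
qed (simp add: assms)

text \<open>An expansion of \<open>g\<close> along the flows turns into an expansion of \<open>K \<epsilon> g\<close> in powers of \<open>\<epsilon>\<close>. The
  exact coefficient of the first-order term is what matters: in the applications it cancels against the
  contribution of \<open>M\<close>.\<close>

lemma K_le:
  assumes e: "\<epsilon> > 0" "0 \<le> \<kappa>" "\<kappa> * \<epsilon> \<le> 1 / 2" and c: "0 \<le> c2" "0 \<le> c4"
    and g0: "\<And>y. 0 \<le> g y"
    and g: "\<And>i s. 0 \<le> s \<Longrightarrow> g (app (expm s (A i)) x)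
      \<le> \<alpha> + \<beta> i * s + c2 * (s ^ 2 * exp (\<kappa> * s)) + c4 * (s ^ 4 * exp (\<kappa> * s))"
  shows "K \<epsilon> (\<lambda>y. ennreal (g y)) x
    \<le> ennreal (\<alpha> + \<epsilon> * (\<Sum>i\<in>UNIV. p i * \<beta> i) + 16 * c2 * \<epsilon> ^ 2 + 768 * c4 * \<epsilon> ^ 4)"
proof -
  interpret prob_space "exp_law \<epsilon>" by (rule prob_space_exp_law[OF \<open>\<epsilon> > 0\<close>])
  let ?u = "\<lambda>i s. \<alpha> + \<beta> i * s + c2 * (s ^ 2 * exp (\<kappa> * s)) + c4 * (s ^ 4 * exp (\<kappa> * s))"
  have i1: "has_bochner_integral (exp_law \<epsilon>) (\<lambda>s. s) \<epsilon>"
    using has_bochner_integral_exp_law_power[OF e(1), of 1] by simp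
  note i2 = exp_law_power_exp[OF e, of 2] and i4 = exp_law_power_exp[OF e, of 4]
  have int: "integrable (exp_law \<epsilon>) (?u i)" for i
    using i1 i2(1) i4(1) by (auto simp: has_bochner_integral_iff)
  have val: "integral\<^sup>L (exp_law \<epsilon>) (?u i) \<le> \<alpha> + \<beta> i * \<epsilon> + 16 * c2 * \<epsilon> ^ 2 + 768 * c4 * \<epsilon> ^ 4" for i
  proof -
    have "integral\<^sup>L (exp_law \<epsilon>) (?u i) = \<alpha> + \<beta> i * \<epsilon> + c2 * (\<integral>s. s ^ 2 * exp (\<kappa> * s) \<partial>exp_law \<epsilon>)
        + c4 * (\<integral>s. s ^ 4 * exp (\<kappa> * s) \<partial>exp_law \<epsilon>)"
      using i1 i2(1) i4(1) by (simp add: has_bochner_integral_iff prob_space[simplified])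
    also have "\<dots> \<le> \<alpha> + \<beta> i * \<epsilon> + c2 * (2 * fact 2 * (2 * \<epsilon>) ^ 2) + c4 * (2 * fact 4 * (2 * \<epsilon>) ^ 4)"
      using c i2(2) i4(2) by (intro add_mono order_refl mult_left_mono) auto
    also have "\<dots> = \<alpha> + \<beta> i * \<epsilon> + 16 * c2 * \<epsilon> ^ 2 + 768 * c4 * \<epsilon> ^ 4"
      by (simp add: fact_numeral power_mult_distrib)
    finally show ?thesis .
  qed
  have ae: "AE s in exp_law \<epsilon>. 0 \<le> ?u i s" for i
    using AE_exp_law_nonneg by eventually_elim (rule order_trans[OF g0 g])
  have one: "(\<integral>\<^sup>+ s. ennreal (g (app (expm s (A i)) x)) \<partial>exp_law \<epsilon>)
      \<le> ennreal (\<alpha> + \<beta> i * \<epsilon> + 16 * c2 * \<epsilon> ^ 2 + 768 * c4 * \<epsilon> ^ 4)" for i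
  proof -
    have "(\<integral>\<^sup>+ s. ennreal (g (app (expm s (A i)) x)) \<partial>exp_law \<epsilon>) \<le> (\<integral>\<^sup>+ s. ennreal (?u i s) \<partial>exp_law \<epsilon>)"
      by (rule nn_integral_mono_AE) (use AE_exp_law_nonneg[of \<epsilon>] in eventually_elim, auto intro: ennreal_leI g)
    also have "\<dots> = ennreal (integral\<^sup>L (exp_law \<epsilon>) (?u i))"
      by (rule nn_integral_eq_integral[OF int ae])
    finally show ?thesis using val order_trans ennreal_leI by blast
  qed
  have pos: "0 \<le> \<alpha> + \<beta> i * \<epsilon> + 16 * c2 * \<epsilon> ^ 2 + 768 * c4 * \<epsilon> ^ 4" for i
    by (rule order_trans[OF integral_nonneg_AE[OF ae] val])
  have "K \<epsilon> (\<lambda>y. ennreal (g y)) x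
      \<le> (\<Sum>i\<in>UNIV. ennreal (p i) * ennreal (\<alpha> + \<beta> i * \<epsilon> + 16 * c2 * \<epsilon> ^ 2 + 768 * c4 * \<epsilon> ^ 4))"
    unfolding K_def by (intro sum_mono mult_left_mono one) auto
  also have "\<dots> = ennreal (\<Sum>i\<in>UNIV. p i * (\<alpha> + \<beta> i * \<epsilon> + 16 * c2 * \<epsilon> ^ 2 + 768 * c4 * \<epsilon> ^ 4))"
    using pos p_nonneg by (simp add: sum_ennreal flip: ennreal_mult)
  also have "(\<Sum>i\<in>UNIV. p i * (\<alpha> + \<beta> i * \<epsilon> + 16 * c2 * \<epsilon> ^ 2 + 768 * c4 * \<epsilon> ^ 4))
      = (\<Sum>i\<in>UNIV. p i) * (\<alpha> + 16 * c2 * \<epsilon> ^ 2 + 768 * c4 * \<epsilon> ^ 4) + \<epsilon> * (\<Sum>i\<in>UNIV. p i * \<beta> i)"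
    by (simp add: sum_distrib_left sum_distrib_right algebra_simps sum.distrib)
  finally show ?thesis by (simp add: p_sum algebra_simps)
qed

text \<open>The second-order coefficient \<open>q i\<close> is kept here, since it carries the noise that \<open>kick\<close> exploits.\<close>

lemma K_ge:
  assumes e: "\<epsilon> > 0" "0 \<le> \<kappa>" "\<kappa> * \<epsilon> \<le> 1 / 2" and c: "0 \<le> c2" "0 \<le> c4"
    and g: "\<And>i s. 0 \<le> s \<Longrightarrow> g (app (expm s (A i)) x)
      \<ge> \<alpha> + \<beta> i * s + q i * s ^ 2 - c2 * (s ^ 2 * exp (\<kappa> * s)) - c4 * (s ^ 4 * exp (\<kappa> * s))"
  shows "K \<epsilon> (\<lambda>y. ennreal (g y)) x \<ge> ennreal (\<alpha> + \<epsilon> * (\<Sum>i\<in>UNIV. p i * \<beta> i)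
      + 2 * \<epsilon> ^ 2 * (\<Sum>i\<in>UNIV. p i * q i) - 16 * c2 * \<epsilon> ^ 2 - 768 * c4 * \<epsilon> ^ 4)"
proof -
  interpret prob_space "exp_law \<epsilon>" by (rule prob_space_exp_law[OF \<open>\<epsilon> > 0\<close>])
  let ?u = "\<lambda>i s. \<alpha> + \<beta> i * s + q i * s ^ 2 - c2 * (s ^ 2 * exp (\<kappa> * s)) - c4 * (s ^ 4 * exp (\<kappa> * s))"
  let ?v = "\<lambda>i. \<alpha> + \<beta> i * \<epsilon> + 2 * q i * \<epsilon> ^ 2 - 16 * c2 * \<epsilon> ^ 2 - 768 * c4 * \<epsilon> ^ 4"
  have i1: "has_bochner_integral (exp_law \<epsilon>) (\<lambda>s. s) \<epsilon>"
    using has_bochner_integral_exp_law_power[OF e(1), of 1] by simp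
  have i2': "has_bochner_integral (exp_law \<epsilon>) (\<lambda>s. s ^ 2) (2 * \<epsilon> ^ 2)"
    using has_bochner_integral_exp_law_power[OF e(1), of 2] by (simp add: fact_numeral)
  note i2 = exp_law_power_exp[OF e, of 2] and i4 = exp_law_power_exp[OF e, of 4]
  have int: "integrable (exp_law \<epsilon>) (?u i)" for i
    using i1 i2' i2(1) i4(1) by (auto simp: has_bochner_integral_iff)
  have val: "?v i \<le> integral\<^sup>L (exp_law \<epsilon>) (?u i)" for i
  proof -
    have "?v i = \<alpha> + \<beta> i * \<epsilon> + q i * (2 * \<epsilon> ^ 2) - c2 * (2 * fact 2 * (2 * \<epsilon>) ^ 2) - c4 * (2 * fact 4 * (2 * \<epsilon>) ^ 4)"
      by (simp add: fact_numeral power_mult_distrib)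
    also have "\<dots> \<le> \<alpha> + \<beta> i * \<epsilon> + q i * (2 * \<epsilon> ^ 2) - c2 * (\<integral>s. s ^ 2 * exp (\<kappa> * s) \<partial>exp_law \<epsilon>)
        - c4 * (\<integral>s. s ^ 4 * exp (\<kappa> * s) \<partial>exp_law \<epsilon>)"
      using c i2(2) i4(2) by (intro add_mono diff_mono order_refl mult_left_mono) auto
    also have "\<dots> = integral\<^sup>L (exp_law \<epsilon>) (?u i)"
      using i1 i2' i2(1) i4(1) by (simp add: has_bochner_integral_iff prob_space[simplified])
    finally show ?thesis .
  qed
  have one: "ennreal (?v i) \<le> (\<integral>\<^sup>+ s. ennreal (g (app (expm s (A i)) x)) \<partial>exp_law \<epsilon>)" for i
  proof -
    have "ennreal (?v i) \<le> (\<integral>\<^sup>+ s. ennreal (?u i s) \<partial>exp_law \<epsilon>)"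
      by (rule order_trans[OF ennreal_leI[OF val] ennreal_integral_le_nn_integral[OF int]])
    also have "\<dots> \<le> (\<integral>\<^sup>+ s. ennreal (g (app (expm s (A i)) x)) \<partial>exp_law \<epsilon>)"
      by (rule nn_integral_mono_AE) (use AE_exp_law_nonneg[of \<epsilon>] in eventually_elim, auto intro: ennreal_leI g)
    finally show ?thesis .
  qed
  have "\<alpha> + \<epsilon> * (\<Sum>i\<in>UNIV. p i * \<beta> i)
      + 2 * \<epsilon> ^ 2 * (\<Sum>i\<in>UNIV. p i * q i) - 16 * c2 * \<epsilon> ^ 2 - 768 * c4 * \<epsilon> ^ 4
      = (\<Sum>i\<in>UNIV. p i) * (\<alpha> - 16 * c2 * \<epsilon> ^ 2 - 768 * c4 * \<epsilon> ^ 4) + \<epsilon> * (\<Sum>i\<in>UNIV. p i * \<beta> i)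
      + 2 * \<epsilon> ^ 2 * (\<Sum>i\<in>UNIV. p i * q i)"
    by (simp add: p_sum)
  also have "\<dots> = (\<Sum>i\<in>UNIV. p i * ?v i)"
    by (simp add: sum_distrib_left sum_distrib_right algebra_simps sum.distrib sum_subtractf)
  also have "\<dots> \<le> (\<Sum>i\<in>UNIV. p i * max 0 (?v i))"
    by (intro sum_mono mult_left_mono p_nonneg) auto
  finally have "ennreal (\<alpha> + \<epsilon> * (\<Sum>i\<in>UNIV. p i * \<beta> i)
      + 2 * \<epsilon> ^ 2 * (\<Sum>i\<in>UNIV. p i * q i) - 16 * c2 * \<epsilon> ^ 2 - 768 * c4 * \<epsilon> ^ 4)
      \<le> ennreal (\<Sum>i\<in>UNIV. p i * max 0 (?v i))" by (rule ennreal_leI)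
  also have "\<dots> = (\<Sum>i\<in>UNIV. ennreal (p i) * ennreal (max 0 (?v i)))"
    by (subst sum_ennreal[symmetric]) (auto simp: ennreal_mult p_nonneg simp del: ennreal_max_0 intro!: sum.cong)
  also have "\<dots> \<le> K \<epsilon> (\<lambda>y. ennreal (g y)) x"
    unfolding K_def
  proof (intro sum_mono mult_left_mono)
    show "ennreal (max 0 (?v i)) \<le> (\<integral>\<^sup>+ s. ennreal (g (app (expm s (A i)) x)) \<partial>exp_law \<epsilon>)" for i
      using one[of i] by (cases "?v i \<ge> 0") (auto simp: max_def)
  qed auto
  finally show ?thesis .
qed

lemma quartic_expansion:
  fixes b v :: "'b::real_inner"
  shows "norm (b + v) ^ 4 \<le> norm b ^ 4 + 4 * (norm b)^2 * (b \<bullet> v) + 8 * (norm b)^2 * (norm v)^2 + 3 * norm v ^ 4"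
proof -
  define d where "d = b \<bullet> v"
  define r where "r = norm b"
  define t where "t = norm v"
  have d: "d \<le> r * t" "- d \<le> r * t" "d^2 \<le> r^2 * t^2"
    using Cauchy_Schwarz_ineq2[of b v] abs_le_square_iff[of d "r * t"]
    by (auto simp: d_def r_def t_def abs_le_iff power_mult_distrib)
  have rt: "0 \<le> r" "0 \<le> t" by (auto simp: r_def t_def)
  have "norm (b + v) ^ 4 = ((norm (b + v))^2)^2" by simp
  also have "(norm (b + v))^2 = r^2 + 2 * d + t^2"
    by (simp add: power2_norm_eq_inner r_def t_def d_def inner_add_left inner_add_right inner_commute)
  also have "(r^2 + 2 * d + t^2)^2 = r ^ 4 + 4 * r^2 * d + 4 * d^2 + 2 * (r^2 * t^2) + 4 * (d * t^2) + t ^ 4"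
    by (simp add: power2_eq_square power4_eq_xxxx algebra_simps)
  finally have 1: "norm (b + v) ^ 4 = r ^ 4 + 4 * r^2 * d + 4 * d^2 + 2 * (r^2 * t^2) + 4 * (d * t^2) + t ^ 4" .
  have "d * t^2 \<le> r * t * t^2" using d by (intro mult_right_mono) auto
  moreover have "2 * (r * t * t^2) \<le> r^2 * t^2 + t ^ 4"
    using sum_squares_bound[of "r * t" "t^2"] by (simp add: power_mult_distrib mult_ac)
  ultimately show ?thesis using 1 d unfolding r_def[symmetric] t_def[symmetric] d_def[symmetric]
    by (simp add: algebra_simps)
qed

lemma exp_le_affine:
  fixes x X :: real assumes "0 \<le> x" "x \<le> X" shows "exp x \<le> 1 + x * exp X"
proof -
  have "1 - x \<le> exp (- x)" using exp_ge_add_one_self[of "-x"] by simp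
  then have "exp x * (1 - x) \<le> exp x * exp (- x)" by (intro mult_left_mono) auto
  then have "exp x \<le> 1 + x * exp x" by (simp add: exp_minus_inverse algebra_simps)
  also have "\<dots> \<le> 1 + x * exp X" using assms by (intro add_left_mono mult_left_mono) auto
  finally show ?thesis .
qed

lemma moment_polynomial_bound:
  fixes z y c \<epsilon> :: real
  assumes "0 \<le> z" "0 \<le> y" "0 \<le> c" "y \<le> z + c" "0 < \<epsilon>" "\<epsilon> \<le> 1"
  shows "\<epsilon>^2 * (z ^ 3 * y + z^2 * y^2) \<le> 5 * (\<epsilon> * z ^ 4 + \<epsilon> ^ 3 * c ^ 4)"
    and "\<epsilon> ^ 4 * y ^ 4 \<le> 8 * (\<epsilon> * z ^ 4 + \<epsilon> ^ 3 * c ^ 4)"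
proof -
  have e: "\<epsilon>^2 \<le> \<epsilon>" "\<epsilon> ^ 4 \<le> \<epsilon>" "\<epsilon> ^ 4 \<le> \<epsilon> ^ 3"
    using assms power_decreasing[of 1 2 \<epsilon>] power_decreasing[of 1 4 \<epsilon>] power_decreasing[of 3 4 \<epsilon>] by auto
  have y2: "y^2 \<le> 2 * z^2 + 2 * c^2"
    using power_mono[of y "z + c" 2] power2_add_le[of z c] assms by linarith
  have "z ^ 3 * y \<le> z ^ 3 * (z + c)" using assms by (intro mult_left_mono) auto
  also have "\<dots> = z ^ 4 + z^2 * (z * c)" by (simp add: power2_eq_square power3_eq_cube power4_eq_xxxx algebra_simps)
  also have "\<dots> \<le> z ^ 4 + z^2 * ((z^2 + c^2) / 2)"
    using sum_squares_bound[of z c] by (intro add_left_mono mult_left_mono) auto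
  also have "\<dots> = 3 / 2 * z ^ 4 + z^2 * c^2 / 2" by (simp add: field_simps power2_eq_square power4_eq_xxxx)
  finally have 1: "z ^ 3 * y \<le> 3 / 2 * z ^ 4 + z^2 * c^2 / 2" .
  have "z^2 * y^2 \<le> z^2 * (2 * z^2 + 2 * c^2)" using y2 by (intro mult_left_mono) auto
  then have 2: "z ^ 3 * y + z^2 * y^2 \<le> 7 / 2 * z ^ 4 + 5 / 2 * (z^2 * c^2)"
    using 1 by (simp add: algebra_simps power2_eq_square power4_eq_xxxx)
  have 3: "2 * (\<epsilon>^2 * (z^2 * c^2)) \<le> \<epsilon> * z ^ 4 + \<epsilon> ^ 3 * c ^ 4"
  proof -
    have "2 * (z^2 * (\<epsilon> * c^2)) \<le> (z^2)^2 + (\<epsilon> * c^2)^2" using sum_squares_bound[of "z^2" "\<epsilon> * c^2"] by simp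
    then have "\<epsilon> * (2 * (z^2 * (\<epsilon> * c^2))) \<le> \<epsilon> * ((z^2)^2 + (\<epsilon> * c^2)^2)"
      using assms by (intro mult_left_mono) auto
    then show ?thesis by (simp add: power2_eq_square power3_eq_cube power4_eq_xxxx algebra_simps)
  qed
  have "\<epsilon>^2 * z ^ 4 \<le> \<epsilon> * z ^ 4" using e by (intro mult_right_mono) auto
  moreover have "\<epsilon>^2 * (z ^ 3 * y + z^2 * y^2) \<le> \<epsilon>^2 * (7 / 2 * z ^ 4 + 5 / 2 * (z^2 * c^2))"
    using 2 by (intro mult_left_mono) auto
  moreover have "0 \<le> \<epsilon> * z ^ 4" "0 \<le> \<epsilon> ^ 3 * c ^ 4" using assms by auto
  ultimately show "\<epsilon>^2 * (z ^ 3 * y + z^2 * y^2) \<le> 5 * (\<epsilon> * z ^ 4 + \<epsilon> ^ 3 * c ^ 4)"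
    using 3 by (simp add: algebra_simps)
  have "y ^ 4 \<le> (z + c) ^ 4" using assms by (intro power_mono) auto
  also have "\<dots> \<le> 8 * z ^ 4 + 8 * c ^ 4" by (rule power4_add_le)
  finally have "\<epsilon> ^ 4 * y ^ 4 \<le> \<epsilon> ^ 4 * (8 * z ^ 4) + \<epsilon> ^ 4 * (8 * c ^ 4)"
    using assms mult_left_mono[of "y ^ 4" "8 * z ^ 4 + 8 * c ^ 4" "\<epsilon> ^ 4"] by (simp add: algebra_simps)
  also have "\<dots> \<le> \<epsilon> * (8 * z ^ 4) + \<epsilon> ^ 3 * (8 * c ^ 4)"
    using e by (intro add_mono mult_right_mono) auto
  finally show "\<epsilon> ^ 4 * y ^ 4 \<le> 8 * (\<epsilon> * z ^ 4 + \<epsilon> ^ 3 * c ^ 4)" by (simp add: algebra_simps)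
qed

definition C4 :: real where
  "C4 = 4 * a * exp (4 * a) + 5 * (16 * a^2 * (exp (4 * a) + 16)) * exp (4 * a) + 8 * (24 * a ^ 4 * (exp (4 * a) + 768))"

lemma C4_nonneg: "0 \<le> C4"
  unfolding C4_def using a_ge by (intro add_nonneg_nonneg mult_nonneg_nonneg) auto

text \<open>The constant of the fourth-moment estimate up to time \<open>t\<close>.\<close>

definition C_t :: "real \<Rightarrow> real" where "C_t t = t * exp (C4 * t) * C4 * exp (4 * a * t)"

lemma C_t_nonneg: "0 \<le> t \<Longrightarrow> 0 \<le> C_t t"
  unfolding C_t_def using C4_nonneg by simp

context
  fixes \<epsilon> :: real
  assumes \<epsilon>: "0 < \<epsilon>" "8 * a * \<epsilon> \<le> 1"
begin

lemma eps_le_1: "\<epsilon> \<le> 1"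
proof -
  have "1 * \<epsilon> \<le> 8 * a * \<epsilon>" using a_ge \<epsilon> by (intro mult_right_mono) auto
  then show ?thesis using \<epsilon> by linarith
qed

lemma expm_bounds:
  assumes B: "norm B \<le> a" and s: "0 \<le> s"
  shows "norm (app (expm s B) y) \<le> exp (a * s) * norm y"
    and "norm (app (expm s B) y - y) \<le> a * (s * exp (a * s)) * norm y"
    and "norm (app (expm s B) y - y - s *\<^sub>R app B y) \<le> a^2 * (s^2 * exp (a * s)) * norm y"
proof -
  have e: "exp (\<bar>s\<bar> * norm B) \<le> exp (a * s)"
    using mult_left_mono[OF B s] s by (simp add: mult.commute)
  show "norm (app (expm s B) y) \<le> exp (a * s) * norm y"
    by (rule order_trans[OF norm_expm_app mult_right_mono[OF e]]) simp
  have "norm (app (expm s B) y - y) \<le> \<bar>s\<bar> * norm B * exp (\<bar>s\<bar> * norm B) * norm y"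
    by (rule expm_first_order)
  also have "\<dots> \<le> \<bar>s\<bar> * a * exp (a * s) * norm y"
    using B e a_ge by (intro mult_right_mono mult_mono mult_left_mono) auto
  finally show "norm (app (expm s B) y - y) \<le> a * (s * exp (a * s)) * norm y" using s by (simp add: mult_ac)
  have "norm (app (expm s B) y - y - s *\<^sub>R app B y) \<le> s^2 * (norm B)^2 * exp (\<bar>s\<bar> * norm B) * norm y"
    by (rule expm_second_order)
  also have "\<dots> \<le> s^2 * a^2 * exp (a * s) * norm y"
    using B e a_ge by (intro mult_right_mono mult_mono mult_left_mono power_mono) auto
  finally show "norm (app (expm s B) y - y - s *\<^sub>R app B y) \<le> a^2 * (s^2 * exp (a * s)) * norm y"
    by (simp add: mult_ac)
qed

lemma increment_bounds:
  assumes s: "0 \<le> s"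
  defines "v \<equiv> \<lambda>i y. app (expm s (A i)) y - app (expm \<epsilon> M) y"
  shows "norm (v i y - (s *\<^sub>R app (A i) y - \<epsilon> *\<^sub>R app M y))
      \<le> a^2 * norm y * (s^2 * exp (a * s) + \<epsilon>^2 * exp a)"
    and "norm (v i y) \<le> a * norm y * (s * exp (a * s) + \<epsilon> * exp a)"
proof -
  have e: "exp (a * \<epsilon>) \<le> exp a" using eps_le_1 a_ge by simp
  note g = expm_bounds[OF norm_A s, of i y] and h = expm_bounds[OF norm_M, of \<epsilon> y]
  have "v i y - (s *\<^sub>R app (A i) y - \<epsilon> *\<^sub>R app M y)
      = (app (expm s (A i)) y - y - s *\<^sub>R app (A i) y) - (app (expm \<epsilon> M) y - y - \<epsilon> *\<^sub>R app M y)"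
    by (simp add: v_def)
  also have "norm \<dots> \<le> a^2 * (s^2 * exp (a * s)) * norm y + a^2 * (\<epsilon>^2 * exp (a * \<epsilon>)) * norm y"
    using \<epsilon> by (intro order_trans[OF norm_triangle_ineq4] add_mono g h) auto
  also have "\<dots> \<le> a^2 * (s^2 * exp (a * s)) * norm y + a^2 * (\<epsilon>^2 * exp a) * norm y"
    using e by (intro add_left_mono mult_right_mono mult_left_mono) auto
  finally show "norm (v i y - (s *\<^sub>R app (A i) y - \<epsilon> *\<^sub>R app M y))
      \<le> a^2 * norm y * (s^2 * exp (a * s) + \<epsilon>^2 * exp a)" by (simp add: algebra_simps)
  have "v i y = (app (expm s (A i)) y - y) - (app (expm \<epsilon> M) y - y)" by (simp add: v_def)
  also have "norm \<dots> \<le> a * (s * exp (a * s)) * norm y + a * (\<epsilon> * exp (a * \<epsilon>)) * norm y"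
    using \<epsilon> by (intro order_trans[OF norm_triangle_ineq4] add_mono g h) auto
  also have "\<dots> \<le> a * (s * exp (a * s)) * norm y + a * (\<epsilon> * exp a) * norm y"
    using e \<epsilon> a_ge by (intro add_left_mono mult_right_mono mult_left_mono) auto
  finally show "norm (v i y) \<le> a * norm y * (s * exp (a * s) + \<epsilon> * exp a)" by (simp add: algebra_simps)
qed

text \<open>Write the deviation after a jump as \<open>b + v\<close> with \<open>b = exp (\<epsilon> M) (y - c)\<close>. In the quartic expansion the term
  linear in \<open>v\<close> has mean \<open>O(\<epsilon>\<^sup>2)\<close>, because \<open>v\<close> is \<open>s A\<^sub>i y - \<epsilon> M y\<close> up to second order and this is
  centred. Hence no term of order \<open>\<epsilon>\<close> survives except a multiple of \<open>\<bar>y - c\<bar>\<^sup>4\<close>, which Gronwall's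
  argument tolerates.\<close>

lemma one_step_fourth_moment:
  "K \<epsilon> (\<lambda>y'. ennreal (norm (y' - app (expm \<epsilon> M) c) ^ 4)) y
    \<le> ennreal ((1 + C4 * \<epsilon>) * norm (y - c) ^ 4 + C4 * \<epsilon> ^ 3 * norm c ^ 4)"
proof -
  define b where "b = app (expm \<epsilon> M) (y - c)"
  define D where "D = exp (4 * a)"
  have D: "exp a \<le> D" "exp (2 * a) \<le> D" "1 \<le> D" "(exp a)^2 \<le> D" "exp a ^ 4 \<le> D"
    using a_ge unfolding D_def by (simp_all flip: exp_of_nat_mult)
  define Y Z where "Y = norm y" and "Z = norm (y - c)"
  define c2 c4 where "c2 = 4 * a^2 * (norm b ^ 3 * Y) + 16 * a^2 * ((norm b)^2 * Y^2)" and "c4 = 24 * a ^ 4 * Y ^ 4"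
  define \<beta> where "\<beta> = (\<lambda>i. 4 * (norm b)^2 * (b \<bullet> app (A i) y))"
  define \<alpha> where "\<alpha> = norm b ^ 4 - 4 * (norm b)^2 * (\<epsilon> * (b \<bullet> app M y)) + c2 * (\<epsilon>^2 * D) + c4 * (\<epsilon> ^ 4 * D)"
  have pos: "0 \<le> Y" "0 \<le> Z" "0 \<le> c2" "0 \<le> c4" using a_ge by (auto simp: Y_def Z_def c2_def c4_def)
  have "K \<epsilon> (\<lambda>y'. ennreal (norm (y' - app (expm \<epsilon> M) c) ^ 4)) y
    \<le> ennreal (\<alpha> + \<epsilon> * (\<Sum>i\<in>UNIV. p i * \<beta> i) + 16 * c2 * \<epsilon> ^ 2 + 768 * c4 * \<epsilon> ^ 4)"
  proof (rule K_le[where \<kappa> = "4 * a"])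
    fix i and s :: real assume s: "0 \<le> s"
    define v where "v = app (expm s (A i)) y - app (expm \<epsilon> M) y"
    define S2 S4 where "S2 = s^2 * exp (4 * a * s)" and "S4 = s ^ 4 * exp (4 * a * s)"
    have ex: "exp (a * s) \<le> exp (4 * a * s)" "(exp (a * s))^2 \<le> exp (4 * a * s)" "exp (a * s) ^ 4 \<le> exp (4 * a * s)"
      using s a_ge by (simp_all flip: exp_of_nat_mult add: mult.assoc)
    have lin: "norm (v - (s *\<^sub>R app (A i) y - \<epsilon> *\<^sub>R app M y)) \<le> a^2 * Y * (S2 + \<epsilon>^2 * D)"
    proof -
      have "s^2 * exp (a * s) + \<epsilon>^2 * exp a \<le> S2 + \<epsilon>^2 * D"
        unfolding S2_def using ex D by (intro add_mono mult_left_mono) auto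
      then show ?thesis using increment_bounds(1)[OF s, of i y] a_ge
        unfolding v_def[symmetric] Y_def[symmetric]
        by (elim order_trans) (intro mult_left_mono, auto simp: pos)
    qed
    have nv: "norm v \<le> a * Y * (s * exp (a * s) + \<epsilon> * exp a)"
      using increment_bounds(2)[OF s, of i y] by (simp add: v_def Y_def)
    have v2: "(norm v)^2 \<le> 2 * a^2 * Y^2 * (S2 + \<epsilon>^2 * D)"
    proof -
      have "(norm v)^2 \<le> (a * Y * (s * exp (a * s) + \<epsilon> * exp a))^2" using nv by (intro power_mono) auto
      also have "\<dots> = (a * Y)^2 * (s * exp (a * s) + \<epsilon> * exp a)^2" by (simp only: power_mult_distrib)
      also have "\<dots> \<le> (a * Y)^2 * (2 * (s * exp (a * s))^2 + 2 * (\<epsilon> * exp a)^2)"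
        using sum_squares_bound[of "s * exp (a * s)" "\<epsilon> * exp a"] by (intro mult_left_mono) (auto simp: power2_sum)
      also have "\<dots> \<le> (a * Y)^2 * (2 * S2 + 2 * (\<epsilon>^2 * D))"
        unfolding S2_def power_mult_distrib[of s] power_mult_distrib[of \<epsilon>] using ex D
        by (intro mult_left_mono add_mono) auto
      finally show ?thesis by (simp add: algebra_simps power_mult_distrib)
    qed
    have v4: "norm v ^ 4 \<le> 8 * a ^ 4 * Y ^ 4 * (S4 + \<epsilon> ^ 4 * D)"
    proof -
      have "norm v ^ 4 \<le> (a * Y * (s * exp (a * s) + \<epsilon> * exp a)) ^ 4" using nv by (intro power_mono) auto
      also have "\<dots> = (a * Y) ^ 4 * (s * exp (a * s) + \<epsilon> * exp a) ^ 4" by (simp only: power_mult_distrib)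
      also have "\<dots> \<le> (a * Y) ^ 4 * (8 * (s * exp (a * s)) ^ 4 + 8 * (\<epsilon> * exp a) ^ 4)"
        by (intro mult_left_mono power4_add_le) auto
      also have "\<dots> \<le> (a * Y) ^ 4 * (8 * S4 + 8 * (\<epsilon> ^ 4 * D))"
        unfolding S4_def power_mult_distrib[of s] power_mult_distrib[of \<epsilon>] using ex D
        by (intro mult_left_mono add_mono) auto
      finally show ?thesis by (simp add: algebra_simps power_mult_distrib)
    qed
    have bv: "b \<bullet> v \<le> s * (b \<bullet> app (A i) y) - \<epsilon> * (b \<bullet> app M y) + norm b * (a^2 * Y * (S2 + \<epsilon>^2 * D))"
    proof -
      have "b \<bullet> v = s * (b \<bullet> app (A i) y) - \<epsilon> * (b \<bullet> app M y) + b \<bullet> (v - (s *\<^sub>R app (A i) y - \<epsilon> *\<^sub>R app M y))"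
        by (simp add: inner_diff_right)
      also have "b \<bullet> (v - (s *\<^sub>R app (A i) y - \<epsilon> *\<^sub>R app M y)) \<le> norm b * (a^2 * Y * (S2 + \<epsilon>^2 * D))"
        by (rule order_trans[OF norm_cauchy_schwarz mult_left_mono[OF lin]]) auto
      finally show ?thesis by simp
    qed
    have "app (expm s (A i)) y - app (expm \<epsilon> M) c = b + v" by (simp add: b_def v_def app_simps)
    then have "norm (app (expm s (A i)) y - app (expm \<epsilon> M) c) ^ 4
      \<le> norm b ^ 4 + 4 * (norm b)^2 * (b \<bullet> v) + 8 * (norm b)^2 * (norm v)^2 + 3 * norm v ^ 4"
      using quartic_expansion[of b v] by simp
    also have "\<dots> \<le> norm b ^ 4
        + 4 * (norm b)^2 * (s * (b \<bullet> app (A i) y) - \<epsilon> * (b \<bullet> app M y) + norm b * (a^2 * Y * (S2 + \<epsilon>^2 * D)))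
        + 8 * (norm b)^2 * (2 * a^2 * Y^2 * (S2 + \<epsilon>^2 * D)) + 3 * (8 * a ^ 4 * Y ^ 4 * (S4 + \<epsilon> ^ 4 * D))"
      by (intro add_mono mult_left_mono order_refl bv v2 v4) auto
    also have "\<dots> = \<alpha> + \<beta> i * s + c2 * S2 + c4 * S4"
      by (simp add: \<alpha>_def \<beta>_def c2_def c4_def algebra_simps power2_eq_square power3_eq_cube)
    finally show "norm (app (expm s (A i)) y - app (expm \<epsilon> M) c) ^ 4
      \<le> \<alpha> + \<beta> i * s + c2 * (s^2 * exp (4 * a * s)) + c4 * (s ^ 4 * exp (4 * a * s))"
      by (simp add: S2_def S4_def)
  qed (use \<epsilon> a_ge pos in auto)
  also have "(\<Sum>i\<in>UNIV. p i * \<beta> i) = 4 * (norm b)^2 * (b \<bullet> app M y)"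
    by (simp add: \<beta>_def app_M inner_sum_right sum_distrib_left mult_ac)
  also have "\<alpha> + \<epsilon> * (4 * (norm b)^2 * (b \<bullet> app M y)) + 16 * c2 * \<epsilon> ^ 2 + 768 * c4 * \<epsilon> ^ 4
      = norm b ^ 4 + c2 * \<epsilon>^2 * (D + 16) + c4 * \<epsilon> ^ 4 * (D + 768)"
    by (simp add: \<alpha>_def algebra_simps)
  also have "\<dots> \<le> (1 + C4 * \<epsilon>) * Z ^ 4 + C4 * \<epsilon> ^ 3 * norm c ^ 4"
  proof -
    have nb: "norm b \<le> exp (a * \<epsilon>) * Z"
      using expm_bounds(1)[OF norm_M, of \<epsilon> "y - c"] \<epsilon> by (simp add: b_def Z_def)
    have "norm b ^ 4 \<le> (exp (a * \<epsilon>) * Z) ^ 4" using nb by (intro power_mono) auto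
    also have "\<dots> = exp (4 * a * \<epsilon>) * Z ^ 4" by (simp add: power_mult_distrib mult_ac flip: exp_of_nat_mult)
    also have "\<dots> \<le> (1 + 4 * a * \<epsilon> * D) * Z ^ 4"
      unfolding D_def using \<epsilon> a_ge eps_le_1 by (intro mult_right_mono exp_le_affine) auto
    finally have 1: "norm b ^ 4 \<le> (1 + 4 * a * \<epsilon> * D) * Z ^ 4" .
    have "exp (a * \<epsilon>) \<le> exp a" using eps_le_1 a_ge by simp
    then have nb': "norm b \<le> exp a * Z" using nb pos by (elim order_trans) (intro mult_right_mono, auto)
    have b3: "norm b ^ 3 \<le> D * Z ^ 3"
    proof -
      have "norm b ^ 3 \<le> (exp a * Z) ^ 3" using nb' by (intro power_mono) auto
      also have "\<dots> = exp (3 * a) * Z ^ 3" by (simp add: power_mult_distrib flip: exp_of_nat_mult)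
      also have "\<dots> \<le> D * Z ^ 3" unfolding D_def using pos a_ge by (intro mult_right_mono) auto
      finally show ?thesis .
    qed
    have b2: "(norm b)^2 \<le> D * Z^2"
    proof -
      have "(norm b)^2 \<le> (exp a * Z)^2" using nb' by (intro power_mono) auto
      also have "\<dots> = (exp a)^2 * Z^2" by (simp add: power_mult_distrib)
      also have "\<dots> \<le> D * Z^2" using D by (intro mult_right_mono) auto
      finally show ?thesis .
    qed
    have "c2 \<le> 16 * a^2 * (norm b ^ 3 * Y) + 16 * a^2 * ((norm b)^2 * Y^2)"
      unfolding c2_def using pos by (intro add_mono mult_right_mono) auto
    also have "\<dots> \<le> 16 * a^2 * (D * Z ^ 3 * Y) + 16 * a^2 * (D * Z^2 * Y^2)"
      using pos by (intro add_mono mult_left_mono mult_right_mono b2 b3) auto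
    also have "\<dots> = 16 * a^2 * D * (Z ^ 3 * Y + Z^2 * Y^2)" by (simp add: algebra_simps)
    finally have "c2 * (\<epsilon>^2 * (D + 16)) \<le> 16 * a^2 * D * (Z ^ 3 * Y + Z^2 * Y^2) * (\<epsilon>^2 * (D + 16))"
      using D by (intro mult_right_mono) auto
    also have "\<dots> = 16 * a^2 * D * (D + 16) * (\<epsilon>^2 * (Z ^ 3 * Y + Z^2 * Y^2))" by (simp only: mult_ac)
    also have "\<dots> \<le> 16 * a^2 * D * (D + 16) * (5 * (\<epsilon> * Z ^ 4 + \<epsilon> ^ 3 * norm c ^ 4))"
      using D \<epsilon> eps_le_1 norm_triangle_ineq[of "y - c" c] unfolding Y_def Z_def
      by (intro mult_left_mono moment_polynomial_bound) auto
    finally have 2: "c2 * (\<epsilon>^2 * (D + 16)) \<le> 16 * a^2 * D * (D + 16) * (5 * (\<epsilon> * Z ^ 4 + \<epsilon> ^ 3 * norm c ^ 4))" .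
    have "c4 * (\<epsilon> ^ 4 * (D + 768)) = 24 * a ^ 4 * (D + 768) * (\<epsilon> ^ 4 * Y ^ 4)"
      by (simp add: c4_def mult_ac)
    also have "\<dots> \<le> 24 * a ^ 4 * (D + 768) * (8 * (\<epsilon> * Z ^ 4 + \<epsilon> ^ 3 * norm c ^ 4))"
      using D \<epsilon> eps_le_1 norm_triangle_ineq[of "y - c" c] a_ge unfolding Y_def Z_def
      by (intro mult_left_mono moment_polynomial_bound) auto
    finally have 3: "c4 * (\<epsilon> ^ 4 * (D + 768)) \<le> 24 * a ^ 4 * (D + 768) * (8 * (\<epsilon> * Z ^ 4 + \<epsilon> ^ 3 * norm c ^ 4))" .
    have "0 \<le> 4 * a * D * (\<epsilon> ^ 3 * norm c ^ 4)" using a_ge D \<epsilon> by auto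
    then show ?thesis using 1 2 3 unfolding C4_def D_def[symmetric]
      by (simp add: algebra_simps)
  qed
  finally show ?thesis by (simp add: Z_def ennreal_leI)
qed

text \<open>Iterating the one-step estimate about \<open>t / \<epsilon>\<close> times, the errors \<open>C4 \<epsilon>\<^sup>3\<close> add up to order \<open>\<epsilon>\<^sup>2\<close>.\<close>

lemma fourth_moment:
  assumes t: "real k * \<epsilon> \<le> t"
  shows "E \<epsilon> k (\<lambda>y. ennreal (norm (y - app (expm (k * \<epsilon>) M) x) ^ 4)) x
    \<le> ennreal (C_t t * \<epsilon>^2 * norm x ^ 4)"
proof -
  define W where "W = exp (4 * a * t) * norm x ^ 4"
  have W: "0 \<le> W" by (simp add: W_def)
  have main: "E \<epsilon> j (\<lambda>y. ennreal (norm (y - app (expm (j * \<epsilon>) M) x) ^ 4)) x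
    \<le> ennreal (j * (1 + C4 * \<epsilon>) ^ j * (C4 * \<epsilon> ^ 3 * W))" if "j \<le> k" for j
    using that
  proof (induction j)
    case 0 then show ?case by simp
  next
    case (Suc j)
    let ?f = "\<lambda>y. ennreal (norm (y - app (expm (j * \<epsilon>) M) x) ^ 4)"
    have c: "norm (app (expm (j * \<epsilon>) M) x) ^ 4 \<le> W"
    proof -
      have "norm (app (expm (j * \<epsilon>) M) x) \<le> exp (a * (j * \<epsilon>)) * norm x"
        using expm_bounds(1)[OF norm_M] \<epsilon> by simp
      also have "\<dots> \<le> exp (a * t) * norm x"
      proof -
        have "j * \<epsilon> \<le> k * \<epsilon>" using Suc.prems \<epsilon> by (intro mult_right_mono) auto
        then show ?thesis using t a_ge by (intro mult_right_mono) auto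
      qed
      finally have "norm (app (expm (j * \<epsilon>) M) x) ^ 4 \<le> (exp (a * t) * norm x) ^ 4"
        by (intro power_mono) auto
      then show ?thesis by (simp add: W_def power_mult_distrib mult_ac flip: exp_of_nat_mult)
    qed
    have step: "K \<epsilon> (\<lambda>y'. ennreal (norm (y' - app (expm (Suc j * \<epsilon>) M) x) ^ 4)) y
        \<le> ennreal (1 + C4 * \<epsilon>) * ?f y + ennreal (C4 * \<epsilon> ^ 3 * W)" for y
    proof -
      have "app (expm (Suc j * \<epsilon>) M) x = app (expm \<epsilon> M) (app (expm (j * \<epsilon>) M) x)"
        by (simp add: distrib_right expm_add)
      then have "K \<epsilon> (\<lambda>y'. ennreal (norm (y' - app (expm (Suc j * \<epsilon>) M) x) ^ 4)) y
        \<le> ennreal ((1 + C4 * \<epsilon>) * norm (y - app (expm (j * \<epsilon>) M) x) ^ 4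
            + C4 * \<epsilon> ^ 3 * norm (app (expm (j * \<epsilon>) M) x) ^ 4)"
        using one_step_fourth_moment[of "app (expm (j * \<epsilon>) M) x" y] by simp
      also have "\<dots> \<le> ennreal ((1 + C4 * \<epsilon>) * norm (y - app (expm (j * \<epsilon>) M) x) ^ 4 + C4 * \<epsilon> ^ 3 * W)"
        using c C4_nonneg \<epsilon> by (intro ennreal_leI add_left_mono mult_left_mono) auto
      also have "\<dots> = ennreal (1 + C4 * \<epsilon>) * ?f y + ennreal (C4 * \<epsilon> ^ 3 * W)"
        using C4_nonneg \<epsilon> W by (simp add: ennreal_plus ennreal_mult)
      finally show ?thesis .
    qed
    have "E \<epsilon> (Suc j) (\<lambda>y. ennreal (norm (y - app (expm (Suc j * \<epsilon>) M) x) ^ 4)) x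
        \<le> E \<epsilon> j (\<lambda>y. ennreal (1 + C4 * \<epsilon>) * ?f y + ennreal (C4 * \<epsilon> ^ 3 * W)) x"
      unfolding E_Suc by (rule E_mono[OF step])
    also have "\<dots> = ennreal (1 + C4 * \<epsilon>) * E \<epsilon> j ?f x + ennreal (C4 * \<epsilon> ^ 3 * W)"
      using \<epsilon> by (subst E_add) (auto simp: E_cmult E_const)
    also have "\<dots> \<le> ennreal (1 + C4 * \<epsilon>) * ennreal (j * (1 + C4 * \<epsilon>) ^ j * (C4 * \<epsilon> ^ 3 * W)) + ennreal (C4 * \<epsilon> ^ 3 * W)"
      using Suc by (intro add_right_mono mult_left_mono) auto
    also have "\<dots> = ennreal ((1 + C4 * \<epsilon>) * (j * (1 + C4 * \<epsilon>) ^ j * (C4 * \<epsilon> ^ 3 * W)) + C4 * \<epsilon> ^ 3 * W)"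
      using C4_nonneg \<epsilon> W by (simp add: ennreal_plus ennreal_mult)
    also have "\<dots> \<le> ennreal (Suc j * (1 + C4 * \<epsilon>) ^ Suc j * (C4 * \<epsilon> ^ 3 * W))"
    proof (rule ennreal_leI)
      have "1 \<le> (1 + C4 * \<epsilon>) ^ Suc j" using C4_nonneg \<epsilon> by (intro one_le_power) auto
      then have "C4 * \<epsilon> ^ 3 * W * 1 \<le> C4 * \<epsilon> ^ 3 * W * (1 + C4 * \<epsilon>) ^ Suc j"
        using C4_nonneg \<epsilon> W by (intro mult_left_mono) auto
      then show "(1 + C4 * \<epsilon>) * (j * (1 + C4 * \<epsilon>) ^ j * (C4 * \<epsilon> ^ 3 * W)) + C4 * \<epsilon> ^ 3 * W
          \<le> Suc j * (1 + C4 * \<epsilon>) ^ Suc j * (C4 * \<epsilon> ^ 3 * W)"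
        by (simp add: algebra_simps)
    qed
    finally show ?case .
  qed
  have "(1 + C4 * \<epsilon>) ^ k \<le> exp (C4 * \<epsilon>) ^ k"
    using C4_nonneg \<epsilon> by (intro power_mono exp_ge_add_one_self) auto
  also have "\<dots> = exp (C4 * (k * \<epsilon>))" by (simp add: mult_ac flip: exp_of_nat_mult)
  also have "\<dots> \<le> exp (C4 * t)" using C4_nonneg t by (simp add: mult_left_mono)
  finally have P: "(1 + C4 * \<epsilon>) ^ k \<le> exp (C4 * t)" .
  have "k * (1 + C4 * \<epsilon>) ^ k * (C4 * \<epsilon> ^ 3 * W) = (k * \<epsilon>) * (1 + C4 * \<epsilon>) ^ k * (C4 * \<epsilon>^2 * W)"
    by (simp add: power2_eq_square power3_eq_cube mult_ac)
  also have "\<dots> \<le> t * exp (C4 * t) * (C4 * \<epsilon>^2 * W)"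
    using P t C4_nonneg \<epsilon> W order_trans[of 0 "k * \<epsilon>" t]
    by (intro mult_right_mono mult_mono) auto
  also have "\<dots> = C_t t * \<epsilon>^2 * norm x ^ 4" by (simp add: C_t_def W_def mult_ac)
  finally show ?thesis using main[OF order_refl] ennreal_leI order_trans by blast
qed

text \<open>The square \<open>s\<^sup>2 \<bar>L A\<^sub>j y\<bar>\<^sup>2\<close> has mean \<open>2 \<epsilon>\<^sup>2 \<bar>L A\<^sub>j y\<bar>\<^sup>2\<close>, of which half
  pays for separating it from the other terms. All corrections carry a factor \<open>\<bar>w\<bar>\<close> or a higher power of
  \<open>\<epsilon>\<close>, except the one with \<open>L M y\<close>, which is of the size of \<open>\<bar>w\<bar>\<close> for the \<open>L\<close> used later.\<close>

lemma one_step_second_moment_ge: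
  assumes L: "norm L \<le> l" and w: "w = app L (app (expm \<epsilon> M) y)"
  defines "C \<equiv> 6 * a ^ 4 * (exp (4 * a) + 768)"
  shows "ennreal ((norm w)^2 + \<epsilon>^2 * p j * (norm (app L (app (A j) y)))^2 - C * l * \<epsilon>^2 * (norm w * norm y)
      - 3 * \<epsilon>^2 * (norm (app L (app M y)))^2 - C * l^2 * \<epsilon> ^ 4 * (norm y)^2)
    \<le> K \<epsilon> (\<lambda>y'. ennreal ((norm (app L y'))^2)) y"
proof -
  have l: "0 \<le> l" using L norm_ge_zero order_trans by blast
  define D where "D = exp (4 * a)"
  have D: "exp a \<le> D" "(exp a)^2 \<le> D" "1 \<le> D"
    using a_ge unfolding D_def by (simp_all flip: exp_of_nat_mult)
  define c2 c4 where "c2 = 2 * a^2 * l * (norm w * norm y)" and "c4 = 6 * a ^ 4 * l^2 * (norm y)^2"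
  define q where "q = (\<lambda>i. (norm (app L (app (A i) y)))^2 / 2)"
  define \<beta> where "\<beta> = (\<lambda>i. 2 * (w \<bullet> app L (app (A i) y)))"
  define \<alpha> where "\<alpha> = (norm w)^2 - 2 * \<epsilon> * (w \<bullet> app L (app M y)) - c2 * (\<epsilon>^2 * D)
     - 3 * \<epsilon>^2 * (norm (app L (app M y)))^2 - c4 * (\<epsilon> ^ 4 * D)"
  have pos: "0 \<le> c2" "0 \<le> c4" using a_ge l by (auto simp: c2_def c4_def)
  \<comment> \<open>Linear arithmetic, separated from the large terms it is applied to.\<close>
  have combine: "N = n + 2 * x + x' \<Longrightarrow> u \<le> n + 2 * y + (Q - 2 * z - V) \<Longrightarrow> y \<le> x \<Longrightarrow> Q - 2 * R - V \<le> x'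
      \<Longrightarrow> R \<le> z \<Longrightarrow> u \<le> N" for N n x x' u y z V Q R :: real by linarith
  have main: "ennreal (\<alpha> + \<epsilon> * (\<Sum>i\<in>UNIV. p i * \<beta> i) + 2 * \<epsilon> ^ 2 * (\<Sum>i\<in>UNIV. p i * q i) - 16 * c2 * \<epsilon> ^ 2 - 768 * c4 * \<epsilon> ^ 4)
    \<le> K \<epsilon> (\<lambda>y'. ennreal ((norm (app L y'))^2)) y"
  proof (rule K_ge[where \<kappa> = "4 * a"])
    fix i and s :: real assume s: "0 \<le> s"
    define v where "v = app L (app (expm s (A i)) y - app (expm \<epsilon> M) y)"
    define r where "r = app L (app (expm s (A i)) y - app (expm \<epsilon> M) y - (s *\<^sub>R app (A i) y - \<epsilon> *\<^sub>R app M y))"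
    define S2 S4 where "S2 = s^2 * exp (4 * a * s)" and "S4 = s ^ 4 * exp (4 * a * s)"
    have ex: "exp (a * s) \<le> exp (4 * a * s)" "(exp (a * s))^2 \<le> exp (4 * a * s)"
      using s a_ge by (simp_all flip: exp_of_nat_mult add: mult.assoc)
    have nr0: "norm r \<le> l * (a^2 * norm y * (s^2 * exp (a * s) + \<epsilon>^2 * exp a))"
      unfolding r_def using L l by (intro order_trans[OF norm_app] mult_mono increment_bounds(1) s) auto
    have nr: "norm r \<le> l * a^2 * norm y * (S2 + \<epsilon>^2 * D)"
    proof -
      have "s^2 * exp (a * s) + \<epsilon>^2 * exp a \<le> S2 + \<epsilon>^2 * D"
        unfolding S2_def using ex D by (intro add_mono mult_left_mono) auto
      then have "l * a^2 * norm y * (s^2 * exp (a * s) + \<epsilon>^2 * exp a) \<le> l * a^2 * norm y * (S2 + \<epsilon>^2 * D)"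
        using l by (intro mult_left_mono) auto
      then show ?thesis using nr0 by (simp add: mult_ac)
    qed
    have nr2: "(norm r)^2 \<le> 2 * l^2 * a ^ 4 * (norm y)^2 * (S4 + \<epsilon> ^ 4 * D)"
    proof -
      have "(norm r)^2 \<le> (l * a^2 * norm y * (s^2 * exp (a * s) + \<epsilon>^2 * exp a))^2"
        using nr0 by (intro power_mono) (auto simp: mult_ac)
      also have "\<dots> = (l * a^2 * norm y)^2 * (s^2 * exp (a * s) + \<epsilon>^2 * exp a)^2" by (simp only: power_mult_distrib)
      also have "\<dots> \<le> (l * a^2 * norm y)^2 * (2 * (s^2 * exp (a * s))^2 + 2 * (\<epsilon>^2 * exp a)^2)"
        using sum_squares_bound[of "s^2 * exp (a * s)" "\<epsilon>^2 * exp a"] by (intro mult_left_mono) (auto simp: power2_sum)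
      also have "\<dots> \<le> (l * a^2 * norm y)^2 * (2 * S4 + 2 * (\<epsilon> ^ 4 * D))"
        unfolding S4_def power_mult_distrib[of "s^2"] power_mult_distrib[of "\<epsilon>^2"] using ex D
        by (intro mult_left_mono add_mono) (auto intro!: mult_left_mono)
      finally show ?thesis by (simp add: algebra_simps power_mult_distrib)
    qed
    have v: "v = s *\<^sub>R app L (app (A i) y) + (r - \<epsilon> *\<^sub>R app L (app M y))"
      by (simp add: v_def r_def app_simps)
    have wv: "w \<bullet> v \<ge> s * (w \<bullet> app L (app (A i) y)) - \<epsilon> * (w \<bullet> app L (app M y)) - norm w * (l * a^2 * norm y * (S2 + \<epsilon>^2 * D))"
    proof -
      have "\<bar>w \<bullet> r\<bar> \<le> norm w * (l * a^2 * norm y * (S2 + \<epsilon>^2 * D))"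
        by (rule order_trans[OF Cauchy_Schwarz_ineq2 mult_left_mono[OF nr]]) auto
      then show ?thesis unfolding v by (simp add: inner_add_right inner_diff_right)
    qed
    have v2: "(norm v)^2 \<ge> s^2 * q i - 2 * (norm r)^2 - 2 * (\<epsilon>^2 * (norm (app L (app M y)))^2)"
    proof -
      have half: "(norm (x + e))^2 \<ge> (norm x)^2 / 2 - (norm e)^2" for x e :: 'a
      proof -
        have "norm x \<le> norm (x + e) + norm e" using norm_triangle_ineq4[of "x + e" e] by simp
        then have "(norm x)^2 \<le> (norm (x + e) + norm e)^2" by (intro power_mono) auto
        also have "\<dots> \<le> 2 * (norm (x + e))^2 + 2 * (norm e)^2"
          using sum_squares_bound[of "norm (x + e)" "norm e"] by (simp add: power2_sum)
        finally show ?thesis by simp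
      qed
      have "norm (r - \<epsilon> *\<^sub>R app L (app M y)) \<le> norm r + \<epsilon> * norm (app L (app M y))"
        using norm_triangle_ineq4[of r "\<epsilon> *\<^sub>R app L (app M y)"] \<epsilon> by simp
      then have "(norm (r - \<epsilon> *\<^sub>R app L (app M y)))^2 \<le> (norm r + \<epsilon> * norm (app L (app M y)))^2"
        by (intro power_mono) auto
      also have "\<dots> \<le> 2 * (norm r)^2 + 2 * (\<epsilon>^2 * (norm (app L (app M y)))^2)"
        using sum_squares_bound[of "norm r" "\<epsilon> * norm (app L (app M y))"] by (simp add: power2_sum power_mult_distrib)
      finally show ?thesis using half[of "s *\<^sub>R app L (app (A i) y)" "r - \<epsilon> *\<^sub>R app L (app M y)"]
        by (simp add: v q_def power_mult_distrib)
    qed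
    have "app L (app (expm s (A i)) y) = w + v" by (simp add: w v_def app_simps)
    then have "(norm (app L (app (expm s (A i)) y)))^2 = (norm w)^2 + 2 * (w \<bullet> v) + (norm v)^2"
      by (simp add: power2_norm_eq_inner inner_add_left inner_add_right inner_commute)
    moreover have "\<alpha> + \<beta> i * s + q i * s^2 - c2 * S2 - c4 * S4 \<le>
        (norm w)^2 + 2 * (s * (w \<bullet> app L (app (A i) y)) - \<epsilon> * (w \<bullet> app L (app M y)) - norm w * (l * a^2 * norm y * (S2 + \<epsilon>^2 * D)))
        + (s^2 * q i - 2 * (2 * l^2 * a ^ 4 * (norm y)^2 * (S4 + \<epsilon> ^ 4 * D)) - 2 * (\<epsilon>^2 * (norm (app L (app M y)))^2))"
    proof -
      have "0 \<le> \<epsilon>^2 * (norm (app L (app M y)))^2" "0 \<le> l^2 * a ^ 4 * (norm y)^2 * (S4 + \<epsilon> ^ 4 * D)"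
        using D s by (auto simp: S4_def)
      then show ?thesis by (simp add: \<alpha>_def \<beta>_def c2_def c4_def algebra_simps)
    qed
    ultimately show "\<alpha> + \<beta> i * s + q i * s^2 - c2 * (s^2 * exp (4 * a * s)) - c4 * (s ^ 4 * exp (4 * a * s))
        \<le> (norm (app L (app (expm s (A i)) y)))^2"
      unfolding S2_def[symmetric] S4_def[symmetric]
      by (rule combine[OF _ _ wv v2 nr2])
  qed (use \<epsilon> a_ge pos in auto)
  have "(\<Sum>i\<in>UNIV. p i * \<beta> i) = 2 * (w \<bullet> app L (app M y))"
    by (simp add: \<beta>_def app_M inner_sum_right sum_distrib_left mult_ac app.sum_right app.scaleR_right)
  moreover have "p j * q j \<le> (\<Sum>i\<in>UNIV. p i * q i)"
    by (rule member_le_sum) (auto simp: q_def p_nonneg)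
  then have "2 * \<epsilon>^2 * (p j * q j) \<le> 2 * \<epsilon>^2 * (\<Sum>i\<in>UNIV. p i * q i)"
    by (intro mult_left_mono) auto
  moreover have "c2 * (D + 16) \<le> C * l * (norm w * norm y)"
  proof -
    have "a^2 \<le> a ^ 4" using a_ge by (intro power_increasing) auto
    then have "2 * a^2 * (D + 16) \<le> C" unfolding C_def D_def[symmetric] using D a_ge by (intro mult_mono) auto
    then have "2 * a^2 * (D + 16) * (l * (norm w * norm y)) \<le> C * (l * (norm w * norm y))"
      using l by (intro mult_right_mono) auto
    then show ?thesis by (simp add: c2_def mult_ac)
  qed
  then have "c2 * (D + 16) * \<epsilon>^2 \<le> C * l * (norm w * norm y) * \<epsilon>^2" by (intro mult_right_mono) auto
  moreover have "c4 * (D + 768) = C * l^2 * (norm y)^2" by (simp add: c4_def C_def D_def)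
  then have "c4 * (D + 768) * \<epsilon> ^ 4 = C * l^2 * (norm y)^2 * \<epsilon> ^ 4" by simp
  ultimately show ?thesis
    by (intro order_trans[OF ennreal_leI main]) (simp add: \<alpha>_def q_def algebra_simps)
qed

end

end

section \<open>Growth of the dominant component\<close>

lemma eventually_mult_less:
  fixes c d :: real assumes "d > 0"
  shows "\<forall>\<^sub>F \<epsilon> in at_right 0. c * \<epsilon> < d" "\<forall>\<^sub>F \<epsilon> in at_right 0. c * sqrt \<epsilon> < d"
proof -
  have "((\<lambda>\<epsilon>. c * \<epsilon>) \<longlongrightarrow> c * 0) (at_right 0)" by (intro tendsto_intros)
  then show "\<forall>\<^sub>F \<epsilon> in at_right 0. c * \<epsilon> < d" using assms by (intro order_tendstoD) auto
  have "((\<lambda>\<epsilon>. c * sqrt \<epsilon>) \<longlongrightarrow> c * sqrt 0) (at_right 0)" by (intro tendsto_intros)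
  then show "\<forall>\<^sub>F \<epsilon> in at_right 0. c * sqrt \<epsilon> < d" using assms by (intro order_tendstoD) auto
qed

lemma ennreal_diff_le:
  assumes "ennreal u \<le> v + ennreal w" "0 \<le> w" shows "ennreal (u - w) \<le> v"
proof (cases v)
  case (real r)
  then have "u \<le> r + w" using assms by (simp flip: ennreal_plus add: ennreal_le_iff)
  then show ?thesis using real by (simp add: ennreal_leI)
qed simp

context switching
begin

abbreviation P :: "real \<Rightarrow> nat \<Rightarrow> 'a set \<Rightarrow> 'a \<Rightarrow> ennreal" where
  "P \<epsilon> k S \<equiv> E \<epsilon> k (indicator S)"

lemma E_zero: "\<epsilon> > 0 \<Longrightarrow> E \<epsilon> k f 0 = f 0"
proof (induction k arbitrary: f)
  case (Suc k)
  have "K \<epsilon> f 0 = f 0"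
    using prob_space.emeasure_space_1[OF prob_space_exp_law, of \<epsilon>] p_sum Suc.prems
    unfolding K_def by (simp flip: sum_distrib_right add: sum_ennreal p_nonneg app.zero_right)
  then show ?case unfolding E_Suc using Suc by simp
qed simp

lemma P_compl:
  assumes "S \<in> sets borel" "\<epsilon> > 0" shows "P \<epsilon> k S x + P \<epsilon> k (- S) x = 1"
proof -
  have "P \<epsilon> k S x + P \<epsilon> k (- S) x = E \<epsilon> k (\<lambda>y. indicator S y + indicator (- S) y) x"
    using assms by (subst E_add) auto
  also have "(\<lambda>y. indicator S y + indicator (- S) y) = (\<lambda>y. 1 :: ennreal)" by (auto simp: indicator_def)
  finally show ?thesis using assms by (simp add: E_const)
qed

lemma P_le_1: "\<epsilon> > 0 \<Longrightarrow> P \<epsilon> k S x \<le> 1"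
proof -
  assume "\<epsilon> > 0"
  have "P \<epsilon> k S x \<le> E \<epsilon> k (\<lambda>_. 1) x" by (rule E_mono) (simp add: indicator_def)
  then show ?thesis using \<open>\<epsilon> > 0\<close> by (simp add: E_const)
qed

lemma P_ge_compl:
  assumes "S \<in> sets borel" "\<epsilon> > 0" "P \<epsilon> k (- S) x \<le> ennreal q" "0 \<le> q"
  shows "ennreal (1 - q) \<le> P \<epsilon> k S x"
proof (rule ennreal_diff_le)
  show "ennreal 1 \<le> P \<epsilon> k S x + ennreal q"
    using P_compl[OF assms(1,2), of k x] assms(3) by (metis add_left_mono ennreal_1)
qed fact

lemma P_compl_le:
  assumes "S \<in> sets borel" "\<epsilon> > 0" "ennreal q \<le> P \<epsilon> k S x" "0 \<le> q"
  shows "P \<epsilon> k (- S) x \<le> ennreal (1 - q)"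
proof -
  have "P \<epsilon> k (- S) x \<le> 1" by (rule P_le_1[OF \<open>\<epsilon> > 0\<close>])
  moreover have "P \<epsilon> k S x \<le> 1" by (rule P_le_1[OF \<open>\<epsilon> > 0\<close>])
  ultimately obtain u v where uv: "P \<epsilon> k (- S) x = ennreal u" "P \<epsilon> k S x = ennreal v" "0 \<le> u" "0 \<le> v"
    by (metis ennreal_cases ennreal_one_less_top le_less_trans less_irrefl)
  have "ennreal (v + u) = 1" using P_compl[OF assms(1,2), of k x] uv by (simp add: ennreal_plus)
  then have "v + u = 1" by (simp only: ennreal_eq_1)
  moreover have "q \<le> v" using assms uv by (simp add: ennreal_le_iff)
  ultimately show ?thesis using uv by (simp add: ennreal_leI)
qed

lemma P_mono: "S \<subseteq> S' \<Longrightarrow> P \<epsilon> k S x \<le> P \<epsilon> k S' x"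
  by (rule E_mono) (auto simp: indicator_def)

text \<open>Markov's inequality for the fourth moment; second moments would only give \<open>O(\<epsilon>)\<close>, too weak for
  \<open>1/\<epsilon>\<close> consecutive blocks.\<close>

lemma P_deviation:
  assumes \<epsilon>: "0 < \<epsilon>" "8 * a * \<epsilon> \<le> 1" and t: "real k * \<epsilon> \<le> t" and \<delta>: "0 < \<delta>"
  shows "P \<epsilon> k {y. \<delta> < norm (y - app (expm (k * \<epsilon>) M) x)} x \<le> ennreal (C_t t * \<epsilon>^2 * norm x ^ 4 / \<delta> ^ 4)"
proof -
  let ?z = "\<lambda>y. norm (y - app (expm (k * \<epsilon>) M) x)"
  have "P \<epsilon> k {y. \<delta> < ?z y} x \<le> E \<epsilon> k (\<lambda>y. ennreal (1 / \<delta> ^ 4) * ennreal (?z y ^ 4)) x"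
  proof (rule E_mono)
    fix y
    show "indicator {y. \<delta> < ?z y} y \<le> ennreal (1 / \<delta> ^ 4) * ennreal (?z y ^ 4)"
    proof (cases "\<delta> < ?z y")
      case True
      then have "1 \<le> 1 / \<delta> ^ 4 * ?z y ^ 4" using \<delta> power_mono[of \<delta> "?z y" 4] by (simp add: field_simps)
      then show ?thesis using \<delta> True by (simp flip: ennreal_mult ennreal_1 add: ennreal_leI)
    qed simp
  qed
  also have "\<dots> \<le> ennreal (1 / \<delta> ^ 4) * ennreal (C_t t * \<epsilon>^2 * norm x ^ 4)"
    using \<epsilon> by (subst E_cmult) (auto intro!: mult_left_mono fourth_moment t)
  also have "\<dots> = ennreal (C_t t * \<epsilon>^2 * norm x ^ 4 / \<delta> ^ 4)"
    using \<delta> C_t_nonneg[of t] t \<epsilon> order_trans[of 0 "k * \<epsilon>" t] by (simp flip: ennreal_mult)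
  finally show ?thesis .
qed

text \<open>The range of the projection \<open>U\<close> grows faster than its kernel under the flow of \<open>M\<close>, by a factor \<open>8\<close> from
  time \<open>t0\<close> on. The margin between \<open>8\<close> and the factor \<open>2\<close> of \<open>drift\<close> absorbs the deviations of the chain.\<close>

definition dominated :: "'a endo \<Rightarrow> real \<Rightarrow> real \<Rightarrow> bool" where
  "dominated U \<beta> t0 \<longleftrightarrow> U * M = M * U \<and> (\<forall>t\<ge>t0. \<forall>x.
     norm (app (expm t M) (x - app U x)) \<le> exp (\<beta> * t) * norm (x - app U x) \<and>
     8 * exp (\<beta> * t) * norm (app U x) \<le> norm (app (expm t M) (app U x)))"

text \<open>Written without a quotient, so that the range of \<open>U\<close> belongs to the cone.\<close>

definition cone :: "'a endo \<Rightarrow> real \<Rightarrow> 'a set" where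
  "cone U r = {x. r * norm (x - app U x) \<le> norm (app U x)}"

lemma cone_borel [measurable]: "cone U r \<in> sets borel"
  unfolding cone_def by (intro borel_closed closed_Collect_le continuous_intros)

lemma cone_antimono: "r \<le> r' \<Longrightarrow> cone U r' \<subseteq> cone U r"
  unfolding cone_def by (auto intro: order_trans[OF mult_right_mono])

text \<open>In the cone, \<open>\<bar>x\<bar> \<le> (1 + 1/r) \<bar>U x\<bar>\<close>. Leaving the cone of ratio \<open>2 r\<close> requires a deviation from
  the averaged flow of at least a constant times \<open>\<bar>U x\<bar>\<close>.\<close>

lemma drift:
  assumes dom: "dominated U \<beta> t0" and \<tau>: "t0 \<le> \<tau>" "0 \<le> \<tau>" and \<rho>: "0 < \<rho>"
  obtains C where "0 \<le> C" "\<And>\<epsilon> m r x. 0 < \<epsilon> \<Longrightarrow> 8 * a * \<epsilon> \<le> 1 \<Longrightarrow> \<tau> \<le> real m * \<epsilon> \<Longrightarrow> real m * \<epsilon> \<le> \<tau> + 1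
    \<Longrightarrow> 0 < r \<Longrightarrow> r \<le> \<rho> \<Longrightarrow> x \<in> cone U r \<Longrightarrow> P \<epsilon> m (- cone U (2 * r)) x \<le> ennreal (C * \<epsilon>^2 * (1 + 1 / r) ^ 4)"
proof -
  define \<kappa>0 where "\<kappa>0 = exp (- (\<bar>\<beta>\<bar> * (\<tau> + 1)))"
  define \<delta> where "\<delta> = \<kappa>0 * min 1 (1 / \<rho>) / (1 + norm U)"
  have U1: "0 < 1 + norm U" using norm_ge_zero[of U] by linarith
  have \<delta>: "0 < \<delta>" using \<rho> U1 by (simp add: \<delta>_def \<kappa>0_def)
  define C where "C = C_t (\<tau> + 1) / \<delta> ^ 4"
  have C: "0 \<le> C" using C_t_nonneg[of "\<tau> + 1"] \<tau> \<delta> by (simp add: C_def)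
  show thesis
  proof (rule that[OF C])
    fix \<epsilon> r :: real and m :: nat and x
    assume \<epsilon>: "0 < \<epsilon>" "8 * a * \<epsilon> \<le> 1" and m: "\<tau> \<le> real m * \<epsilon>" "real m * \<epsilon> \<le> \<tau> + 1"
      and r: "0 < r" "r \<le> \<rho>" and x: "x \<in> cone U r"
    show "P \<epsilon> m (- cone U (2 * r)) x \<le> ennreal (C * \<epsilon>^2 * (1 + 1 / r) ^ 4)"
    proof (cases "x = 0")
      case True
      then show ?thesis using \<epsilon> by (simp add: E_zero cone_def app.zero_right)
    next
      case False
      define t where "t = real m * \<epsilon>"
      define \<kappa> where "\<kappa> = exp (\<beta> * t)"
      define u where "u = norm (app U x)"
      have xu: "norm (x - app U x) \<le> u / r" using x r by (simp add: cone_def u_def field_simps)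
      have nx: "norm x \<le> (1 + 1 / r) * u"
        using xu norm_triangle_ineq[of "x - app U x" "app U x"] by (simp add: u_def algebra_simps)
      have u: "0 < u"
      proof (rule ccontr)
        assume "\<not> 0 < u"
        then have "u = 0" by (simp add: u_def)
        then show False using nx False by simp
      qed
      have t0: "0 \<le> t" "t \<le> \<tau> + 1" "t0 \<le> t" using m \<tau> by (auto simp: t_def)
      have k: "\<kappa>0 \<le> \<kappa>"
        unfolding \<kappa>0_def \<kappa>_def using t0 by (intro exp_lower_const) auto
      have k0: "0 \<le> \<kappa>0" "0 \<le> \<kappa>" by (simp_all add: \<kappa>0_def \<kappa>_def)
      have dk: "(1 + norm U) * \<delta> \<le> \<kappa>" "(1 + norm U) * \<delta> \<le> \<kappa> / \<rho>"
      proof -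
        have e: "(1 + norm U) * \<delta> = \<kappa>0 * min 1 (1 / \<rho>)" using U1 by (simp add: \<delta>_def)
        have "\<kappa>0 * min 1 (1 / \<rho>) \<le> \<kappa> * 1" "\<kappa>0 * min 1 (1 / \<rho>) \<le> \<kappa> * (1 / \<rho>)"
          using k \<rho> k0 by (intro mult_mono; simp)+
        then show "(1 + norm U) * \<delta> \<le> \<kappa>" "(1 + norm U) * \<delta> \<le> \<kappa> / \<rho>" using e by auto
      qed
      have kp: "0 < \<kappa>" by (simp add: \<kappa>_def)
      have comm: "app U (app (expm t M) y) = app (expm t M) (app U y)" for y
        using expm_commute[of U M t] dom by (simp add: dominated_def flip: app_mult)
      have D1: "norm (app (expm t M) (x - app U x)) \<le> \<kappa> * norm (x - app U x)"
        and D2: "8 * \<kappa> * u \<le> norm (app (expm t M) (app U x))"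
        using dom t0 unfolding dominated_def \<kappa>_def u_def by blast+
      have sub: "- cone U (2 * r) \<subseteq> {y. \<delta> * u < norm (y - app (expm (m * \<epsilon>) M) x)}"
      proof (rule subsetI, rule ccontr)
        fix y assume y: "y \<in> - cone U (2 * r)" and "y \<notin> {y. \<delta> * u < norm (y - app (expm (m * \<epsilon>) M) x)}"
        then have z: "norm (y - app (expm t M) x) \<le> \<delta> * u" by (simp add: t_def)
        define z' where "z' = y - app (expm t M) x"
        have y': "y = app (expm t M) x + z'" by (simp add: z'_def)
        have Uy: "app U y = app (expm t M) (app U x) + app U z'" by (simp add: y' app_simps comm)
        have Vy: "y - app U y = app (expm t M) (x - app U x) + (z' - app U z')"
          by (simp add: y' app_simps comm)
        have nUz: "norm (app U z') \<le> norm U * (\<delta> * u)"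
          using z by (intro order_trans[OF norm_app mult_left_mono]) (auto simp: z'_def)
        have nVz: "norm (z' - app U z') \<le> (1 + norm U) * (\<delta> * u)"
          using norm_triangle_ineq4[of z' "app U z'"] nUz z by (simp add: z'_def algebra_simps)
        have du: "(1 + norm U) * (\<delta> * u) \<le> \<kappa> * u" "(1 + norm U) * (\<delta> * u) \<le> \<kappa> / \<rho> * u"
          using mult_right_mono[OF dk(1), of u] mult_right_mono[OF dk(2), of u] u by (auto simp: mult_ac)
        have "norm U * (\<delta> * u) \<le> (1 + norm U) * (\<delta> * u)" using \<delta> u by (intro mult_right_mono) auto
        then have 1: "7 * \<kappa> * u \<le> norm (app U y)"
          using D2 nUz du(1) norm_triangle_ineq4[of "app U y" "app U z'"] unfolding Uy by (simp add: algebra_simps)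
        have "\<kappa> / \<rho> * u \<le> \<kappa> / r * u" using r u kp by (intro mult_right_mono divide_left_mono) auto
        moreover have "\<kappa> * norm (x - app U x) \<le> \<kappa> / r * u"
          using mult_left_mono[OF xu, of \<kappa>] kp by simp
        ultimately have 2: "norm (y - app U y) \<le> 2 * (\<kappa> / r * u)"
          unfolding Vy using norm_triangle_ineq[of "app (expm t M) (x - app U x)" "z' - app U z'"] D1 nVz du(2) by linarith
        have "2 * r * norm (y - app U y) \<le> 2 * r * (2 * (\<kappa> / r * u))" using 2 r by (intro mult_left_mono) auto
        also have "\<dots> = 4 * \<kappa> * u" using r by simp
        also have "\<dots> \<le> 7 * \<kappa> * u" using kp u by (intro mult_right_mono) auto
        finally have "y \<in> cone U (2 * r)" using 1 by (simp add: cone_def)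
        then show False using y by simp
      qed
      have "P \<epsilon> m (- cone U (2 * r)) x \<le> ennreal (C_t (\<tau> + 1) * \<epsilon>^2 * norm x ^ 4 / (\<delta> * u) ^ 4)"
        by (rule order_trans[OF P_mono[OF sub] P_deviation]) (use \<epsilon> m \<delta> u in auto)
      also have "\<dots> \<le> ennreal (C_t (\<tau> + 1) * \<epsilon>^2 * ((1 + 1 / r) * u) ^ 4 / (\<delta> * u) ^ 4)"
        using nx C_t_nonneg[of "\<tau> + 1"] \<tau> \<delta> u
        by (intro ennreal_leI divide_right_mono mult_left_mono power_mono) auto
      also have "C_t (\<tau> + 1) * \<epsilon>^2 * ((1 + 1 / r) * u) ^ 4 / (\<delta> * u) ^ 4 = C * \<epsilon>^2 * (1 + 1 / r) ^ 4"
        using u \<delta> unfolding C_def power_mult_distrib by simp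
      finally show ?thesis .
    qed
  qed
qed

text \<open>As long as the ratio doubles, the failure probabilities \<open>\<epsilon>\<^sup>2 / r\<^sup>4\<close> form a geometric series; once \<open>\<rho>\<close> is
  reached they stay of order \<open>\<epsilon>\<^sup>2 / \<rho>\<^sup>4\<close> per block.\<close>

lemma drift_iterated:
  assumes step: "\<And>r x. 0 < r \<Longrightarrow> r \<le> \<rho> \<Longrightarrow> x \<in> cone U r \<Longrightarrow> P \<epsilon> m (- cone U (2 * r)) x \<le> ennreal (C * \<epsilon>^2 * (1 + 1 / r) ^ 4)"
    and C: "0 \<le> C" and \<epsilon>: "0 < \<epsilon>" and r: "0 < r" "r \<le> \<rho>" and x: "x \<in> cone U r"
  shows "P \<epsilon> (b * m) (- cone U (min \<rho> (2 ^ b * r))) x \<le> ennreal (8 * C * \<epsilon>^2 * (b * (1 + 1 / \<rho> ^ 4) + 2 / r ^ 4))"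
proof -
  define th where "th = (\<lambda>j. min \<rho> (2 ^ j * r))"
  have th: "0 < th j" "th j \<le> \<rho>" for j using r by (auto simp: th_def)
  \<comment> \<open>A bound for the probability of failure within the first \<open>j\<close> blocks, the threshold after them being \<open>th j\<close>.\<close>
  define s where "s = (\<lambda>j. 8 * C * \<epsilon>^2 * (j * (1 + 1 / \<rho> ^ 4) + (\<Sum>i<j. (1 / 16) ^ i) / r ^ 4))"
  have s: "0 \<le> s j" for j unfolding s_def using C r by (intro mult_nonneg_nonneg add_nonneg_nonneg divide_nonneg_nonneg sum_nonneg) auto
  have q: "C * \<epsilon>^2 * (1 + 1 / th j) ^ 4 \<le> s (Suc j) - s j" for j
  proof -
    have "(1 + 1 / th j) ^ 4 \<le> 8 * (1 + (1 / th j) ^ 4)"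
      using power4_add_le[of 1 "1 / th j"] by simp
    also have "(1 / th j) ^ 4 \<le> 1 / \<rho> ^ 4 + (1 / 16) ^ j / r ^ 4"
    proof (cases "\<rho> \<le> 2 ^ j * r")
      case True
      then show ?thesis using r by (simp add: th_def power_one_over)
    next
      case False
      then have "(1 / th j) ^ 4 = 1 / (((2 ^ j) ^ 4) * r ^ 4)"
        by (simp add: th_def min_def power_mult_distrib power_divide)
      also have "(2 ^ j :: real) ^ 4 = 16 ^ j"
      proof -
        have "(2 ^ j :: real) ^ 4 = (2 ^ 4) ^ j" by (metis power_mult mult.commute)
        then show ?thesis by simp
      qed
      also have "1 / (16 ^ j * r ^ 4) = (1 / 16) ^ j / r ^ 4" by (simp add: power_divide)
      finally show ?thesis using r by simp
    qed
    finally have "(1 + 1 / th j) ^ 4 \<le> 8 * (1 + (1 / \<rho> ^ 4 + (1 / 16) ^ j / r ^ 4))" by simp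
    then have "C * \<epsilon>^2 * (1 + 1 / th j) ^ 4 \<le> C * \<epsilon>^2 * (8 * (1 + (1 / \<rho> ^ 4 + (1 / 16) ^ j / r ^ 4)))"
      using C by (intro mult_left_mono) auto
    also have "\<dots> = s (Suc j) - s j" by (simp add: s_def algebra_simps add_divide_distrib)
    finally show ?thesis .
  qed
  have "P \<epsilon> (b * m) (- cone U (th b)) x \<le> ennreal (s b)"
  proof (induction b)
    case 0
    have "x \<in> cone U (th 0)" using x r by (simp add: th_def)
    then show ?case by simp
  next
    case (Suc b)
    have sub: "- cone U (th (Suc b)) \<subseteq> - cone U (2 * th b)"
      using cone_antimono[of "th (Suc b)" "2 * th b" U] r by (auto simp: th_def min_def)
    have "P \<epsilon> m (- cone U (th (Suc b))) y \<le> indicator (- cone U (th b)) y + ennreal (C * \<epsilon>^2 * (1 + 1 / th b) ^ 4)" for y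
    proof (cases "y \<in> cone U (th b)")
      case True
      then show ?thesis using order_trans[OF P_mono[OF sub] step[OF th True]] by simp
    next
      case False
      have "P \<epsilon> m (- cone U (th (Suc b))) y \<le> 1" by (rule P_le_1[OF \<epsilon>])
      also have "\<dots> \<le> 1 + ennreal (C * \<epsilon>^2 * (1 + 1 / th b) ^ 4)" by simp
      finally show ?thesis using False by simp
    qed
    then have "P \<epsilon> (b * m + m) (- cone U (th (Suc b))) x
        \<le> E \<epsilon> (b * m) (\<lambda>y. indicator (- cone U (th b)) y + ennreal (C * \<epsilon>^2 * (1 + 1 / th b) ^ 4)) x"
      unfolding E_plus by (rule E_mono)
    also have "\<dots> = P \<epsilon> (b * m) (- cone U (th b)) x + ennreal (C * \<epsilon>^2 * (1 + 1 / th b) ^ 4)"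
      using \<epsilon> by (subst E_add) (auto simp: E_const)
    also have "\<dots> \<le> ennreal (s b) + ennreal (s (Suc b) - s b)"
      using q by (intro add_mono Suc ennreal_leI) auto
    also have "\<dots> = ennreal (s (Suc b))"
    proof -
      have "0 \<le> C * \<epsilon>^2 * (1 + 1 / th b) ^ 4" using C by simp
      then show ?thesis using s[of b] q[of b] by (subst ennreal_plus[symmetric]) auto
    qed
    finally show ?case by (simp add: add.commute)
  qed
  also have "s b \<le> 8 * C * \<epsilon>^2 * (b * (1 + 1 / \<rho> ^ 4) + 2 / r ^ 4)"
  proof -
    have "(\<Sum>i<b. (1 / 16 :: real) ^ i) = (1 - (1 / 16) ^ b) / (1 - 1 / 16)"
      by (subst sum_gp_strict) auto
    also have "\<dots> \<le> 2"
    proof -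
      have "(1 - g) / (1 - 1 / 16) \<le> 2" if "0 \<le> g" for g :: real using that by (simp add: field_simps)
      from this[of "(1 / 16) ^ b"] show ?thesis by simp
    qed
    finally show ?thesis unfolding s_def using C r by (intro mult_left_mono add_left_mono divide_right_mono) auto
  qed
  finally show ?thesis unfolding th_def using ennreal_leI by (meson order_trans ennreal_leI)
qed

text \<open>For the initial ratio \<open>r = R sqrt \<epsilon>\<close>, the geometric part of the failure probability is of order
  \<open>\<epsilon>\<^sup>2 / r\<^sup>4 = 1 / R\<^sup>4\<close>, and the remaining part is of order \<open>\<epsilon>\<close> over \<open>O(1/\<epsilon>)\<close> blocks.\<close>

lemma reach:
  assumes dom: "dominated U \<beta> t0" and \<tau>: "t0 \<le> \<tau>" "0 \<le> \<tau>" and \<rho>: "0 < \<rho>"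
  obtains R where "0 < R" "\<forall>\<^sub>F \<epsilon> in at_right 0. \<forall>m b x. \<tau> \<le> real m * \<epsilon> \<longrightarrow> real m * \<epsilon> \<le> \<tau> + 1 \<longrightarrow>
    1 / \<epsilon> \<le> real b \<longrightarrow> real b \<le> 3 / \<epsilon> \<longrightarrow> x \<in> cone U (R * sqrt \<epsilon>) \<longrightarrow> ennreal (1 / 2) \<le> P \<epsilon> (b * m) (cone U \<rho>) x"
proof -
  obtain C where C: "0 \<le> C" and step: "\<And>\<epsilon> m r x. 0 < \<epsilon> \<Longrightarrow> 8 * a * \<epsilon> \<le> 1 \<Longrightarrow> \<tau> \<le> real m * \<epsilon> \<Longrightarrow> real m * \<epsilon> \<le> \<tau> + 1
    \<Longrightarrow> 0 < r \<Longrightarrow> r \<le> \<rho> \<Longrightarrow> x \<in> cone U r \<Longrightarrow> P \<epsilon> m (- cone U (2 * r)) x \<le> ennreal (C * \<epsilon>^2 * (1 + 1 / r) ^ 4)"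
    using drift[OF dom \<tau> \<rho>] by blast
  define R where "R = 1 + 64 * C"
  have R: "1 \<le> R" "64 * C \<le> R ^ 4"
    using C power_increasing[of 1 4 R] by (auto simp: R_def)
  then have R0: "0 < R" by simp
  have q0: "0 < (1 / 4 :: real)" by simp
  have "\<forall>\<^sub>F \<epsilon> in at_right 0. \<forall>m b x. \<tau> \<le> real m * \<epsilon> \<longrightarrow> real m * \<epsilon> \<le> \<tau> + 1 \<longrightarrow>
    1 / \<epsilon> \<le> real b \<longrightarrow> real b \<le> 3 / \<epsilon> \<longrightarrow> x \<in> cone U (R * sqrt \<epsilon>) \<longrightarrow> ennreal (1 / 2) \<le> P \<epsilon> (b * m) (cone U \<rho>) x"
    using eventually_at_right_less[of 0] eventually_mult_less(1)[OF zero_less_one, of "8 * a"] eventually_mult_less(2)[OF \<rho>, of R]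
      eventually_mult_less(2)[OF R0, of \<rho>] eventually_mult_less(1)[OF q0, of "24 * C * (1 + 1 / \<rho> ^ 4)"]
  proof (eventually_elim, intro allI impI)
    case (elim \<epsilon>)
    have \<epsilon>: "0 < \<epsilon>" "8 * a * \<epsilon> \<le> 1" using elim by auto
    note e3 = elim(3) and e4 = elim(4) and e5 = elim(5)
    fix m b x assume m: "\<tau> \<le> real m * \<epsilon>" "real m * \<epsilon> \<le> \<tau> + 1" and b: "1 / \<epsilon> \<le> real b" "real b \<le> 3 / \<epsilon>"
      and x: "x \<in> cone U (R * sqrt \<epsilon>)"
    have sq: "0 < sqrt \<epsilon>" "sqrt \<epsilon> * sqrt \<epsilon> = \<epsilon>" using \<epsilon> by auto
    have "real b \<le> 2 ^ b" by (rule less_imp_le[OF of_nat_less_two_power])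
    then have "1 / \<epsilon> \<le> 2 ^ b" using b by linarith
    then have "1 / \<epsilon> * (R * sqrt \<epsilon>) \<le> 2 ^ b * (R * sqrt \<epsilon>)" using R sq by (intro mult_right_mono) auto
    moreover have "\<rho> \<le> 1 / \<epsilon> * (R * sqrt \<epsilon>)"
    proof -
      have "\<rho> * sqrt \<epsilon> * sqrt \<epsilon> \<le> R * sqrt \<epsilon>" using e4 R sq by (intro mult_right_mono) (auto simp: mult.commute)
      then show ?thesis using \<epsilon> sq by (simp add: field_simps)
    qed
    ultimately have th: "min \<rho> (2 ^ b * (R * sqrt \<epsilon>)) = \<rho>" by simp
    have "P \<epsilon> (b * m) (- cone U (min \<rho> (2 ^ b * (R * sqrt \<epsilon>)))) x
      \<le> ennreal (8 * C * \<epsilon>^2 * (b * (1 + 1 / \<rho> ^ 4) + 2 / (R * sqrt \<epsilon>) ^ 4))"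
      using \<epsilon> R sq C x e3 by (intro drift_iterated step m) auto
    also have "8 * C * \<epsilon>^2 * (b * (1 + 1 / \<rho> ^ 4) + 2 / (R * sqrt \<epsilon>) ^ 4) \<le> 1 / 2"
    proof -
      have s4: "sqrt \<epsilon> ^ 4 = \<epsilon>^2" using sq by (metis mult.assoc power2_eq_square power4_eq_xxxx)
      have "\<epsilon>^2 * b \<le> \<epsilon>^2 * (3 / \<epsilon>)" using b by (intro mult_left_mono) auto
      also have "\<dots> = 3 * \<epsilon>" using \<epsilon> by (simp add: power2_eq_square)
      finally have "8 * C * (1 + 1 / \<rho> ^ 4) * (\<epsilon>^2 * b) \<le> 8 * C * (1 + 1 / \<rho> ^ 4) * (3 * \<epsilon>)"
        using C \<rho> by (intro mult_left_mono) auto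
      moreover have "8 * C * \<epsilon>^2 * (2 / (R * sqrt \<epsilon>) ^ 4) \<le> 1 / 4"
      proof -
        have "8 * C * \<epsilon>^2 * (2 / (R * sqrt \<epsilon>) ^ 4) = 16 * C / R ^ 4"
          using \<epsilon> s4 by (simp add: power_mult_distrib)
        also have "\<dots> \<le> 1 / 4" using R by (simp add: divide_simps)
        finally show ?thesis .
      qed
      moreover have "8 * C * (1 + 1 / \<rho> ^ 4) * (3 * \<epsilon>) = 24 * C * (1 + 1 / \<rho> ^ 4) * \<epsilon>" by simp
      moreover have "8 * C * \<epsilon>^2 * (b * (1 + 1 / \<rho> ^ 4) + 2 / (R * sqrt \<epsilon>) ^ 4)
          = 8 * C * (1 + 1 / \<rho> ^ 4) * (\<epsilon>^2 * b) + 8 * C * \<epsilon>^2 * (2 / (R * sqrt \<epsilon>) ^ 4)"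
        by (simp add: algebra_simps)
      ultimately show ?thesis using e5 by linarith
    qed
    finally have "P \<epsilon> (b * m) (- cone U \<rho>) x \<le> ennreal (1 / 2)" unfolding th using ennreal_leI by (meson order_trans ennreal_leI)
    from P_ge_compl[OF _ \<epsilon>(1) this] show "ennreal (1 / 2) \<le> P \<epsilon> (b * m) (cone U \<rho>) x" by simp
  qed
  then show thesis using that[of R] R by simp
qed

end

section \<open>Creation of a dominant component by the noise\<close>

lemma square_le_fourth_power:
  fixes x \<epsilon> :: real assumes "0 < \<epsilon>" shows "x^2 \<le> \<epsilon> / 2 + x ^ 4 / (2 * \<epsilon>)"
proof -
  have "2 * (\<epsilon> * x^2) \<le> \<epsilon>^2 + x ^ 4" using sum_squares_bound[of \<epsilon> "x^2"] by simp
  then have "2 * (\<epsilon> * x^2) / (2 * \<epsilon>) \<le> (\<epsilon>^2 + x ^ 4) / (2 * \<epsilon>)" using assms by (intro divide_right_mono) auto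
  then show ?thesis using assms by (simp add: add_divide_distrib power2_eq_square)
qed

context switching
begin

lemma E_affine_le:
  fixes f g :: "'a \<Rightarrow> real"
  assumes \<epsilon>: "0 < \<epsilon>" and g: "g \<in> borel_measurable borel" "\<And>y. 0 \<le> g y"
    and fg: "\<And>y. f y \<le> u + v * g y" and uv: "0 \<le> u" "0 \<le> v" "0 \<le> B"
    and B: "E \<epsilon> k (\<lambda>y. ennreal (g y)) x \<le> ennreal B"
  shows "E \<epsilon> k (\<lambda>y. ennreal (f y)) x \<le> ennreal (u + v * B)"
proof -
  have "E \<epsilon> k (\<lambda>y. ennreal (f y)) x \<le> E \<epsilon> k (\<lambda>y. ennreal u + ennreal v * ennreal (g y)) x"
  proof (rule E_mono)
    fix y
    have "ennreal (f y) \<le> ennreal (u + v * g y)" by (rule ennreal_leI[OF fg])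
    then show "ennreal (f y) \<le> ennreal u + ennreal v * ennreal (g y)"
      using uv g by (simp add: ennreal_plus ennreal_mult)
  qed
  also have "\<dots> = ennreal u + ennreal v * E \<epsilon> k (\<lambda>y. ennreal (g y)) x"
    using \<epsilon> g(1) by (subst E_add) (auto simp: E_const E_cmult)
  also have "\<dots> \<le> ennreal u + ennreal v * ennreal B"
    by (intro add_left_mono mult_left_mono B) auto
  also have "\<dots> = ennreal (u + v * B)" using uv by (simp add: ennreal_plus ennreal_mult)
  finally show ?thesis .
qed

text \<open>On the event in question \<open>f\<close> is bounded by a multiple of \<open>f\<^sup>2\<close> plus a constant (arithmetic and geometric
  means), elsewhere by \<open>B1 / 4\<close>; the multiple is chosen such that half of the mean is left for the event.\<close>

lemma paley_zygmund:
  fixes f :: "'a \<Rightarrow> real"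
  assumes \<epsilon>: "0 < \<epsilon>" and f: "f \<in> borel_measurable borel" "\<And>y. 0 \<le> f y"
    and m1: "ennreal B1 \<le> E \<epsilon> k (\<lambda>y. ennreal (f y)) x" and m2: "E \<epsilon> k (\<lambda>y. ennreal ((f y)^2)) x \<le> ennreal B2"
    and B: "0 < B1" "0 < B2"
  shows "ennreal (B1^2 / (2 * B2)) \<le> P \<epsilon> k {y. B1 / 4 < f y} x"
proof -
  note [measurable] = f(1)
  let ?S = "{y. B1 / 4 < f y}"
  have S[measurable]: "?S \<in> sets borel" by measurable
  have pt: "ennreal (f y) \<le> ennreal (B1 / 4) + (ennreal (B1 / (4 * B2)) * ennreal ((f y)^2)
      + ennreal (B2 / B1) * indicator ?S y)" for y
  proof (cases "y \<in> ?S")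
    case True
    have "2 * (B1 / (2 * B2) * f y * 1) \<le> (B1 / (2 * B2) * f y)^2 + 1^2" using sum_squares_bound[of "B1 / (2 * B2) * f y" 1] by simp
    then have "B2 / B1 * (2 * (B1 / (2 * B2) * f y)) \<le> B2 / B1 * ((B1 / (2 * B2) * f y)^2 + 1)"
      using B by (intro mult_left_mono) auto
    moreover have "B2 / B1 * (2 * (B1 / (2 * B2) * f y)) = f y" using B by simp
    moreover have "B2 / B1 * ((B1 / (2 * B2) * f y)^2 + 1) = B1 / (4 * B2) * (f y)^2 + B2 / B1"
      using B by (simp add: field_simps power2_eq_square)
    ultimately have "f y \<le> B1 / (4 * B2) * (f y)^2 + B2 / B1" by simp
    then have "ennreal (f y) \<le> ennreal (B1 / (4 * B2) * (f y)^2 + B2 / B1)" by (rule ennreal_leI)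
    also have "\<dots> = ennreal (B1 / (4 * B2)) * ennreal ((f y)^2) + ennreal (B2 / B1) * indicator ?S y"
    proof -
      have "ennreal (B1 / (4 * B2) * (f y)^2) = ennreal (B1 / (4 * B2)) * ennreal ((f y)^2)"
        using B by (intro ennreal_mult) auto
      moreover have "ennreal (B1 / (4 * B2) * (f y)^2 + B2 / B1) = ennreal (B1 / (4 * B2) * (f y)^2) + ennreal (B2 / B1)"
        using B by (intro ennreal_plus) auto
      ultimately show ?thesis using True by simp
    qed
    also have "\<dots> \<le> ennreal (B1 / 4) + (ennreal (B1 / (4 * B2)) * ennreal ((f y)^2) + ennreal (B2 / B1) * indicator ?S y)"
      by simp
    finally show ?thesis .
  next
    case False
    then have "ennreal (f y) \<le> ennreal (B1 / 4)" by (intro ennreal_leI) auto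
    then show ?thesis by (rule order_trans) simp
  qed
  have "ennreal B1 \<le> E \<epsilon> k (\<lambda>y. ennreal (B1 / 4) + (ennreal (B1 / (4 * B2)) * ennreal ((f y)^2)
      + ennreal (B2 / B1) * indicator ?S y)) x"
    by (rule order_trans[OF m1 E_mono[OF pt]])
  also have "\<dots> = ennreal (B1 / 4) + (ennreal (B1 / (4 * B2)) * E \<epsilon> k (\<lambda>y. ennreal ((f y)^2)) x + ennreal (B2 / B1) * P \<epsilon> k ?S x)"
    using \<epsilon> by (simp add: E_add E_const E_cmult)
  also have "\<dots> \<le> ennreal (B1 / 4) + (ennreal (B1 / (4 * B2)) * ennreal B2 + ennreal (B2 / B1) * P \<epsilon> k ?S x)"
    by (intro add_left_mono add_right_mono mult_left_mono m2) auto
  also have "\<dots> = ennreal (B2 / B1) * P \<epsilon> k ?S x + ennreal (B1 / 2)"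
  proof -
    have "ennreal (B1 / (4 * B2)) * ennreal B2 = ennreal (B1 / 4)" using B by (simp flip: ennreal_mult)
    moreover have "ennreal (B1 / 4) + ennreal (B1 / 4) = ennreal (B1 / 2)" using B by (simp flip: ennreal_plus)
    ultimately show ?thesis by (simp add: ac_simps flip: add.assoc)
  qed
  finally have "ennreal (B1 - B1 / 2) \<le> ennreal (B2 / B1) * P \<epsilon> k ?S x" by (rule ennreal_diff_le) (use B in auto)
  then have "ennreal (B1 / B2) * ennreal (B1 / 2) \<le> ennreal (B1 / B2) * (ennreal (B2 / B1) * P \<epsilon> k ?S x)"
    by (intro mult_left_mono) auto
  also have "ennreal (B1 / B2) * (ennreal (B2 / B1) * P \<epsilon> k ?S x) = P \<epsilon> k ?S x"
    using B by (simp flip: mult.assoc ennreal_mult)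
  finally show ?thesis using B by (simp flip: ennreal_mult add: power2_eq_square field_simps)
qed

text \<open>In this moving frame the averaged flow is at rest: \<open>noise_frame \<epsilon> U k\<close> maps \<open>exp (k \<epsilon> M) x\<close> to \<open>U x\<close>. What
  moves is the accumulated noise in the direction of \<open>U\<close>.\<close>

definition noise_frame :: "real \<Rightarrow> 'a endo \<Rightarrow> nat \<Rightarrow> 'a endo" where
  "noise_frame \<epsilon> U k = expm (- (real k * \<epsilon>)) M * U"

context
  fixes U :: "'a endo" assumes comm: "U * M = M * U"
begin

lemma U_expm: "app U (app (expm t M) y) = app (expm t M) (app U y)"
  using expm_commute[OF comm, of t] by (simp flip: app_mult)

lemma norm_noise_frame:
  assumes "0 < \<epsilon>" "real k * \<epsilon> \<le> t" shows "norm (noise_frame \<epsilon> U k) \<le> exp (a * t) * norm U"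
proof -
  have "norm (noise_frame \<epsilon> U k) \<le> norm (expm (- (real k * \<epsilon>)) M) * norm U"
    unfolding noise_frame_def by (rule norm_mult_ineq)
  also have "\<dots> \<le> exp (a * t) * norm U"
  proof (rule mult_right_mono)
    have "norm (expm (- (real k * \<epsilon>)) M) \<le> exp (real k * \<epsilon> * norm M)"
      using norm_expm[of "- (real k * \<epsilon>)" M] assms by simp
    also have "\<dots> \<le> exp (a * t)"
      using mult_mono[OF assms(2) norm_M] assms a_ge order_trans[of 0 "k * \<epsilon>" t] by (simp add: mult.commute)
    finally show "norm (expm (- (real k * \<epsilon>)) M) \<le> exp (a * t)" .
  qed simp
  finally show ?thesis .
qed

lemma noise_frame_mean: "app (noise_frame \<epsilon> U k) (app (expm (k * \<epsilon>) M) x) = app U x"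
  using expm_inverse(2)[of "k * \<epsilon>" M "app U x"] by (simp add: noise_frame_def U_expm)

lemma noise_frame_Suc: "app (noise_frame \<epsilon> U (Suc k)) (app (expm \<epsilon> M) y) = app (noise_frame \<epsilon> U k) y"
proof -
  have "app (expm (- (real (Suc k) * \<epsilon>)) M) (app (expm \<epsilon> M) z) = app (expm (- (real k * \<epsilon>)) M) z" for z
    using expm_add[of "- (real (Suc k) * \<epsilon>)" \<epsilon> M] by (simp flip: app_mult add: algebra_simps)
  then show ?thesis by (simp add: noise_frame_def U_expm)
qed

text \<open>The second moments come from fourth moments by \<open>x\<^sup>2 \<le> \<epsilon> / 2 + x\<^sup>4 / (2 \<epsilon>)\<close>, which loses nothing at the
  scale \<open>x \<approx> sqrt \<epsilon>\<close>.\<close>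

lemma noise_moments:
  assumes \<epsilon>: "0 < \<epsilon>" "8 * a * \<epsilon> \<le> 1" and t: "real k * \<epsilon> \<le> t" and x: "norm x = 1" and Ux: "norm (app U x) \<le> R * sqrt \<epsilon>"
  defines "l \<equiv> exp (a * t) * norm U" and "C2 \<equiv> 8 * R ^ 4 + 8 * (exp (a * t) * norm U) ^ 4 * C_t t"
  shows "E \<epsilon> k (\<lambda>y. ennreal ((norm (y - app (expm (k * \<epsilon>) M) x))^2)) x \<le> ennreal ((1 + C_t t) * \<epsilon>)"
    and "E \<epsilon> k (\<lambda>y. ennreal (((norm (app (noise_frame \<epsilon> U k) y))^2)^2)) x \<le> ennreal (C2 * \<epsilon>^2)"
    and "E \<epsilon> k (\<lambda>y. ennreal ((norm (app (noise_frame \<epsilon> U k) y))^2)) x \<le> ennreal ((1 + C2) * \<epsilon>)"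
    and "E \<epsilon> k (\<lambda>y. ennreal ((norm y)^2)) x \<le> ennreal (2 * exp (2 * a * t) + 2 * (1 + C_t t) * \<epsilon>)"
proof -
  let ?c = "app (expm (k * \<epsilon>) M) x" and ?L = "noise_frame \<epsilon> U k"
  have t0: "0 \<le> t" using t \<epsilon> order_trans[of 0 "k * \<epsilon>" t] by simp
  note Ct = C_t_nonneg[OF t0]
  have m4: "E \<epsilon> k (\<lambda>y. ennreal (norm (y - ?c) ^ 4)) x \<le> ennreal (C_t t * \<epsilon>^2)"
    using fourth_moment[OF \<epsilon> t, of x] x by simp
  have "E \<epsilon> k (\<lambda>y. ennreal ((norm (y - ?c))^2)) x \<le> ennreal (\<epsilon> / 2 + 1 / (2 * \<epsilon>) * (C_t t * \<epsilon>^2))"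
    by (rule E_affine_le[OF \<epsilon>(1) _ _ _ _ _ _ m4]) (use \<epsilon> Ct square_le_fourth_power[OF \<epsilon>(1)] in auto)
  also have "\<dots> \<le> ennreal ((1 + C_t t) * \<epsilon>)"
    using \<epsilon> Ct by (intro ennreal_leI) (simp add: power2_eq_square field_simps)
  finally show m2: "E \<epsilon> k (\<lambda>y. ennreal ((norm (y - ?c))^2)) x \<le> ennreal ((1 + C_t t) * \<epsilon>)" .
  have l0: "0 \<le> l" by (simp add: l_def)
  have C2: "0 \<le> C2" using Ct by (simp add: C2_def)
  have R: "0 \<le> R * sqrt \<epsilon>" using Ux norm_ge_zero order_trans by blast
  have "((norm (app ?L y))^2)^2 \<le> 8 * (R * sqrt \<epsilon>) ^ 4 + 8 * l ^ 4 * norm (y - ?c) ^ 4" for y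
  proof -
    have "app ?L y = app U x + app ?L (y - ?c)" by (simp add: app_simps noise_frame_mean)
    then have "norm (app ?L y) \<le> R * sqrt \<epsilon> + l * norm (y - ?c)"
      using norm_triangle_ineq[of "app U x" "app ?L (y - ?c)"] Ux norm_app[of ?L "y - ?c"]
        mult_right_mono[OF norm_noise_frame[OF \<epsilon>(1) t], of "norm (y - ?c)"] unfolding l_def by simp
    then have "norm (app ?L y) ^ 4 \<le> (R * sqrt \<epsilon> + l * norm (y - ?c)) ^ 4" by (intro power_mono) auto
    also note power4_add_le
    finally show ?thesis by (simp add: power_mult_distrib)
  qed
  then have "E \<epsilon> k (\<lambda>y. ennreal (((norm (app ?L y))^2)^2)) x \<le> ennreal (8 * (R * sqrt \<epsilon>) ^ 4 + 8 * l ^ 4 * (C_t t * \<epsilon>^2))"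
    by (intro E_affine_le[OF \<epsilon>(1) _ _ _ _ _ _ m4]) (use \<epsilon> Ct R in auto)
  also have "8 * (R * sqrt \<epsilon>) ^ 4 + 8 * l ^ 4 * (C_t t * \<epsilon>^2) = C2 * \<epsilon>^2"
  proof -
    have "sqrt \<epsilon> ^ 4 = (sqrt \<epsilon> ^ 2) ^ 2" by simp
    then have "sqrt \<epsilon> ^ 4 = \<epsilon>^2" using \<epsilon> by simp
    then show ?thesis by (simp add: C2_def l_def power_mult_distrib algebra_simps)
  qed
  finally show mL4: "E \<epsilon> k (\<lambda>y. ennreal (((norm (app ?L y))^2)^2)) x \<le> ennreal (C2 * \<epsilon>^2)" .
  have "E \<epsilon> k (\<lambda>y. ennreal ((norm (app ?L y))^2)) x \<le> ennreal (\<epsilon> / 2 + 1 / (2 * \<epsilon>) * (C2 * \<epsilon>^2))"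
    by (rule E_affine_le[OF \<epsilon>(1) _ _ _ _ _ _ mL4]) (use \<epsilon> C2 square_le_fourth_power[OF \<epsilon>(1)] in auto)
  also have "\<dots> \<le> ennreal ((1 + C2) * \<epsilon>)"
    using \<epsilon> C2 by (intro ennreal_leI) (simp add: power2_eq_square field_simps)
  finally show "E \<epsilon> k (\<lambda>y. ennreal ((norm (app ?L y))^2)) x \<le> ennreal ((1 + C2) * \<epsilon>)" .
  have "(norm y)^2 \<le> 2 * exp (2 * a * t) + 2 * (norm (y - ?c))^2" for y
  proof -
    have "norm ?c \<le> exp (a * t)"
    proof -
      have "norm ?c \<le> exp (a * (k * \<epsilon>)) * norm x" using expm_bounds(1)[OF \<epsilon> norm_M] \<epsilon> by simp
      also have "\<dots> \<le> exp (a * t)" using x t a_ge by simp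
      finally show ?thesis .
    qed
    then have "norm y \<le> exp (a * t) + norm (y - ?c)" using norm_triangle_ineq[of ?c "y - ?c"] by simp
    then have "(norm y)^2 \<le> (exp (a * t) + norm (y - ?c))^2" by (intro power_mono) auto
    also note power2_add_le
    finally show ?thesis by (simp add: mult_ac flip: exp_of_nat_mult)
  qed
  then have "E \<epsilon> k (\<lambda>y. ennreal ((norm y)^2)) x \<le> ennreal (2 * exp (2 * a * t) + 2 * ((1 + C_t t) * \<epsilon>))"
    by (intro E_affine_le[OF \<epsilon>(1) _ _ _ _ _ _ m2]) (use \<epsilon> Ct in auto)
  then show "E \<epsilon> k (\<lambda>y. ennreal ((norm y)^2)) x \<le> ennreal (2 * exp (2 * a * t) + 2 * (1 + C_t t) * \<epsilon>)"
    by (simp only: mult.assoc)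
qed

text \<open>The lower bound of one step is rearranged without subtraction, as required by extended nonnegative
  reals. The mixed term \<open>\<epsilon>\<^sup>2 \<bar>w\<bar> \<bar>y\<bar>\<close> is split with the weights \<open>\<epsilon>\<^bsup>3/2\<^esup>\<close> and
  \<open>\<epsilon>\<^bsup>5/2\<^esup>\<close>, so that with \<open>\<bar>w\<bar>\<^sup>2 \<approx> \<epsilon>\<close> both errors are \<open>O(\<epsilon>\<^bsup>5/2\<^esup>)\<close>, smaller than the gain of
  order \<open>\<epsilon>\<^sup>2\<close>.\<close>

lemma noise_step:
  assumes \<epsilon>: "0 < \<epsilon>" "8 * a * \<epsilon> \<le> 1" and t: "real (Suc k) * \<epsilon> \<le> t"
  defines "l \<equiv> exp (a * t) * norm U" and "D \<equiv> 6 * a ^ 4 * (exp (4 * a) + 768)"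
  shows "ennreal ((norm (app (noise_frame \<epsilon> U k) y))^2)
      + ennreal (\<epsilon>^2 * p j * exp (- (2 * a * (real (Suc k) * \<epsilon>)))) * ennreal ((norm (app U (app (A j) y)))^2)
    \<le> K \<epsilon> (\<lambda>y'. ennreal ((norm (app (noise_frame \<epsilon> U (Suc k)) y'))^2)) y
      + (ennreal ((D * l + 3 * a^2 * exp (2 * a) + D * l^2) * sqrt \<epsilon> ^ 3) * ennreal ((norm (app (noise_frame \<epsilon> U k) y))^2)
      + ennreal ((D * l + 3 * a^2 * exp (2 * a) + D * l^2) * sqrt \<epsilon> ^ 5) * ennreal ((norm y)^2))"
proof -
  define L where "L = noise_frame \<epsilon> U (Suc k)"
  define w where "w = app (noise_frame \<epsilon> U k) y"
  define W where "W = norm w"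
  define Y where "Y = norm y"
  define \<eta> where "\<eta> = sqrt \<epsilon>"
  define u where "u = norm (app U (app (A j) y))"
  define C where "C = D * l + 3 * a^2 * exp (2 * a) + D * l^2"
  have pos: "0 \<le> l" "0 \<le> D" "0 \<le> W" "0 \<le> Y" "0 < \<eta>" using \<epsilon> by (auto simp: l_def D_def W_def Y_def \<eta>_def)
  have e1: "\<epsilon> \<le> 1" by (rule eps_le_1[OF \<epsilon>])
  have \<eta>: "\<eta>^2 = \<epsilon>" "\<eta> \<le> 1" using \<epsilon> e1 by (auto simp: \<eta>_def)
  have e2: "\<epsilon>^2 = \<eta> ^ 4" "\<epsilon> ^ 4 = \<eta> ^ 8" unfolding \<eta>(1)[symmetric] by (simp_all flip: power_mult)
  have wL: "w = app L (app (expm \<epsilon> M) y)" by (simp add: w_def L_def noise_frame_Suc)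
  have nL: "norm L \<le> l" unfolding L_def l_def by (rule norm_noise_frame[OF \<epsilon>(1) t])
  have LA: "exp (- (2 * a * (real (Suc k) * \<epsilon>))) * u^2 \<le> (norm (app L (app (A j) y)))^2"
  proof -
    have "exp (- (a * (real (Suc k) * \<epsilon>))) * u \<le> exp (- \<bar>- (real (Suc k) * \<epsilon>)\<bar> * norm M) * u"
    proof (rule mult_right_mono)
      have "(real (Suc k) * \<epsilon>) * norm M \<le> (real (Suc k) * \<epsilon>) * a" using norm_M \<epsilon> by (intro mult_left_mono) auto
      then show "exp (- (a * (real (Suc k) * \<epsilon>))) \<le> exp (- \<bar>- (real (Suc k) * \<epsilon>)\<bar> * norm M)"
        using \<epsilon> by (simp add: abs_mult mult_ac)
    qed (simp add: u_def)
    also have "\<dots> \<le> norm (app (expm (- (real (Suc k) * \<epsilon>)) M) (app U (app (A j) y)))"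
      unfolding u_def by (rule norm_expm_app_lower)
    also have "\<dots> = norm (app L (app (A j) y))" by (simp add: L_def noise_frame_def)
    finally have "(exp (- (a * (real (Suc k) * \<epsilon>))) * u)^2 \<le> (norm (app L (app (A j) y)))^2"
      by (intro power_mono) (auto simp: u_def)
    then show ?thesis by (simp add: power_mult_distrib mult_ac flip: exp_of_nat_mult)
  qed
  have LM: "(norm (app L (app M y)))^2 \<le> a^2 * exp (2 * a) * W^2"
  proof -
    have "app L (app M y) = app (expm (- \<epsilon>) M) (app L (app (expm \<epsilon> M) (app M y)))"
    proof -
      have "app L (app (expm \<epsilon> M) z) = app (expm \<epsilon> M) (app L z)" for z
        unfolding L_def noise_frame_def app_mult U_expm
        by (metis app_mult expm_add add.commute)
      then show ?thesis using expm_inverse(2)[of \<epsilon> M "app L (app M y)"] by simp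
    qed
    also have "app L (app (expm \<epsilon> M) (app M y)) = app M w"
    proof -
      have "app U (app M z) = app M (app U z)" for z using comm by (metis app_mult)
      then show ?thesis
        unfolding wL L_def noise_frame_def app_mult U_expm by (simp only: expm_app_commute)
    qed
    finally have "norm (app L (app M y)) \<le> exp (\<epsilon> * norm M) * (norm M * W)"
      using norm_expm_app[of "- \<epsilon>" M "app M w"] norm_app[of M w] \<epsilon>
      by (auto simp: W_def intro: order_trans[OF _ mult_left_mono])
    also have "\<dots> \<le> exp a * (a * W)"
    proof (intro mult_mono mult_right_mono norm_M)
      have "\<epsilon> * norm M \<le> 1 * a" using e1 norm_M \<epsilon> by (intro mult_mono) auto
      then show "exp (\<epsilon> * norm M) \<le> exp a" by simp
    qed (use pos a_ge in auto)
    finally have "(norm (app L (app M y)))^2 \<le> (exp a * (a * W))^2" by (intro power_mono) auto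
    then show ?thesis by (simp add: power_mult_distrib mult_ac flip: exp_of_nat_mult)
  qed
  have "W^2 + \<epsilon>^2 * p j * (exp (- (2 * a * (real (Suc k) * \<epsilon>))) * u^2) - C * \<eta> ^ 3 * W^2 - C * \<eta> ^ 5 * Y^2
    \<le> W^2 + \<epsilon>^2 * p j * (norm (app L (app (A j) y)))^2 - D * l * \<epsilon>^2 * (W * Y)
      - 3 * \<epsilon>^2 * (norm (app L (app M y)))^2 - D * l^2 * \<epsilon> ^ 4 * Y^2"
  proof -
    have "\<epsilon>^2 * p j * (exp (- (2 * a * (real (Suc k) * \<epsilon>))) * u^2) \<le> \<epsilon>^2 * p j * (norm (app L (app (A j) y)))^2"
      using LA p_nonneg by (intro mult_left_mono) auto
    moreover have "D * l * \<epsilon>^2 * (W * Y) \<le> D * l * (\<eta> ^ 3 * W^2 + \<eta> ^ 5 * Y^2)"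
    proof -
      have "2 * (W * (\<eta> * Y)) \<le> W^2 + (\<eta> * Y)^2" using sum_squares_bound[of W "\<eta> * Y"] by simp
      moreover have "0 \<le> W^2 + (\<eta> * Y)^2" by simp
      ultimately have "W * (\<eta> * Y) \<le> W^2 + (\<eta> * Y)^2" by linarith
      then have "\<eta> ^ 3 * (W * (\<eta> * Y)) \<le> \<eta> ^ 3 * (W^2 + (\<eta> * Y)^2)" using pos by (intro mult_left_mono) auto
      moreover have "\<eta> ^ 3 * (W * (\<eta> * Y)) = \<epsilon>^2 * (W * Y)" "\<eta> ^ 3 * (W^2 + (\<eta> * Y)^2) = \<eta> ^ 3 * W^2 + \<eta> ^ 5 * Y^2"
        unfolding e2 by (simp_all add: power_mult_distrib algebra_simps eval_nat_numeral)
      ultimately show ?thesis using pos mult_left_mono[of "\<epsilon>^2 * (W * Y)" "\<eta> ^ 3 * W^2 + \<eta> ^ 5 * Y^2" "D * l"]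
        by (simp add: mult.assoc)
    qed
    moreover have "3 * \<epsilon>^2 * (norm (app L (app M y)))^2 \<le> 3 * a^2 * exp (2 * a) * (\<eta> ^ 3 * W^2)"
    proof -
      have "\<epsilon>^2 \<le> \<eta> ^ 3" unfolding e2 using \<eta> pos by (intro power_decreasing) auto
      then have "3 * \<epsilon>^2 * (norm (app L (app M y)))^2 \<le> 3 * \<eta> ^ 3 * (a^2 * exp (2 * a) * W^2)"
        using LM pos by (intro mult_mono) auto
      then show ?thesis by (simp add: mult_ac)
    qed
    moreover have "D * l^2 * \<epsilon> ^ 4 * Y^2 \<le> D * l^2 * (\<eta> ^ 5 * Y^2)"
    proof -
      have "\<epsilon> ^ 4 \<le> \<eta> ^ 5" unfolding e2 using \<eta> pos by (intro power_decreasing) auto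
      then have "D * l^2 * (\<epsilon> ^ 4 * Y^2) \<le> D * l^2 * (\<eta> ^ 5 * Y^2)"
        using pos by (intro mult_left_mono mult_right_mono) auto
      then show ?thesis by (simp add: mult_ac)
    qed
    moreover have "D * l * (\<eta> ^ 3 * W^2 + \<eta> ^ 5 * Y^2) + 3 * a^2 * exp (2 * a) * (\<eta> ^ 3 * W^2) + D * l^2 * (\<eta> ^ 5 * Y^2)
      \<le> C * \<eta> ^ 3 * W^2 + C * \<eta> ^ 5 * Y^2"
    proof -
      have "0 \<le> D * l^2 * (\<eta> ^ 3 * W^2)" "0 \<le> 3 * a^2 * exp (2 * a) * (\<eta> ^ 5 * Y^2)"
        using pos by auto
      then show ?thesis by (simp add: C_def algebra_simps)
    qed
    ultimately show ?thesis by linarith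
  qed
  then have "ennreal (W^2 + \<epsilon>^2 * p j * (exp (- (2 * a * (real (Suc k) * \<epsilon>))) * u^2) - (C * \<eta> ^ 3 * W^2 + C * \<eta> ^ 5 * Y^2))
    \<le> K \<epsilon> (\<lambda>y'. ennreal ((norm (app L y'))^2)) y" (is "ennreal (?l - ?r) \<le> ?K")
    by (intro order_trans[OF ennreal_leI one_step_second_moment_ge[OF \<epsilon> nL wL, of j, folded D_def W_def Y_def]]) (simp only: diff_diff_eq)
  moreover have r0: "0 \<le> ?r" using pos a_ge by (auto simp: C_def)
  ultimately have "ennreal (?l - ?r) + ennreal ?r \<le> ?K + ennreal ?r" by (intro add_right_mono)
  moreover have "ennreal ?l \<le> ennreal (?l - ?r) + ennreal ?r"
  proof (cases "?r \<le> ?l")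
    case True then show ?thesis using r0 by (subst ennreal_plus[symmetric]) auto
  next
    case False then show ?thesis by (simp add: ennreal_leI add_increasing)
  qed
  ultimately have fin: "ennreal ?l \<le> ?K + ennreal ?r" by (rule order_trans[rotated])
  have "ennreal ?l = ennreal (W^2) + ennreal (\<epsilon>^2 * p j * exp (- (2 * a * (real (Suc k) * \<epsilon>)))) * ennreal (u^2)"
    using p_nonneg[of j] by (subst ennreal_mult[symmetric]) (auto simp: ennreal_plus[symmetric] mult.assoc simp del: ennreal_plus)
  moreover have "ennreal ?r = ennreal (C * \<eta> ^ 3) * ennreal (W^2) + ennreal (C * \<eta> ^ 5) * ennreal (Y^2)"
  proof -
    have "0 \<le> C * \<eta> ^ 3" "0 \<le> C * \<eta> ^ 5" using pos a_ge by (auto simp: C_def)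
    then show ?thesis by (simp add: ennreal_mult[symmetric] ennreal_plus[symmetric] del: ennreal_plus)
  qed
  ultimately show ?thesis using fin unfolding L_def w_def W_def Y_def u_def \<eta>_def C_def by simp
qed

text \<open>During the first time \<open>\<sigma>\<close> the chain stays near \<open>x\<close>, so every jump adds at least a multiple of \<open>\<epsilon>\<^sup>2\<close>;
  the \<open>\<sigma> / \<epsilon>\<close> jumps add a multiple of \<open>\<epsilon>\<close>. The later jumps lose only \<open>O(\<epsilon>\<^bsup>3/2\<^esup>)\<close> in total. The
  constant \<open>c1\<close> must not depend on \<open>R\<close>: the noise is compared with \<open>R sqrt \<epsilon>\<close> afterwards.\<close>

lemma noise_second_moment:
  assumes pj: "0 < p j" and g: "0 < g"
  obtains \<sigma> c1 where "0 < \<sigma>" "0 < c1" "\<And>R t. 0 \<le> R \<Longrightarrow> 0 \<le> t \<Longrightarrow> \<forall>\<^sub>F \<epsilon> in at_right 0. \<forall>k x.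
    norm x = 1 \<longrightarrow> norm (app U x) \<le> R * sqrt \<epsilon> \<longrightarrow> g \<le> norm (app U (app (A j) x)) \<longrightarrow>
    \<sigma> \<le> real k * \<epsilon> \<longrightarrow> real k * \<epsilon> \<le> t \<longrightarrow>
    ennreal (c1 * \<epsilon>) \<le> E \<epsilon> k (\<lambda>y. ennreal ((norm (app (noise_frame \<epsilon> U k) y))^2)) x"
proof -
  \<comment> \<open>Up to time \<open>\<sigma>\<close> the averaged flow changes \<open>U A\<^sub>j x\<close> by at most \<open>g / 4\<close>.\<close>
  define \<sigma> where "\<sigma> = min 1 (g / (4 * (1 + norm U) * a^2 * exp a))"
  define g1 where "g1 = p j * exp (- (2 * a)) * (g^2 / 8)"
  have U1: "0 < 1 + norm U" using norm_ge_zero[of U] by linarith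
  have a0: "0 < a" using a_ge by simp
  have \<sigma>: "0 < \<sigma>" "\<sigma> \<le> 1" using g U1 a0 by (auto simp: \<sigma>_def)
  have \<sigma>g: "norm U * a * (a * (\<sigma> * exp a)) \<le> g / 4"
  proof -
    have "(1 + norm U) * a^2 * exp a * \<sigma> \<le> (1 + norm U) * a^2 * exp a * (g / (4 * (1 + norm U) * a^2 * exp a))"
      using U1 a0 by (intro mult_left_mono) (auto simp: \<sigma>_def)
    also have "\<dots> = g / 4"
    proof -
      have "N * a^2 * exp a * (g / (4 * N * a^2 * exp a)) = g / 4" if "0 < N" for N using that a0 by simp
      from this[OF U1] show ?thesis .
    qed
    finally have "(1 + norm U) * (a^2 * exp a * \<sigma>) \<le> g / 4" by (simp add: mult.assoc)
    moreover have "norm U * (a^2 * exp a * \<sigma>) \<le> (1 + norm U) * (a^2 * exp a * \<sigma>)"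
      using \<sigma> by (intro mult_right_mono) auto
    moreover have "norm U * a * (a * (\<sigma> * exp a)) = norm U * (a^2 * exp a * \<sigma>)" by (simp add: power2_eq_square)
    ultimately show ?thesis by linarith
  qed
  have g1: "0 < g1" using pj g by (simp add: g1_def)
  show thesis
  proof (rule that)
    show "0 < \<sigma>" by fact
    show "0 < \<sigma> * g1 / 4" using \<sigma> g1 by simp
    fix R t :: real assume R: "0 \<le> R" and t: "0 \<le> t"
    define D where "D = 6 * a ^ 4 * (exp (4 * a) + 768)"
    define l where "l = exp (a * t) * norm U"
    define C where "C = D * l + 3 * a^2 * exp (2 * a) + D * l^2"
    define C2 where "C2 = 8 * R ^ 4 + 8 * (exp (a * t) * norm U) ^ 4 * C_t t"
    define C5 where "C5 = 2 * exp (2 * a * t) + 2 * (1 + C_t t)"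
    define C7 where "C7 = C * (1 + C2) + C * C5"
    note Ct = C_t_nonneg[OF t]
    have D0: "0 \<le> D" "0 \<le> l" using a0 by (auto simp: D_def l_def)
    have C: "0 \<le> C" using D0 by (auto simp: C_def)
    have C2: "0 \<le> C2" "0 \<le> C5" using Ct R by (auto simp: C2_def C5_def)
    have C7: "0 \<le> C7" using C C2 by (auto simp: C7_def)
    have s4: "0 < \<sigma> * g1 / 4" "0 < g^2 / 8" "0 < \<sigma> / 2" using \<sigma> g1 g by auto
    show "\<forall>\<^sub>F \<epsilon> in at_right 0. \<forall>k x.
      norm x = 1 \<longrightarrow> norm (app U x) \<le> R * sqrt \<epsilon> \<longrightarrow> g \<le> norm (app U (app (A j) x)) \<longrightarrow>
      \<sigma> \<le> real k * \<epsilon> \<longrightarrow> real k * \<epsilon> \<le> t \<longrightarrow>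
      ennreal (\<sigma> * g1 / 4 * \<epsilon>) \<le> E \<epsilon> k (\<lambda>y. ennreal ((norm (app (noise_frame \<epsilon> U k) y))^2)) x"
      using eventually_at_right_less[of 0] eventually_mult_less(1)[OF zero_less_one, of "8 * a"]
        eventually_mult_less(1)[OF s4(3), of 1]
        eventually_mult_less(1)[OF s4(2), of "(norm U)^2 * a^2 * (1 + C_t t)"]
        eventually_mult_less(2)[OF s4(1), of "t * C7"]
    proof (eventually_elim, intro allI impI)
      case (elim \<epsilon>)
      have \<epsilon>: "0 < \<epsilon>" "8 * a * \<epsilon> \<le> 1" using elim by auto
      note e3 = elim(3) and e4 = elim(4) and e5 = elim(5)
      fix k x assume x: "norm x = 1" and Ux: "norm (app U x) \<le> R * sqrt \<epsilon>"
        and gx: "g \<le> norm (app U (app (A j) x))" and k: "\<sigma> \<le> real k * \<epsilon>" "real k * \<epsilon> \<le> t"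
      define k0 where "k0 = nat \<lfloor>\<sigma> / \<epsilon>\<rfloor>"
      have k0: "real k0 \<le> \<sigma> / \<epsilon>" "\<sigma> / \<epsilon> - 1 \<le> real k0"
        using \<sigma> \<epsilon> of_int_floor_le[of "\<sigma> / \<epsilon>"] real_of_int_floor_gt_diff_one[of "\<sigma> / \<epsilon>"] by (auto simp: k0_def)
      define \<phi> where "\<phi> = (\<lambda>i y. ennreal ((norm (app (noise_frame \<epsilon> U i) y))^2))"
      have [measurable]: "\<phi> i \<in> borel_measurable borel" for i unfolding \<phi>_def by measurable
      have sq: "sqrt \<epsilon> ^ 3 * \<epsilon> = sqrt \<epsilon> ^ 5" "sqrt \<epsilon> ^ 5 = \<epsilon> * \<epsilon> * sqrt \<epsilon>"
      proof -
        have r: "r ^ 5 = (r * r) * (r * r) * r" "r ^ 5 = r ^ 3 * (r * r)" for r :: real by (simp_all add: eval_nat_numeral)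
        have "sqrt \<epsilon> * sqrt \<epsilon> = \<epsilon>" using \<epsilon> by simp
        then show "sqrt \<epsilon> ^ 3 * \<epsilon> = sqrt \<epsilon> ^ 5" "sqrt \<epsilon> ^ 5 = \<epsilon> * \<epsilon> * sqrt \<epsilon>"
          using r[of "sqrt \<epsilon>"] by simp_all
      qed
      have main: "ennreal (real (min i k0) * (\<epsilon>^2 * g1)) \<le> E \<epsilon> i (\<phi> i) x + ennreal (real i * (C7 * sqrt \<epsilon> ^ 5))" if "i \<le> k" for i
        using that
      proof (induction i)
        case (Suc i)
        have ik: "real i * \<epsilon> \<le> t" "real (Suc i) * \<epsilon> \<le> t"
        proof -
          have "real (Suc i) * \<epsilon> \<le> real k * \<epsilon>" using Suc.prems \<epsilon> by (intro mult_right_mono) auto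
          then show "real (Suc i) * \<epsilon> \<le> t" using k by simp
          moreover have "real i * \<epsilon> \<le> real (Suc i) * \<epsilon>" using \<epsilon> by (intro mult_right_mono) auto
          ultimately show "real i * \<epsilon> \<le> t" by simp
        qed
        note nm = noise_moments[OF \<epsilon> ik(1) x Ux, folded C2_def]
        define v where "v = \<epsilon>^2 * p j * exp (- (2 * a * (real (Suc i) * \<epsilon>)))"
        define \<psi> where "\<psi> = (\<lambda>y. ennreal ((norm (app U (app (A j) y)))^2))"
        have [measurable]: "\<psi> \<in> borel_measurable borel" unfolding \<psi>_def by measurable
        have "E \<epsilon> i (\<lambda>y. \<phi> i y + ennreal v * \<psi> y) x \<le> E \<epsilon> i (\<lambda>y. K \<epsilon> (\<phi> (Suc i)) y
            + (ennreal (C * sqrt \<epsilon> ^ 3) * \<phi> i y + ennreal (C * sqrt \<epsilon> ^ 5) * ennreal ((norm y)^2))) x"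
          using noise_step[OF \<epsilon> ik(2), of _ j, folded D_def, folded l_def, folded C_def]
          by (intro E_mono) (simp only: \<phi>_def \<psi>_def v_def)
        also have "E \<epsilon> i (\<lambda>y. \<phi> i y + ennreal v * \<psi> y) x = E \<epsilon> i (\<phi> i) x + ennreal v * E \<epsilon> i \<psi> x"
          using \<epsilon> by (simp add: E_add E_cmult)
        also have "E \<epsilon> i (\<lambda>y. K \<epsilon> (\<phi> (Suc i)) y
            + (ennreal (C * sqrt \<epsilon> ^ 3) * \<phi> i y + ennreal (C * sqrt \<epsilon> ^ 5) * ennreal ((norm y)^2))) x
            = E \<epsilon> (Suc i) (\<phi> (Suc i)) x + (ennreal (C * sqrt \<epsilon> ^ 3) * E \<epsilon> i (\<phi> i) x + ennreal (C * sqrt \<epsilon> ^ 5) * E \<epsilon> i (\<lambda>y. ennreal ((norm y)^2)) x)"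
          using \<epsilon> by (simp add: E_add E_cmult K_measurable E_Suc del: funpow.simps)
        also have "\<dots> \<le> E \<epsilon> (Suc i) (\<phi> (Suc i)) x + (ennreal (C * sqrt \<epsilon> ^ 3) * ennreal ((1 + C2) * \<epsilon>) + ennreal (C * sqrt \<epsilon> ^ 5) * ennreal C5)"
        proof (intro add_left_mono add_mono mult_left_mono)
          show "E \<epsilon> i (\<phi> i) x \<le> ennreal ((1 + C2) * \<epsilon>)"
            unfolding \<phi>_def by (rule nm(3))
          have "2 * (1 + C_t t) * \<epsilon> \<le> 2 * (1 + C_t t) * 1" using eps_le_1[OF \<epsilon>] Ct by (intro mult_left_mono) auto
          then show "E \<epsilon> i (\<lambda>y. ennreal ((norm y)^2)) x \<le> ennreal C5"
            using nm(4) by (elim order_trans) (simp add: C5_def ennreal_leI)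
        qed auto
        also have "ennreal (C * sqrt \<epsilon> ^ 3) * ennreal ((1 + C2) * \<epsilon>) + ennreal (C * sqrt \<epsilon> ^ 5) * ennreal C5 = ennreal (C7 * sqrt \<epsilon> ^ 5)"
        proof -
          have "C7 * sqrt \<epsilon> ^ 5 = C * sqrt \<epsilon> ^ 3 * ((1 + C2) * \<epsilon>) + C * sqrt \<epsilon> ^ 5 * C5"
            unfolding C7_def sq(1)[symmetric] by (simp add: algebra_simps)
          then show ?thesis using C C2 \<epsilon> by (simp add: ennreal_mult[symmetric] ennreal_plus[symmetric] del: ennreal_plus)
        qed
        finally have step: "E \<epsilon> i (\<phi> i) x + ennreal v * E \<epsilon> i \<psi> x \<le> E \<epsilon> (Suc i) (\<phi> (Suc i)) x + ennreal (C7 * sqrt \<epsilon> ^ 5)" .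
        have gain: "ennreal (if i < k0 then \<epsilon>^2 * g1 else 0) \<le> ennreal v * E \<epsilon> i \<psi> x"
        proof (cases "i < k0")
          case True
          have i\<sigma>: "real (Suc i) * \<epsilon> \<le> \<sigma>"
          proof -
            have "real (Suc i) * \<epsilon> \<le> \<sigma> / \<epsilon> * \<epsilon>" using True k0 \<epsilon> by (intro mult_right_mono) linarith+
            then show ?thesis using \<epsilon> by simp
          qed
          have "real i * \<epsilon> \<le> real (Suc i) * \<epsilon>" using \<epsilon> by (intro mult_right_mono) auto
          then have "real i * \<epsilon> \<le> \<sigma>" using i\<sigma> by (rule order_trans)
          then have i\<sigma>': "0 \<le> real i * \<epsilon>" "real i * \<epsilon> \<le> \<sigma>" using \<epsilon> by auto
          have v: "\<epsilon>^2 * (p j * exp (- (2 * a))) \<le> v"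
          proof -
            have "a * (real (Suc i) * \<epsilon>) \<le> a * 1" using i\<sigma> \<sigma> a0 by (intro mult_left_mono) auto
            then show ?thesis using pj by (simp add: v_def mult_left_mono mult.assoc)
          qed
          let ?z = "\<lambda>y. y - app (expm (i * \<epsilon>) M) x"
          have pt: "g^2 / 4 \<le> (norm (app U (app (A j) y)))^2 + (norm U)^2 * a^2 * (norm (?z y))^2" for y
          proof -
            have "norm (y - x) \<le> norm (?z y) + norm (app (expm (i * \<epsilon>) M) x - x)"
              using norm_triangle_ineq[of "?z y" "app (expm (i * \<epsilon>) M) x - x"] by simp
            also have "norm (app (expm (i * \<epsilon>) M) x - x) \<le> a * (\<sigma> * exp a)"
            proof -
              have "norm (app (expm (i * \<epsilon>) M) x - x) \<le> a * (i * \<epsilon> * exp (a * (i * \<epsilon>)))"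
                using expm_bounds(2)[OF \<epsilon> norm_M i\<sigma>'(1), of x] x by simp
              also have "\<dots> \<le> a * (\<sigma> * exp (a * 1))"
                using i\<sigma>' \<sigma> a0 by (intro mult_left_mono mult_mono) auto
              finally show ?thesis by simp
            qed
            finally have yx: "norm (y - x) \<le> norm (?z y) + a * (\<sigma> * exp a)" by simp
            have "norm (app U (app (A j) (y - x))) \<le> norm U * (a * norm (y - x))"
              using norm_A a0 by (intro order_trans[OF norm_app mult_left_mono] order_trans[OF norm_app mult_right_mono]) auto
            also have "\<dots> \<le> norm U * (a * (norm (?z y) + a * (\<sigma> * exp a)))"
              using yx a0 by (intro mult_left_mono) auto
            also have "\<dots> \<le> norm U * a * norm (?z y) + g / 4" using \<sigma>g by (simp add: algebra_simps)
            finally have "g \<le> norm (app U (app (A j) y)) + (norm U * a * norm (?z y) + g / 4)"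
              using gx norm_triangle_ineq4[of "app U (app (A j) y)" "app U (app (A j) (y - x))"] by (simp add: app_simps)
            then have "3 / 4 * g \<le> norm (app U (app (A j) y)) + norm U * a * norm (?z y)" by simp
            then have "(3 / 4 * g)^2 \<le> (norm (app U (app (A j) y)) + norm U * a * norm (?z y))^2"
              using g by (intro power_mono) auto
            also have "\<dots> \<le> 2 * (norm (app U (app (A j) y)))^2 + 2 * (norm U * a * norm (?z y))^2" by (rule power2_add_le)
            finally have "9 / 16 * g^2 \<le> 2 * (norm (app U (app (A j) y)))^2 + 2 * ((norm U)^2 * a^2 * (norm (?z y))^2)"
              by (simp add: power_mult_distrib power_divide)
            moreover have "0 \<le> g^2" by simp
            ultimately show ?thesis by linarith
          qed
          have "ennreal (g^2 / 4) \<le> \<psi> y + ennreal ((norm U)^2 * a^2) * ennreal ((norm (?z y))^2)" for y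
          proof -
            have "ennreal (g^2 / 4) \<le> ennreal ((norm (app U (app (A j) y)))^2 + (norm U)^2 * a^2 * (norm (?z y))^2)"
              by (rule ennreal_leI[OF pt])
            then show ?thesis unfolding \<psi>_def by (simp add: ennreal_plus ennreal_mult)
          qed
          then have "E \<epsilon> i (\<lambda>y. ennreal (g^2 / 4)) x \<le> E \<epsilon> i (\<lambda>y. \<psi> y + ennreal ((norm U)^2 * a^2) * ennreal ((norm (?z y))^2)) x"
            by (rule E_mono)
          also have "\<dots> = E \<epsilon> i \<psi> x + ennreal ((norm U)^2 * a^2) * E \<epsilon> i (\<lambda>y. ennreal ((norm (?z y))^2)) x"
            using \<epsilon> by (simp add: E_add E_cmult)
          also have "\<dots> \<le> E \<epsilon> i \<psi> x + ennreal ((norm U)^2 * a^2) * ennreal ((1 + C_t t) * \<epsilon>)"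
            using nm(1) by (intro add_left_mono mult_left_mono) auto
          also have "\<dots> \<le> E \<epsilon> i \<psi> x + ennreal (g^2 / 8)"
            using e4 \<epsilon> Ct by (intro add_left_mono) (subst ennreal_mult[symmetric], auto intro!: ennreal_leI simp: mult_ac)
          finally have "ennreal (g^2 / 4) \<le> E \<epsilon> i \<psi> x + ennreal (g^2 / 8)" using \<epsilon> by (simp add: E_const)
          from ennreal_diff_le[OF this] have E8: "ennreal (g^2 / 8) \<le> E \<epsilon> i \<psi> x" by simp
          have "ennreal (\<epsilon>^2 * g1) = ennreal (\<epsilon>^2 * (p j * exp (- (2 * a)))) * ennreal (g^2 / 8)"
            using pj by (subst ennreal_mult[symmetric]) (auto simp: g1_def mult_ac)
          also have "\<dots> \<le> ennreal v * E \<epsilon> i \<psi> x" by (intro mult_mono E8 ennreal_leI v) auto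
          finally show ?thesis using True by simp
        qed simp
        have "real (min (Suc i) k0) * (\<epsilon>^2 * g1) = real (min i k0) * (\<epsilon>^2 * g1) + (if i < k0 then \<epsilon>^2 * g1 else 0)"
          by (auto simp: min_def algebra_simps)
        then have "ennreal (real (min (Suc i) k0) * (\<epsilon>^2 * g1)) = ennreal (real (min i k0) * (\<epsilon>^2 * g1)) + ennreal (if i < k0 then \<epsilon>^2 * g1 else 0)"
          using g1 by (simp add: ennreal_plus[symmetric] del: ennreal_plus)
        also have "\<dots> \<le> (E \<epsilon> i (\<phi> i) x + ennreal (real i * (C7 * sqrt \<epsilon> ^ 5))) + ennreal v * E \<epsilon> i \<psi> x"
          using Suc gain by (intro add_mono) auto
        also have "\<dots> = (E \<epsilon> i (\<phi> i) x + ennreal v * E \<epsilon> i \<psi> x) + ennreal (real i * (C7 * sqrt \<epsilon> ^ 5))" by (simp add: ac_simps)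
        also have "\<dots> \<le> (E \<epsilon> (Suc i) (\<phi> (Suc i)) x + ennreal (C7 * sqrt \<epsilon> ^ 5)) + ennreal (real i * (C7 * sqrt \<epsilon> ^ 5))"
          by (intro add_right_mono step)
        also have "\<dots> = E \<epsilon> (Suc i) (\<phi> (Suc i)) x + ennreal (real (Suc i) * (C7 * sqrt \<epsilon> ^ 5))"
          using C7 \<epsilon> by (simp add: add.assoc ennreal_plus[symmetric] algebra_simps del: ennreal_plus)
        finally show ?case .
      qed simp
      have "\<sigma> / \<epsilon> * \<epsilon> = \<sigma>" using \<epsilon> by simp
      then have "real k0 * \<epsilon> \<le> real k * \<epsilon>" using k \<epsilon> mult_right_mono[OF k0(1), of \<epsilon>] by linarith
      from mult_right_le_imp_le[OF this \<epsilon>(1)] have "min k k0 = k0" by simp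
      then have "ennreal (real k0 * (\<epsilon>^2 * g1)) \<le> E \<epsilon> k (\<phi> k) x + ennreal (real k * (C7 * sqrt \<epsilon> ^ 5))"
        using main[of k] by simp
      then have "ennreal (real k0 * (\<epsilon>^2 * g1) - real k * (C7 * sqrt \<epsilon> ^ 5)) \<le> E \<epsilon> k (\<phi> k) x"
        by (rule ennreal_diff_le) (use C7 \<epsilon> in auto)
      moreover have "\<sigma> * g1 / 4 * \<epsilon> \<le> real k0 * (\<epsilon>^2 * g1) - real k * (C7 * sqrt \<epsilon> ^ 5)"
      proof -
        have "\<sigma> / 2 * \<epsilon> * g1 \<le> (\<sigma> - \<epsilon>) * \<epsilon> * g1" using e3 \<epsilon> g1 by (intro mult_right_mono) auto
        also have "\<dots> = (\<sigma> / \<epsilon> - 1) * (\<epsilon>^2 * g1)" using \<epsilon> by (simp add: field_simps power2_eq_square)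
        also have "\<dots> \<le> real k0 * (\<epsilon>^2 * g1)" using k0 g1 by (intro mult_right_mono) auto
        finally have 1: "\<sigma> / 2 * \<epsilon> * g1 \<le> real k0 * (\<epsilon>^2 * g1)" .
        have "real k * (C7 * sqrt \<epsilon> ^ 5) = (real k * \<epsilon>) * C7 * sqrt \<epsilon> * \<epsilon>" unfolding sq(2) by (simp add: mult_ac)
        also have "\<dots> \<le> t * C7 * sqrt \<epsilon> * \<epsilon>" using k C7 \<epsilon> by (intro mult_right_mono) auto
        also have "\<dots> \<le> \<sigma> * g1 / 4 * \<epsilon>" using e5 \<epsilon> by (intro mult_right_mono) auto
        finally show ?thesis using 1 by (simp add: algebra_simps)
      qed
      ultimately show "ennreal (\<sigma> * g1 / 4 * \<epsilon>) \<le> E \<epsilon> k (\<lambda>y. ennreal ((norm (app (noise_frame \<epsilon> U k) y))^2)) x"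
        unfolding \<phi>_def using ennreal_leI order_trans by blast
    qed
  qed
qed

end

lemma dominated_iterated:
  assumes dom: "dominated U \<beta> t0" and t: "t0 \<le> t"
  shows "norm (app (expm (real s * t) M) (x - app U x)) \<le> exp (\<beta> * (real s * t)) * norm (x - app U x)"
    and "8 ^ s * exp (\<beta> * (real s * t)) * norm (app U x) \<le> norm (app (expm (real s * t) M) (app U x))"
proof -
  have comm: "U * M = M * U" using dom by (simp add: dominated_def)
  have add: "app (expm (real (Suc s) * t) M) z = app (expm t M) (app (expm (real s * t) M) z)" for s z
    by (simp add: distrib_right expm_add)
  have ex: "exp (\<beta> * (real (Suc s) * t)) = exp (\<beta> * t) * exp (\<beta> * (real s * t))" for s
    by (simp add: algebra_simps flip: exp_add)
  have dom1: "norm (app (expm t M) (x - app U x)) \<le> exp (\<beta> * t) * norm (x - app U x)"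
    and dom2: "8 * exp (\<beta> * t) * norm (app U x) \<le> norm (app (expm t M) (app U x))" for x
    using dom t by (auto simp: dominated_def)
  show "norm (app (expm (real s * t) M) (x - app U x)) \<le> exp (\<beta> * (real s * t)) * norm (x - app U x)"
  proof (induction s)
    case (Suc s)
    let ?y = "app (expm (real s * t) M) x"
    have y: "app (expm (real s * t) M) (x - app U x) = ?y - app U ?y" by (simp add: app_simps U_expm[OF comm])
    have "norm (app (expm (real (Suc s) * t) M) (x - app U x)) \<le> exp (\<beta> * t) * norm (?y - app U ?y)"
      unfolding add y by (rule dom1)
    also have "\<dots> \<le> exp (\<beta> * t) * (exp (\<beta> * (real s * t)) * norm (x - app U x))"
      using Suc unfolding y by (intro mult_left_mono) auto
    finally show ?case unfolding ex by (simp add: mult.assoc)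
  qed simp
  show "8 ^ s * exp (\<beta> * (real s * t)) * norm (app U x) \<le> norm (app (expm (real s * t) M) (app U x))"
  proof (induction s)
    case (Suc s)
    let ?y = "app (expm (real s * t) M) x"
    have y: "app (expm (real s * t) M) (app U x) = app U ?y" by (simp add: U_expm[OF comm])
    have "8 * exp (\<beta> * t) * (8 ^ s * exp (\<beta> * (real s * t)) * norm (app U x)) \<le> 8 * exp (\<beta> * t) * norm (app U ?y)"
      using Suc unfolding y by (intro mult_left_mono) auto
    also have "\<dots> \<le> norm (app (expm (real (Suc s) * t) M) (app U x))" unfolding add y by (rule dom2)
    finally show ?case unfolding ex by (simp add: mult_ac)
  qed simp
qed

lemma P_le_add:
  assumes "S \<subseteq> S1 \<union> S2" "S1 \<in> sets borel" "S2 \<in> sets borel" "0 < \<epsilon>"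
  shows "P \<epsilon> k S x \<le> P \<epsilon> k S1 x + P \<epsilon> k S2 x"
proof -
  have "P \<epsilon> k S x \<le> E \<epsilon> k (\<lambda>y. indicator S1 y + indicator S2 y) x"
    using assms(1) by (intro E_mono) (auto simp: indicator_def)
  then show ?thesis using assms by (simp add: E_add)
qed

text \<open>The noise has size about \<open>sqrt (c1 \<epsilon>)\<close> with positive probability. This may be less than \<open>R sqrt \<epsilon>\<close>, but the
  factors \<open>8\<close> of \<open>s\<close> blocks make up for any constant. The hypothesis on \<open>A j\<close>, \<open>U\<close>, \<open>Q\<close> says that \<open>U A\<^sub>j x\<close>
  is not small if \<open>x\<close> is near the range of \<open>Q\<close> and \<open>U x\<close> is small.\<close>

lemma kick:
  assumes dom: "dominated U \<beta> t0" and \<tau>: "t0 \<le> \<tau>" "0 < \<tau>" and pj: "0 < p j"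
    and c: "0 < c" and B: "0 \<le> B"
    and C: "\<And>x. c * norm x \<le> norm (app U (app (A j) x)) + B * norm (app U x) + B * norm (x - app Q x)"
    and \<rho>: "0 < \<rho>" "4 * B * norm Q \<le> c * \<rho>" and R: "0 < R"
  obtains s :: nat and q :: real where "0 < q" "\<forall>\<^sub>F \<epsilon> in at_right 0. \<forall>m x. \<tau> \<le> real m * \<epsilon> \<longrightarrow> real m * \<epsilon> \<le> \<tau> + 1 \<longrightarrow>
    x \<in> cone Q \<rho> \<longrightarrow> x \<notin> cone U (R * sqrt \<epsilon>) \<longrightarrow> ennreal q \<le> P \<epsilon> (s * m) (cone U (R * sqrt \<epsilon>)) x"
proof -
  have comm: "U * M = M * U" using dom by (simp add: dominated_def)
  have U1: "0 < 1 + norm U" using norm_ge_zero[of U] by linarith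
  have g: "0 < c / 2" using c by simp
  obtain \<sigma> c1 where \<sigma>: "0 < \<sigma>" and c1: "0 < c1" and noise: "\<And>R t. 0 \<le> R \<Longrightarrow> 0 \<le> t \<Longrightarrow> \<forall>\<^sub>F \<epsilon> in at_right 0. \<forall>k x.
    norm x = 1 \<longrightarrow> norm (app U x) \<le> R * sqrt \<epsilon> \<longrightarrow> c / 2 \<le> norm (app U (app (A j) x)) \<longrightarrow>
    \<sigma> \<le> real k * \<epsilon> \<longrightarrow> real k * \<epsilon> \<le> t \<longrightarrow>
    ennreal (c1 * \<epsilon>) \<le> E \<epsilon> k (\<lambda>y. ennreal ((norm (app (noise_frame \<epsilon> U k) y))^2)) x"
    using noise_second_moment[OF comm pj g] by blast
  define R' where "R' = R * (1 + norm U)"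
  have R': "0 < R'" using R U1 by (simp add: R'_def)
  obtain s where s: "4 * R' / sqrt c1 \<le> 8 ^ s" "\<sigma> \<le> real s * \<tau>"
  proof -
    obtain n where n: "4 * R' / sqrt c1 < 8 ^ n" using real_arch_pow[of 8 "4 * R' / sqrt c1"] by auto
    define s where "s = max n (nat \<lceil>\<sigma> / \<tau>\<rceil>)"
    have "(8::real) ^ n \<le> 8 ^ s" by (intro power_increasing) (auto simp: s_def)
    then have "4 * R' / sqrt c1 \<le> 8 ^ s" using n by linarith
    moreover have "\<sigma> / \<tau> \<le> real s" unfolding s_def by linarith
    then have "\<sigma> \<le> real s * \<tau>" using \<tau> by (simp add: field_simps)
    ultimately show thesis by (rule that)
  qed
  define T where "T = real s * (\<tau> + 1)"
  have T: "0 \<le> T" using \<tau> by (simp add: T_def)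
  note Ct = C_t_nonneg[OF T]
  define C2 where "C2 = 8 * R' ^ 4 + 8 * (exp (a * T) * norm U) ^ 4 * C_t T"
  have C2: "0 < C2" using R' Ct by (auto simp: C2_def intro!: add_pos_nonneg)
  define q where "q = c1^2 / (4 * C2)"
  have q: "0 < q" using c1 C2 by (simp add: q_def)
  define \<delta> where "\<delta> = exp (- (\<bar>\<beta>\<bar> * T))"
  have \<delta>: "0 < \<delta>" by (simp add: \<delta>_def)
  have c4: "0 < c / 4" using c by simp
  have "\<forall>\<^sub>F \<epsilon> in at_right 0. \<forall>m x. \<tau> \<le> real m * \<epsilon> \<longrightarrow> real m * \<epsilon> \<le> \<tau> + 1 \<longrightarrow>
    x \<in> cone Q \<rho> \<longrightarrow> x \<notin> cone U (R * sqrt \<epsilon>) \<longrightarrow> ennreal q \<le> P \<epsilon> (s * m) (cone U (R * sqrt \<epsilon>)) x"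
    using eventually_at_right_less[of 0] eventually_mult_less(1)[OF zero_less_one, of "8 * a"]
      noise[OF less_imp_le[OF R'] T] eventually_mult_less(2)[OF c4, of "B * R'"]
      eventually_mult_less(1)[OF q, of "C_t T / \<delta> ^ 4"]
  proof (eventually_elim, intro allI impI)
    case (elim \<epsilon>)
    have \<epsilon>: "0 < \<epsilon>" "8 * a * \<epsilon> \<le> 1" using elim by auto
    note e1 = eps_le_1[OF \<epsilon>]
    note noise = elim(3)[rule_format] and e4 = elim(4) and e5 = elim(5)
    fix m x0 assume m: "\<tau> \<le> real m * \<epsilon>" "real m * \<epsilon> \<le> \<tau> + 1"
      and x0: "x0 \<in> cone Q \<rho>" "x0 \<notin> cone U (R * sqrt \<epsilon>)"
    define x where "x = x0 /\<^sub>R norm x0"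
    have "x0 \<noteq> 0" using x0 by (auto simp: cone_def app.zero_right)
    then have nx0: "0 < norm x0" and x: "norm x = 1" "x0 = norm x0 *\<^sub>R x" by (auto simp: x_def)
    have cone: "c *\<^sub>R y \<in> cone V r \<longleftrightarrow> y \<in> cone V r" if "0 < c" for c y V r
      using that by (simp add: cone_def app.scaleR_right mult.left_commute flip: scaleR_diff_right)
    have xH: "x \<in> cone Q \<rho>" "x \<notin> cone U (R * sqrt \<epsilon>)" using x0 x(2) cone[OF nx0] by metis+
    have Ux: "norm (app U x) \<le> R' * sqrt \<epsilon>"
    proof -
      have "norm (app U x) \<le> R * sqrt \<epsilon> * norm (x - app U x)" using xH by (simp add: cone_def)
      also have "norm (x - app U x) \<le> 1 + norm U"
        using norm_triangle_ineq4[of x "app U x"] norm_app[of U x] x by simp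
      finally show ?thesis using R \<epsilon> by (simp add: R'_def mult_ac mult_left_mono)
    qed
    have UAx: "c / 2 \<le> norm (app U (app (A j) x))"
    proof -
      have "B * norm (app U x) \<le> B * (R' * sqrt \<epsilon>)" using Ux B by (intro mult_left_mono)
      then have 1: "B * norm (app U x) \<le> c / 4" using e4 by (simp add: mult.assoc)
      have "\<rho> * norm (x - app Q x) \<le> norm Q" using xH norm_app[of Q x] x by (simp add: cone_def)
      then have "4 * B * (\<rho> * norm (x - app Q x)) \<le> 4 * B * norm Q" using B by (intro mult_left_mono) auto
      also note \<rho>(2)
      finally have "\<rho> * (4 * B * norm (x - app Q x)) \<le> \<rho> * c" by (simp add: mult_ac)
      then have "B * norm (x - app Q x) \<le> c / 4" using \<rho>(1) by simp
      then show ?thesis using C[of x] 1 x by simp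
    qed
    define k where "k = s * m"
    have k: "\<sigma> \<le> real k * \<epsilon>" "real k * \<epsilon> \<le> T"
    proof -
      have e: "real k * \<epsilon> = real s * (real m * \<epsilon>)" by (simp add: k_def)
      have "real s * \<tau> \<le> real k * \<epsilon>" unfolding e using m by (intro mult_left_mono) auto
      then show "\<sigma> \<le> real k * \<epsilon>" using s by simp
      show "real k * \<epsilon> \<le> T" unfolding e T_def using m by (intro mult_left_mono) auto
    qed
    let ?L = "noise_frame \<epsilon> U k" and ?c = "app (expm (k * \<epsilon>) M) x"
    have "ennreal ((c1 * \<epsilon>)^2 / (2 * (C2 * \<epsilon>^2))) \<le> P \<epsilon> k {y. c1 * \<epsilon> / 4 < (norm (app ?L y))^2} x"
      using noise[OF x(1) Ux UAx k] noise_moments(2)[OF comm \<epsilon> k(2) x(1) Ux, folded C2_def] \<epsilon> c1 C2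
      by (intro paley_zygmund) auto
    also have "(c1 * \<epsilon>)^2 / (2 * (C2 * \<epsilon>^2)) = 2 * q" using \<epsilon> by (simp add: q_def power_mult_distrib)
    also have "P \<epsilon> k {y. c1 * \<epsilon> / 4 < (norm (app ?L y))^2} x \<le> P \<epsilon> k (cone U (R * sqrt \<epsilon>)) x + P \<epsilon> k {y. \<delta> < norm (y - ?c)} x"
    proof (rule P_le_add)
      show "{y. c1 * \<epsilon> / 4 < (norm (app ?L y))^2} \<subseteq> cone U (R * sqrt \<epsilon>) \<union> {y. \<delta> < norm (y - ?c)}"
      proof (rule subsetI, rule UnCI)
        fix y assume "y \<in> {y. c1 * \<epsilon> / 4 < (norm (app ?L y))^2}" and "y \<notin> {y. \<delta> < norm (y - ?c)}"
        then have y: "c1 * \<epsilon> / 4 < (norm (app ?L y))^2" and z: "norm (y - ?c) \<le> \<delta>" by simp_all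
        define b where "b = exp (\<beta> * (real k * \<epsilon>))"
        have b: "\<delta> \<le> b" "0 < b"
        proof -
          show "\<delta> \<le> b" unfolding \<delta>_def b_def using \<epsilon> k by (intro exp_lower_const) auto
        qed (simp add: b_def)
        have ks: "real k * \<epsilon> = real s * (real m * \<epsilon>)" by (simp add: k_def)
        have tm: "t0 \<le> real m * \<epsilon>" using m \<tau> by simp
        have "sqrt (c1 * \<epsilon> / 4) \<le> norm (app ?L y)" by (rule real_le_lsqrt) (use y in auto)
        then have Ly: "sqrt c1 * sqrt \<epsilon> / 2 \<le> norm (app ?L y)" by (simp add: real_sqrt_mult real_sqrt_divide)
        have "app ?L y = app U (app (expm (- (real k * \<epsilon>)) M) y)" unfolding noise_frame_def app_mult U_expm[OF comm] ..
        then have "8 ^ s * b * norm (app ?L y) \<le> norm (app (expm (real k * \<epsilon>) M) (app ?L y))"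
          using dominated_iterated(2)[OF dom tm, of s] unfolding b_def ks by simp
        also have "app (expm (real k * \<epsilon>) M) (app ?L y) = app U y"
          unfolding noise_frame_def app_mult by (rule expm_inverse(1))
        finally have Uy: "8 ^ s * b * norm (app ?L y) \<le> norm (app U y)" .
        have "y - app U y = app (expm (real k * \<epsilon>) M) (x - app U x) + ((y - ?c) - app U (y - ?c))"
          by (simp add: app_simps U_expm[OF comm])
        also have "norm \<dots> \<le> b * (1 + norm U) + (1 + norm U) * \<delta>"
        proof (rule order_trans[OF norm_triangle_ineq add_mono])
          have "norm (app (expm (real k * \<epsilon>) M) (x - app U x)) \<le> b * norm (x - app U x)"
            using dominated_iterated(1)[OF dom tm, of s x] unfolding b_def ks .
          also have "\<dots> \<le> b * (1 + norm U)"
            using norm_triangle_ineq4[of x "app U x"] norm_app[of U x] x b by (intro mult_left_mono) auto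
          finally show "norm (app (expm (real k * \<epsilon>) M) (x - app U x)) \<le> b * (1 + norm U)" .
          have "norm ((y - ?c) - app U (y - ?c)) \<le> (1 + norm U) * norm (y - ?c)"
            using norm_triangle_ineq4[of "y - ?c" "app U (y - ?c)"] norm_app[of U "y - ?c"] by (simp add: algebra_simps)
          also have "\<dots> \<le> (1 + norm U) * \<delta>" using z U1 by (intro mult_left_mono) auto
          finally show "norm ((y - ?c) - app U (y - ?c)) \<le> (1 + norm U) * \<delta>" .
        qed
        also have "\<dots> \<le> 2 * b * (1 + norm U)" using mult_right_mono[OF b(1), of "1 + norm U"] U1 by (simp add: mult.commute)
        finally have "R * sqrt \<epsilon> * norm (y - app U y) \<le> R * sqrt \<epsilon> * (2 * b * (1 + norm U))"
          using R \<epsilon> by (intro mult_left_mono) auto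
        also have "\<dots> = 2 * b * R' * sqrt \<epsilon>" by (simp add: R'_def)
        also have "\<dots> \<le> 8 ^ s * b * (sqrt c1 * sqrt \<epsilon> / 2)"
        proof -
          have "4 * R' \<le> 8 ^ s * sqrt c1" using s(1) c1 by (simp add: divide_le_eq)
          then have "b * sqrt \<epsilon> / 2 * (4 * R') \<le> b * sqrt \<epsilon> / 2 * (8 ^ s * sqrt c1)" using b \<epsilon> by (intro mult_left_mono) auto
          then show ?thesis by (simp add: mult_ac)
        qed
        also have "\<dots> \<le> 8 ^ s * b * norm (app ?L y)" using Ly b by (intro mult_left_mono) auto
        also note Uy
        finally show "y \<in> cone U (R * sqrt \<epsilon>)" by (simp add: cone_def)
      qed
    qed (use \<epsilon> in auto)
    also have "P \<epsilon> k {y. \<delta> < norm (y - ?c)} x \<le> ennreal q"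
    proof -
      have "P \<epsilon> k {y. \<delta> < norm (y - ?c)} x \<le> ennreal (C_t T * \<epsilon>^2 * norm x ^ 4 / \<delta> ^ 4)"
        by (rule P_deviation[OF \<epsilon> k(2) \<delta>])
      also have "\<dots> \<le> ennreal q"
      proof (rule ennreal_leI)
        have "C_t T / \<delta> ^ 4 * \<epsilon>^2 \<le> C_t T / \<delta> ^ 4 * \<epsilon>"
          using Ct \<delta> \<epsilon> e1 power_decreasing[of 1 2 \<epsilon>] by (intro mult_left_mono) auto
        then show "C_t T * \<epsilon>^2 * norm x ^ 4 / \<delta> ^ 4 \<le> q" using e5 x by simp
      qed
      finally show ?thesis .
    qed
    finally have "ennreal (2 * q) \<le> P \<epsilon> k (cone U (R * sqrt \<epsilon>)) x + ennreal q" by (simp add: add_left_mono)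
    from ennreal_diff_le[OF this] q have "ennreal q \<le> P \<epsilon> k (cone U (R * sqrt \<epsilon>)) x" by simp
    also have "\<dots> = P \<epsilon> k (cone U (R * sqrt \<epsilon>)) (norm x0 *\<^sub>R x)"
      using cone[OF nx0] by (intro E_cone[symmetric]) (simp add: indicator_def)
    also have "norm x0 *\<^sub>R x = x0" by (rule x(2)[symmetric])
    finally show "ennreal q \<le> P \<epsilon> (s * m) (cone U (R * sqrt \<epsilon>)) x0" by (simp add: k_def)
  qed
  then show thesis using that q by blast
qed

end

section \<open>Time spent in the dominant cone\<close>

context switching
begin

text \<open>The number \<open>b\<close> of blocks has to be the same for all starting points, and \<open>O(1/\<epsilon>)\<close> since
  the cone is known to persist only that long.\<close>

definition reaches :: "real \<Rightarrow> real \<Rightarrow> 'a endo \<Rightarrow> bool" where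
  "reaches \<tau> \<rho> U \<longleftrightarrow> (\<exists>q>0. \<exists>D. \<forall>\<^sub>F \<epsilon> in at_right 0. \<exists>b. real b \<le> D / \<epsilon> \<and>
     (\<forall>m x. \<tau> \<le> real m * \<epsilon> \<longrightarrow> real m * \<epsilon> \<le> \<tau> + 1 \<longrightarrow> ennreal q \<le> P \<epsilon> (b * m) (cone U \<rho>) x))"

text \<open>The induction starts with the trivial projection, whose cone is the whole space.\<close>

lemma reaches_one: "reaches \<tau> \<rho> 1"
  unfolding reaches_def
proof (intro exI conjI)
  show "\<forall>\<^sub>F \<epsilon> in at_right 0. \<exists>b. real b \<le> 0 / \<epsilon> \<and>
     (\<forall>m x. \<tau> \<le> real m * \<epsilon> \<longrightarrow> real m * \<epsilon> \<le> \<tau> + 1 \<longrightarrow> ennreal 1 \<le> P \<epsilon> (b * m) (cone 1 \<rho>) x)"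
    by (intro always_eventually allI exI[of _ 0]) (simp add: cone_def)
qed simp

lemma E_ge_of_indicator:
  assumes "\<And>y. y \<in> S \<Longrightarrow> c \<le> f y" "S \<in> sets borel" "0 < \<epsilon>" "d \<le> P \<epsilon> k S x"
  shows "c * d \<le> E \<epsilon> k f x"
proof -
  have "c * d \<le> c * P \<epsilon> k S x" using assms by (intro mult_left_mono) auto
  also have "\<dots> = E \<epsilon> k (\<lambda>y. c * indicator S y) x" using assms by (simp add: E_cmult)
  also have "\<dots> \<le> E \<epsilon> k f x" using assms(1) by (intro E_mono) (auto simp: indicator_def)
  finally show ?thesis .
qed

text \<open>First wait until the cone of \<open>Q\<close> is occupied. From there either the ratio for \<open>U\<close> is already at least
  \<open>R sqrt \<epsilon>\<close>, or \<open>kick\<close> brings it there in \<open>s\<close> blocks; then \<open>reach\<close> takes over. Since \<open>reach\<close> allows a range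
  of block numbers, both cases can be given the same length.\<close>

lemma reaches_step:
  assumes Q: "reaches \<tau> \<rho> Q"
    and dom: "dominated U \<beta> t0" and \<tau>: "t0 \<le> \<tau>" "0 < \<tau>" and pj: "0 < p j"
    and c: "0 < c" and B: "0 \<le> B"
    and C: "\<And>x. c * norm x \<le> norm (app U (app (A j) x)) + B * norm (app U x) + B * norm (x - app Q x)"
    and \<rho>: "0 < \<rho>" "4 * B * norm Q \<le> c * \<rho>"
  shows "reaches \<tau> \<rho> U"
proof -
  obtain q1 D where q1: "0 < q1" and D: "\<forall>\<^sub>F \<epsilon> in at_right 0. \<exists>b. real b \<le> D / \<epsilon> \<and>
     (\<forall>m x. \<tau> \<le> real m * \<epsilon> \<longrightarrow> real m * \<epsilon> \<le> \<tau> + 1 \<longrightarrow> ennreal q1 \<le> P \<epsilon> (b * m) (cone Q \<rho>) x)"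
    using Q unfolding reaches_def by blast
  obtain R where R: "0 < R" and reach: "\<forall>\<^sub>F \<epsilon> in at_right 0. \<forall>m b x. \<tau> \<le> real m * \<epsilon> \<longrightarrow> real m * \<epsilon> \<le> \<tau> + 1 \<longrightarrow>
    1 / \<epsilon> \<le> real b \<longrightarrow> real b \<le> 3 / \<epsilon> \<longrightarrow> x \<in> cone U (R * sqrt \<epsilon>) \<longrightarrow> ennreal (1 / 2) \<le> P \<epsilon> (b * m) (cone U \<rho>) x"
    using reach[OF dom \<tau>(1) less_imp_le[OF \<tau>(2)] \<rho>(1)] by blast
  obtain s q2 where q2: "0 < q2" and kick: "\<forall>\<^sub>F \<epsilon> in at_right 0. \<forall>m x. \<tau> \<le> real m * \<epsilon> \<longrightarrow> real m * \<epsilon> \<le> \<tau> + 1 \<longrightarrow>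
    x \<in> cone Q \<rho> \<longrightarrow> x \<notin> cone U (R * sqrt \<epsilon>) \<longrightarrow> ennreal q2 \<le> P \<epsilon> (s * m) (cone U (R * sqrt \<epsilon>)) x"
    using kick[OF dom \<tau> pj c B C \<rho> R] by blast
  define q where "q = min (1 / 2) (q2 / 2)"
  have q: "0 < q" using q2 by (simp add: q_def)
  have "\<forall>\<^sub>F \<epsilon> in at_right 0. \<exists>b. real b \<le> (D + 3) / \<epsilon> \<and>
     (\<forall>m x. \<tau> \<le> real m * \<epsilon> \<longrightarrow> real m * \<epsilon> \<le> \<tau> + 1 \<longrightarrow> ennreal (q * q1) \<le> P \<epsilon> (b * m) (cone U \<rho>) x)"
    using eventually_at_right_less[of 0] eventually_mult_less(1)[OF zero_less_one, of s]
      eventually_mult_less(1)[OF zero_less_one, of 1] D reach kick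
  proof eventually_elim
    case (elim \<epsilon>)
    have \<epsilon>: "0 < \<epsilon>" "real s * \<epsilon> < 1" "\<epsilon> < 1" using elim by auto
    note reach = elim(5)[rule_format] and kick = elim(6)[rule_format]
    obtain b1 where b1: "real b1 \<le> D / \<epsilon>" and
      hit1: "\<And>m x. \<tau> \<le> real m * \<epsilon> \<Longrightarrow> real m * \<epsilon> \<le> \<tau> + 1 \<Longrightarrow> ennreal q1 \<le> P \<epsilon> (b1 * m) (cone Q \<rho>) x"
      using elim(4) by blast
    \<comment> \<open>Waiting \<open>L\<close> or \<open>s + L\<close> blocks are both admissible in \<open>reach\<close>.\<close>
    define L where "L = nat \<lceil>1 / \<epsilon>\<rceil>"
    have L: "1 / \<epsilon> \<le> real L" "real L \<le> 1 / \<epsilon> + 1"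
    proof -
      show "1 / \<epsilon> \<le> real L" unfolding L_def by linarith
      have "0 \<le> 1 / \<epsilon>" using \<epsilon> by simp
      then show "real L \<le> 1 / \<epsilon> + 1" unfolding L_def by linarith
    qed
    have "real s \<le> 1 / \<epsilon>" "1 \<le> 1 / \<epsilon>" using \<epsilon> by (auto simp: field_simps)
    then have sL: "real (s + L) \<le> 3 / \<epsilon>" "real L \<le> 3 / \<epsilon>" "1 / \<epsilon> \<le> real (s + L)" using L by auto
    have hit2: "ennreal q \<le> P \<epsilon> ((s + L) * m) (cone U \<rho>) x"
      if m: "\<tau> \<le> real m * \<epsilon>" "real m * \<epsilon> \<le> \<tau> + 1" and x: "x \<in> cone Q \<rho>" for m x
    proof (cases "x \<in> cone U (R * sqrt \<epsilon>)")
      case True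
      have "ennreal q \<le> ennreal (1 / 2)" by (intro ennreal_leI) (simp add: q_def)
      also have "\<dots> \<le> P \<epsilon> ((s + L) * m) (cone U \<rho>) x" by (rule reach[OF m sL(3,1) True])
      finally show ?thesis .
    next
      case False
      have "ennreal (1 / 2) * ennreal q2 \<le> E \<epsilon> (s * m) (P \<epsilon> (L * m) (cone U \<rho>)) x"
        by (rule E_ge_of_indicator[OF _ _ \<epsilon>(1) kick[OF m x False]]) (use reach[OF m L(1) sL(2)] in auto)
      also have "\<dots> = P \<epsilon> ((s + L) * m) (cone U \<rho>) x" by (simp add: E_plus distrib_right)
      finally have "ennreal (1 / 2 * q2) \<le> P \<epsilon> ((s + L) * m) (cone U \<rho>) x" using q2 by (simp only: ennreal_mult)
      moreover have "ennreal q \<le> ennreal (1 / 2 * q2)" by (intro ennreal_leI) (simp add: q_def)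
      ultimately show ?thesis by (rule order_trans[rotated])
    qed
    show ?case
    proof (intro exI[of _ "b1 + (s + L)"] conjI allI impI)
      show "real (b1 + (s + L)) \<le> (D + 3) / \<epsilon>" using b1 sL by (simp add: add_divide_distrib)
      fix m x assume m: "\<tau> \<le> real m * \<epsilon>" "real m * \<epsilon> \<le> \<tau> + 1"
      have "ennreal q * ennreal q1 \<le> E \<epsilon> (b1 * m) (P \<epsilon> ((s + L) * m) (cone U \<rho>)) x"
        by (rule E_ge_of_indicator[OF hit2[OF m] _ \<epsilon>(1) hit1[OF m]]) auto
      also have "\<dots> = P \<epsilon> ((b1 + (s + L)) * m) (cone U \<rho>) x"
        using E_plus[of "b1 * m" "(s + L) * m" \<epsilon> "indicator (cone U \<rho>)" x] by (simp add: distrib_right)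
      finally show "ennreal (q * q1) \<le> P \<epsilon> ((b1 + (s + L)) * m) (cone U \<rho>) x" using q q1 by (simp add: ennreal_mult)
    qed
  qed
  then show ?thesis unfolding reaches_def using q q1 by (intro exI[of _ "q * q1"]) auto
qed

text \<open>In a round of \<open>b\<close> blocks, a point of the cone leaves it with probability at most \<open>G \<epsilon>\<close>, and another point fails to
  enter with probability at most \<open>1 - q\<close>. So the probability to be outside satisfies
  \<open>u' \<le> (1 - q) u + G \<epsilon>\<close>, whose limit is \<open>G \<epsilon> / q\<close>.\<close>

lemma mixing:
  assumes reaches: "reaches \<tau> \<rho> U" and dom: "dominated U \<beta> t0" and \<tau>: "t0 \<le> \<tau>" "0 \<le> \<tau>" and \<rho>: "0 < \<rho>"
    and \<eta>: "0 < \<eta>"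
  shows "\<forall>\<^sub>F \<epsilon> in at_right 0. \<forall>m. \<tau> \<le> real m * \<epsilon> \<longrightarrow> real m * \<epsilon> \<le> \<tau> + 1 \<longrightarrow>
    (\<exists>b0. \<forall>b\<ge>b0. \<forall>x. P \<epsilon> (b * m) (- cone U \<rho>) x \<le> ennreal \<eta>)"
proof -
  obtain q' D' where q': "0 < q'" and D': "\<forall>\<^sub>F \<epsilon> in at_right 0. \<exists>b. real b \<le> D' / \<epsilon> \<and>
     (\<forall>m x. \<tau> \<le> real m * \<epsilon> \<longrightarrow> real m * \<epsilon> \<le> \<tau> + 1 \<longrightarrow> ennreal q' \<le> P \<epsilon> (b * m) (cone U \<rho>) x)"
    using reaches unfolding reaches_def by blast
  define q where "q = min q' (1 / 2)"
  have q: "0 < q" "q < 1" "q \<le> q'" using q' by (auto simp: q_def)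
  define D where "D = max D' 0"
  obtain C where C: "0 \<le> C" and step: "\<And>\<epsilon> m r x. 0 < \<epsilon> \<Longrightarrow> 8 * a * \<epsilon> \<le> 1 \<Longrightarrow> \<tau> \<le> real m * \<epsilon> \<Longrightarrow> real m * \<epsilon> \<le> \<tau> + 1
    \<Longrightarrow> 0 < r \<Longrightarrow> r \<le> \<rho> \<Longrightarrow> x \<in> cone U r \<Longrightarrow> P \<epsilon> m (- cone U (2 * r)) x \<le> ennreal (C * \<epsilon>^2 * (1 + 1 / r) ^ 4)"
    using drift[OF dom \<tau> \<rho>] by blast
  obtain j where j: "(1 - q) ^ j < \<eta> / 2" using real_arch_pow_inv[of "\<eta> / 2" "1 - q"] q \<eta> by auto
  define G where "G = 8 * C * (D * (1 + 1 / \<rho> ^ 4) + 2 / \<rho> ^ 4)"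
  have G: "0 \<le> G" using C \<rho> by (auto simp: G_def D_def)
  have q2: "0 < q * (\<eta> / 2)" using q \<eta> by simp
  show ?thesis
    using eventually_at_right_less[of 0] eventually_mult_less(1)[OF zero_less_one, of "8 * a"]
      eventually_mult_less(1)[OF q2, of G] D'
  proof (eventually_elim, intro allI impI)
    case (elim \<epsilon>)
    have \<epsilon>: "0 < \<epsilon>" "8 * a * \<epsilon> \<le> 1" using elim by auto
    note e3 = elim(3)
    fix m assume m: "\<tau> \<le> real m * \<epsilon>" "real m * \<epsilon> \<le> \<tau> + 1"
    obtain b where b: "real b \<le> D' / \<epsilon>" and hit: "\<And>x. ennreal q' \<le> P \<epsilon> (b * m) (cone U \<rho>) x"
      using elim(4) m by blast
    have one: "P \<epsilon> (b * m) (- cone U \<rho>) x \<le> ennreal (1 - q) * indicator (- cone U \<rho>) x + ennreal (G * \<epsilon>)" for x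
    proof (cases "x \<in> cone U \<rho>")
      case True
      have "P \<epsilon> (b * m) (- cone U (min \<rho> (2 ^ b * \<rho>))) x \<le> ennreal (8 * C * \<epsilon>^2 * (b * (1 + 1 / \<rho> ^ 4) + 2 / \<rho> ^ 4))"
        using True \<epsilon> C \<rho> by (intro drift_iterated step m) auto
      also have "8 * C * \<epsilon>^2 * (b * (1 + 1 / \<rho> ^ 4) + 2 / \<rho> ^ 4) \<le> G * \<epsilon>"
      proof -
        have "D' / \<epsilon> \<le> D / \<epsilon>" using \<epsilon> by (intro divide_right_mono) (auto simp: D_def)
        then have "real b * \<epsilon>^2 \<le> D / \<epsilon> * \<epsilon>^2" using b by (intro mult_right_mono) auto
        also have "\<dots> = D * \<epsilon>" using \<epsilon> by (simp add: power2_eq_square)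
        finally have b2: "real b * \<epsilon>^2 \<le> D * \<epsilon>" .
        have e2: "\<epsilon>^2 \<le> \<epsilon>" using \<epsilon> eps_le_1[OF \<epsilon>] power_decreasing[of 1 2 \<epsilon>] by simp
        have "8 * C * \<epsilon>^2 * (b * (1 + 1 / \<rho> ^ 4) + 2 / \<rho> ^ 4) = 8 * C * ((real b * \<epsilon>^2) * (1 + 1 / \<rho> ^ 4) + \<epsilon>^2 * (2 / \<rho> ^ 4))"
          by (simp add: algebra_simps)
        also have "\<dots> \<le> 8 * C * ((D * \<epsilon>) * (1 + 1 / \<rho> ^ 4) + \<epsilon> * (2 / \<rho> ^ 4))"
          using C \<rho> b2 e2 by (intro mult_left_mono add_mono mult_right_mono) auto
        finally show ?thesis by (simp add: G_def algebra_simps)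
      qed
      finally show ?thesis using True \<rho> by (simp add: min_def ennreal_leI order_trans)
    next
      case False
      have "P \<epsilon> (b * m) (- cone U \<rho>) x \<le> ennreal (1 - q')"
        using q' \<epsilon> by (intro P_compl_le hit) auto
      also have "\<dots> \<le> ennreal (1 - q)" using q by (intro ennreal_leI) auto
      finally show ?thesis using False by (simp add: add_increasing2)
    qed
    have iter: "P \<epsilon> (i * b * m) (- cone U \<rho>) x \<le> ennreal ((1 - q) ^ i + G * \<epsilon> / q)" for i x
    proof (induction i)
      case 0
      have "P \<epsilon> (0 * b * m) (- cone U \<rho>) x \<le> ennreal 1" by (simp add: indicator_def)
      also have "\<dots> \<le> ennreal ((1 - q) ^ 0 + G * \<epsilon> / q)" using G \<epsilon> q by (intro ennreal_leI) auto
      finally show ?case .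
    next
      case (Suc i)
      have "P \<epsilon> (Suc i * b * m) (- cone U \<rho>) x = E \<epsilon> (i * b * m) (P \<epsilon> (b * m) (- cone U \<rho>)) x"
        using E_plus[of "i * b * m" "b * m" \<epsilon> "indicator (- cone U \<rho>)" x] by (simp add: distrib_right add.commute)
      also have "\<dots> \<le> E \<epsilon> (i * b * m) (\<lambda>y. ennreal (1 - q) * indicator (- cone U \<rho>) y + ennreal (G * \<epsilon>)) x"
        by (rule E_mono[OF one])
      also have "\<dots> = ennreal (1 - q) * P \<epsilon> (i * b * m) (- cone U \<rho>) x + ennreal (G * \<epsilon>)"
        using \<epsilon> by (simp add: E_add E_cmult E_const)
      also have "\<dots> \<le> ennreal (1 - q) * ennreal ((1 - q) ^ i + G * \<epsilon> / q) + ennreal (G * \<epsilon>)"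
        by (intro add_right_mono mult_left_mono Suc) auto
      also have "\<dots> = ennreal ((1 - q) * ((1 - q) ^ i + G * \<epsilon> / q) + G * \<epsilon>)"
      proof -
        have "0 \<le> (1 - q) ^ i + G * \<epsilon> / q" using G q \<epsilon> by auto
        then show ?thesis using G q \<epsilon> by (simp add: ennreal_mult ennreal_plus del: ennreal_plus[symmetric])
      qed
      also have "(1 - q) * ((1 - q) ^ i + G * \<epsilon> / q) + G * \<epsilon> = (1 - q) ^ Suc i + G * \<epsilon> / q"
        using q by (simp add: field_simps)
      finally show ?case .
    qed
    show "\<exists>b0. \<forall>b\<ge>b0. \<forall>x. P \<epsilon> (b * m) (- cone U \<rho>) x \<le> ennreal \<eta>"
    proof (intro exI[of _ "j * b"] allI impI)
      fix b' x assume b': "j * b \<le> b'"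
      have "P \<epsilon> (b' * m) (- cone U \<rho>) x = E \<epsilon> ((b' - j * b) * m) (P \<epsilon> (j * b * m) (- cone U \<rho>)) x"
        using E_plus[of "(b' - j * b) * m" "j * b * m" \<epsilon> "indicator (- cone U \<rho>)" x] b' by (simp flip: distrib_right)
      also have "\<dots> \<le> E \<epsilon> ((b' - j * b) * m) (\<lambda>y. ennreal ((1 - q) ^ j + G * \<epsilon> / q)) x"
        by (rule E_mono[OF iter])
      also have "\<dots> = ennreal ((1 - q) ^ j + G * \<epsilon> / q)" using \<epsilon> by (simp add: E_const)
      also have "\<dots> \<le> ennreal \<eta>"
      proof (rule ennreal_leI)
        have "G * \<epsilon> / q \<le> \<eta> / 2" using e3 q by (simp add: field_simps)
        then show "(1 - q) ^ j + G * \<epsilon> / q \<le> \<eta>" using j by linarith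
      qed
      finally show "P \<epsilon> (b' * m) (- cone U \<rho>) x \<le> ennreal \<eta>" .
    qed
  qed
qed

text \<open>In the cone, \<open>\<bar>x\<bar>\<close> is controlled by \<open>\<bar>U x\<bar>\<close>, which grows; a slower growth of the chain is a deviation of
  order \<open>\<bar>x\<bar>\<close> from the averaged flow. Outside the cone nothing is claimed, but \<open>mixing\<close> makes this rare.\<close>

lemma slow_growth_rare:
  assumes comm: "U * M = M * U" and \<tau>: "0 \<le> \<tau>" and \<rho>: "0 < \<rho>"
    and growth: "\<And>t x. \<tau> \<le> t \<Longrightarrow> 2 * (1 + 1 / \<rho>) * (1 + norm U) * exp (\<gamma> * t) * norm (app U x) \<le> norm (app (expm t M) (app U x))"
    and reaches: "reaches \<tau> \<rho> U" and dom: "dominated U \<beta> t0" "t0 \<le> \<tau>" and \<eta>: "0 < \<eta>"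
  shows "\<forall>\<^sub>F \<epsilon> in at_right 0. \<forall>m. \<tau> \<le> real m * \<epsilon> \<longrightarrow> real m * \<epsilon> \<le> \<tau> + 1 \<longrightarrow>
    (\<exists>b0. \<forall>b\<ge>b0. \<forall>x. E \<epsilon> (b * m) (\<lambda>y. P \<epsilon> m {y'. norm y' < exp (\<gamma> * (real m * \<epsilon>)) * norm y} y) x \<le> ennreal \<eta>)"
proof -
  define \<delta> where "\<delta> = exp (- (\<bar>\<gamma>\<bar> * (\<tau> + 1)))"
  have \<delta>: "0 < \<delta>" by (simp add: \<delta>_def)
  have U1: "0 < 1 + norm U" using norm_ge_zero[of U] by linarith
  have Ct: "0 \<le> C_t (\<tau> + 1)" using C_t_nonneg \<tau> by simp
  have \<eta>2: "0 < \<eta> / 2" using \<eta> by simp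
  show ?thesis
    using eventually_at_right_less[of 0] eventually_mult_less(1)[OF zero_less_one, of "8 * a"]
      eventually_mult_less(1)[OF \<eta>2, of "C_t (\<tau> + 1) / \<delta> ^ 4"]
      mixing[OF reaches dom \<tau> \<rho> \<eta>2]
  proof (eventually_elim, intro allI impI)
    case (elim \<epsilon>)
    have \<epsilon>: "0 < \<epsilon>" "8 * a * \<epsilon> \<le> 1" using elim by auto
    note e3 = elim(3)
    fix m assume m: "\<tau> \<le> real m * \<epsilon>" "real m * \<epsilon> \<le> \<tau> + 1"
    define t where "t = real m * \<epsilon>"
    obtain b0 where b0: "\<And>b x. b \<ge> b0 \<Longrightarrow> P \<epsilon> (b * m) (- cone U \<rho>) x \<le> ennreal (\<eta> / 2)"
      using elim(4) m by blast
    have \<delta>t: "\<delta> \<le> exp (\<gamma> * t)" unfolding \<delta>_def using m \<tau> by (intro exp_lower_const) (auto simp: t_def)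
    have one: "P \<epsilon> m {y'. norm y' < exp (\<gamma> * t) * norm x} x \<le> indicator (- cone U \<rho>) x + ennreal (\<eta> / 2)" for x
    proof (cases "x \<in> cone U \<rho> \<and> x \<noteq> 0")
      case False
      show ?thesis
      proof (cases "x = 0")
        case True
        then have "{y' :: 'a. norm y' < exp (\<gamma> * t) * norm x} = {}" by auto
        moreover have "indicator {} = (\<lambda>_ :: 'a. 0 :: ennreal)" by auto
        ultimately have "P \<epsilon> m {y'. norm y' < exp (\<gamma> * t) * norm x} x = E \<epsilon> m (\<lambda>_. 0) x" by (simp only:)
        then show ?thesis using \<epsilon> by (simp add: E_const)
      next
        case nz: False
        then have "x \<notin> cone U \<rho>" using False by auto
        then show ?thesis using P_le_1[OF \<epsilon>(1), of m "{y'. norm y' < exp (\<gamma> * t) * norm x}" x]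
          by (simp add: add_increasing2)
      qed
    next
      case True
      then have x: "x \<in> cone U \<rho>" "0 < norm x" by auto
      have "{y'. norm y' < exp (\<gamma> * t) * norm x} \<subseteq> {y. \<delta> * norm x < norm (y - app (expm (m * \<epsilon>) M) x)}"
      proof (rule subsetI, rule ccontr)
        fix y assume y: "y \<in> {y'. norm y' < exp (\<gamma> * t) * norm x}" and "y \<notin> {y. \<delta> * norm x < norm (y - app (expm (m * \<epsilon>) M) x)}"
        then have z: "norm (y - app (expm t M) x) \<le> \<delta> * norm x" by (simp add: t_def)
        have "norm x \<le> norm (app U x) + norm (x - app U x)" using norm_triangle_ineq[of "app U x" "x - app U x"] by simp
        also have "norm (x - app U x) \<le> norm (app U x) / \<rho>" using x \<rho> by (simp add: cone_def field_simps)
        finally have nx: "norm x \<le> (1 + 1 / \<rho>) * norm (app U x)" by (simp add: algebra_simps)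
        have "app U y = app (expm t M) (app U x) + app U (y - app (expm t M) x)" by (simp add: app_simps U_expm[OF comm])
        then have "norm (app (expm t M) (app U x)) \<le> norm (app U y) + norm (app U (y - app (expm t M) x))"
          using norm_triangle_ineq4[of "app U y" "app U (y - app (expm t M) x)"] by simp
        moreover have "norm (app U y) \<le> (1 + norm U) * norm y"
        proof -
          have "(1 + norm U) * norm y = norm y + norm U * norm y" by (simp add: algebra_simps)
          then show ?thesis using norm_app[of U y] norm_ge_zero[of y] by linarith
        qed
        moreover have "norm (app U (y - app (expm t M) x)) \<le> (1 + norm U) * (exp (\<gamma> * t) * norm x)"
        proof -
          have "norm (app U (y - app (expm t M) x)) \<le> norm U * (\<delta> * norm x)"
            using z by (intro order_trans[OF norm_app] mult_left_mono) auto
          also have "\<dots> \<le> (1 + norm U) * (exp (\<gamma> * t) * norm x)"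
            using \<delta>t U1 \<delta> by (intro mult_mono mult_right_mono) auto
          finally show ?thesis .
        qed
        moreover have "2 * (1 + norm U) * exp (\<gamma> * t) * norm x \<le> norm (app (expm t M) (app U x))"
        proof -
          have "2 * (1 + norm U) * exp (\<gamma> * t) * norm x \<le> 2 * (1 + norm U) * exp (\<gamma> * t) * ((1 + 1 / \<rho>) * norm (app U x))"
            using nx U1 by (intro mult_left_mono) auto
          also have "\<dots> = 2 * (1 + 1 / \<rho>) * (1 + norm U) * exp (\<gamma> * t) * norm (app U x)" by (simp only: mult_ac)
          also have "\<dots> \<le> norm (app (expm t M) (app U x))" by (rule growth) (use m in \<open>simp add: t_def\<close>)
          finally show ?thesis .
        qed
        ultimately have "(1 + norm U) * (exp (\<gamma> * t) * norm x) \<le> (1 + norm U) * norm y" by (simp add: algebra_simps)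
        then have "exp (\<gamma> * t) * norm x \<le> norm y" using U1 by simp
        then show False using y by simp
      qed
      then have "P \<epsilon> m {y'. norm y' < exp (\<gamma> * t) * norm x} x \<le> P \<epsilon> m {y. \<delta> * norm x < norm (y - app (expm (m * \<epsilon>) M) x)} x"
        by (rule P_mono)
      also have "\<dots> \<le> ennreal (C_t (\<tau> + 1) * \<epsilon>^2 * norm x ^ 4 / (\<delta> * norm x) ^ 4)"
        using x \<delta> by (intro P_deviation[OF \<epsilon> m(2)]) auto
      also have "\<dots> \<le> ennreal (\<eta> / 2)"
      proof (rule ennreal_leI)
        have "C_t (\<tau> + 1) * \<epsilon>^2 * norm x ^ 4 / (\<delta> * norm x) ^ 4 = C_t (\<tau> + 1) / \<delta> ^ 4 * \<epsilon>^2"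
          using x by (simp add: power_mult_distrib)
        also have "\<dots> \<le> C_t (\<tau> + 1) / \<delta> ^ 4 * \<epsilon>"
          using Ct \<delta> \<epsilon> eps_le_1[OF \<epsilon>] power_decreasing[of 1 2 \<epsilon>] by (intro mult_left_mono) auto
        finally show "C_t (\<tau> + 1) * \<epsilon>^2 * norm x ^ 4 / (\<delta> * norm x) ^ 4 \<le> \<eta> / 2" using e3 by linarith
      qed
      finally show ?thesis using x by simp
    qed
    show "\<exists>b0. \<forall>b\<ge>b0. \<forall>x. E \<epsilon> (b * m) (\<lambda>y. P \<epsilon> m {y'. norm y' < exp (\<gamma> * (real m * \<epsilon>)) * norm y} y) x \<le> ennreal \<eta>"
    proof (intro exI[of _ b0] allI impI)
      fix b x assume b: "b0 \<le> b"
      have "E \<epsilon> (b * m) (\<lambda>y. P \<epsilon> m {y'. norm y' < exp (\<gamma> * (real m * \<epsilon>)) * norm y} y) x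
          \<le> E \<epsilon> (b * m) (\<lambda>y. indicator (- cone U \<rho>) y + ennreal (\<eta> / 2)) x"
        using one unfolding t_def by (rule E_mono)
      also have "\<dots> = P \<epsilon> (b * m) (- cone U \<rho>) x + ennreal (\<eta> / 2)" using \<epsilon> by (simp add: E_add E_const)
      also have "\<dots> \<le> ennreal (\<eta> / 2) + ennreal (\<eta> / 2)" by (intro add_right_mono b0 b)
      also have "\<dots> = ennreal \<eta>" using \<eta> by (simp flip: ennreal_plus)
      finally show "E \<epsilon> (b * m) (\<lambda>y. P \<epsilon> m {y'. norm y' < exp (\<gamma> * (real m * \<epsilon>)) * norm y} y) x \<le> ennreal \<eta>" .
    qed
  qed
qed

text \<open>The block estimate is submultiplicative in the number of blocks. The factor \<open>1/2\<close> in the hypothesis leaves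
  room for the deviation.\<close>

lemma mean_growth:
  assumes \<tau>: "0 \<le> \<tau>" and growth: "\<And>t x. \<tau> \<le> t \<Longrightarrow> norm (app (expm t M) x) \<le> exp (\<gamma> * t) / 2 * norm x"
  shows "\<forall>\<^sub>F \<epsilon> in at_right 0. \<forall>m b x. \<tau> \<le> real m * \<epsilon> \<longrightarrow> real m * \<epsilon> \<le> \<tau> + 1 \<longrightarrow>
    E \<epsilon> (b * m) (\<lambda>y. ennreal (norm y)) x \<le> ennreal (exp (\<gamma> * (real (b * m) * \<epsilon>)) * norm x)"
proof -
  define \<delta> where "\<delta> = exp (- (\<bar>\<gamma>\<bar> * (\<tau> + 1))) / 4"
  have \<delta>: "0 < \<delta>" by (simp add: \<delta>_def)
  have Ct: "0 \<le> C_t (\<tau> + 1)" using C_t_nonneg \<tau> by simp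
  show ?thesis
    using eventually_at_right_less[of 0] eventually_mult_less(1)[OF zero_less_one, of "8 * a"]
      eventually_mult_less(1)[OF \<delta>, of "C_t (\<tau> + 1) / \<delta> ^ 3"]
  proof (eventually_elim, intro allI impI)
    case (elim \<epsilon>)
    have \<epsilon>: "0 < \<epsilon>" "8 * a * \<epsilon> \<le> 1" using elim by auto
    note e3 = elim(3)
    fix m b x assume m: "\<tau> \<le> real m * \<epsilon>" "real m * \<epsilon> \<le> \<tau> + 1"
    define t where "t = real m * \<epsilon>"
    have \<delta>t: "4 * \<delta> \<le> exp (\<gamma> * t)" using exp_lower_const[of t "\<tau> + 1" \<gamma>] m \<tau> by (auto simp: t_def \<delta>_def)
    have one: "E \<epsilon> m (\<lambda>y. ennreal (norm y)) x \<le> ennreal (exp (\<gamma> * t)) * ennreal (norm x)" for x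
    proof (cases "x = 0")
      case True then show ?thesis using \<epsilon> by (simp add: E_zero)
    next
      case False
      let ?z = "\<lambda>y. norm (y - app (expm (m * \<epsilon>) M) x)"
      have nx: "0 < norm x" using False by simp
      \<comment> \<open>A first moment is bounded by a small constant plus a multiple of the fourth moment.\<close>
      have z: "r \<le> d + 1 / d ^ 3 * r ^ 4" if "0 < d" "0 \<le> r" for r d :: real
      proof (cases "r \<le> d")
        case True then show ?thesis using that by (simp add: add_increasing2)
      next
        case False
        then have "r * d ^ 3 \<le> r * r ^ 3" using that by (intro mult_left_mono power_mono) auto
        moreover have "0 \<le> d * d ^ 3" "r * r ^ 3 = r ^ 4" using that by (simp_all add: eval_nat_numeral)
        ultimately have "r * d ^ 3 \<le> d * d ^ 3 + r ^ 4" by linarith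
        then show ?thesis using that by (simp add: field_simps)
      qed
      have pt: "norm y \<le> (exp (\<gamma> * t) / 2 * norm x + \<delta> * norm x) + 1 / (\<delta> * norm x) ^ 3 * ?z y ^ 4" for y
      proof -
        have "norm y \<le> norm (app (expm (m * \<epsilon>) M) x) + ?z y"
          using norm_triangle_ineq[of "app (expm (m * \<epsilon>) M) x" "y - app (expm (m * \<epsilon>) M) x"] by simp
        also have "norm (app (expm (m * \<epsilon>) M) x) \<le> exp (\<gamma> * t) / 2 * norm x"
          using growth[of t x] m by (simp add: t_def)
        finally show ?thesis using z[of "\<delta> * norm x" "?z y"] \<delta> nx by simp
      qed
      have m4: "E \<epsilon> m (\<lambda>y. ennreal (?z y ^ 4)) x \<le> ennreal (C_t (\<tau> + 1) * \<epsilon>^2 * norm x ^ 4)"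
        by (rule fourth_moment[OF \<epsilon> m(2)])
      have "E \<epsilon> m (\<lambda>y. ennreal (norm y)) x \<le> ennreal ((exp (\<gamma> * t) / 2 * norm x + \<delta> * norm x)
          + 1 / (\<delta> * norm x) ^ 3 * (C_t (\<tau> + 1) * \<epsilon>^2 * norm x ^ 4))"
        by (rule E_affine_le[OF \<epsilon>(1) _ _ pt _ _ _ m4]) (use \<delta> nx Ct in auto)
      also have "\<dots> \<le> ennreal (exp (\<gamma> * t) * norm x)"
      proof (rule ennreal_leI)
        have "1 / (\<delta> * norm x) ^ 3 * (C_t (\<tau> + 1) * \<epsilon>^2 * norm x ^ 4) = C_t (\<tau> + 1) / \<delta> ^ 3 * \<epsilon>^2 * norm x"
          using nx by (simp add: power_mult_distrib field_simps eval_nat_numeral)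
        also have "\<dots> \<le> C_t (\<tau> + 1) / \<delta> ^ 3 * \<epsilon> * norm x"
          using Ct \<delta> \<epsilon> eps_le_1[OF \<epsilon>] power_decreasing[of 1 2 \<epsilon>] by (intro mult_right_mono mult_left_mono) auto
        also have "\<dots> \<le> \<delta> * norm x" using e3 by (intro mult_right_mono) auto
        finally have 1: "1 / (\<delta> * norm x) ^ 3 * (C_t (\<tau> + 1) * \<epsilon>^2 * norm x ^ 4) \<le> \<delta> * norm x" .
        have "4 * \<delta> * norm x \<le> exp (\<gamma> * t) * norm x" using \<delta>t by (intro mult_right_mono) auto
        then show "exp (\<gamma> * t) / 2 * norm x + \<delta> * norm x + 1 / (\<delta> * norm x) ^ 3 * (C_t (\<tau> + 1) * \<epsilon>^2 * norm x ^ 4) \<le> exp (\<gamma> * t) * norm x"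
          using 1 by linarith
      qed
      finally show ?thesis by (simp add: ennreal_mult)
    qed
    have "E \<epsilon> (b * m) (\<lambda>y. ennreal (norm y)) x \<le> ennreal (exp (\<gamma> * (real b * t))) * ennreal (norm x)"
    proof (induction b)
      case (Suc b)
      have "E \<epsilon> (Suc b * m) (\<lambda>y. ennreal (norm y)) x = E \<epsilon> (b * m) (E \<epsilon> m (\<lambda>y. ennreal (norm y))) x"
        using E_plus[of "b * m" m \<epsilon> "\<lambda>y. ennreal (norm y)" x] by (simp add: add.commute)
      also have "\<dots> \<le> E \<epsilon> (b * m) (\<lambda>y. ennreal (exp (\<gamma> * t)) * ennreal (norm y)) x" by (rule E_mono[OF one])
      also have "\<dots> = ennreal (exp (\<gamma> * t)) * E \<epsilon> (b * m) (\<lambda>y. ennreal (norm y)) x" using \<epsilon> by (simp add: E_cmult)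
      also have "\<dots> \<le> ennreal (exp (\<gamma> * t)) * (ennreal (exp (\<gamma> * (real b * t))) * ennreal (norm x))"
        by (intro mult_left_mono Suc) auto
      also have "\<dots> = ennreal (exp (\<gamma> * (real (Suc b) * t))) * ennreal (norm x)"
        by (simp add: algebra_simps exp_add ennreal_mult)
      finally show ?case .
    qed simp
    then show "E \<epsilon> (b * m) (\<lambda>y. ennreal (norm y)) x \<le> ennreal (exp (\<gamma> * (real (b * m) * \<epsilon>)) * norm x)"
      by (simp add: ennreal_mult t_def mult.assoc)
  qed
qed

end

section \<open>The law of the jumps\<close>

text \<open>As every row of the transition matrix is the initial law, the chain of states is a sequence of independent
  choices.\<close>

locale switched_process = markov_process \<Omega> X T \<pi> \<mu> TP + switching A "\<lambda>i. \<pi> $ i" a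
  for \<Omega> :: "'w measure" and X :: "nat \<Rightarrow> 'w \<Rightarrow> 'n::finite" and T \<pi> \<mu> TP
    and A :: "'n \<Rightarrow> 'a::euclidean_space endo" and a +
  assumes P_rows: "\<And>i j. TP $ i $ j = \<pi> $ j"
begin

lemma T_measurable [measurable]: "T k \<in> borel_measurable \<Omega>"
  using distributed_measurable[OF T_exponential[of k]] by simp

lemma X_event [measurable]: "{\<omega> \<in> space \<Omega>. X k \<omega> \<in> B} \<in> sets \<Omega>"
  using measurable_sets[OF X_measurable[of k], of B] by (simp add: vimage_def Int_def conj_commute)

lemma X_prefix_event [measurable]: "{\<omega> \<in> space \<Omega>. \<forall>k<m. X k \<omega> \<in> B k} \<in> sets \<Omega>"
  by measurable

lemma X_path_law: "\<P>(\<omega> in \<Omega>. \<forall>k<m. X k \<omega> = s k) = (\<Prod>k<m. \<pi> $ s k)"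
proof (induction m)
  case 0 then show ?case by (simp add: prob_space)
next
  case (Suc m)
  show ?case
  proof (cases m)
    case 0 then show ?thesis using initial_law[of "s 0"] by simp
  next
    case (Suc l)
    have pre: "(\<forall>k<m. X k \<omega> = s k) \<longleftrightarrow> (\<forall>k\<le>l. X k \<omega> = s k)" for \<omega> using Suc by (simp add: less_Suc_eq_le)
    have suc: "(\<forall>k<Suc m. X k \<omega> = s k) \<longleftrightarrow> X (Suc l) \<omega> = s m \<and> (\<forall>k\<le>l. X k \<omega> = s k)" for \<omega>
      using Suc pre[of \<omega>] by (auto simp: less_Suc_eq)
    have [measurable]: "{\<omega> \<in> space \<Omega>. \<forall>k\<le>l. X k \<omega> = s k} \<in> sets \<Omega>" by measurable
    show ?thesis
    proof (cases "\<P>(\<omega> in \<Omega>. \<forall>k\<le>l. X k \<omega> = s k) > 0")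
      case True
      have "\<P>(\<omega> in \<Omega>. X (Suc l) \<omega> = s m \<and> (\<forall>k\<le>l. X k \<omega> = s k)) = \<pi> $ s m * \<P>(\<omega> in \<Omega>. \<forall>k\<le>l. X k \<omega> = s k)"
        using transition[OF True, of "s m"] True by (simp add: cond_prob_def P_rows field_simps)
      then show ?thesis using Suc.IH unfolding suc pre by simp
    next
      case False
      then have 0: "\<P>(\<omega> in \<Omega>. \<forall>k\<le>l. X k \<omega> = s k) = 0" using measure_nonneg[of \<Omega>] by (simp add: less_le)
      have "\<P>(\<omega> in \<Omega>. X (Suc l) \<omega> = s m \<and> (\<forall>k\<le>l. X k \<omega> = s k)) \<le> \<P>(\<omega> in \<Omega>. \<forall>k\<le>l. X k \<omega> = s k)"
        by (intro finite_measure_mono) auto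
      then have "\<P>(\<omega> in \<Omega>. X (Suc l) \<omega> = s m \<and> (\<forall>k\<le>l. X k \<omega> = s k)) = 0"
        using 0 measure_nonneg[of \<Omega>] by (simp add: order_antisym)
      then show ?thesis using Suc.IH 0 unfolding suc pre by simp
    qed
  qed
qed

lemma X_rectangle_law: "\<P>(\<omega> in \<Omega>. \<forall>k<m. X k \<omega> \<in> B k) = (\<Prod>k<m. \<Sum>i\<in>B k. \<pi> $ i)"
proof -
  let ?C = "\<lambda>s. {\<omega> \<in> space \<Omega>. \<forall>k<m. X k \<omega> = s k}"
  let ?I = "PiE {..<m} B"
  have fin: "finite ?I" by (intro finite_PiE) auto
  have eq: "{\<omega> \<in> space \<Omega>. \<forall>k<m. X k \<omega> \<in> B k} = (\<Union>s\<in>?I. ?C s)"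
  proof safe
    fix \<omega> assume \<omega>: "\<omega> \<in> space \<Omega>" "\<forall>k<m. X k \<omega> \<in> B k"
    show "\<omega> \<in> (\<Union>s\<in>?I. ?C s)"
      using \<omega> by (intro UN_I[of "restrict (\<lambda>k. X k \<omega>) {..<m}"]) auto
  qed (auto simp: PiE_iff)
  have "disjoint_family_on ?C ?I"
    unfolding disjoint_family_on_def
  proof (intro ballI impI, rule ccontr)
    fix s s' assume s: "s \<in> ?I" "s' \<in> ?I" "s \<noteq> s'" "?C s \<inter> ?C s' \<noteq> {}"
    then have "\<forall>k<m. s k = s' k" by auto
    then have "s = s'" using s by (intro PiE_ext) auto
    then show False using s by simp
  qed
  from finite_measure_finite_Union[OF fin _ this]
  have "measure \<Omega> (\<Union>s\<in>?I. ?C s) = (\<Sum>s\<in>?I. measure \<Omega> (?C s))"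
    by (simp add: image_subset_iff)
  also have "\<dots> = (\<Sum>s\<in>?I. \<Prod>k<m. \<pi> $ s k)" by (simp only: X_path_law)
  also have "\<dots> = (\<Prod>k<m. \<Sum>i\<in>B k. \<pi> $ i)" by (rule prod_sum_PiE[symmetric]) auto
  finally show ?thesis unfolding eq .
qed

lemma X_finite_rectangle_law:
  assumes "finite J" "J \<noteq> {}"
  shows "prob (\<Inter>j\<in>J. {\<omega> \<in> space \<Omega>. X j \<omega> \<in> B j} \<inter> space \<Omega>) = (\<Prod>j\<in>J. \<Sum>i\<in>B j. \<pi> $ i)"
proof -
  obtain m where m: "J \<subseteq> {..<m}" using assms finite_nat_iff_bounded by blast
  define B' where "B' = (\<lambda>j. if j \<in> J then B j else UNIV)"
  have "(\<Inter>j\<in>J. {\<omega> \<in> space \<Omega>. X j \<omega> \<in> B j} \<inter> space \<Omega>) = {\<omega> \<in> space \<Omega>. \<forall>k<m. X k \<omega> \<in> B' k}"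
    using m assms by (auto simp: B'_def)
  then have "prob (\<Inter>j\<in>J. {\<omega> \<in> space \<Omega>. X j \<omega> \<in> B j} \<inter> space \<Omega>) = (\<Prod>k<m. \<Sum>i\<in>B' k. \<pi> $ i)"
    by (simp add: X_rectangle_law)
  also have "\<dots> = (\<Prod>k\<in>J. \<Sum>i\<in>B' k. \<pi> $ i)"
    using m p_sum by (intro prod.mono_neutral_right) (auto simp: B'_def)
  finally show ?thesis by (simp add: B'_def)
qed

text \<open>The states and the times are only known to be independent as whole sequences; for rectangles this gives the
  product formula that characterizes the joint law.\<close>

lemma joint_rectangle_law:
  assumes J: "finite J" "J \<noteq> {}" and C: "\<And>j. j \<in> J \<Longrightarrow> C j \<in> sets borel"
  shows "prob (\<Inter>j\<in>J. (\<lambda>\<omega>. (X j \<omega>, T j \<omega>)) -` (B j \<times> C j) \<inter> space \<Omega>)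
    = (\<Prod>j\<in>J. (\<Sum>i\<in>B j. \<pi> $ i) * prob (T j -` C j \<inter> space \<Omega>))"
proof -
  let ?SX = "vimage_algebra (space \<Omega>) (\<lambda>\<omega> k. X k \<omega>) (\<Pi>\<^sub>M k\<in>UNIV. count_space UNIV)"
  let ?ST = "vimage_algebra (space \<Omega>) (\<lambda>\<omega> k. T k \<omega>) (\<Pi>\<^sub>M k\<in>(UNIV::nat set). (borel :: real measure))"
  define U where "U = (\<Inter>j\<in>J. {\<omega> \<in> space \<Omega>. X j \<omega> \<in> B j} \<inter> space \<Omega>)"
  define V where "V = (\<Inter>j\<in>J. T j -` C j \<inter> space \<Omega>)"
  have "U \<in> sets ?SX"
  proof -
    have "{f \<in> space (\<Pi>\<^sub>M k\<in>UNIV. count_space UNIV). \<forall>j\<in>J. f j \<in> B j} \<in> sets (\<Pi>\<^sub>M k\<in>(UNIV :: nat set). count_space (UNIV :: 'n set))"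
      using J by measurable
    from in_vimage_algebra[OF this, of "\<lambda>\<omega> k. X k \<omega>" "space \<Omega>"]
    show ?thesis by (rule back_subst[of "\<lambda>S. S \<in> sets ?SX"]) (use J in \<open>auto simp: U_def space_PiM\<close>)
  qed
  moreover have "V \<in> sets ?ST"
  proof -
    have [measurable]: "\<And>j. j \<in> J \<Longrightarrow> C j \<in> sets borel" by (rule C)
    have "{f \<in> space (\<Pi>\<^sub>M k\<in>UNIV. borel). \<forall>j\<in>J. f j \<in> C j} \<in> sets (\<Pi>\<^sub>M k\<in>(UNIV :: nat set). (borel :: real measure))"
      using J by measurable
    from in_vimage_algebra[OF this, of "\<lambda>\<omega> k. T k \<omega>" "space \<Omega>"]
    show ?thesis by (rule back_subst[of "\<lambda>S. S \<in> sets ?ST"]) (use J in \<open>auto simp: V_def space_PiM\<close>)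
  qed
  ultimately have "prob (U \<inter> V) = prob U * prob V" by (rule indep_setD[OF X_T_indep])
  also have "prob U = (\<Prod>j\<in>J. \<Sum>i\<in>B j. \<pi> $ i)" unfolding U_def by (rule X_finite_rectangle_law[OF J])
  also have "prob V = (\<Prod>j\<in>J. prob (T j -` C j \<inter> space \<Omega>))"
    unfolding V_def by (rule indep_varsD[OF T_indep J(2,1)]) (use C in auto)
  also have "U \<inter> V = (\<Inter>j\<in>J. (\<lambda>\<omega>. (X j \<omega>, T j \<omega>)) -` (B j \<times> C j) \<inter> space \<Omega>)"
    using J by (auto simp: U_def V_def)
  finally show ?thesis by (simp add: prod.distrib)
qed

abbreviation jump_space :: "('n \<times> real) measure" where "jump_space \<equiv> count_space UNIV \<Otimes>\<^sub>M borel"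

abbreviation \<zeta> :: "nat \<Rightarrow> 'w \<Rightarrow> 'n \<times> real" where "\<zeta> k \<omega> \<equiv> (X k \<omega>, T k \<omega>)"

lemma indep_jumps: "indep_vars (\<lambda>_. jump_space) \<zeta> UNIV"
proof -
  let ?G = "{b \<times> c | b c. b \<in> sets (count_space (UNIV :: 'n set)) \<and> c \<in> sets (borel :: real measure)}"
  have fin: "indep_vars (\<lambda>_. jump_space) \<zeta> J" if J: "finite J" "J \<noteq> {}" for J
  proof (subst indep_vars_finite[where E = "\<lambda>_. ?G"])
    show "sets jump_space = sigma_sets (space jump_space) ?G"
      by (simp add: sets_pair_measure space_pair_measure)
    show "Int_stable ?G" by (rule Int_stable_pair_measure_generator)
    show "space jump_space \<in> ?G"
      by (intro CollectI exI[of _ UNIV]) (simp add: space_pair_measure)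
    show "?G \<subseteq> Pow (space jump_space)" by (auto simp: space_pair_measure)
    show "random_variable jump_space (\<zeta> i)" for i by measurable
    show "\<forall>G\<in>J \<rightarrow> ?G. prob (\<Inter>j\<in>J. \<zeta> j -` G j \<inter> space \<Omega>) = (\<Prod>j\<in>J. prob (\<zeta> j -` G j \<inter> space \<Omega>))"
    proof
      fix G assume G: "G \<in> J \<rightarrow> ?G"
      then have "\<forall>j\<in>J. \<exists>b c. G j = b \<times> c \<and> c \<in> sets (borel :: real measure)" by (fastforce simp: Pi_iff)
      then obtain b c where bc: "\<And>j. j \<in> J \<Longrightarrow> G j = b j \<times> c j" "\<And>j. j \<in> J \<Longrightarrow> c j \<in> sets (borel :: real measure)"
        by metis
      have "prob (\<Inter>j\<in>J. \<zeta> j -` G j \<inter> space \<Omega>) = prob (\<Inter>j\<in>J. \<zeta> j -` (b j \<times> c j) \<inter> space \<Omega>)"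
        using bc by simp
      also have "\<dots> = (\<Prod>j\<in>J. (\<Sum>i\<in>b j. \<pi> $ i) * prob (T j -` c j \<inter> space \<Omega>))"
        by (rule joint_rectangle_law[OF J bc(2)])
      also have "\<dots> = (\<Prod>j\<in>J. prob (\<zeta> j -` G j \<inter> space \<Omega>))"
      proof (rule prod.cong[OF refl])
        fix j assume j: "j \<in> J"
        show "(\<Sum>i\<in>b j. \<pi> $ i) * prob (T j -` c j \<inter> space \<Omega>) = prob (\<zeta> j -` G j \<inter> space \<Omega>)"
          using joint_rectangle_law[of "{j}" c b] j bc by simp
      qed
      finally show "prob (\<Inter>j\<in>J. \<zeta> j -` G j \<inter> space \<Omega>) = (\<Prod>j\<in>J. prob (\<zeta> j -` G j \<inter> space \<Omega>))" .
    qed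
  qed (use J in auto)
  show ?thesis
    unfolding indep_vars_def2
  proof
    show "\<forall>i\<in>UNIV. random_variable jump_space (\<zeta> i)" by simp
    show "indep_sets (\<lambda>i. {\<zeta> i -` A \<inter> space \<Omega> |A. A \<in> sets jump_space}) UNIV"
      by (subst indep_sets_finite_index_sets) (use fin in \<open>auto simp: indep_vars_def2\<close>)
  qed
qed

definition \<epsilon> :: real where "\<epsilon> = 1 / \<mu>"

lemma \<epsilon>_pos: "0 < \<epsilon>" using rate_pos by (simp add: \<epsilon>_def)

lemma T_distr: "distr \<Omega> borel (T k) = exp_law \<epsilon>"
proof -
  have "distr \<Omega> borel (T k) = distr \<Omega> lborel (T k)" by (rule distr_cong) auto
  also have "\<dots> = density lborel (exponential_density \<mu>)"
    by (rule distributed_distr_eq_density[OF T_exponential])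
  finally show ?thesis by (simp add: exp_law_def \<epsilon>_def)
qed

lemma nn_integral_jump:
  assumes [measurable]: "G \<in> borel_measurable jump_space"
  shows "(\<integral>\<^sup>+z. G z \<partial>distr \<Omega> jump_space (\<zeta> k)) = (\<Sum>i\<in>UNIV. ennreal (\<pi> $ i) * (\<integral>\<^sup>+s. G (i, s) \<partial>exp_law \<epsilon>))"
proof -
  let ?DX = "distr \<Omega> (count_space UNIV) (X k)" and ?DT = "distr \<Omega> borel (T k)"
  interpret DX: prob_space ?DX by (rule prob_space_distr) measurable
  interpret DT: prob_space ?DT by (rule prob_space_distr) measurable
  have "?DX \<Otimes>\<^sub>M ?DT = distr \<Omega> jump_space (\<zeta> k)"
  proof (rule pair_measure_eqI)
    show "sets (?DX \<Otimes>\<^sub>M ?DT) = sets (distr \<Omega> jump_space (\<zeta> k))"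
    proof -
      have "sets (?DX \<Otimes>\<^sub>M ?DT) = sets jump_space" by (intro sets_pair_measure_cong) simp_all
      then show ?thesis by simp
    qed
    fix B C assume "B \<in> sets ?DX" "C \<in> sets ?DT"
    then have C: "C \<in> sets borel" by simp
    have 1: "prob (\<zeta> k -` (B \<times> C) \<inter> space \<Omega>) = (\<Sum>i\<in>B. \<pi> $ i) * prob (T k -` C \<inter> space \<Omega>)"
      using joint_rectangle_law[of "{k}" "\<lambda>_. C" "\<lambda>_. B"] C by simp
    have 2: "prob (X k -` B \<inter> space \<Omega>) = (\<Sum>i\<in>B. \<pi> $ i)"
      using X_finite_rectangle_law[of "{k}" "\<lambda>_. B"] by (simp add: vimage_def Int_def conj_commute)
    show "emeasure ?DX B * emeasure ?DT C = emeasure (distr \<Omega> jump_space (\<zeta> k)) (B \<times> C)"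
      using C by (simp add: emeasure_distr emeasure_eq_measure 1 2 ennreal_mult sum_nonneg p_nonneg)
  qed unfold_locales
  then have "(\<integral>\<^sup>+z. G z \<partial>distr \<Omega> jump_space (\<zeta> k)) = (\<integral>\<^sup>+z. G z \<partial>(?DX \<Otimes>\<^sub>M ?DT))" by simp
  also have "\<dots> = (\<integral>\<^sup>+i. \<integral>\<^sup>+s. G (i, s) \<partial>?DT \<partial>?DX)"
    by (rule DT.nn_integral_fst[symmetric]) (simp cong: measurable_cong_sets sets_pair_measure_cong)
  also have "\<dots> = (\<integral>\<^sup>+i. (\<Sum>j\<in>UNIV. (\<integral>\<^sup>+s. G (j, s) \<partial>?DT) * indicator {j} i) \<partial>?DX)"
    by (intro nn_integral_cong) (simp add: indicator_def if_distrib[of "(*) _"] sum.delta cong: if_cong)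
  also have "\<dots> = (\<Sum>j\<in>UNIV. (\<integral>\<^sup>+s. G (j, s) \<partial>?DT) * emeasure ?DX {j})"
    by (subst nn_integral_sum) (auto simp: nn_integral_cmult_indicator)
  also have "\<dots> = (\<Sum>i\<in>UNIV. ennreal (\<pi> $ i) * (\<integral>\<^sup>+s. G (i, s) \<partial>exp_law \<epsilon>))"
  proof (rule sum.cong[OF refl])
    fix j
    have "prob (X k -` {j} \<inter> space \<Omega>) = \<pi> $ j"
      using X_finite_rectangle_law[of "{k}" "\<lambda>_. {j}"] by (simp add: vimage_def Int_def conj_commute)
    then show "(\<integral>\<^sup>+s. G (j, s) \<partial>?DT) * emeasure ?DX {j} = ennreal (\<pi> $ j) * (\<integral>\<^sup>+s. G (j, s) \<partial>exp_law \<epsilon>)"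
      by (simp add: emeasure_distr emeasure_eq_measure T_distr mult.commute)
  qed
  finally show ?thesis .
qed

text \<open>Conditioning on the past: the next jump can be integrated out first.\<close>

lemma nn_integral_history:
  assumes [measurable]: "F \<in> borel_measurable (PiM {..<n} (\<lambda>_. jump_space) \<Otimes>\<^sub>M jump_space)"
  shows "(\<integral>\<^sup>+\<omega>. F (restrict (\<lambda>k. \<zeta> k \<omega>) {..<n}, \<zeta> n \<omega>) \<partial>\<Omega>)
    = (\<integral>\<^sup>+\<omega>. (\<Sum>i\<in>UNIV. ennreal (\<pi> $ i) * (\<integral>\<^sup>+s. F (restrict (\<lambda>k. \<zeta> k \<omega>) {..<n}, (i, s)) \<partial>exp_law \<epsilon>)) \<partial>\<Omega>)"
proof -
  let ?N = "PiM {..<n} (\<lambda>_. jump_space)" and ?h = "\<lambda>\<omega>. restrict (\<lambda>k. \<zeta> k \<omega>) {..<n}"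
  let ?L = "PiM {n} (\<lambda>_. jump_space)" and ?l = "\<lambda>\<omega>. restrict (\<lambda>k. \<zeta> k \<omega>) {n}"
  have ind: "indep_var ?N ?h ?L ?l"
    by (rule indep_var_restrict[OF indep_jumps]) auto
  have rv[measurable]: "?h \<in> measurable \<Omega> ?N" "?l \<in> measurable \<Omega> ?L"
    using ind by (auto dest: indep_var_rv1 indep_var_rv2)
  let ?D = "distr \<Omega> ?L ?l"
  interpret D: prob_space ?D by (rule prob_space_distr) measurable
  have [measurable]: "(\<lambda>z. F (fst z, snd z n)) \<in> borel_measurable (?N \<Otimes>\<^sub>M ?L)" by measurable
  have "(\<integral>\<^sup>+\<omega>. F (?h \<omega>, \<zeta> n \<omega>) \<partial>\<Omega>) = (\<integral>\<^sup>+z. F (fst z, snd z n) \<partial>distr \<Omega> (?N \<Otimes>\<^sub>M ?L) (\<lambda>\<omega>. (?h \<omega>, ?l \<omega>)))"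
    by (subst nn_integral_distr) auto
  also have "distr \<Omega> (?N \<Otimes>\<^sub>M ?L) (\<lambda>\<omega>. (?h \<omega>, ?l \<omega>)) = distr \<Omega> ?N ?h \<Otimes>\<^sub>M ?D"
    using ind by (simp add: indep_var_distribution_eq)
  also have "(\<integral>\<^sup>+z. F (fst z, snd z n) \<partial>(distr \<Omega> ?N ?h \<Otimes>\<^sub>M ?D)) = (\<integral>\<^sup>+h. \<integral>\<^sup>+f. F (h, f n) \<partial>?D \<partial>distr \<Omega> ?N ?h)"
  proof (subst D.nn_integral_fst[symmetric])
    have "sets (distr \<Omega> ?N ?h \<Otimes>\<^sub>M ?D) = sets (?N \<Otimes>\<^sub>M ?L)" by (intro sets_pair_measure_cong) simp_all
    then show "(\<lambda>z. F (fst z, snd z n)) \<in> borel_measurable (distr \<Omega> ?N ?h \<Otimes>\<^sub>M ?D)"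
      by (simp cong: measurable_cong_sets)
  qed simp
  also have "\<dots> = (\<integral>\<^sup>+h. \<integral>\<^sup>+\<omega>'. F (h, \<zeta> n \<omega>') \<partial>\<Omega> \<partial>distr \<Omega> ?N ?h)"
    by (intro nn_integral_cong, subst nn_integral_distr) auto
  also have "\<dots> = (\<integral>\<^sup>+\<omega>. \<integral>\<^sup>+\<omega>'. F (?h \<omega>, \<zeta> n \<omega>') \<partial>\<Omega> \<partial>\<Omega>)"
    by (subst nn_integral_distr) auto
  also have "\<dots> = (\<integral>\<^sup>+\<omega>. \<integral>\<^sup>+z. F (?h \<omega>, z) \<partial>distr \<Omega> jump_space (\<zeta> n) \<partial>\<Omega>)"
  proof (rule nn_integral_cong)
    fix \<omega> assume "\<omega> \<in> space \<Omega>"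
    then have [measurable]: "?h \<omega> \<in> space ?N" by (rule measurable_space[OF rv(1)])
    show "(\<integral>\<^sup>+\<omega>'. F (?h \<omega>, \<zeta> n \<omega>') \<partial>\<Omega>) = (\<integral>\<^sup>+z. F (?h \<omega>, z) \<partial>distr \<Omega> jump_space (\<zeta> n))"
      by (subst nn_integral_distr) auto
  qed
  also have "\<dots> = (\<integral>\<^sup>+\<omega>. (\<Sum>i\<in>UNIV. ennreal (\<pi> $ i) * (\<integral>\<^sup>+s. F (?h \<omega>, (i, s)) \<partial>exp_law \<epsilon>)) \<partial>\<Omega>)"
  proof (rule nn_integral_cong)
    fix \<omega> assume "\<omega> \<in> space \<Omega>"
    then have "?h \<omega> \<in> space ?N" by (rule measurable_space[OF rv(1)])
    then show "(\<integral>\<^sup>+z. F (?h \<omega>, z) \<partial>distr \<Omega> jump_space (\<zeta> n)) = (\<Sum>i\<in>UNIV. ennreal (\<pi> $ i) * (\<integral>\<^sup>+s. F (?h \<omega>, (i, s)) \<partial>exp_law \<epsilon>))"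
      by (intro nn_integral_jump) measurable
  qed
  finally show ?thesis .
qed

end

section \<open>The chain at the jump times\<close>

context switched_process
begin

text \<open>The chain as a function of the list of jumps, so that independence of past and future can be used.\<close>

primrec path :: "'a \<Rightarrow> nat \<Rightarrow> (nat \<Rightarrow> 'n \<times> real) \<Rightarrow> 'a" where
  "path x 0 z = x"
| "path x (Suc k) z = app (expm (snd (z k)) (A (fst (z k)))) (path x k z)"

definition Y :: "'a \<Rightarrow> nat \<Rightarrow> 'w \<Rightarrow> 'a" where
  "Y x k \<omega> = path x k (\<lambda>j. \<zeta> j \<omega>)"

lemma Y_0 [simp]: "Y x 0 \<omega> = x"
  and Y_Suc: "Y x (Suc k) \<omega> = app (expm (T k \<omega>) (A (X k \<omega>))) (Y x k \<omega>)"
  by (simp_all add: Y_def)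

lemma path_restrict: "k \<le> n \<Longrightarrow> path x k (restrict z {..<n}) = path x k z"
  by (induction k) auto

lemma Y_history: "k \<le> n \<Longrightarrow> Y x k \<omega> = path x k (restrict (\<lambda>j. \<zeta> j \<omega>) {..<n})"
  unfolding Y_def by (rule path_restrict[symmetric])

lemma flow_step_measurable:
  assumes [measurable]: "f \<in> N \<rightarrow>\<^sub>M count_space UNIV" "g \<in> borel_measurable N" "h \<in> borel_measurable N"
  shows "(\<lambda>w. app (expm (g w) (A (f w))) (h w)) \<in> borel_measurable N"
proof (rule measurable_compose_countable'[where f = "\<lambda>i w. app (expm (g w) (A i)) (h w)" and g = f and I = UNIV])
  fix i
  have "(\<lambda>w. (case (h w, g w) of (x, s) \<Rightarrow> app (expm s (A i)) x)) \<in> borel_measurable N"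
    by (rule measurable_compose[OF _ flow_measurable[of "A i"]]) measurable
  then show "(\<lambda>w. app (expm (g w) (A i)) (h w)) \<in> borel_measurable N" by simp
qed (auto intro: countable_finite)

lemma path_measurable: "k \<le> n \<Longrightarrow> path x k \<in> borel_measurable (PiM {..<n} (\<lambda>_. jump_space))"
proof (induction k)
  case (Suc k)
  have [measurable]: "(\<lambda>z. z k) \<in> PiM {..<n} (\<lambda>_. jump_space) \<rightarrow>\<^sub>M jump_space"
    using Suc.prems by (intro measurable_component_singleton) auto
  have [measurable]: "path x k \<in> borel_measurable (PiM {..<n} (\<lambda>_. jump_space))" using Suc by simp
  show ?case unfolding path.simps(2)[abs_def] by (rule flow_step_measurable) measurable
next
  case 0
  have "path x 0 = (\<lambda>_. x)" by auto
  then show ?case by simp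
qed

lemma Y_measurable [measurable]: "Y x k \<in> borel_measurable \<Omega>"
proof (induction k)
  case (Suc k)
  note [measurable] = Suc
  show ?case unfolding Y_Suc[abs_def] by (rule flow_step_measurable) measurable
qed (simp add: Y_def[abs_def])

lemma K_pair_measurable:
  assumes [measurable]: "G \<in> borel_measurable (borel \<Otimes>\<^sub>M borel)"
  shows "(\<lambda>w. K \<epsilon> (\<lambda>y'. G (fst w, y')) (snd w)) \<in> borel_measurable (borel \<Otimes>\<^sub>M borel)"
proof -
  interpret jump_time: prob_space "exp_law \<epsilon>" by (rule prob_space_exp_law[OF \<epsilon>_pos])
  have "(\<lambda>(w, s). G (fst w, app (expm s (A i)) (snd w))) \<in> borel_measurable ((borel \<Otimes>\<^sub>M borel) \<Otimes>\<^sub>M exp_law \<epsilon>)" for i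
  proof -
    have [measurable]: "(\<lambda>v. app (expm (snd v) (A i)) (snd (fst v))) \<in> borel_measurable ((borel \<Otimes>\<^sub>M borel) \<Otimes>\<^sub>M exp_law \<epsilon>)"
    proof -
      have "(\<lambda>v. (case (snd (fst v), snd v) of (x, s) \<Rightarrow> app (expm s (A i)) x)) \<in> borel_measurable ((borel \<Otimes>\<^sub>M borel) \<Otimes>\<^sub>M exp_law \<epsilon>)"
        by (rule measurable_compose[OF _ flow_measurable[of "A i"]]) measurable
      then show ?thesis by simp
    qed
    show ?thesis unfolding case_prod_beta by measurable
  qed
  then show ?thesis unfolding K_def by measurable
qed

text \<open>The value \<open>Y x j \<omega>\<close> is carried along because growth over a block compares two times.\<close>

lemma chain_step:
  assumes G[measurable]: "G \<in> borel_measurable (borel \<Otimes>\<^sub>M borel)" and j: "j \<le> n"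
  shows "(\<integral>\<^sup>+\<omega>. G (Y x j \<omega>, Y x (Suc n) \<omega>) \<partial>\<Omega>) = (\<integral>\<^sup>+\<omega>. K \<epsilon> (\<lambda>y'. G (Y x j \<omega>, y')) (Y x n \<omega>) \<partial>\<Omega>)"
proof -
  define F where "F = (\<lambda>w. G (path x j (fst w), app (expm (snd (snd w)) (A (fst (snd w)))) (path x n (fst w))))"
  let ?N = "PiM {..<n} (\<lambda>_. jump_space)"
  have [measurable]: "path x j \<in> borel_measurable ?N" "path x n \<in> borel_measurable ?N"
    using path_measurable j by auto
  have [measurable]: "(\<lambda>w. app (expm (snd (snd w)) (A (fst (snd w)))) (path x n (fst w))) \<in> borel_measurable (?N \<Otimes>\<^sub>M jump_space)"
    by (rule flow_step_measurable) measurable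
  have "F \<in> borel_measurable (?N \<Otimes>\<^sub>M jump_space)" unfolding F_def by measurable
  from nn_integral_history[OF this] show ?thesis
    unfolding F_def by (simp add: Y_history[of _ n] j K_def Y_Suc del: path.simps)
qed

lemma chain:
  assumes [measurable]: "G \<in> borel_measurable (borel \<Otimes>\<^sub>M borel)"
  shows "(\<integral>\<^sup>+\<omega>. G (Y x n \<omega>, Y x (n + m) \<omega>) \<partial>\<Omega>) = (\<integral>\<^sup>+\<omega>. E \<epsilon> m (\<lambda>y'. G (Y x n \<omega>, y')) (Y x n \<omega>) \<partial>\<Omega>)"
  using assms
proof (induction m arbitrary: G)
  case (Suc m)
  have "(\<integral>\<^sup>+\<omega>. G (Y x n \<omega>, Y x (n + Suc m) \<omega>) \<partial>\<Omega>)
      = (\<integral>\<^sup>+\<omega>. K \<epsilon> (\<lambda>y'. G (Y x n \<omega>, y')) (Y x (n + m) \<omega>) \<partial>\<Omega>)"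
    using chain_step[OF Suc.prems, of n "n + m" x] by simp
  also have "\<dots> = (\<integral>\<^sup>+\<omega>. (\<lambda>w. K \<epsilon> (\<lambda>y'. G (fst w, y')) (snd w)) (Y x n \<omega>, Y x (n + m) \<omega>) \<partial>\<Omega>)" by simp
  also have "\<dots> = (\<integral>\<^sup>+\<omega>. E \<epsilon> m (\<lambda>y'. K \<epsilon> (\<lambda>y''. G (Y x n \<omega>, y'')) y') (Y x n \<omega>) \<partial>\<Omega>)"
    using Suc.IH[OF K_pair_measurable[OF Suc.prems]] by simp
  finally show ?case by (simp only: E_Suc)
qed simp

lemma expectation_Y:
  assumes [measurable]: "f \<in> borel_measurable borel"
  shows "(\<integral>\<^sup>+\<omega>. f (Y x n \<omega>) \<partial>\<Omega>) = E \<epsilon> n f x"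
  using chain[of "\<lambda>w. f (snd w)" x 0 n] by (simp add: emeasure_space_1)

lemma E_pair_measurable:
  assumes "G \<in> borel_measurable (borel \<Otimes>\<^sub>M borel)"
  shows "(\<lambda>w. E \<epsilon> m (\<lambda>y'. G (fst w, y')) (snd w)) \<in> borel_measurable (borel \<Otimes>\<^sub>M borel)"
  using assms
proof (induction m arbitrary: G)
  case 0 then show ?case by simp
next
  case (Suc m)
  show ?case unfolding E_Suc using Suc.IH[OF K_pair_measurable[OF Suc.prems]] by simp
qed

lemma expectation_Y_block:
  assumes G[measurable]: "G \<in> borel_measurable (borel \<Otimes>\<^sub>M borel)"
  shows "(\<integral>\<^sup>+\<omega>. G (Y x n \<omega>, Y x (n + m) \<omega>) \<partial>\<Omega>) = E \<epsilon> n (\<lambda>y. E \<epsilon> m (\<lambda>y'. G (y, y')) y) x"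
proof -
  have "(\<lambda>y. E \<epsilon> m (\<lambda>y'. G (y, y')) y) \<in> borel_measurable borel"
    using measurable_compose[OF _ E_pair_measurable[OF G, of m], of "\<lambda>y. (y, y)" borel] by simp
  from expectation_Y[OF this, of x n] show ?thesis unfolding chain[OF G] by simp
qed

definition time :: "nat \<Rightarrow> 'w \<Rightarrow> real" where "time n \<omega> = (\<Sum>k<n. T k \<omega>)"

lemma time_measurable [measurable]: "time n \<in> borel_measurable \<Omega>"
  unfolding time_def[abs_def] by measurable

lemma AE_T_nonneg: "AE \<omega> in \<Omega>. \<forall>k. 0 \<le> T k \<omega>"
proof (subst AE_all_countable, rule allI)
  fix k
  have "AE s in distr \<Omega> borel (T k). 0 \<le> s" unfolding T_distr by (rule AE_exp_law_nonneg)
  then show "AE \<omega> in \<Omega>. 0 \<le> T k \<omega>" by (subst (asm) AE_distr_iff) auto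
qed

lemma sum_T_erlang:
  assumes "finite I" "I \<noteq> {}"
  shows "distributed \<Omega> lborel (\<lambda>\<omega>. \<Sum>i\<in>I. T i \<omega>) (erlang_density (card I - 1) \<mu>)"
  by (rule exponential_distributed_sum[OF assms rate_pos T_exponential]) (rule indep_vars_subset[OF T_indep], simp)

lemma sum_T_square:
  assumes I: "finite I" "card I = m" "0 < m"
  shows "integrable \<Omega> (\<lambda>\<omega>. (\<Sum>i\<in>I. T i \<omega>)^2)" "expectation (\<lambda>\<omega>. (\<Sum>i\<in>I. T i \<omega>)^2) \<le> 2 * (real m * \<epsilon>)^2"
proof -
  have D: "distributed \<Omega> lborel (\<lambda>\<omega>. \<Sum>i\<in>I. T i \<omega>) (erlang_density (m - 1) \<mu>)"
  proof -
    have "I \<noteq> {}" using I by auto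
    from sum_T_erlang[OF I(1) this] show ?thesis using I by simp
  qed
  show "integrable \<Omega> (\<lambda>\<omega>. (\<Sum>i\<in>I. T i \<omega>)^2)" by (rule erlang_ith_moment_integrable[OF rate_pos D])
  have "expectation (\<lambda>\<omega>. (\<Sum>i\<in>I. T i \<omega>)^2) = fact (m - 1 + 2) / (fact (m - 1) * \<mu>^2)"
    by (rule erlang_ith_moment[OF rate_pos D])
  also have "fact (m - 1 + 2) = (fact (m - 1) * (real m * (real m + 1)) :: real)"
  proof -
    obtain l where l: "m = Suc l" using I by (cases m) auto
    show ?thesis by (simp add: l algebra_simps)
  qed
  also have "fact (m - 1) * (real m * (real m + 1)) / (fact (m - 1) * \<mu>^2) = real m * (real m + 1) * \<epsilon>^2"
    by (simp add: \<epsilon>_def power_divide)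
  also have "\<dots> \<le> real m * (real m + real m) * \<epsilon>^2"
    using I by (intro mult_right_mono mult_left_mono) auto
  finally show "expectation (\<lambda>\<omega>. (\<Sum>i\<in>I. T i \<omega>)^2) \<le> 2 * (real m * \<epsilon>)^2"
    by (simp add: power2_eq_square algebra_simps)
qed

lemma time_integrable: "integrable \<Omega> (time n)"
proof -
  have "integrable \<Omega> (T k)" for k
    using erlang_ith_moment_integrable[OF rate_pos T_exponential, of k 1] by simp
  then show ?thesis unfolding time_def[abs_def] by (intro Bochner_Integration.integrable_sum)
qed

text \<open>The mean deviation is at most the standard deviation; arithmetic and geometric means replace the
  Cauchy-Schwarz inequality.\<close>

lemma time_deviation: "expectation (\<lambda>\<omega>. \<bar>time n \<omega> - real n * \<epsilon>\<bar>) \<le> sqrt (real n) * \<epsilon>"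
proof (cases "n = 0")
  case True then show ?thesis by (simp add: time_def)
next
  case False
  have D: "distributed \<Omega> lborel (time n) (erlang_density (n - 1) \<mu>)"
    unfolding time_def[abs_def] using sum_T_erlang[of "{..<n}"] False by auto
  have mean: "expectation (time n) = real n * \<epsilon>"
    using erlang_ith_moment[OF rate_pos D, of 1] False by (cases n) (auto simp: \<epsilon>_def)
  have var: "variance (time n) = real n * \<epsilon>^2"
    using erlang_distributed_variance[OF rate_pos D] False by (cases n) (auto simp: \<epsilon>_def power_divide)
  have int2: "integrable \<Omega> (\<lambda>\<omega>. (time n \<omega>)^2)" by (rule erlang_ith_moment_integrable[OF rate_pos D])
  let ?Z = "\<lambda>\<omega>. time n \<omega> - real n * \<epsilon>"
  define c where "c = sqrt (real n) * \<epsilon>"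
  have c: "0 < c" "c^2 = real n * \<epsilon>^2" using False \<epsilon>_pos by (auto simp: c_def power_mult_distrib)
  have intZ2: "integrable \<Omega> (\<lambda>\<omega>. (?Z \<omega>)^2)"
    unfolding power2_diff using int2 time_integrable[of n] by auto
  have "expectation (\<lambda>\<omega>. \<bar>?Z \<omega>\<bar>) \<le> expectation (\<lambda>\<omega>. c / 2 + (?Z \<omega>)^2 / (2 * c))"
  proof (rule integral_mono)
    show "integrable \<Omega> (\<lambda>\<omega>. \<bar>?Z \<omega>\<bar>)" using time_integrable[of n] by auto
    show "integrable \<Omega> (\<lambda>\<omega>. c / 2 + (?Z \<omega>)^2 / (2 * c))" using intZ2 by auto
    fix \<omega>
    have "2 * (c * \<bar>?Z \<omega>\<bar>) \<le> c^2 + (?Z \<omega>)^2" using sum_squares_bound[of c "\<bar>?Z \<omega>\<bar>"] by simp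
    then have "2 * (c * \<bar>?Z \<omega>\<bar>) / (2 * c) \<le> (c^2 + (?Z \<omega>)^2) / (2 * c)" using c by (intro divide_right_mono) auto
    then show "\<bar>?Z \<omega>\<bar> \<le> c / 2 + (?Z \<omega>)^2 / (2 * c)" using c(1) by (simp add: add_divide_distrib power2_eq_square)
  qed
  also have "\<dots> = c / 2 + expectation (\<lambda>\<omega>. (?Z \<omega>)^2) / (2 * c)"
    using intZ2 by (simp add: prob_space)
  also have "expectation (\<lambda>\<omega>. (?Z \<omega>)^2) = c^2" using var c unfolding mean by simp
  also have "c / 2 + c^2 / (2 * c) = c" using c(1) by (simp add: power2_eq_square)
  finally show ?thesis by (simp add: c_def)
qed

lemma Y_lower:
  assumes "\<forall>k. 0 \<le> T k \<omega>"
  shows "exp (- a * (\<Sum>k\<in>{n..<n+m}. T k \<omega>)) * norm (Y x n \<omega>) \<le> norm (Y x (n + m) \<omega>)"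
proof (induction m)
  case (Suc m)
  have "exp (- a * (\<Sum>k\<in>{n..<n+Suc m}. T k \<omega>)) * norm (Y x n \<omega>)
     = exp (- a * T (n + m) \<omega>) * (exp (- a * (\<Sum>k\<in>{n..<n+m}. T k \<omega>)) * norm (Y x n \<omega>))"
  proof -
    have s: "- a * (\<Sum>k\<in>{n..<n+Suc m}. T k \<omega>) = - a * T (n + m) \<omega> + - a * (\<Sum>k\<in>{n..<n+m}. T k \<omega>)"
      by (simp add: algebra_simps)
    show ?thesis unfolding s exp_add by simp
  qed
  also have "\<dots> \<le> exp (- a * T (n + m) \<omega>) * norm (Y x (n + m) \<omega>)" by (intro mult_left_mono Suc) auto
  also have "\<dots> \<le> exp (- \<bar>T (n + m) \<omega>\<bar> * norm (A (X (n + m) \<omega>))) * norm (Y x (n + m) \<omega>)"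
    using mult_left_mono[OF norm_A[of "X (n + m) \<omega>"], of "T (n + m) \<omega>"] assms by (intro mult_right_mono) (auto simp: mult.commute)
  also have "\<dots> \<le> norm (Y x (n + Suc m) \<omega>)"
    using norm_expm_app_lower[of "T (n + m) \<omega>" "A (X (n + m) \<omega>)" "Y x (n + m) \<omega>"] by (simp add: Y_Suc)
  finally show ?case .
qed simp

lemma Y_upper:
  assumes "\<forall>k. 0 \<le> T k \<omega>"
  shows "norm (Y x n \<omega>) \<le> exp (a * time n \<omega>) * norm x"
proof (induction n)
  case (Suc n)
  have "norm (Y x (Suc n) \<omega>) \<le> exp (\<bar>T n \<omega>\<bar> * norm (A (X n \<omega>))) * norm (Y x n \<omega>)"
    unfolding Y_Suc by (rule norm_expm_app)
  also have "\<dots> \<le> exp (a * T n \<omega>) * norm (Y x n \<omega>)"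
    using mult_left_mono[OF norm_A[of "X n \<omega>"], of "T n \<omega>"] assms by (intro mult_right_mono) (auto simp: mult.commute)
  also have "\<dots> \<le> exp (a * T n \<omega>) * (exp (a * time n \<omega>) * norm x)" by (intro mult_left_mono Suc) auto
  finally show ?case by (simp add: time_def algebra_simps exp_add)
qed (simp add: time_def)

lemma Y_nonzero: "x \<noteq> 0 \<Longrightarrow> Y x n \<omega> \<noteq> 0"
proof (induction n)
  case (Suc n)
  then have "0 < exp (- \<bar>T n \<omega>\<bar> * norm (A (X n \<omega>))) * norm (Y x n \<omega>)" by simp
  then show ?case unfolding Y_Suc using norm_expm_app_lower[of "T n \<omega>" "A (X n \<omega>)" "Y x n \<omega>"] by auto
qed simp

lemma ln_Y_integrable:
  assumes x: "x \<noteq> 0" shows "integrable \<Omega> (\<lambda>\<omega>. ln (norm (Y x n \<omega>)))"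
proof (rule Bochner_Integration.integrable_bound)
  show "integrable \<Omega> (\<lambda>\<omega>. \<bar>ln (norm x)\<bar> + a * time n \<omega>)" using time_integrable by auto
  show "AE \<omega> in \<Omega>. norm (ln (norm (Y x n \<omega>))) \<le> norm (\<bar>ln (norm x)\<bar> + a * time n \<omega>)"
    using AE_T_nonneg
  proof eventually_elim
    case (elim \<omega>)
    have nx: "0 < norm x" "0 < norm (Y x n \<omega>)" using x Y_nonzero[OF x] by auto
    have "ln (norm (Y x n \<omega>)) \<le> ln (exp (a * time n \<omega>) * norm x)" using Y_upper[OF elim, of x n] nx by (subst ln_le_cancel_iff) auto
    moreover have "ln (exp (- a * time n \<omega>) * norm x) \<le> ln (norm (Y x n \<omega>))"
      using Y_lower[OF elim, of 0 n x] nx by (subst ln_le_cancel_iff) (auto simp: time_def atLeast0LessThan)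
    moreover have "0 \<le> time n \<omega>" unfolding time_def using elim by (intro sum_nonneg) auto
    ultimately show ?case using nx a_ge by (auto simp: ln_mult)
  qed
qed measurable

text \<open>On a good block the logarithm grows by \<open>\<gamma> m \<epsilon>\<close>. On a bad one it loses at most \<open>v\<close>, the deterministic
  rate \<open>a\<close> times the duration of the block, and \<open>v\<close> on an event of probability \<open>\<eta>\<^sup>2\<close> has mean of order \<open>\<eta>\<close>.
  The first \<open>b0\<close> blocks, for which no estimate is available, cost a constant.\<close>

lemma expected_log_lower:
  assumes x: "x \<noteq> 0" and m: "0 < m" and \<eta>: "0 < \<eta>"
    and rare: "\<And>b x. b0 \<le> b \<Longrightarrow> E \<epsilon> (b * m) (\<lambda>y. P \<epsilon> m {y'. norm y' < exp (\<gamma> * (real m * \<epsilon>)) * norm y} y) x \<le> ennreal (\<eta>^2)"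
  defines "V \<equiv> 2 * (\<gamma> * (real m * \<epsilon>))^2 + 4 * (a * (real m * \<epsilon>))^2 + 1"
  shows "ln (norm x) + real b * (\<gamma> * (real m * \<epsilon>)) - V * (real b0 + \<eta> * real b) \<le> expectation (\<lambda>\<omega>. ln (norm (Y x (b * m) \<omega>)))"
proof -
  define t where "t = real m * \<epsilon>"
  define bad where "bad = (\<lambda>b. {\<omega> \<in> space \<Omega>. norm (Y x (b * m + m) \<omega>) < exp (\<gamma> * t) * norm (Y x (b * m) \<omega>)})"
  have [measurable]: "bad b \<in> sets \<Omega>" for b unfolding bad_def by measurable
  define v where "v = (\<lambda>b \<omega>. \<bar>\<gamma> * t\<bar> + a * (\<Sum>k\<in>{b*m..<b*m+m}. T k \<omega>))"
  have V1: "1 \<le> V" by (simp add: V_def)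
  have v2: "integrable \<Omega> (\<lambda>\<omega>. (v b \<omega>)^2)" "expectation (\<lambda>\<omega>. (v b \<omega>)^2) \<le> V - 1 + 1" for b
  proof -
    let ?S = "\<lambda>\<omega>. \<Sum>k\<in>{b*m..<b*m+m}. T k \<omega>"
    note S = sum_T_square[of "{b*m..<b*m+m}" m, simplified, OF m]
    have intT: "integrable \<Omega> ?S"
    proof -
      have "integrable \<Omega> (T k)" for k
        using erlang_ith_moment_integrable[OF rate_pos T_exponential, of k 1] by simp
      then show ?thesis by (intro Bochner_Integration.integrable_sum)
    qed
    have e: "(v b \<omega>)^2 = (\<gamma> * t)^2 + 2 * \<bar>\<gamma> * t\<bar> * a * ?S \<omega> + a^2 * (?S \<omega>)^2" for \<omega>
      unfolding v_def by (simp add: power2_sum power_mult_distrib)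
    show "integrable \<Omega> (\<lambda>\<omega>. (v b \<omega>)^2)" unfolding e using S(1) intT by auto
    have "expectation (\<lambda>\<omega>. (v b \<omega>)^2) \<le> expectation (\<lambda>\<omega>. 2 * (\<gamma> * t)^2 + 2 * a^2 * (?S \<omega>)^2)"
    proof (rule integral_mono)
      show "integrable \<Omega> (\<lambda>\<omega>. (v b \<omega>)^2)" by fact
      show "integrable \<Omega> (\<lambda>\<omega>. 2 * (\<gamma> * t)^2 + 2 * a^2 * (?S \<omega>)^2)" using S(1) by auto
      show "(v b \<omega>)^2 \<le> 2 * (\<gamma> * t)^2 + 2 * a^2 * (?S \<omega>)^2" for \<omega>
        using power2_add_le[of "\<bar>\<gamma> * t\<bar>" "a * ?S \<omega>"] unfolding v_def by (simp add: power_mult_distrib)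
    qed
    also have "\<dots> = 2 * (\<gamma> * t)^2 + 2 * a^2 * expectation (\<lambda>\<omega>. (?S \<omega>)^2)"
      using S(1) by (simp add: prob_space)
    also have "\<dots> \<le> 2 * (\<gamma> * t)^2 + 2 * a^2 * (2 * t^2)"
      using S(2) by (intro add_left_mono mult_left_mono) (auto simp: t_def)
    finally show "expectation (\<lambda>\<omega>. (v b \<omega>)^2) \<le> V - 1 + 1" by (simp add: V_def t_def power_mult_distrib)
  qed
  have pbad: "prob (bad b) \<le> \<eta>^2" if "b0 \<le> b" for b
  proof -
    let ?G = "\<lambda>w. indicator {w :: 'a \<times> 'a. norm (snd w) < exp (\<gamma> * t) * norm (fst w)} w :: ennreal"
    have G: "?G \<in> borel_measurable (borel \<Otimes>\<^sub>M borel)" by measurable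
    have "emeasure \<Omega> (bad b) = (\<integral>\<^sup>+\<omega>. indicator (bad b) \<omega> \<partial>\<Omega>)" by simp
    also have "\<dots> = (\<integral>\<^sup>+\<omega>. ?G (Y x (b * m) \<omega>, Y x (b * m + m) \<omega>) \<partial>\<Omega>)"
      by (intro nn_integral_cong) (auto simp: bad_def indicator_def)
    also have "\<dots> = E \<epsilon> (b * m) (\<lambda>y. E \<epsilon> m (\<lambda>y'. ?G (y, y')) y) x" by (rule expectation_Y_block[OF G])
    also have "(\<lambda>y. E \<epsilon> m (\<lambda>y'. ?G (y, y')) y) = (\<lambda>y. P \<epsilon> m {y'. norm y' < exp (\<gamma> * t) * norm y} y)"
      by (simp add: indicator_def[abs_def])
    also have "E \<epsilon> (b * m) \<dots> x \<le> ennreal (\<eta>^2)" using rare[OF that] by (simp add: t_def)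
    finally show ?thesis by (simp add: emeasure_eq_measure ennreal_le_iff)
  qed
  define loss where "loss = (\<lambda>b. if b < b0 then V else \<eta> * V)"
  have step: "expectation (\<lambda>\<omega>. ln (norm (Y x (b * m) \<omega>))) + \<gamma> * t - loss b \<le> expectation (\<lambda>\<omega>. ln (norm (Y x (Suc b * m) \<omega>)))" for b
  proof -
    \<comment> \<open>The weight in \<open>v I \<le> c / 2 v\<^sup>2 + I / (2 c)\<close> for the indicator \<open>I\<close> of the bad event: its optimal value is
        the square root of the probability.\<close>
    define c where "c = (if b < b0 then 1 else \<eta>)"
    have c: "0 < c" using \<eta> by (simp add: c_def)
    have "expectation (\<lambda>\<omega>. ln (norm (Y x (b * m) \<omega>)) + \<gamma> * t - (c / 2 * (v b \<omega>)^2 + 1 / (2 * c) * indicator (bad b) \<omega>))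
       \<le> expectation (\<lambda>\<omega>. ln (norm (Y x (Suc b * m) \<omega>)))"
    proof (rule integral_mono_AE)
      show "integrable \<Omega> (\<lambda>\<omega>. ln (norm (Y x (b * m) \<omega>)) + \<gamma> * t - (c / 2 * (v b \<omega>)^2 + 1 / (2 * c) * indicator (bad b) \<omega>))"
        using ln_Y_integrable[OF x] v2(1) by (auto simp: emeasure_eq_measure)
      show "integrable \<Omega> (\<lambda>\<omega>. ln (norm (Y x (Suc b * m) \<omega>)))" by (rule ln_Y_integrable[OF x])
      show "AE \<omega> in \<Omega>. ln (norm (Y x (b * m) \<omega>)) + \<gamma> * t - (c / 2 * (v b \<omega>)^2 + 1 / (2 * c) * indicator (bad b) \<omega>)
          \<le> ln (norm (Y x (Suc b * m) \<omega>))"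
        using AE_T_nonneg AE_space
      proof eventually_elim
        case (elim \<omega>)
        have ny: "0 < norm (Y x (b * m) \<omega>)" "0 < norm (Y x (b * m + m) \<omega>)" using Y_nonzero[OF x] by auto
        have S: "Suc b * m = b * m + m" by simp
        have c2: "0 \<le> c / 2 * (v b \<omega>)^2" using c by simp
        show ?case
        proof (cases "\<omega> \<in> bad b")
          case False
          then have "exp (\<gamma> * t) * norm (Y x (b * m) \<omega>) \<le> norm (Y x (b * m + m) \<omega>)" using elim by (auto simp: bad_def)
          then have "ln (exp (\<gamma> * t) * norm (Y x (b * m) \<omega>)) \<le> ln (norm (Y x (b * m + m) \<omega>))"
            using ny by (subst ln_le_cancel_iff) auto
          then show ?thesis using False ny c2 unfolding S by (simp add: ln_mult)
        next
          case True
          let ?S = "\<Sum>k\<in>{b*m..<b*m+m}. T k \<omega>"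
          have "ln (exp (- a * ?S) * norm (Y x (b * m) \<omega>)) \<le> ln (norm (Y x (b * m + m) \<omega>))"
            using Y_lower[OF elim(1), of "b * m" m x] ny by (subst ln_le_cancel_iff) auto
          then have 1: "ln (norm (Y x (b * m) \<omega>)) - a * ?S \<le> ln (norm (Y x (b * m + m) \<omega>))"
            using ny by (simp add: ln_mult)
          have "2 * (c * v b \<omega> * 1) \<le> (c * v b \<omega>)^2 + 1" using sum_squares_bound[of "c * v b \<omega>" 1] by simp
          then have "2 * (c * v b \<omega>) / (2 * c) \<le> ((c * v b \<omega>)^2 + 1) / (2 * c)" using c by (intro divide_right_mono) auto
          then have "v b \<omega> \<le> c / 2 * (v b \<omega>)^2 + 1 / (2 * c)"
            using c by (simp add: add_divide_distrib power2_eq_square mult_ac)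
          then show ?thesis using 1 True unfolding S v_def by simp
        qed
      qed
    qed
    also have "expectation (\<lambda>\<omega>. ln (norm (Y x (b * m) \<omega>)) + \<gamma> * t - (c / 2 * (v b \<omega>)^2 + 1 / (2 * c) * indicator (bad b) \<omega>))
      = expectation (\<lambda>\<omega>. ln (norm (Y x (b * m) \<omega>))) + \<gamma> * t - (c / 2 * expectation (\<lambda>\<omega>. (v b \<omega>)^2) + 1 / (2 * c) * prob (bad b))"
      using ln_Y_integrable[OF x, of "b * m"] v2(1)[of b] by (simp add: prob_space emeasure_eq_measure)
    finally have main: "expectation (\<lambda>\<omega>. ln (norm (Y x (b * m) \<omega>))) + \<gamma> * t - (c / 2 * expectation (\<lambda>\<omega>. (v b \<omega>)^2) + 1 / (2 * c) * prob (bad b))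
      \<le> expectation (\<lambda>\<omega>. ln (norm (Y x (Suc b * m) \<omega>)))" .
    have "c / 2 * expectation (\<lambda>\<omega>. (v b \<omega>)^2) \<le> c / 2 * V" using v2(2)[of b] c by (intro mult_left_mono) auto
    moreover have "1 / (2 * c) * prob (bad b) \<le> c / 2"
    proof (cases "b < b0")
      case True then show ?thesis by (simp add: c_def)
    next
      case False
      have "1 / (2 * c) * prob (bad b) \<le> 1 / (2 * c) * c^2" using pbad[of b] False c by (intro mult_left_mono) (auto simp: c_def)
      then show ?thesis using c by (simp add: power2_eq_square)
    qed
    moreover have "c / 2 * V + c / 2 \<le> loss b"
    proof -
      have "c / 2 * 1 \<le> c / 2 * V" using V1 c by (intro mult_left_mono) auto
      then have "c / 2 * V + c / 2 \<le> c * V" by (simp add: algebra_simps)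
      then show ?thesis by (simp add: loss_def c_def split: if_splits)
    qed
    ultimately show ?thesis using main by linarith
  qed
  have "ln (norm x) + real b * (\<gamma> * t) - (\<Sum>i<b. loss i) \<le> expectation (\<lambda>\<omega>. ln (norm (Y x (b * m) \<omega>)))"
  proof (induction b)
    case 0 then show ?case by (simp add: prob_space)
  next
    case (Suc b) then show ?case using step[of b] by (simp add: algebra_simps)
  qed
  moreover have "(\<Sum>i<b. loss i) \<le> V * (real b0 + \<eta> * real b)"
  proof -
    have "(\<Sum>i<b. loss i) \<le> (\<Sum>i<b. (if i < b0 then V else 0) + \<eta> * V)"
      using V1 \<eta> by (intro sum_mono) (auto simp: loss_def)
    also have "\<dots> = (\<Sum>i\<in>{..<b} \<inter> {..<b0}. V) + real b * (\<eta> * V)"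
      by (simp add: sum.distrib sum.If_cases lessThan_def Int_def)
    also have "(\<Sum>i\<in>{..<b} \<inter> {..<b0}. V) \<le> real b0 * V"
    proof -
      have "card ({..<b} \<inter> {..<b0}) \<le> card {..<b0}" by (intro card_mono) auto
      then show ?thesis using V1 by (simp add: mult_right_mono)
    qed
    finally show ?thesis by (simp add: algebra_simps)
  qed
  ultimately show ?thesis unfolding t_def by linarith
qed

end

section \<open>Linear equations with bounded coefficients\<close>

lemma continuous_on_atLeastI:
  fixes f :: "real \<Rightarrow> 'b::topological_space"
  assumes "\<And>b. c \<le> b \<Longrightarrow> continuous_on {c..b} f" shows "continuous_on {c..} f"
  unfolding continuous_on_def
proof
  fix t assume t: "t \<in> {c..}"
  have "(f \<longlongrightarrow> f t) (at t within {c..t + 1})" using assms[of "t + 1"] t by (auto simp: continuous_on_def)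
  moreover have "at t within {c..} = at t within {c..t + 1}"
    by (rule at_within_nhd[of t "{..<t + 1}"]) auto
  ultimately show "(f \<longlongrightarrow> f t) (at t within {c..})" by simp
qed

lemma has_integral_exp_weight:
  fixes a c :: real
  assumes "a > 0" "r \<le> s"
  shows "((\<lambda>u. a * exp (2 * a * (u - c))) has_integral (exp (2 * a * (s - c)) - exp (2 * a * (r - c))) / 2) {r..s}"
    and "((\<lambda>u. a * exp (2 * a * (c - u))) has_integral (exp (2 * a * (c - r)) - exp (2 * a * (c - s))) / 2) {r..s}"
proof -
  have "((\<lambda>u. a * exp (2 * a * (u - c))) has_integral (exp (2 * a * (s - c)) / 2 - exp (2 * a * (r - c)) / 2)) {r..s}"
    using assms by (intro fundamental_theorem_of_calculus)
      (auto intro!: derivative_eq_intros simp flip: has_real_derivative_iff_has_vector_derivative)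
  then show "((\<lambda>u. a * exp (2 * a * (u - c))) has_integral (exp (2 * a * (s - c)) - exp (2 * a * (r - c))) / 2) {r..s}"
    by (simp add: diff_divide_distrib)
  have "((\<lambda>u. a * exp (2 * a * (c - u))) has_integral (- exp (2 * a * (c - s)) / 2 - (- exp (2 * a * (c - r)) / 2))) {r..s}"
    using assms by (intro fundamental_theorem_of_calculus)
      (auto intro!: derivative_eq_intros simp flip: has_real_derivative_iff_has_vector_derivative)
  then show "((\<lambda>u. a * exp (2 * a * (c - u))) has_integral (exp (2 * a * (c - r)) - exp (2 * a * (c - s))) / 2) {r..s}"
    by (simp add: diff_divide_distrib)
qed

text \<open>Bounding the maximum of \<open>D\<close> in the norm with weight \<open>exp (-2 a (r - s))\<close>, or its mirror image
  for the second part, avoids derivatives: \<open>f\<close> need not be continuous, as it jumps with the state. The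
  integral operator has norm at most \<open>1/2\<close> in this norm, whence the constants \<open>2\<close>.\<close>

lemma gronwall:
  fixes D f :: "real \<Rightarrow> 'e::euclidean_space"
  assumes st: "s \<le> t" and cont: "continuous_on {s..t} D"
    and int: "\<And>r. r \<in> {s..t} \<Longrightarrow> (f has_integral (D r - D s)) {s..r}"
    and bound: "\<And>r. r \<in> {s..t} \<Longrightarrow> norm (f r) \<le> a * norm (D r)" and a: "a > 0"
  shows "norm (D t) \<le> 2 * exp (2 * a * (t - s)) * norm (D s)"
    and "norm (D s) \<le> 2 * exp (2 * a * (t - s)) * norm (D t)"
proof -
  have unweight: "exp (- x) * d \<le> m \<Longrightarrow> d \<le> m * exp x" for x d m :: real
    by (simp add: exp_minus field_simps)
  have fint: "f integrable_on {r..r'}" if "s \<le> r" "r \<le> r'" "r' \<le> t" for r r'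
  proof (rule integrable_on_subinterval)
    show "f integrable_on {s..t}" using has_integral_integrable[OF int[of t]] st by simp
    show "{r..r'} \<subseteq> {s..t}" using that by auto
  qed
  have inc: "D r' - D r = integral {r..r'} f" if "s \<le> r" "r \<le> r'" "r' \<le> t" for r r'
  proof -
    have "integral {s..r} f + integral {r..r'} f = integral {s..r'} f"
      using that by (intro Henstock_Kurzweil_Integration.integral_combine fint) auto
    moreover have "integral {s..r} f = D r - D s" "integral {s..r'} f = D r' - D s"
      using int[of r] int[of r'] that by (auto intro!: integral_unique)
    ultimately show ?thesis by (simp add: algebra_simps)
  qed
  show "norm (D t) \<le> 2 * exp (2 * a * (t - s)) * norm (D s)"
  proof -
    define g where "g = (\<lambda>r. exp (- (2 * a * (r - s))) * norm (D r))"
    have "continuous_on {s..t} g" unfolding g_def using cont by (intro continuous_intros)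
    then obtain r0 where r0: "r0 \<in> {s..t}" "\<And>r. r \<in> {s..t} \<Longrightarrow> g r \<le> g r0"
      using continuous_attains_sup[of "{s..t}" g] st by auto
    define m where "m = g r0"
    have Dm: "norm (D r) \<le> m * exp (2 * a * (r - s))" if "r \<in> {s..t}" for r
      using r0(2)[OF that] by (intro unweight) (simp add: m_def g_def)
    have "norm (D r0 - D s) \<le> m * ((exp (2 * a * (r0 - s)) - exp (2 * a * (s - s))) / 2)"
    proof -
      have hi: "((\<lambda>u. m * (a * exp (2 * a * (u - s)))) has_integral m * ((exp (2 * a * (r0 - s)) - exp (2 * a * (s - s))) / 2)) {s..r0}"
        using r0(1) a by (intro has_integral_mult_right has_integral_exp_weight) auto
      have "norm (integral {s..r0} f) \<le> integral {s..r0} (\<lambda>u. m * (a * exp (2 * a * (u - s))))"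
      proof (rule integral_norm_bound_integral)
        show "f integrable_on {s..r0}" using r0 by (intro fint) auto
        show "(\<lambda>u. m * (a * exp (2 * a * (u - s)))) integrable_on {s..r0}" using hi by (rule has_integral_integrable)
        fix u assume "u \<in> {s..r0}"
        then have u: "u \<in> {s..t}" using r0 by auto
        show "norm (f u) \<le> m * (a * exp (2 * a * (u - s)))"
          using order_trans[OF bound[OF u] mult_left_mono[OF Dm[OF u], of a]] a by (simp add: mult_ac)
      qed
      then show ?thesis unfolding integral_unique[OF hi] using inc[of s r0] r0 by simp
    qed
    then have "norm (D r0) \<le> norm (D s) + m * ((exp (2 * a * (r0 - s)) - 1) / 2)"
      using norm_triangle_sub[of "D r0" "D s"] by simp
    moreover have "norm (D r0) = m * exp (2 * a * (r0 - s))" by (simp add: m_def g_def exp_minus)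
    moreover have m0: "0 \<le> m" by (simp add: m_def g_def)
    moreover have "m * ((exp (2 * a * (r0 - s)) - 1) / 2) = m * exp (2 * a * (r0 - s)) / 2 - m / 2" by (simp add: field_simps)
    ultimately have "m * exp (2 * a * (r0 - s)) \<le> 2 * norm (D s)" by linarith
    moreover have "m * 1 \<le> m * exp (2 * a * (r0 - s))" using r0 a m0 by (intro mult_left_mono) auto
    ultimately have "m \<le> 2 * norm (D s)" by simp
    then have "m * exp (2 * a * (t - s)) \<le> 2 * norm (D s) * exp (2 * a * (t - s))" by (intro mult_right_mono) auto
    then show ?thesis using order_trans[OF Dm[of t]] st by (simp add: mult_ac)
  qed
  show "norm (D s) \<le> 2 * exp (2 * a * (t - s)) * norm (D t)"
  proof -
    define g where "g = (\<lambda>r. exp (- (2 * a * (t - r))) * norm (D r))"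
    have "continuous_on {s..t} g" unfolding g_def using cont by (intro continuous_intros)
    then obtain r0 where r0: "r0 \<in> {s..t}" "\<And>r. r \<in> {s..t} \<Longrightarrow> g r \<le> g r0"
      using continuous_attains_sup[of "{s..t}" g] st by auto
    define m where "m = g r0"
    have Dm: "norm (D r) \<le> m * exp (2 * a * (t - r))" if "r \<in> {s..t}" for r
      using r0(2)[OF that] by (intro unweight) (simp add: m_def g_def)
    have "norm (D t - D r0) \<le> m * ((exp (2 * a * (t - r0)) - exp (2 * a * (t - t))) / 2)"
    proof -
      have hi: "((\<lambda>u. m * (a * exp (2 * a * (t - u)))) has_integral m * ((exp (2 * a * (t - r0)) - exp (2 * a * (t - t))) / 2)) {r0..t}"
        using r0(1) a by (intro has_integral_mult_right has_integral_exp_weight) auto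
      have "norm (integral {r0..t} f) \<le> integral {r0..t} (\<lambda>u. m * (a * exp (2 * a * (t - u))))"
      proof (rule integral_norm_bound_integral)
        show "f integrable_on {r0..t}" using r0 by (intro fint) auto
        show "(\<lambda>u. m * (a * exp (2 * a * (t - u)))) integrable_on {r0..t}" using hi by (rule has_integral_integrable)
        fix u assume "u \<in> {r0..t}"
        then have u: "u \<in> {s..t}" using r0 by auto
        show "norm (f u) \<le> m * (a * exp (2 * a * (t - u)))"
          using order_trans[OF bound[OF u] mult_left_mono[OF Dm[OF u], of a]] a by (simp add: mult_ac)
      qed
      then show ?thesis unfolding integral_unique[OF hi] using inc[of r0 t] r0 by simp
    qed
    then have "norm (D r0) \<le> norm (D t) + m * ((exp (2 * a * (t - r0)) - 1) / 2)"
      using norm_triangle_sub[of "D r0" "D t"] by (simp add: norm_minus_commute)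
    moreover have "norm (D r0) = m * exp (2 * a * (t - r0))" by (simp add: m_def g_def exp_minus)
    moreover have m0: "0 \<le> m" by (simp add: m_def g_def)
    moreover have "m * ((exp (2 * a * (t - r0)) - 1) / 2) = m * exp (2 * a * (t - r0)) / 2 - m / 2" by (simp add: field_simps)
    ultimately have "m * exp (2 * a * (t - r0)) \<le> 2 * norm (D t)" by linarith
    moreover have "m * 1 \<le> m * exp (2 * a * (t - r0))" using r0 a m0 by (intro mult_left_mono) auto
    ultimately have "m \<le> 2 * norm (D t)" by simp
    then have "m * exp (2 * a * (t - s)) \<le> 2 * norm (D t) * exp (2 * a * (t - s))" by (intro mult_right_mono) auto
    then show ?thesis using order_trans[OF Dm[of s]] st by (simp add: mult_ac)
  qed
qed

lemma bounded_measurable_integrable: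
  fixes f :: "real \<Rightarrow> 'e::euclidean_space"
  assumes [measurable]: "f \<in> borel_measurable borel" and "\<And>s. s \<in> {r..t} \<Longrightarrow> norm (f s) \<le> c"
  shows "f integrable_on {r..t}" "(LINT s|lborel. indicator {r..t} s *\<^sub>R f s) = integral {r..t} f"
proof -
  have "set_integrable lborel {r..t} f"
    unfolding set_integrable_def using assms
    by (intro integrableI_bounded_set_indicator[where B = c]) (auto simp: emeasure_lborel_Icc_eq)
  from set_borel_integral_eq_integral[OF this]
  show "f integrable_on {r..t}" "(LINT s|lborel. indicator {r..t} s *\<^sub>R f s) = integral {r..t} f"
    by (simp_all add: set_lebesgue_integral_def)
qed

text \<open>Picard iteration converges geometrically in the weighted norm. The iterates are built with Lebesgue integrals,
  which keeps them measurable in the parameter \<open>\<omega>\<close>; so is their limit.\<close>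

lemma picard:
  fixes L :: "'w \<Rightarrow> real \<Rightarrow> 'e::euclidean_space \<Rightarrow> 'e" and I :: 'e
  assumes meas: "(\<lambda>w. L (fst (fst w)) (snd (fst w)) (snd w)) \<in> borel_measurable ((N \<Otimes>\<^sub>M borel) \<Otimes>\<^sub>M borel)"
    and lip: "\<And>\<omega> s y z. norm (L \<omega> s y - L \<omega> s z) \<le> a * norm (y - z)" and zero: "\<And>\<omega> s. L \<omega> s 0 = 0" and a: "a > 0"
  obtains \<Phi> where "\<And>\<omega>. \<omega> \<in> space N \<Longrightarrow> continuous_on {0..} (\<Phi> \<omega>)"
    "\<And>\<omega> t. \<omega> \<in> space N \<Longrightarrow> 0 \<le> t \<Longrightarrow> ((\<lambda>s. L \<omega> s (\<Phi> \<omega> s)) has_integral (\<Phi> \<omega> t - I)) {0..t}"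
    "\<And>t. (\<lambda>\<omega>. \<Phi> \<omega> t) \<in> borel_measurable N"
proof -
  \<comment> \<open>The iterates; for negative times they keep the initial value.\<close>
  define Pn where "Pn = rec_nat (\<lambda>\<omega> t. I) (\<lambda>n p \<omega> t. I + (LINT s|lborel. indicator {0..t} s *\<^sub>R L \<omega> s (p \<omega> s)))"
  have P0: "Pn 0 \<omega> t = I" and PS: "Pn (Suc n) \<omega> t = I + (LINT s|lborel. indicator {0..t} s *\<^sub>R L \<omega> s (Pn n \<omega> s))" for n \<omega> t
    by (simp_all add: Pn_def)
  have Pm: "(\<lambda>w. Pn n (fst w) (snd w)) \<in> borel_measurable (N \<Otimes>\<^sub>M borel)" for n
  proof (induction n)
    case 0 then show ?case by (simp add: P0)
  next
    case (Suc n)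
    have "(\<lambda>v. (fst (fst v), snd v)) \<in> (N \<Otimes>\<^sub>M borel) \<Otimes>\<^sub>M lborel \<rightarrow>\<^sub>M N \<Otimes>\<^sub>M (borel :: real measure)" by measurable
    from measurable_compose[OF this Suc]
    have [measurable]: "(\<lambda>v. Pn n (fst (fst v)) (snd v)) \<in> borel_measurable ((N \<Otimes>\<^sub>M borel) \<Otimes>\<^sub>M lborel)" by simp
    have [measurable]: "(\<lambda>v. L (fst (fst v)) (snd v) (Pn n (fst (fst v)) (snd v))) \<in> borel_measurable ((N \<Otimes>\<^sub>M borel) \<Otimes>\<^sub>M lborel)"
    proof -
      have "(\<lambda>v. ((fst (fst v), snd v), Pn n (fst (fst v)) (snd v))) \<in> (N \<Otimes>\<^sub>M borel) \<Otimes>\<^sub>M lborel \<rightarrow>\<^sub>M (N \<Otimes>\<^sub>M borel) \<Otimes>\<^sub>M borel"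
        by measurable
      from measurable_compose[OF this meas] show ?thesis by simp
    qed
    have [measurable]: "Measurable.pred ((N \<Otimes>\<^sub>M borel) \<Otimes>\<^sub>M (lborel :: real measure)) (\<lambda>v. snd v \<in> {0..snd (fst v)})"
      unfolding atLeastAtMost_iff by measurable
    have "(\<lambda>(w, s). indicator {0..snd w} s *\<^sub>R L (fst w) s (Pn n (fst w) s)) \<in> borel_measurable ((N \<Otimes>\<^sub>M borel) \<Otimes>\<^sub>M lborel)"
      unfolding case_prod_beta by measurable
    from lborel.borel_measurable_lebesgue_integral[OF this]
    show ?case unfolding PS by measurable
  qed
  have Ps: "Pn n \<omega> \<in> borel_measurable borel" if "\<omega> \<in> space N" for n \<omega>
    using measurable_compose[OF measurable_Pair1'[OF that] Pm[of n]] by simp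
  have LPs: "(\<lambda>s. L \<omega> s (h s)) \<in> borel_measurable borel" if "\<omega> \<in> space N" "h \<in> borel_measurable borel" for h \<omega>
  proof -
    have "(\<lambda>s. ((\<omega>, s), h s)) \<in> borel \<rightarrow>\<^sub>M (N \<Otimes>\<^sub>M borel) \<Otimes>\<^sub>M borel"
      using that by (intro measurable_Pair measurable_const) auto
    from measurable_compose[OF this meas] show ?thesis by simp
  qed
  have Lb: "norm (L \<omega> s y) \<le> a * norm y" for \<omega> s y using lip[of \<omega> s y 0] by (simp add: zero)
  have hint: "((\<lambda>u. c * (a * exp (2 * a * u))) has_integral c * ((exp (2 * a * t) - 1) / 2)) {0..t}" if "0 \<le> t" for c t
    using has_integral_mult_right[OF has_integral_exp_weight(1)[OF a that, of 0], of c] by simp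
  \<comment> \<open>an integral operator bound in the weighted norm\<close>
  have weighted: "norm (integral {0..t} g) \<le> c * ((exp (2 * a * t) - 1) / 2)"
    if "0 \<le> t" "g integrable_on {0..t}" "\<And>s. s \<in> {0..t} \<Longrightarrow> norm (g s) \<le> c * (a * exp (2 * a * s))" for t c and g :: "real \<Rightarrow> 'e"
    using integral_norm_bound_integral[OF that(2) has_integral_integrable[OF hint[OF that(1)]] that(3)]
    unfolding integral_unique[OF hint[OF that(1)]] .
  have intP: "(\<lambda>s. L \<omega> s (h s)) integrable_on {0..t}" "(LINT s|lborel. indicator {0..t} s *\<^sub>R L \<omega> s (h s)) = integral {0..t} (\<lambda>s. L \<omega> s (h s))"
    if \<omega>: "\<omega> \<in> space N" and h: "h \<in> borel_measurable borel" "\<And>s. 0 \<le> s \<Longrightarrow> norm (h s) \<le> norm I * exp (2 * a * s)" for \<omega> t h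
  proof -
    have "norm (L \<omega> s (h s)) \<le> a * (norm I * exp (2 * a * t))" if "s \<in> {0..t}" for s
    proof -
      have "norm (L \<omega> s (h s)) \<le> a * norm (h s)" by (rule Lb)
      also have "\<dots> \<le> a * (norm I * exp (2 * a * t))"
      proof (rule mult_left_mono)
        have "norm I * exp (2 * a * s) \<le> norm I * exp (2 * a * t)" using that a by (intro mult_left_mono) auto
        then show "norm (h s) \<le> norm I * exp (2 * a * t)" using h(2)[of s] that by simp
      qed (use a in simp)
      finally show ?thesis .
    qed
    note b = this
    show "(\<lambda>s. L \<omega> s (h s)) integrable_on {0..t}"
      by (rule bounded_measurable_integrable(1)[OF LPs[OF \<omega> h(1)] b])
    show "(LINT s|lborel. indicator {0..t} s *\<^sub>R L \<omega> s (h s)) = integral {0..t} (\<lambda>s. L \<omega> s (h s))"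
      by (rule bounded_measurable_integrable(2)[OF LPs[OF \<omega> h(1)] b])
  qed
  have Pb: "norm (Pn n \<omega> t) \<le> norm I * exp (2 * a * t)" if "\<omega> \<in> space N" "0 \<le> t" for n \<omega> t
    using that(2)
  proof (induction n arbitrary: t)
    case 0
    have "norm I * 1 \<le> norm I * exp (2 * a * t)" using 0 a by (intro mult_left_mono) auto
    then show ?case by (simp add: P0)
  next
    case (Suc n)
    have "norm (integral {0..t} (\<lambda>s. L \<omega> s (Pn n \<omega> s))) \<le> norm I * ((exp (2 * a * t) - 1) / 2)"
    proof (rule weighted[OF \<open>0 \<le> t\<close>])
      show "(\<lambda>s. L \<omega> s (Pn n \<omega> s)) integrable_on {0..t}" by (rule intP(1)[OF that(1) Ps[OF that(1)] Suc.IH])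
      show "norm (L \<omega> s (Pn n \<omega> s)) \<le> norm I * (a * exp (2 * a * s))" if "s \<in> {0..t}" for s
        using order_trans[OF Lb mult_left_mono[OF Suc.IH[of s], of a], of \<omega> s] a that by (simp add: mult_ac)
    qed
    moreover have "0 \<le> norm I * (exp (2 * a * t) - 1)" using Suc.prems a by (intro mult_nonneg_nonneg) auto
    moreover have "Pn (Suc n) \<omega> t = I + integral {0..t} (\<lambda>s. L \<omega> s (Pn n \<omega> s))"
      unfolding PS using intP(2)[OF that(1) Ps[OF that(1)] Suc.IH] by simp
    ultimately show ?case using norm_triangle_ineq[of I "integral {0..t} (\<lambda>s. L \<omega> s (Pn n \<omega> s))"] by (simp add: algebra_simps)
  qed
  have PSi: "Pn (Suc n) \<omega> t = I + integral {0..t} (\<lambda>s. L \<omega> s (Pn n \<omega> s))" if "\<omega> \<in> space N" for n \<omega> t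
    unfolding PS using intP(2)[OF that Ps[OF that] Pb[OF that]] by simp
  have diff: "norm (Pn (Suc n) \<omega> t - Pn n \<omega> t) \<le> norm I * (1 / 2) ^ n * exp (2 * a * t)" if \<omega>: "\<omega> \<in> space N" and "0 \<le> t" for n \<omega> t
    using that(2)
  proof (induction n arbitrary: t)
    case 0
    have "norm (integral {0..t} (\<lambda>s. L \<omega> s (Pn 0 \<omega> s))) \<le> norm I * ((exp (2 * a * t) - 1) / 2)"
    proof (rule weighted[OF \<open>0 \<le> t\<close> intP(1)[OF \<omega> Ps[OF \<omega>] Pb[OF \<omega>]]])
      show "norm (L \<omega> s (Pn 0 \<omega> s)) \<le> norm I * (a * exp (2 * a * s))" if "s \<in> {0..t}" for s
        using order_trans[OF Lb mult_left_mono[OF Pb[OF \<omega>, of s 0], of a], of \<omega> s] a that by (simp add: mult_ac)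
    qed
    also have "norm I * ((exp (2 * a * t) - 1) / 2) \<le> norm I * exp (2 * a * t)"
    proof (rule mult_left_mono)
      have "(e - 1) / 2 \<le> e" if "0 < e" for e :: real using that by (simp add: field_simps)
      from this[OF exp_gt_zero] show "(exp (2 * a * t) - 1) / 2 \<le> exp (2 * a * t)" .
    qed simp
    finally show ?case using PSi[OF \<omega>, of 0 t] by (simp add: P0)
  next
    case (Suc n)
    have i: "(\<lambda>s. L \<omega> s (Pn k \<omega> s)) integrable_on {0..t}" for k by (rule intP(1)[OF \<omega> Ps[OF \<omega>] Pb[OF \<omega>]])
    have "Pn (Suc (Suc n)) \<omega> t - Pn (Suc n) \<omega> t = integral {0..t} (\<lambda>s. L \<omega> s (Pn (Suc n) \<omega> s) - L \<omega> s (Pn n \<omega> s))"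
      using PSi[OF \<omega>, of "Suc n" t] PSi[OF \<omega>, of n t] by (simp add: Henstock_Kurzweil_Integration.integral_diff[OF i i])
    also have "norm \<dots> \<le> (norm I * (1 / 2) ^ n) * ((exp (2 * a * t) - 1) / 2)"
    proof (rule weighted[OF \<open>0 \<le> t\<close>])
      show "(\<lambda>s. L \<omega> s (Pn (Suc n) \<omega> s) - L \<omega> s (Pn n \<omega> s)) integrable_on {0..t}" by (intro integrable_diff i)
      show "norm (L \<omega> s (Pn (Suc n) \<omega> s) - L \<omega> s (Pn n \<omega> s)) \<le> norm I * (1 / 2) ^ n * (a * exp (2 * a * s))" if "s \<in> {0..t}" for s
        using order_trans[OF lip mult_left_mono[OF Suc.IH[of s], of a]] a that by (simp add: mult_ac)
    qed
    also have "\<dots> \<le> (norm I * (1 / 2) ^ n) * (exp (2 * a * t) / 2)" by (intro mult_left_mono) auto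
    finally show ?case by simp
  qed
  have diffs: "norm (Pn (n + k) \<omega> t - Pn n \<omega> t) \<le> 2 * norm I * (1 / 2) ^ n * (1 - (1 / 2) ^ k) * exp (2 * a * t)" if \<omega>: "\<omega> \<in> space N" and "0 \<le> t" for n k \<omega> t
  proof (induction k)
    case (Suc k)
    have "Pn (n + Suc k) \<omega> t - Pn n \<omega> t = (Pn (Suc (n + k)) \<omega> t - Pn (n + k) \<omega> t) + (Pn (n + k) \<omega> t - Pn n \<omega> t)" by simp
    also have "norm \<dots> \<le> norm I * (1 / 2) ^ (n + k) * exp (2 * a * t) + 2 * norm I * (1 / 2) ^ n * (1 - (1 / 2) ^ k) * exp (2 * a * t)"
      by (intro order_trans[OF norm_triangle_ineq] add_mono diff Suc \<omega> that)
    also have "\<dots> = 2 * norm I * (1 / 2) ^ n * (1 - (1 / 2) ^ Suc k) * exp (2 * a * t)"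
      by (simp add: power_add algebra_simps)
    finally show ?case .
  qed simp
  define \<Phi> where "\<Phi> = (\<lambda>\<omega> t. lim (\<lambda>n. Pn n \<omega> t))"
  have conv: "(\<lambda>n. Pn n \<omega> t) \<longlonglongrightarrow> \<Phi> \<omega> t" if \<omega>: "\<omega> \<in> space N" and t: "0 \<le> t" for \<omega> t
  proof -
    define C where "C = 2 * norm I * exp (2 * a * t)"
    have bd: "norm (Pn (n + k) \<omega> t - Pn n \<omega> t) \<le> C * (1 / 2) ^ n" for n k
    proof -
      have "2 * norm I * (1 / 2) ^ n * (1 - (1 / 2) ^ k) * exp (2 * a * t) \<le> 2 * norm I * (1 / 2) ^ n * 1 * exp (2 * a * t)"
        by (intro mult_right_mono mult_left_mono) auto
      then show ?thesis using diffs[OF that, of n k] by (simp add: C_def mult_ac)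
    qed
    have "Cauchy (\<lambda>n. Pn n \<omega> t)"
    proof (rule CauchyI')
      fix e :: real assume e: "0 < e"
      have "(\<lambda>n. C * (1 / 2) ^ n) \<longlonglongrightarrow> C * 0" by (intro tendsto_intros LIMSEQ_power_zero) auto
      then have "\<forall>\<^sub>F n in sequentially. C * (1 / 2) ^ n < e" using e by (intro order_tendstoD) auto
      then obtain M where M: "\<And>n. n \<ge> M \<Longrightarrow> C * (1 / 2) ^ n < e" by (auto simp: eventually_sequentially)
      show "\<exists>M. \<forall>m\<ge>M. \<forall>n>m. dist (Pn m \<omega> t) (Pn n \<omega> t) < e"
      proof (intro exI[of _ M] allI impI)
        fix m n assume "M \<le> m" "m < n"
        then show "dist (Pn m \<omega> t) (Pn n \<omega> t) < e"
          using bd[of m "n - m"] M[of m] by (simp add: dist_norm norm_minus_commute)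
      qed
    qed
    then show ?thesis unfolding \<Phi>_def by (simp add: Cauchy_convergent_iff convergent_LIMSEQ_iff)
  qed
  have close: "norm (\<Phi> \<omega> t - Pn n \<omega> t) \<le> 2 * norm I * (1 / 2) ^ n * exp (2 * a * t)" if \<omega>: "\<omega> \<in> space N" and t: "0 \<le> t" for \<omega> t n
  proof (rule tendsto_upperbound)
    show "((\<lambda>k. norm (Pn (n + k) \<omega> t - Pn n \<omega> t)) \<longlongrightarrow> norm (\<Phi> \<omega> t - Pn n \<omega> t)) sequentially"
      using LIMSEQ_ignore_initial_segment[OF conv[OF that], of n] by (intro tendsto_intros) (simp add: add.commute)
    have "2 * norm I * (1 / 2) ^ n * (1 - (1 / 2) ^ k) * exp (2 * a * t) \<le> 2 * norm I * (1 / 2) ^ n * 1 * exp (2 * a * t)" for k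
      by (intro mult_right_mono mult_left_mono) auto
    then show "\<forall>\<^sub>F k in sequentially. norm (Pn (n + k) \<omega> t - Pn n \<omega> t) \<le> 2 * norm I * (1 / 2) ^ n * exp (2 * a * t)"
      using order_trans[OF diffs[OF that]] by (intro always_eventually allI) simp
  qed simp
  have \<Phi>b: "norm (\<Phi> \<omega> t) \<le> norm I * exp (2 * a * t)" if \<omega>: "\<omega> \<in> space N" and t: "0 \<le> t" for \<omega> t
    by (rule tendsto_upperbound[OF tendsto_norm[OF conv[OF that]]]) (auto intro!: always_eventually Pb that)
  have \<Phi>neg: "\<Phi> \<omega> t = I" if "t < 0" for \<omega> t
  proof -
    have "Pn n \<omega> t = I" for n
      using that by (cases n) (simp_all add: P0 PS)
    then show ?thesis by (simp add: \<Phi>_def)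
  qed
  have conv': "(\<lambda>n. Pn n \<omega> t) \<longlonglongrightarrow> \<Phi> \<omega> t" if \<omega>: "\<omega> \<in> space N" for \<omega> t
  proof (cases "0 \<le> t")
    case False
    then have "Pn n \<omega> t = I" for n by (cases n) (simp_all add: P0 PS)
    then show ?thesis using \<Phi>neg[of t \<omega>] False by simp
  qed (rule conv[OF that])
  have \<Phi>s: "\<Phi> \<omega> \<in> borel_measurable borel" if "\<omega> \<in> space N" for \<omega>
    by (rule borel_measurable_LIMSEQ_metric[OF Ps[OF that] conv'[OF that]])
  have integ: "((\<lambda>s. L \<omega> s (\<Phi> \<omega> s)) has_integral (\<Phi> \<omega> t - I)) {0..t}" if \<omega>: "\<omega> \<in> space N" and t: "0 \<le> t" for \<omega> t
  proof -
    have i: "(\<lambda>s. L \<omega> s (\<Phi> \<omega> s)) integrable_on {0..t}" by (rule intP(1)[OF \<omega> \<Phi>s[OF \<omega>] \<Phi>b[OF \<omega>]])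
    have iP: "(\<lambda>s. L \<omega> s (Pn n \<omega> s)) integrable_on {0..t}" for n by (rule intP(1)[OF \<omega> Ps[OF \<omega>] Pb[OF \<omega>]])
    have "norm (integral {0..t} (\<lambda>s. L \<omega> s (Pn n \<omega> s)) - integral {0..t} (\<lambda>s. L \<omega> s (\<Phi> \<omega> s)))
        \<le> (2 * norm I * (1 / 2) ^ n) * ((exp (2 * a * t) - 1) / 2)" for n
      unfolding Henstock_Kurzweil_Integration.integral_diff[OF iP i, symmetric]
    proof (rule weighted[OF t])
      show "(\<lambda>s. L \<omega> s (Pn n \<omega> s) - L \<omega> s (\<Phi> \<omega> s)) integrable_on {0..t}" by (intro integrable_diff i iP)
      show "norm (L \<omega> s (Pn n \<omega> s) - L \<omega> s (\<Phi> \<omega> s)) \<le> 2 * norm I * (1 / 2) ^ n * (a * exp (2 * a * s))" if "s \<in> {0..t}" for s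
        using order_trans[OF lip mult_left_mono[OF close[OF \<omega>, of s n], of a], of \<omega> s] a that
        by (simp add: norm_minus_commute mult_ac)
    qed
    then have ev: "\<forall>\<^sub>F n in sequentially. norm (integral {0..t} (\<lambda>s. L \<omega> s (Pn n \<omega> s)) - integral {0..t} (\<lambda>s. L \<omega> s (\<Phi> \<omega> s)))
        \<le> (2 * norm I * (1 / 2) ^ n) * ((exp (2 * a * t) - 1) / 2)" by (rule always_eventually[OF allI])
    have "(\<lambda>n. (2 * norm I * (1 / 2) ^ n) * ((exp (2 * a * t) - 1) / 2)) \<longlonglongrightarrow> (2 * norm I * 0) * ((exp (2 * a * t) - 1) / 2)"
      by (intro tendsto_intros LIMSEQ_power_zero) auto
    then have "(\<lambda>n. (2 * norm I * (1 / 2) ^ n) * ((exp (2 * a * t) - 1) / 2)) \<longlonglongrightarrow> 0" by simp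
    from Lim_null_comparison[OF ev this]
    have "(\<lambda>n. integral {0..t} (\<lambda>s. L \<omega> s (Pn n \<omega> s)) - integral {0..t} (\<lambda>s. L \<omega> s (\<Phi> \<omega> s))) \<longlonglongrightarrow> 0" .
    then have 1: "(\<lambda>n. integral {0..t} (\<lambda>s. L \<omega> s (Pn n \<omega> s))) \<longlonglongrightarrow> integral {0..t} (\<lambda>s. L \<omega> s (\<Phi> \<omega> s))"
      by (simp add: LIM_zero_iff)
    have "(\<lambda>n. Pn (Suc n) \<omega> t - I) \<longlonglongrightarrow> \<Phi> \<omega> t - I"
      using LIMSEQ_Suc[OF conv[OF that]] by (intro tendsto_intros)
    then have "(\<lambda>n. integral {0..t} (\<lambda>s. L \<omega> s (Pn n \<omega> s))) \<longlonglongrightarrow> \<Phi> \<omega> t - I" by (simp add: PSi[OF \<omega>])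
    from LIMSEQ_unique[OF 1 this] i show ?thesis by (metis integrable_integral)
  qed
  show thesis
  proof (rule that)
    fix \<omega> assume \<omega>: "\<omega> \<in> space N"
    show "continuous_on {0..} (\<Phi> \<omega>)"
    proof (rule continuous_on_atLeastI)
      fix b :: real assume b: "0 \<le> b"
      have "continuous_on {0..b} (\<lambda>t. I + integral {0..t} (\<lambda>s. L \<omega> s (\<Phi> \<omega> s)))"
        using has_integral_integrable[OF integ[OF \<omega> b]] by (intro continuous_intros indefinite_integral_continuous_1)
      then show "continuous_on {0..b} (\<Phi> \<omega>)"
        by (rule continuous_on_eq) (use integral_unique[OF integ[OF \<omega>]] in auto)
    qed
  next
    show "(\<lambda>\<omega>. \<Phi> \<omega> t) \<in> borel_measurable N" for t
    proof (rule borel_measurable_LIMSEQ_metric)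
      show "(\<lambda>\<omega>. Pn n \<omega> t) \<in> borel_measurable N" for n
        using measurable_compose[OF measurable_Pair2'[of t borel N] Pm[of n]] by simp
      show "(\<lambda>n. Pn n \<omega> t) \<longlonglongrightarrow> \<Phi> \<omega> t" if "\<omega> \<in> space N" for \<omega> by (rule conv'[OF that])
    qed
  qed (rule integ)
qed

section \<open>The flow of the switched system\<close>

lemma linear_matrix_mult_right: "linear (\<lambda>Z :: real^'d^'d. B ** Z)" for B :: "real^'d^'d"
  by (rule linearI) (simp_all add: matrix_matrix_mult_def vec_eq_iff sum.distrib sum_distrib_left algebra_simps)

lemma linear_matrix_vector_left: "linear (\<lambda>Z :: real^'d^'d. Z *v x)" for x :: "real^'d"
  by (rule linearI) (simp_all add: matrix_vector_mult_def vec_eq_iff sum.distrib sum_distrib_left algebra_simps)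

lemma has_integral_from:
  fixes f :: "real \<Rightarrow> 'e::euclidean_space"
  assumes "\<And>t. 0 \<le> t \<Longrightarrow> (f has_integral (D t - I)) {0..t}" "0 \<le> s" "s \<le> t"
  shows "(f has_integral (D t - D s)) {s..t}"
proof -
  have i: "f integrable_on {0..t}" using assms by (intro has_integral_integrable[OF assms(1)]) auto
  have i': "f integrable_on {s..t}" by (rule integrable_on_subinterval[OF i]) (use assms in auto)
  have "integral {0..s} f + integral {s..t} f = integral {0..t} f"
    by (intro Henstock_Kurzweil_Integration.integral_combine i) (use assms in auto)
  moreover have "integral {0..s} f = D s - I" "integral {0..t} f = D t - I"
    using assms by (auto intro!: integral_unique assms(1))
  ultimately have "integral {s..t} f = D t - D s" by (simp add: algebra_simps)
  then show ?thesis using i' by (metis integrable_integral)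
qed

lemma fundamental_solution_0: "fundamental_solution B \<Phi> \<Longrightarrow> \<Phi> 0 = mat 1"
  unfolding fundamental_solution_def
  using has_integral_unique[of "\<lambda>s. B s ** \<Phi> s" "\<Phi> 0 - mat 1" "{0..0::real}" 0] has_integral_refl(2)
  by force

text \<open>The difference of two solutions starts at \<open>0\<close>, and Gronwall's inequality keeps it there.\<close>

lemma fundamental_solution_unique:
  fixes B :: "real \<Rightarrow> real^'d^'d"
  assumes \<Phi>: "fundamental_solution B \<Phi>" and \<Psi>: "fundamental_solution B \<Psi>"
    and c: "\<And>s (Z :: real^'d^'d). norm (B s ** Z) \<le> c * norm Z" "0 < c" and t: "0 \<le> t"
  shows "\<Phi> t = \<Psi> t"
proof -
  have "norm (\<Phi> t - \<Psi> t) \<le> 2 * exp (2 * c * (t - 0)) * norm (\<Phi> 0 - \<Psi> 0)"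
  proof (rule gronwall(1)[where D = "\<lambda>r. \<Phi> r - \<Psi> r" and f = "\<lambda>r. B r ** (\<Phi> r - \<Psi> r)"])
    have "continuous_on {0..} \<Phi>" "continuous_on {0..} \<Psi>" using \<Phi> \<Psi> by (auto simp: fundamental_solution_def)
    then show "continuous_on {0..t} (\<lambda>r. \<Phi> r - \<Psi> r)"
      by (intro continuous_on_diff) (auto elim!: continuous_on_subset)
    fix r assume "r \<in> {0..t}"
    then have "((\<lambda>s. B s ** \<Phi> s - B s ** \<Psi> s) has_integral (\<Phi> r - mat 1 - (\<Psi> r - mat 1))) {0..r}"
      using \<Phi> \<Psi> by (intro has_integral_diff) (auto simp: fundamental_solution_def)
    moreover have "B s ** \<Phi> s - B s ** \<Psi> s = B s ** (\<Phi> s - \<Psi> s)" for s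
      using linear_diff[OF linear_matrix_mult_right] by metis
    ultimately show "((\<lambda>r. B r ** (\<Phi> r - \<Psi> r)) has_integral (\<Phi> r - \<Psi> r - (\<Phi> 0 - \<Psi> 0))) {0..r}"
      using fundamental_solution_0[OF \<Phi>] fundamental_solution_0[OF \<Psi>] by simp
    show "norm (B r ** (\<Phi> r - \<Psi> r)) \<le> c * norm (\<Phi> r - \<Psi> r)" by (rule c)
  qed (use t c in auto)
  then show ?thesis using fundamental_solution_0[OF \<Phi>] fundamental_solution_0[OF \<Psi>] by simp
qed

lemma flow_eq:
  fixes B :: "real \<Rightarrow> real^'d^'d"
  assumes \<Phi>: "fundamental_solution B \<Phi>" and c: "\<And>s (Z :: real^'d^'d). norm (B s ** Z) \<le> c * norm Z" "0 < c"
    and t: "0 \<le> t"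
  shows "flow B t = \<Phi> t"
  unfolding flow_def
proof (rule the_equality)
  show "\<exists>\<Phi>'. fundamental_solution B \<Phi>' \<and> \<Phi>' t = \<Phi> t" using \<Phi> by blast
  fix Y assume "\<exists>\<Phi>'. fundamental_solution B \<Phi>' \<and> \<Phi>' t = Y"
  then obtain \<Phi>' where "fundamental_solution B \<Phi>'" "\<Phi>' t = Y" by blast
  then show "Y = \<Phi> t" using fundamental_solution_unique[OF _ \<Phi> c t] by metis
qed

lemma fundamental_solution_vec:
  assumes \<Phi>: "fundamental_solution B \<Phi>"
  shows "continuous_on {0..} (\<lambda>s. \<Phi> s *v x)"
    and "0 \<le> s \<Longrightarrow> s \<le> t \<Longrightarrow> ((\<lambda>s. B s *v (\<Phi> s *v x)) has_integral (\<Phi> t *v x - \<Phi> s *v x)) {s..t}"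
proof -
  have bl: "bounded_linear (\<lambda>Z :: real^'a^'a. Z *v x)"
    using linear_matrix_vector_left by (simp add: linear_conv_bounded_linear)
  show "continuous_on {0..} (\<lambda>s. \<Phi> s *v x)"
    using \<Phi> by (intro bounded_linear.continuous_on[OF bl]) (simp add: fundamental_solution_def)
  have "((\<lambda>s. B s *v (\<Phi> s *v x)) has_integral (\<Phi> t *v x - x)) {0..t}" if "0 \<le> t" for t
  proof -
    have "((\<lambda>s. B s ** \<Phi> s) has_integral (\<Phi> t - mat 1)) {0..t}" using \<Phi> that by (simp add: fundamental_solution_def)
    from has_integral_linear[OF this bl] show ?thesis
      by (simp add: o_def matrix_vector_mul_assoc matrix_vector_mult_diff_rdistrib)
  qed
  then show "0 \<le> s \<Longrightarrow> s \<le> t \<Longrightarrow> ((\<lambda>s. B s *v (\<Phi> s *v x)) has_integral (\<Phi> t *v x - \<Phi> s *v x)) {s..t}"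
    by (rule has_integral_from)
qed

locale matrix_switched_process = switched_process \<Omega> X T \<pi> \<mu> TP "\<lambda>i. endo_of ((*v) (B i))" a
  for \<Omega> :: "'w measure" and X :: "nat \<Rightarrow> 'w \<Rightarrow> 'n::finite" and T \<pi> \<mu> TP
    and B :: "'n \<Rightarrow> real^'d^'d" and a
begin

abbreviation traj :: "'w \<Rightarrow> real \<Rightarrow> 'n" where "traj \<equiv> trajectory X T"

abbreviation Flow :: "'w \<Rightarrow> real \<Rightarrow> real^'d^'d" where "Flow \<omega> \<equiv> flow (\<lambda>s. B (traj \<omega> s))"

lemma app_B [simp]: "app (endo_of ((*v) (B i))) y = B i *v y"
  by (simp add: app_endo_of)

lemma norm_B: "norm (B i *v y) \<le> a * norm y"
  using order_trans[OF norm_app mult_right_mono[OF norm_A[of i]], of y] by simp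

lemma traj_measurable: "(\<lambda>w. traj (fst w) (snd w)) \<in> \<Omega> \<Otimes>\<^sub>M borel \<rightarrow>\<^sub>M count_space UNIV"
  unfolding trajectory_def
proof (rule measurable_compose_countable'[where f = "\<lambda>k w. X k (fst w)" and I = UNIV])
  show "(\<lambda>w. LEAST k. snd w < (\<Sum>j\<le>k. T j (fst w))) \<in> \<Omega> \<Otimes>\<^sub>M borel \<rightarrow>\<^sub>M count_space UNIV"
    by (rule measurable_Least) measurable
qed auto

text \<open>The description of \<^const>\<open>flow\<close> by uniqueness is replaced by a family that is known to solve the equation and
  to be measurable; the latter is needed to integrate the logarithm of the norm.\<close>

lemma ex_flow:
  obtains \<Phi> c where "0 < c" "\<And>i (Z :: real^'d^'d). norm (B i ** Z) \<le> c * norm Z"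
    "\<And>\<omega>. \<omega> \<in> space \<Omega> \<Longrightarrow> fundamental_solution (\<lambda>s. B (traj \<omega> s)) (\<Phi> \<omega>)"
    "\<And>t. (\<lambda>\<omega>. \<Phi> \<omega> t) \<in> borel_measurable \<Omega>"
    "\<And>\<omega> t. \<omega> \<in> space \<Omega> \<Longrightarrow> 0 \<le> t \<Longrightarrow> Flow \<omega> t = \<Phi> \<omega> t"
proof -
  have "\<exists>c>0. \<forall>Z :: real^'d^'d. norm (B i ** Z) \<le> norm Z * c" for i
    using linear_matrix_mult_right[of "B i"] by (intro bounded_linear.pos_bounded) (simp add: linear_conv_bounded_linear)
  then obtain ci where ci: "\<And>i. 0 < ci i" "\<And>i (Z :: real^'d^'d). norm (B i ** Z) \<le> norm Z * ci i" by metis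
  define c where "c = (\<Sum>i\<in>UNIV. ci i)"
  have ci_le: "ci i \<le> c" for i unfolding c_def using ci(1) by (intro member_le_sum) (auto intro: less_imp_le)
  have c0: "0 < c" using ci(1) ci_le by (meson less_le_trans)
  have c: "norm (B i ** Z) \<le> c * norm Z" for i and Z :: "real^'d^'d"
    using order_trans[OF ci(2)[of i Z] mult_left_mono[OF ci_le[of i], of "norm Z"]] by (simp add: mult.commute)
  have lip: "norm (B i ** y - B i ** z) \<le> c * norm (y - z)" for i and y z :: "real^'d^'d"
    using c[of i "y - z"] linear_diff[OF linear_matrix_mult_right, of "B i" y z] by simp
  have meas: "(\<lambda>w. B (traj (fst (fst w)) (snd (fst w))) ** (snd w :: real^'d^'d)) \<in> borel_measurable ((\<Omega> \<Otimes>\<^sub>M borel) \<Otimes>\<^sub>M borel)"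
  proof (rule measurable_compose_countable'[where f = "\<lambda>i w. B i ** (snd w :: real^'d^'d)" and I = UNIV])
    show "(\<lambda>w. B i ** (snd w :: real^'d^'d)) \<in> borel_measurable ((\<Omega> \<Otimes>\<^sub>M borel) \<Otimes>\<^sub>M borel)" for i
    proof (rule measurable_compose[OF measurable_snd])
      show "(\<lambda>Z :: real^'d^'d. B i ** Z) \<in> borel_measurable borel"
        by (intro borel_measurable_continuous_onI linear_continuous_on)
          (use linear_matrix_mult_right[of "B i"] in \<open>simp add: linear_conv_bounded_linear\<close>)
    qed
    show "(\<lambda>w. traj (fst (fst w)) (snd (fst w))) \<in> (\<Omega> \<Otimes>\<^sub>M borel) \<Otimes>\<^sub>M borel \<rightarrow>\<^sub>M count_space UNIV"
      by (rule measurable_compose[OF measurable_fst traj_measurable])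
  qed (auto intro: countable_finite)
  have zero: "B (traj \<omega> s) ** (0 :: real^'d^'d) = 0" for \<omega> s using linear_0[OF linear_matrix_mult_right] .
  obtain \<Phi> where \<Phi>: "\<And>\<omega>. \<omega> \<in> space \<Omega> \<Longrightarrow> continuous_on {0..} (\<Phi> \<omega>)"
    "\<And>\<omega> t. \<omega> \<in> space \<Omega> \<Longrightarrow> 0 \<le> t \<Longrightarrow> ((\<lambda>s. B (traj \<omega> s) ** \<Phi> \<omega> s) has_integral (\<Phi> \<omega> t - mat 1)) {0..t}"
    "\<And>t. (\<lambda>\<omega>. \<Phi> \<omega> t) \<in> borel_measurable \<Omega>"
    using picard[OF meas lip zero c0, of "mat 1"] by blast
  have fs: "fundamental_solution (\<lambda>s. B (traj \<omega> s)) (\<Phi> \<omega>)" if "\<omega> \<in> space \<Omega>" for \<omega>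
    using \<Phi>(1,2)[OF that] by (simp add: fundamental_solution_def)
  show thesis
    by (rule that[OF c0 c fs \<Phi>(3) flow_eq[OF fs c c0]]) auto
qed

lemma Flow_measurable:
  assumes "0 \<le> t" shows "(\<lambda>\<omega>. Flow \<omega> t) \<in> borel_measurable \<Omega>"
proof -
  obtain \<Phi> where "\<And>t. (\<lambda>\<omega>. \<Phi> \<omega> t) \<in> borel_measurable \<Omega>" "\<And>\<omega> t. \<omega> \<in> space \<Omega> \<Longrightarrow> 0 \<le> t \<Longrightarrow> Flow \<omega> t = \<Phi> \<omega> t"
    using ex_flow by metis
  then show ?thesis using assms by (subst measurable_cong) auto
qed

lemma time_Suc: "time (Suc n) \<omega> = time n \<omega> + T n \<omega>"
  by (simp add: time_def)

lemma traj_eq: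
  assumes "\<forall>k. 0 \<le> T k \<omega>" "time n \<omega> \<le> s" "s < time (Suc n) \<omega>"
  shows "traj \<omega> s = X n \<omega>"
proof -
  have e: "(\<Sum>j\<le>k. T j \<omega>) = time (Suc k) \<omega>" for k by (simp add: time_def lessThan_Suc_atMost)
  have mono: "time k \<omega> \<le> time k' \<omega>" if "k \<le> k'" for k k'
    unfolding time_def using that assms(1) by (intro sum_mono2) auto
  have "(LEAST k. s < (\<Sum>j\<le>k. T j \<omega>)) = n"
  proof (rule Least_equality)
    fix k assume "s < (\<Sum>j\<le>k. T j \<omega>)"
    then have "time n \<omega> < time (Suc k) \<omega>" using assms e by simp
    then show "n \<le> k" using mono[of "Suc k" n] by (meson not_less not_less_eq_eq)
  qed (use assms e in simp)
  then show ?thesis by (simp add: trajectory_def)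
qed

text \<open>Between two jumps the coefficient is constant except at the end point, so by uniqueness the solution is an
  exponential there.\<close>

lemma solution_at_jump:
  assumes T: "\<forall>k. 0 \<le> T k \<omega>" and \<Phi>: "fundamental_solution (\<lambda>s. B (traj \<omega> s)) \<Phi>"
  shows "\<Phi> (time n \<omega>) *v x = Y x n \<omega>"
proof (induction n)
  case 0
  then show ?case using fundamental_solution_0[OF \<Phi>] by (simp add: time_def)
next
  case (Suc n)
  let ?Bn = "endo_of ((*v) (B (X n \<omega>)))"
  define p where "p = time n \<omega>"
  define q where "q = time (Suc n) \<omega>"
  have pq: "0 \<le> p" "p \<le> q" "q = p + T n \<omega>"
    using T unfolding p_def q_def by (auto simp: time_Suc time_def intro!: sum_nonneg)
  define D where "D = (\<lambda>r. \<Phi> r *v x - app (expm (r - p) ?Bn) (Y x n \<omega>))"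
  have "norm (D q) \<le> 2 * exp (2 * a * (q - p)) * norm (D p)"
  proof (rule gronwall(1)[where f = "\<lambda>r. B (X n \<omega>) *v D r"])
    show "continuous_on {p..q} D"
      unfolding D_def using fundamental_solution_vec(1)[OF \<Phi>, where x = x] pq
      by (intro continuous_on_diff continuous_intros) (auto elim!: continuous_on_subset)
    show "norm (B (X n \<omega>) *v D r) \<le> a * norm (D r)" for r by (rule norm_B)
    fix r assume r: "r \<in> {p..q}"
    have "((\<lambda>s. B (traj \<omega> s) *v (\<Phi> s *v x)) has_integral (\<Phi> r *v x - \<Phi> p *v x)) {p..r}"
      using pq r by (intro fundamental_solution_vec(2)[OF \<Phi>]) auto
    then have 1: "((\<lambda>s. B (X n \<omega>) *v (\<Phi> s *v x)) has_integral (\<Phi> r *v x - \<Phi> p *v x)) {p..r}"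
    proof (rule has_integral_spike_finite[where S = "{q}", rotated 2])
      fix s assume "s \<in> {p..r} - {q}"
      then have "traj \<omega> s = X n \<omega>" using r by (intro traj_eq[OF T]) (auto simp: p_def q_def)
      then show "B (X n \<omega>) *v (\<Phi> s *v x) = B (traj \<omega> s) *v (\<Phi> s *v x)" by simp
    qed auto
    have 2: "((\<lambda>s. app ?Bn (app (expm (s - p) ?Bn) (Y x n \<omega>))) has_integral
        (app (expm (r - p) ?Bn) (Y x n \<omega>) - app (expm (p - p) ?Bn) (Y x n \<omega>))) {p..r}"
    proof (rule fundamental_theorem_of_calculus)
      fix s
      have "((\<lambda>s. s - p) has_real_derivative 1) (at s within {p..r})" by (auto intro!: derivative_eq_intros)
      from vector_diff_chain_within[OF this[unfolded has_real_derivative_iff_has_vector_derivative]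
          expm_has_vector_derivative[of ?Bn "Y x n \<omega>"]]
      show "((\<lambda>s. app (expm (s - p) ?Bn) (Y x n \<omega>)) has_vector_derivative app ?Bn (app (expm (s - p) ?Bn) (Y x n \<omega>))) (at s within {p..r})"
        by (simp add: o_def)
    qed (use r in auto)
    from has_integral_diff[OF 1 2] show "((\<lambda>r. B (X n \<omega>) *v D r) has_integral (D r - D p)) {p..r}"
      by (simp add: D_def matrix_vector_mult_diff_distrib algebra_simps)
  qed (use pq a_ge in auto)
  moreover have "D p = 0" using Suc unfolding D_def p_def by simp
  ultimately have "D q = 0" by simp
  then show ?case using pq by (simp add: D_def q_def p_def Y_Suc time_Suc)
qed

text \<open>Away from a jump time the solution changes by at most the factor of Gronwall's inequality, in both directions.\<close>

lemma ln_flow: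
  assumes \<omega>: "\<omega> \<in> space \<Omega>" and T: "\<forall>k. 0 \<le> T k \<omega>" and t: "0 \<le> t" and x: "x \<noteq> 0"
  shows "Flow \<omega> t *v x \<noteq> 0"
    and "\<bar>ln (norm (Flow \<omega> t *v x)) - ln (norm (Y x n \<omega>))\<bar> \<le> ln 2 + 2 * a * \<bar>t - time n \<omega>\<bar>"
proof -
  obtain \<Phi> where \<Phi>: "fundamental_solution (\<lambda>s. B (traj \<omega> s)) \<Phi>" and F: "Flow \<omega> t = \<Phi> t"
    using ex_flow \<omega> t by metis
  have two: "norm (\<Phi> q *v x) \<le> 2 * exp (2 * a * (q - p)) * norm (\<Phi> p *v x)"
    "norm (\<Phi> p *v x) \<le> 2 * exp (2 * a * (q - p)) * norm (\<Phi> q *v x)" if "0 \<le> p" "p \<le> q" for p q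
  proof -
    have cont: "continuous_on {p..q} (\<lambda>r. \<Phi> r *v x)"
      by (rule continuous_on_subset[OF fundamental_solution_vec(1)[OF \<Phi>, where x = x]]) (use that in auto)
    have int: "((\<lambda>r. B (traj \<omega> r) *v (\<Phi> r *v x)) has_integral (\<Phi> r *v x - \<Phi> p *v x)) {p..r}" if "r \<in> {p..q}" for r
      using that \<open>0 \<le> p\<close> by (intro fundamental_solution_vec(2)[OF \<Phi>]) auto
    have a: "0 < a" using a_ge by simp
    show "norm (\<Phi> q *v x) \<le> 2 * exp (2 * a * (q - p)) * norm (\<Phi> p *v x)"
      by (rule gronwall(1)[OF \<open>p \<le> q\<close> cont int norm_B a])
    show "norm (\<Phi> p *v x) \<le> 2 * exp (2 * a * (q - p)) * norm (\<Phi> q *v x)"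
      by (rule gronwall(2)[OF \<open>p \<le> q\<close> cont int norm_B a])
  qed
  have p: "0 \<le> time n \<omega>" unfolding time_def using T by (intro sum_nonneg) auto
  have Yn: "\<Phi> (time n \<omega>) *v x = Y x n \<omega>" by (rule solution_at_jump[OF T \<Phi>])
  have ny: "0 < norm (Y x n \<omega>)" using Y_nonzero[OF x] by simp
  have le: "norm (\<Phi> t *v x) \<le> 2 * exp (2 * a * \<bar>t - time n \<omega>\<bar>) * norm (Y x n \<omega>)"
    "norm (Y x n \<omega>) \<le> 2 * exp (2 * a * \<bar>t - time n \<omega>\<bar>) * norm (\<Phi> t *v x)"
    using two[OF p, of t] two[OF t, of "time n \<omega>"] unfolding Yn by (cases "time n \<omega> \<le> t"; simp add: abs_if)+
  have nt: "0 < norm (\<Phi> t *v x)"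
  proof (rule ccontr)
    assume "\<not> 0 < norm (\<Phi> t *v x)"
    then have "norm (\<Phi> t *v x) = 0" by simp
    then show False using le(2) ny by simp
  qed
  then show "Flow \<omega> t *v x \<noteq> 0" by (simp add: F)
  have "ln (norm (\<Phi> t *v x)) \<le> ln (2 * exp (2 * a * \<bar>t - time n \<omega>\<bar>) * norm (Y x n \<omega>))"
    "ln (norm (Y x n \<omega>)) \<le> ln (2 * exp (2 * a * \<bar>t - time n \<omega>\<bar>) * norm (\<Phi> t *v x))"
    using le nt ny by (subst ln_le_cancel_iff; simp)+
  moreover have "ln (2 * exp (2 * a * \<bar>t - time n \<omega>\<bar>) * r) = ln 2 + 2 * a * \<bar>t - time n \<omega>\<bar> + ln r" if "0 < r" for r
    using that by (simp add: ln_mult)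
  ultimately show "\<bar>ln (norm (Flow \<omega> t *v x)) - ln (norm (Y x n \<omega>))\<bar> \<le> ln 2 + 2 * a * \<bar>t - time n \<omega>\<bar>"
    using nt ny unfolding F abs_le_iff by fastforce
qed

end

section \<open>Operator norms and the Lyapunov exponent\<close>

text \<open>Needed because the operator norm in the statement comes from an arbitrary norm, whereas the estimates
  use the Euclidean one; constant factors disappear in the limit \<open>t \<rightarrow> \<infinity>\<close>.\<close>

lemma is_norm_equiv:
  fixes \<nu> :: "real^'d \<Rightarrow> real"
  assumes \<nu>: "is_norm \<nu>"
  obtains c1 c2 where "0 < c1" "0 < c2" "\<And>x. c1 * norm x \<le> \<nu> x" "\<And>x. \<nu> x \<le> c2 * norm x"
proof -
  have z: "\<nu> x = 0 \<longleftrightarrow> x = 0" and sc: "\<nu> (c *\<^sub>R x) = \<bar>c\<bar> * \<nu> x" and tri: "\<nu> (x + y) \<le> \<nu> x + \<nu> y" for c x y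
    using \<nu> by (auto simp: is_norm_def)
  have nn: "0 \<le> \<nu> x" for x
    using tri[of x "- x"] sc[of "- 1" x] z[of 0] by simp
  have sum: "\<nu> (\<Sum>b\<in>S. f b) \<le> (\<Sum>b\<in>S. \<nu> (f b))" if "finite S" for S and f :: "(real^'d) \<Rightarrow> real^'d"
    using that z[of 0] by (induction S) (auto intro: order_trans[OF tri] add_left_mono)
  define c2 where "c2 = (\<Sum>b\<in>Basis. \<nu> (b :: real^'d)) + 1"
  have c2: "0 < c2" unfolding c2_def using nn by (intro add_nonneg_pos sum_nonneg) auto
  have up: "\<nu> x \<le> c2 * norm x" for x
  proof -
    have "\<nu> x = \<nu> (\<Sum>b\<in>Basis. (x \<bullet> b) *\<^sub>R b)" by (simp add: euclidean_representation)
    also have "\<dots> \<le> (\<Sum>b\<in>Basis. \<nu> ((x \<bullet> b) *\<^sub>R b))" by (rule sum) simp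
    also have "\<dots> \<le> (\<Sum>b\<in>Basis. norm x * \<nu> b)"
      unfolding sc by (intro sum_mono mult_right_mono nn Basis_le_norm)
    also have "\<dots> \<le> c2 * norm x" by (simp add: c2_def sum_distrib_left[symmetric] algebra_simps)
    finally show ?thesis .
  qed
  have lip: "\<bar>\<nu> x - \<nu> y\<bar> \<le> c2 * norm (x - y)" for x y
    using tri[of "x - y" y] tri[of "y - x" x] up[of "x - y"] up[of "y - x"] by (auto simp: norm_minus_commute abs_le_iff)
  have cont: "continuous_on UNIV \<nu>"
  proof (rule continuous_at_imp_continuous_on, intro ballI)
    fix x :: "real^'d"
    have "((\<lambda>y. c2 * norm (y - x)) \<longlongrightarrow> c2 * norm (x - x)) (at x)" by (intro tendsto_intros)
    then have "((\<lambda>y. c2 * norm (y - x)) \<longlongrightarrow> 0) (at x)" by simp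
    then have "((\<lambda>y. \<nu> y - \<nu> x) \<longlongrightarrow> 0) (at x)"
      by (rule Lim_null_comparison[rotated]) (simp add: lip)
    then show "continuous (at x) \<nu>" by (simp add: continuous_at LIM_zero_iff)
  qed
  have "(axis undefined 1 :: real^'d) \<in> sphere 0 1" by (simp add: norm_axis_1)
  then have "sphere (0 :: real^'d) 1 \<noteq> {}" by blast
  then obtain x0 where x0: "x0 \<in> sphere 0 1" "\<And>x. x \<in> sphere 0 1 \<Longrightarrow> \<nu> x0 \<le> \<nu> x"
    using continuous_attains_inf[of "sphere 0 1" \<nu>] continuous_on_subset[OF cont] by auto
  have "x0 \<noteq> 0" using x0 by auto
  then have c1: "0 < \<nu> x0" using nn[of x0] z[of x0] by linarith
  have low: "\<nu> x0 * norm x \<le> \<nu> x" for x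
  proof (cases "x = 0")
    case False
    have "\<nu> x0 \<le> \<nu> ((1 / norm x) *\<^sub>R x)" using False by (intro x0(2)) simp
    then show ?thesis using False by (simp add: sc field_simps)
  qed (use z[of 0] in simp)
  show thesis by (rule that[OF c1 c2 low up])
qed

lemma induced_norm_bounds:
  fixes \<nu> :: "real^'d \<Rightarrow> real"
  assumes \<nu>: "is_norm \<nu>"
  obtains c C where "0 < c" "0 < C" "\<And>M x. c * norm (M *v x) \<le> induced_norm \<nu> M * norm x"
    "\<And>M. induced_norm \<nu> M \<le> C * (\<Sum>b\<in>Basis. norm (M *v b))"
    "\<And>M N. induced_norm \<nu> (M + N) \<le> induced_norm \<nu> M + induced_norm \<nu> N"
proof -
  obtain c1 c2 where c: "0 < c1" "0 < c2" "\<And>x. c1 * norm x \<le> \<nu> x" "\<And>x. \<nu> x \<le> c2 * norm x"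
    using is_norm_equiv[OF \<nu>] by metis
  have tri: "\<nu> (x + y) \<le> \<nu> x + \<nu> y" for x y using \<nu> by (auto simp: is_norm_def)
  have nn: "0 \<le> \<nu> x" for x using c by (meson mult_nonneg_nonneg norm_ge_zero order_trans less_imp_le)
  have Mx: "norm (M *v x) \<le> norm x * (\<Sum>b\<in>Basis. norm (M *v b))" for M :: "real^'d^'d" and x
  proof -
    have "M *v x = M *v (\<Sum>b\<in>Basis. (x \<bullet> b) *\<^sub>R b)" by (simp add: euclidean_representation)
    also have "\<dots> = (\<Sum>b\<in>Basis. (x \<bullet> b) *\<^sub>R (M *v b))" by (simp add: linear_sum linear_scale)
    also have "norm \<dots> \<le> (\<Sum>b\<in>Basis. norm x * norm (M *v b))"
      by (rule sum_norm_le) (auto intro!: mult_right_mono Basis_le_norm)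
    finally show ?thesis by (simp add: sum_distrib_left)
  qed
  have quot: "\<nu> (M *v x) / \<nu> x \<le> c2 / c1 * (\<Sum>b\<in>Basis. norm (M *v b))" for M x
  proof (cases "x = 0")
    case True
    have "\<nu> 0 = 0" using \<nu> by (auto simp: is_norm_def)
    then show ?thesis using True c by (simp add: sum_nonneg)
  next
    case False
    have px: "0 < c1 * norm x" "c1 * norm x \<le> \<nu> x" using False c(1) c(3)[of x] by simp_all
    have "\<nu> (M *v x) / \<nu> x \<le> \<nu> (M *v x) / (c1 * norm x)" using px nn c(1) by (intro divide_left_mono mult_pos_pos) auto
    also have "\<dots> \<le> (c2 * (norm x * (\<Sum>b\<in>Basis. norm (M *v b)))) / (c1 * norm x)"
      using px c by (intro divide_right_mono order_trans[OF c(4)] mult_left_mono Mx) auto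
    finally show ?thesis using False by simp
  qed
  have bdd: "bdd_above (range (\<lambda>x. \<nu> (M *v x) / \<nu> x))" for M
    using quot[of M] by (intro bdd_aboveI2)
  have le: "\<nu> (M *v x) / \<nu> x \<le> induced_norm \<nu> M" for M x
    unfolding induced_norm_def by (rule cSUP_upper[OF _ bdd]) simp
  show thesis
  proof (rule that)
    show "0 < c1 / c2" "0 < c2 / c1" using c by auto
    show "induced_norm \<nu> M \<le> c2 / c1 * (\<Sum>b\<in>Basis. norm (M *v b))" for M
      unfolding induced_norm_def by (rule cSUP_least) (simp, rule quot)
    show "induced_norm \<nu> (M + N) \<le> induced_norm \<nu> M + induced_norm \<nu> N" for M N
      unfolding induced_norm_def[of \<nu> "M + N"]
    proof (rule cSUP_least)
      fix x
      have "\<nu> ((M + N) *v x) / \<nu> x \<le> (\<nu> (M *v x) + \<nu> (N *v x)) / \<nu> x"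
        using nn tri by (intro divide_right_mono) (auto simp: matrix_vector_mult_add_rdistrib)
      then show "\<nu> ((M + N) *v x) / \<nu> x \<le> induced_norm \<nu> M + induced_norm \<nu> N"
        using le[of M x] le[of N x] by (simp add: add_divide_distrib)
    qed simp
    show "c1 / c2 * norm (M *v x) \<le> induced_norm \<nu> M * norm x" for M x
    proof (cases "x = 0")
      case False
      have px: "0 < \<nu> x" using c(1) c(3)[of x] False by (meson less_le_trans mult_pos_pos zero_less_norm_iff)
      have "c1 * norm (M *v x) \<le> \<nu> (M *v x)" by (rule c)
      also have "\<dots> \<le> induced_norm \<nu> M * \<nu> x" using le[of M x] px by (simp add: field_simps)
      also have "\<dots> \<le> induced_norm \<nu> M * (c2 * norm x)"
      proof (rule mult_left_mono[OF c(4)])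
        show "0 \<le> induced_norm \<nu> M" using order_trans[OF _ le[of M x]] nn px by simp
      qed
      finally show ?thesis using c by (simp add: field_simps)
    qed simp
  qed
qed

lemma induced_norm_measurable:
  fixes \<nu> :: "real^'d \<Rightarrow> real"
  assumes \<nu>: "is_norm \<nu>" shows "induced_norm \<nu> \<in> borel_measurable borel"
proof -
  obtain c C where C: "0 < C" "\<And>M. induced_norm \<nu> M \<le> C * (\<Sum>b\<in>Basis. norm (M *v b))"
    and tri: "\<And>M N. induced_norm \<nu> (M + N) \<le> induced_norm \<nu> M + induced_norm \<nu> N"
    using induced_norm_bounds[OF \<nu>] by metis
  have "continuous_on UNIV (induced_norm \<nu>)"
  proof (rule continuous_at_imp_continuous_on, intro ballI)
    fix M :: "real^'d^'d"
    have cM: "continuous_on UNIV (\<lambda>Z :: real^'d^'d. Z *v b)" for b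
      using linear_matrix_vector_left by (intro linear_continuous_on) (simp add: linear_conv_bounded_linear)
    have "((\<lambda>N. C * (\<Sum>b\<in>Basis. norm (N *v b - M *v b))) \<longlongrightarrow> C * (\<Sum>b\<in>Basis. norm (M *v b - M *v b))) (at M)"
      using cM by (intro tendsto_intros) (auto simp: continuous_on_def)
    then have lim: "((\<lambda>N. C * (\<Sum>b\<in>Basis. norm (N *v b - M *v b))) \<longlongrightarrow> 0) (at M)" by simp
    have "\<bar>induced_norm \<nu> N - induced_norm \<nu> M\<bar> \<le> C * (\<Sum>b\<in>Basis. norm (N *v b - M *v b))" for N
      using tri[of "N - M" M] tri[of "M - N" N] C(2)[of "N - M"] C(2)[of "M - N"]
      by (auto simp: matrix_vector_mult_diff_rdistrib norm_minus_commute[of "M *v _"] abs_le_iff)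
    then have "((\<lambda>N. induced_norm \<nu> N - induced_norm \<nu> M) \<longlongrightarrow> 0) (at M)"
      by (intro Lim_null_comparison[OF _ lim]) simp
    then show "continuous (at M) (induced_norm \<nu>)" by (simp add: continuous_at LIM_zero_iff)
  qed
  then show ?thesis by (rule borel_measurable_continuous_onI)
qed

context matrix_switched_process
begin

definition log_norm :: "(real^'d \<Rightarrow> real) \<Rightarrow> real \<Rightarrow> 'w \<Rightarrow> real" where
  "log_norm \<nu> t \<omega> = ln (induced_norm \<nu> (Flow \<omega> t))"

text \<open>The operator norm is at least the norm of a single image and at most a multiple of the sum over the basis. The
  sum, unlike a maximum, has an expectation that is the sum of expectations.\<close>

lemma log_norm_bounds:
  assumes \<nu>: "is_norm \<nu>"
  obtains c where "0 \<le> c"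
    "\<And>\<omega> t n x. \<omega> \<in> space \<Omega> \<Longrightarrow> \<forall>k. 0 \<le> T k \<omega> \<Longrightarrow> 0 \<le> t \<Longrightarrow> norm x = 1 \<Longrightarrow>
      ln (norm (Y x n \<omega>)) - c - 2 * a * \<bar>t - time n \<omega>\<bar> \<le> log_norm \<nu> t \<omega>"
    "\<And>\<omega> t n. \<omega> \<in> space \<Omega> \<Longrightarrow> \<forall>k. 0 \<le> T k \<omega> \<Longrightarrow> 0 \<le> t \<Longrightarrow>
      log_norm \<nu> t \<omega> \<le> ln (\<Sum>b\<in>Basis. norm (Y b n \<omega>)) + c + 2 * a * \<bar>t - time n \<omega>\<bar>"
proof -
  obtain c C where cC: "0 < c" "0 < C" and low: "\<And>M x. c * norm (M *v x) \<le> induced_norm \<nu> M * norm x"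
    and up: "\<And>M. induced_norm \<nu> M \<le> C * (\<Sum>b\<in>Basis. norm (M *v b))"
    using induced_norm_bounds[OF \<nu>] by metis
  define k where "k = \<bar>ln c\<bar> + \<bar>ln C\<bar> + ln 2"
  have lower: "ln (norm (Y x n \<omega>)) - k - 2 * a * \<bar>t - time n \<omega>\<bar> \<le> log_norm \<nu> t \<omega>" and pos: "0 < induced_norm \<nu> (Flow \<omega> t)"
    if \<omega>: "\<omega> \<in> space \<Omega>" "\<forall>k. 0 \<le> T k \<omega>" "0 \<le> t" and x: "norm x = 1" for \<omega> t n x
  proof -
    have x0: "x \<noteq> 0" using x by auto
    have f: "0 < norm (Flow \<omega> t *v x)" using ln_flow(1)[OF \<omega> x0] by simp
    have le: "c * norm (Flow \<omega> t *v x) \<le> induced_norm \<nu> (Flow \<omega> t)" using low[of "Flow \<omega> t" x] x by simp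
    then show "0 < induced_norm \<nu> (Flow \<omega> t)" using f cC by (meson less_le_trans mult_pos_pos)
    have "ln (c * norm (Flow \<omega> t *v x)) \<le> log_norm \<nu> t \<omega>"
    proof -
      have p: "0 < c * norm (Flow \<omega> t *v x)" using f cC by simp
      then have "0 < induced_norm \<nu> (Flow \<omega> t)" using le by linarith
      then show ?thesis unfolding log_norm_def using p le by (subst ln_le_cancel_iff)
    qed
    then have "ln c + ln (norm (Flow \<omega> t *v x)) \<le> log_norm \<nu> t \<omega>" using f cC by (simp add: ln_mult)
    then show "ln (norm (Y x n \<omega>)) - k - 2 * a * \<bar>t - time n \<omega>\<bar> \<le> log_norm \<nu> t \<omega>"
      using ln_flow(2)[OF \<omega> x0, of n] unfolding k_def by linarith
  qed
  obtain b0 :: "real^'d" where b0: "b0 \<in> Basis" using nonempty_Basis by blast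
  show thesis
  proof (rule that[of k])
    show "0 \<le> k" by (simp add: k_def)
    show "ln (norm (Y x n \<omega>)) - k - 2 * a * \<bar>t - time n \<omega>\<bar> \<le> log_norm \<nu> t \<omega>"
      if \<omega>: "\<omega> \<in> space \<Omega>" "\<forall>k. 0 \<le> T k \<omega>" "0 \<le> t" and x: "norm x = 1" for \<omega> t n x
      by (rule lower[OF that])
    fix \<omega> and t :: real and n assume \<omega>: "\<omega> \<in> space \<Omega>" "\<forall>k. 0 \<le> T k \<omega>" "0 \<le> t"
    define e where "e = 2 * exp (2 * a * \<bar>t - time n \<omega>\<bar>)"
    have S: "0 < (\<Sum>b\<in>Basis. norm (Y b n \<omega>))"
      using Y_nonzero[OF nonzero_Basis] by (intro sum_pos) (auto simp: zero_less_norm_iff)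
    have "norm (Flow \<omega> t *v b) \<le> e * norm (Y b n \<omega>)" if "b \<in> Basis" for b
    proof -
      have b: "b \<noteq> 0" using that by auto
      have n: "0 < norm (Flow \<omega> t *v b)" "0 < norm (Y b n \<omega>)" using ln_flow(1)[OF \<omega> b] Y_nonzero[OF b] by auto
      have "ln (norm (Flow \<omega> t *v b)) \<le> ln (e * norm (Y b n \<omega>))"
        using ln_flow(2)[OF \<omega> b, of n] n by (simp add: e_def ln_mult abs_le_iff)
      then show ?thesis using n by (subst (asm) ln_le_cancel_iff) (auto simp: e_def)
    qed
    then have "(\<Sum>b\<in>Basis. norm (Flow \<omega> t *v b)) \<le> e * (\<Sum>b\<in>Basis. norm (Y b n \<omega>))"
      unfolding sum_distrib_left by (intro sum_mono)
    then have "induced_norm \<nu> (Flow \<omega> t) \<le> C * (e * (\<Sum>b\<in>Basis. norm (Y b n \<omega>)))"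
      using up[of "Flow \<omega> t"] cC by (elim order_trans) (intro mult_left_mono, auto)
    then have "log_norm \<nu> t \<omega> \<le> ln (C * (e * (\<Sum>b\<in>Basis. norm (Y b n \<omega>))))"
      unfolding log_norm_def using pos[OF \<omega>, of b0] b0 S cC by (subst ln_le_cancel_iff) (auto simp: e_def)
    also have "\<dots> = ln C + (ln 2 + 2 * a * \<bar>t - time n \<omega>\<bar> + ln (\<Sum>b\<in>Basis. norm (Y b n \<omega>)))"
      using S cC by (simp add: ln_mult e_def)
    finally show "log_norm \<nu> t \<omega> \<le> ln (\<Sum>b\<in>Basis. norm (Y b n \<omega>)) + k + 2 * a * \<bar>t - time n \<omega>\<bar>"
      unfolding k_def by linarith
  qed
qed

lemma log_norm_integrable:
  assumes \<nu>: "is_norm \<nu>" and t: "0 \<le> t" shows "integrable \<Omega> (log_norm \<nu> t)"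
proof (rule log_norm_bounds[OF \<nu>])
  fix c :: real
  assume c: "0 \<le> c"
    "\<And>\<omega> t n x. \<omega> \<in> space \<Omega> \<Longrightarrow> \<forall>k. 0 \<le> T k \<omega> \<Longrightarrow> 0 \<le> t \<Longrightarrow> norm x = 1 \<Longrightarrow>
      ln (norm (Y x n \<omega>)) - c - 2 * a * \<bar>t - time n \<omega>\<bar> \<le> log_norm \<nu> t \<omega>"
    "\<And>\<omega> t n. \<omega> \<in> space \<Omega> \<Longrightarrow> \<forall>k. 0 \<le> T k \<omega> \<Longrightarrow> 0 \<le> t \<Longrightarrow>
      log_norm \<nu> t \<omega> \<le> ln (\<Sum>b\<in>Basis. norm (Y b n \<omega>)) + c + 2 * a * \<bar>t - time n \<omega>\<bar>"
  obtain b0 :: "real^'d" where b0: "b0 \<in> Basis" using nonempty_Basis by blast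
  \<comment> \<open>At the jump number \<open>0\<close> the comparison holds with the initial vectors.\<close>
  define G where "G = \<bar>ln (real DIM(real^'d))\<bar> + c + 2 * a * t"
  show ?thesis
  proof (rule Bochner_Integration.integrable_bound)
    show "integrable \<Omega> (\<lambda>\<omega>. G)" by simp
    show "log_norm \<nu> t \<in> borel_measurable \<Omega>"
      unfolding log_norm_def[abs_def]
      by (rule borel_measurable_ln, rule measurable_compose[OF Flow_measurable[OF t] induced_norm_measurable[OF \<nu>]])
    show "AE \<omega> in \<Omega>. norm (log_norm \<nu> t \<omega>) \<le> norm G"
      using AE_T_nonneg AE_space
    proof eventually_elim
      case (elim \<omega>)
      have "- c - 2 * a * t \<le> log_norm \<nu> t \<omega>"
        using c(2)[OF elim(2,1) t, of b0 0] b0 t by (simp add: time_def)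
      moreover have "log_norm \<nu> t \<omega> \<le> ln (real DIM(real^'d)) + c + 2 * a * t"
        using c(3)[OF elim(2,1) t, of 0] t by (simp add: time_def)
      moreover have "0 \<le> 2 * a * t" using a_ge t by simp
      moreover have "0 \<le> ln (real DIM(real^'d))" by (simp add: Suc_leI)
      ultimately show ?case unfolding G_def real_norm_def using c(1) by linarith
    qed
  qed
qed

lemma time_deviation_block:
  assumes t: "0 \<le> t" and m: "0 < m"
  defines "b \<equiv> nat \<lfloor>t / (real m * \<epsilon>)\<rfloor>"
  shows "real b * (real m * \<epsilon>) \<le> t" "t - real m * \<epsilon> \<le> real b * (real m * \<epsilon>)"
    and "integrable \<Omega> (\<lambda>\<omega>. \<bar>t - time (b * m) \<omega>\<bar>)"
    and "expectation (\<lambda>\<omega>. \<bar>t - time (b * m) \<omega>\<bar>) \<le> real m * \<epsilon> + sqrt (t * \<epsilon>)"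
proof -
  have me: "0 < real m * \<epsilon>" using m \<epsilon>_pos by simp
  have b: "real b \<le> t / (real m * \<epsilon>)" "t / (real m * \<epsilon>) - 1 \<le> real b"
    using t me of_int_floor_le[of "t / (real m * \<epsilon>)"] real_of_int_floor_gt_diff_one[of "t / (real m * \<epsilon>)"]
    by (auto simp: b_def)
  show b1: "real b * (real m * \<epsilon>) \<le> t" using b(1) me by (simp add: pos_le_divide_eq)
  have "(t / (real m * \<epsilon>) - 1) * (real m * \<epsilon>) \<le> real b * (real m * \<epsilon>)" using b(2) me by (intro mult_right_mono) auto
  moreover have "(t / (real m * \<epsilon>) - 1) * (real m * \<epsilon>) = t - real m * \<epsilon>" using me m \<epsilon>_pos by (simp add: left_diff_distrib)
  ultimately show b2: "t - real m * \<epsilon> \<le> real b * (real m * \<epsilon>)" by simp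
  show i: "integrable \<Omega> (\<lambda>\<omega>. \<bar>t - time (b * m) \<omega>\<bar>)" using time_integrable by auto
  have "expectation (\<lambda>\<omega>. \<bar>t - time (b * m) \<omega>\<bar>) \<le> expectation (\<lambda>\<omega>. real m * \<epsilon> + \<bar>time (b * m) \<omega> - real (b * m) * \<epsilon>\<bar>)"
  proof (rule integral_mono[OF i])
    show "integrable \<Omega> (\<lambda>\<omega>. real m * \<epsilon> + \<bar>time (b * m) \<omega> - real (b * m) * \<epsilon>\<bar>)" using time_integrable by auto
    show "\<bar>t - time (b * m) \<omega>\<bar> \<le> real m * \<epsilon> + \<bar>time (b * m) \<omega> - real (b * m) * \<epsilon>\<bar>" for \<omega>
      using b1 b2 by (simp add: mult.assoc)
  qed
  also have "\<dots> = real m * \<epsilon> + expectation (\<lambda>\<omega>. \<bar>time (b * m) \<omega> - real (b * m) * \<epsilon>\<bar>)"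
    using time_integrable by (simp add: prob_space)
  also have "\<dots> \<le> real m * \<epsilon> + sqrt (real (b * m)) * \<epsilon>" by (intro add_left_mono time_deviation)
  also have "sqrt (real (b * m)) * \<epsilon> = sqrt (real b * (real m * \<epsilon>) * \<epsilon>)"
    using \<epsilon>_pos by (simp add: real_sqrt_mult mult.assoc)
  also have "\<dots> \<le> sqrt (t * \<epsilon>)" using b1 \<epsilon>_pos by (intro real_sqrt_le_mono mult_right_mono) auto
  finally show "expectation (\<lambda>\<omega>. \<bar>t - time (b * m) \<omega>\<bar>) \<le> real m * \<epsilon> + sqrt (t * \<epsilon>)" by simp
qed

lemma affine_sqrt_limit: "((\<lambda>t::real. 1 / t * (L * t + c + d * sqrt t)) \<longlongrightarrow> L) at_top"
proof -
  have "((\<lambda>t::real. L + c * inverse t + d * inverse (sqrt t)) \<longlongrightarrow> L + c * 0 + d * 0) at_top"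
    by (intro tendsto_intros tendsto_inverse_0_at_top filterlim_ident sqrt_at_top)
  moreover have "\<forall>\<^sub>F t in at_top. L + c * inverse t + d * inverse (sqrt t) = 1 / t * (L * t + c + d * sqrt t)"
    using eventually_gt_at_top[of 0]
  proof eventually_elim
    case (elim t)
    have "sqrt t * sqrt t = t" using elim by simp
    then show ?case using elim by (simp add: field_simps)
  qed
  ultimately show ?thesis by (auto elim: Lim_transform_eventually)
qed

text \<open>Jensen's inequality, in the form \<open>ln Z \<le> ln g + Z / g - 1\<close> where \<open>g\<close> is the bound for the mean of \<open>Z\<close>.\<close>

lemma lyapunov_exponent_le:
  assumes \<nu>: "is_norm \<nu>" and m: "0 < m"
    and growth: "\<And>b x. E \<epsilon> (b * m) (\<lambda>y. ennreal (norm y)) x \<le> ennreal (exp (\<gamma> * (real (b * m) * \<epsilon>)) * norm x)"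
  shows "lyapunov_exponent \<nu> B \<Omega> X T \<le> ereal \<gamma>"
proof (rule log_norm_bounds[OF \<nu>])
  fix c :: real
  assume c: "0 \<le> c"
    "\<And>\<omega> t n. \<omega> \<in> space \<Omega> \<Longrightarrow> \<forall>k. 0 \<le> T k \<omega> \<Longrightarrow> 0 \<le> t \<Longrightarrow>
      log_norm \<nu> t \<omega> \<le> ln (\<Sum>b\<in>Basis. norm (Y b n \<omega>)) + c + 2 * a * \<bar>t - time n \<omega>\<bar>"
  let ?d = "real DIM(real^'d)"
  define k where "k = ln ?d + \<bar>\<gamma>\<bar> * (real m * \<epsilon>) + c + 2 * a * (real m * \<epsilon>)"
  have d: "0 < ?d" by simp
  have main: "expectation (log_norm \<nu> t) \<le> \<gamma> * t + k + 2 * a * sqrt \<epsilon> * sqrt t" if t: "0 \<le> t" for t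
  proof -
    define b where "b = nat \<lfloor>t / (real m * \<epsilon>)\<rfloor>"
    note tb = time_deviation_block[OF t m, folded b_def]
    define n where "n = b * m"
    define Z where "Z = (\<lambda>\<omega>. \<Sum>b\<in>(Basis :: (real^'d) set). norm (Y b n \<omega>))"
    define g where "g = ?d * exp (\<gamma> * (real n * \<epsilon>))"
    have g: "0 < g" using d by (simp add: g_def)
    have EY: "integrable \<Omega> (\<lambda>\<omega>. norm (Y x n \<omega>))" "expectation (\<lambda>\<omega>. norm (Y x n \<omega>)) \<le> exp (\<gamma> * (real n * \<epsilon>)) * norm x" for x
    proof -
      have nn: "(\<integral>\<^sup>+\<omega>. ennreal (norm (Y x n \<omega>)) \<partial>\<Omega>) \<le> ennreal (exp (\<gamma> * (real n * \<epsilon>)) * norm x)"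
        using expectation_Y[of "\<lambda>y. ennreal (norm y)" x n] growth[of b x] by (simp add: n_def)
      show i: "integrable \<Omega> (\<lambda>\<omega>. norm (Y x n \<omega>))"
        using nn by (intro integrableI_nonneg) (auto simp: le_less_trans[OF _ ennreal_less_top])
      show "expectation (\<lambda>\<omega>. norm (Y x n \<omega>)) \<le> exp (\<gamma> * (real n * \<epsilon>)) * norm x"
        using nn by (subst (asm) nn_integral_eq_integral[OF i]) (auto simp: ennreal_le_iff)
    qed
    have Zi: "integrable \<Omega> Z" unfolding Z_def by (intro Bochner_Integration.integrable_sum EY)
    have EZ: "expectation Z \<le> g"
    proof -
      have "expectation Z = (\<Sum>b\<in>Basis. expectation (\<lambda>\<omega>. norm (Y (b :: real^'d) n \<omega>)))"
        unfolding Z_def by (rule Bochner_Integration.integral_sum) (rule EY)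
      also have "\<dots> \<le> (\<Sum>b\<in>(Basis :: (real^'d) set). exp (\<gamma> * (real n * \<epsilon>)))"
      proof (rule sum_mono)
        fix b :: "real^'d" assume "b \<in> Basis"
        then show "expectation (\<lambda>\<omega>. norm (Y b n \<omega>)) \<le> exp (\<gamma> * (real n * \<epsilon>))"
          using EY(2)[of b] by simp
      qed
      finally show ?thesis by (simp add: g_def)
    qed
    have "expectation (log_norm \<nu> t) \<le> expectation (\<lambda>\<omega>. (ln g + (Z \<omega> / g - 1)) + c + 2 * a * \<bar>t - time n \<omega>\<bar>)"
    proof (rule integral_mono_AE)
      show "integrable \<Omega> (log_norm \<nu> t)" by (rule log_norm_integrable[OF \<nu> t])
      show "integrable \<Omega> (\<lambda>\<omega>. (ln g + (Z \<omega> / g - 1)) + c + 2 * a * \<bar>t - time n \<omega>\<bar>)" using Zi tb(3) by (auto simp: n_def)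
      show "AE \<omega> in \<Omega>. log_norm \<nu> t \<omega> \<le> (ln g + (Z \<omega> / g - 1)) + c + 2 * a * \<bar>t - time n \<omega>\<bar>"
        using AE_T_nonneg AE_space
      proof eventually_elim
        case (elim \<omega>)
        have Z0: "0 < Z \<omega>" unfolding Z_def using Y_nonzero[OF nonzero_Basis] by (intro sum_pos) (auto simp: zero_less_norm_iff)
        have "ln (Z \<omega> / g) \<le> Z \<omega> / g - 1" using Z0 g by (intro ln_le_minus_one) auto
        then have "ln (Z \<omega>) \<le> ln g + (Z \<omega> / g - 1)" using Z0 g by (simp add: ln_div)
        then show ?case using c(2)[OF elim(2,1) t, of n] by (simp add: Z_def)
      qed
    qed
    also have "\<dots> = ln g + (expectation Z / g - 1) + c + 2 * a * expectation (\<lambda>\<omega>. \<bar>t - time n \<omega>\<bar>)"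
      using Zi tb(3) by (simp add: prob_space n_def)
    also have "\<dots> \<le> ln g + 0 + c + 2 * a * (real m * \<epsilon> + sqrt (t * \<epsilon>))"
      using EZ g tb(4) a_ge by (intro add_mono mult_left_mono order_refl) (auto simp: n_def)
    also have "ln g \<le> ln ?d + (\<gamma> * t + \<bar>\<gamma>\<bar> * (real m * \<epsilon>))"
    proof -
      have nt: "real n * \<epsilon> \<le> t" "t - real m * \<epsilon> \<le> real n * \<epsilon>" using tb(1,2) by (simp_all add: n_def mult.assoc)
      have "\<gamma> * (real n * \<epsilon> - t) \<le> \<bar>\<gamma>\<bar> * \<bar>real n * \<epsilon> - t\<bar>" by (metis abs_ge_self abs_mult)
      also have "\<dots> \<le> \<bar>\<gamma>\<bar> * (real m * \<epsilon>)" using nt by (intro mult_left_mono) auto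
      finally have "\<gamma> * (real n * \<epsilon>) \<le> \<gamma> * t + \<bar>\<gamma>\<bar> * (real m * \<epsilon>)" by (simp add: right_diff_distrib)
      then show ?thesis using d by (simp add: g_def ln_mult)
    qed
    finally show ?thesis using t \<epsilon>_pos by (simp add: k_def real_sqrt_mult algebra_simps)
  qed
  have "lyapunov_exponent \<nu> B \<Omega> X T \<le> Limsup at_top (\<lambda>t. ereal (1 / t * (\<gamma> * t + k + 2 * a * sqrt \<epsilon> * sqrt t)))"
    unfolding lyapunov_exponent_def
  proof (rule Limsup_mono)
    show "\<forall>\<^sub>F t in at_top. ereal (1 / t * (LINT \<omega>|\<Omega>. ln (induced_norm \<nu> (Flow \<omega> t)))) \<le> ereal (1 / t * (\<gamma> * t + k + 2 * a * sqrt \<epsilon> * sqrt t))"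
      using eventually_gt_at_top[of 0]
    proof eventually_elim
      case (elim t)
      then show ?case using main[of t] by (simp add: log_norm_def[abs_def] divide_right_mono)
    qed
  qed
  also have "\<dots> = ereal \<gamma>"
    by (rule lim_imp_Limsup, simp, rule tendsto_ereal, rule affine_sqrt_limit)
  finally show ?thesis .
qed

text \<open>Logarithms are summed over blocks, and the time of the last complete block is close to \<open>t\<close> in mean.\<close>

lemma lyapunov_exponent_ge:
  assumes \<nu>: "is_norm \<nu>" and m: "0 < m" and \<eta>: "0 < \<eta>"
    and rare: "\<And>b x. b0 \<le> b \<Longrightarrow> E \<epsilon> (b * m) (\<lambda>y. P \<epsilon> m {y'. norm y' < exp (\<gamma> * (real m * \<epsilon>)) * norm y} y) x \<le> ennreal (\<eta>^2)"
  defines "V \<equiv> 2 * (\<gamma> * (real m * \<epsilon>))^2 + 4 * (a * (real m * \<epsilon>))^2 + 1"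
  shows "ereal (\<gamma> - V * \<eta> / (real m * \<epsilon>)) \<le> lyapunov_exponent \<nu> B \<Omega> X T"
proof (rule log_norm_bounds[OF \<nu>])
  fix c :: real
  assume c: "0 \<le> c"
    "\<And>\<omega> t n x. \<omega> \<in> space \<Omega> \<Longrightarrow> \<forall>k. 0 \<le> T k \<omega> \<Longrightarrow> 0 \<le> t \<Longrightarrow> norm x = 1 \<Longrightarrow>
      ln (norm (Y x n \<omega>)) - c - 2 * a * \<bar>t - time n \<omega>\<bar> \<le> log_norm \<nu> t \<omega>"
  obtain x :: "real^'d" where x: "norm x = 1" using nonempty_Basis norm_Basis by blast
  then have x0: "x \<noteq> 0" by auto
  have V: "0 \<le> V" by (simp add: V_def)
  have me: "0 < real m * \<epsilon>" using m \<epsilon>_pos by simp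
  define k where "k = \<bar>\<gamma>\<bar> * (real m * \<epsilon>) + V * real b0 + c + 2 * a * (real m * \<epsilon>)"
  define L where "L = \<gamma> - V * \<eta> / (real m * \<epsilon>)"
  have main: "L * t + (- k) + (- 2 * a * sqrt \<epsilon>) * sqrt t \<le> expectation (log_norm \<nu> t)" if t: "0 \<le> t" for t
  proof -
    define b where "b = nat \<lfloor>t / (real m * \<epsilon>)\<rfloor>"
    note tb = time_deviation_block[OF t m, folded b_def]
    have "\<gamma> * t - \<bar>\<gamma>\<bar> * (real m * \<epsilon>) \<le> real b * (\<gamma> * (real m * \<epsilon>))"
    proof -
      have "\<gamma> * (t - real b * (real m * \<epsilon>)) \<le> \<bar>\<gamma>\<bar> * \<bar>t - real b * (real m * \<epsilon>)\<bar>" by (metis abs_ge_self abs_mult)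
      also have "\<dots> \<le> \<bar>\<gamma>\<bar> * (real m * \<epsilon>)" using tb(1,2) by (intro mult_left_mono) auto
      finally show ?thesis by (simp add: algebra_simps)
    qed
    moreover have "V * (real b0 + \<eta> * real b) \<le> V * real b0 + V * \<eta> / (real m * \<epsilon>) * t"
    proof -
      have "real b \<le> t / (real m * \<epsilon>)" using tb(1) me by (simp add: pos_le_divide_eq)
      then have "V * \<eta> * real b \<le> V * \<eta> * (t / (real m * \<epsilon>))" using V \<eta> by (intro mult_left_mono) auto
      then show ?thesis by (simp add: algebra_simps)
    qed
    moreover have "ln (norm x) + real b * (\<gamma> * (real m * \<epsilon>)) - V * (real b0 + \<eta> * real b) \<le> expectation (\<lambda>\<omega>. ln (norm (Y x (b * m) \<omega>)))"
      unfolding V_def by (rule expected_log_lower[OF x0 m \<eta> rare])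
    ultimately have 1: "L * t - \<bar>\<gamma>\<bar> * (real m * \<epsilon>) - V * real b0 \<le> expectation (\<lambda>\<omega>. ln (norm (Y x (b * m) \<omega>)))"
      using x unfolding L_def by (simp add: left_diff_distrib)
    have "expectation (\<lambda>\<omega>. ln (norm (Y x (b * m) \<omega>)) - c - 2 * a * \<bar>t - time (b * m) \<omega>\<bar>) \<le> expectation (log_norm \<nu> t)"
    proof (rule integral_mono_AE)
      show "integrable \<Omega> (log_norm \<nu> t)" by (rule log_norm_integrable[OF \<nu> t])
      show "integrable \<Omega> (\<lambda>\<omega>. ln (norm (Y x (b * m) \<omega>)) - c - 2 * a * \<bar>t - time (b * m) \<omega>\<bar>)"
        using ln_Y_integrable[OF x0] tb(3) by auto
      show "AE \<omega> in \<Omega>. ln (norm (Y x (b * m) \<omega>)) - c - 2 * a * \<bar>t - time (b * m) \<omega>\<bar> \<le> log_norm \<nu> t \<omega>"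
        using AE_T_nonneg AE_space by eventually_elim (rule c(2)[OF _ _ t x])
    qed
    also have "expectation (\<lambda>\<omega>. ln (norm (Y x (b * m) \<omega>)) - c - 2 * a * \<bar>t - time (b * m) \<omega>\<bar>)
      = expectation (\<lambda>\<omega>. ln (norm (Y x (b * m) \<omega>))) - c - 2 * a * expectation (\<lambda>\<omega>. \<bar>t - time (b * m) \<omega>\<bar>)"
      using ln_Y_integrable[OF x0, of "b * m"] tb(3) by (simp add: prob_space)
    finally have 2: "expectation (\<lambda>\<omega>. ln (norm (Y x (b * m) \<omega>))) - c - 2 * a * expectation (\<lambda>\<omega>. \<bar>t - time (b * m) \<omega>\<bar>)
        \<le> expectation (log_norm \<nu> t)" .
    have "2 * a * expectation (\<lambda>\<omega>. \<bar>t - time (b * m) \<omega>\<bar>) \<le> 2 * a * (real m * \<epsilon> + sqrt (t * \<epsilon>))"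
      using tb(4) a_ge by (intro mult_left_mono) auto
    then show ?thesis using 1 2 t \<epsilon>_pos by (simp add: k_def real_sqrt_mult algebra_simps)
  qed
  have "ereal L = Liminf at_top (\<lambda>t. ereal (1 / t * (L * t + (- k) + (- 2 * a * sqrt \<epsilon>) * sqrt t)))"
    by (rule lim_imp_Liminf[symmetric], simp, rule tendsto_ereal, rule affine_sqrt_limit)
  also have "\<dots> \<le> Liminf at_top (\<lambda>t. ereal (1 / t * (LINT \<omega>|\<Omega>. ln (induced_norm \<nu> (Flow \<omega> t)))))"
  proof (rule Liminf_mono)
    show "\<forall>\<^sub>F t in at_top. ereal (1 / t * (L * t + (- k) + (- 2 * a * sqrt \<epsilon>) * sqrt t)) \<le> ereal (1 / t * (LINT \<omega>|\<Omega>. ln (induced_norm \<nu> (Flow \<omega> t))))"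
      using eventually_gt_at_top[of 0]
    proof eventually_elim
      case (elim t)
      then have "1 / t * (L * t + (- k) + (- 2 * a * sqrt \<epsilon>) * sqrt t) \<le> 1 / t * expectation (log_norm \<nu> t)"
        by (intro mult_left_mono main) auto
      then show ?case by (simp only: log_norm_def[abs_def] ereal_less_eq)
    qed
  qed
  also have "\<dots> \<le> Limsup at_top (\<lambda>t. ereal (1 / t * (LINT \<omega>|\<Omega>. ln (induced_norm \<nu> (Flow \<omega> t)))))"
    by (rule Liminf_le_Limsup) simp
  finally show ?thesis unfolding lyapunov_exponent_def L_def .
qed

end

section \<open>Spectral projections\<close>

lemma app_expm_sums: "(\<lambda>n. ((t ^ n) /\<^sub>R fact n) *\<^sub>R app (A ^ n) x) sums app (expm t A) x"
proof -
  have "(\<lambda>n. app ((t *\<^sub>R A) ^ n /\<^sub>R fact n) x) sums app (expm t A) x"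
    by (rule bounded_linear.sums[OF app.bounded_linear_left exp_converges])
  then show ?thesis by (simp add: app_simps scaleR_power)
qed

lemma subspace_growth:
  fixes G :: "real \<Rightarrow> 'a::euclidean_space endo" and g :: "real \<Rightarrow> real"
  shows "subspace {x. \<exists>C. \<forall>t\<in>I. norm (app (G t) x) \<le> C * g t}"
  unfolding subspace_def
proof (intro conjI allI ballI CollectI)
  show "\<exists>C. \<forall>t\<in>I. norm (app (G t) 0) \<le> C * g t"
    by (intro exI[of _ 0]) (simp add: app_simps)
  fix x assume "x \<in> {x. \<exists>C. \<forall>t\<in>I. norm (app (G t) x) \<le> C * g t}"
  then obtain C where C: "\<And>t. t \<in> I \<Longrightarrow> norm (app (G t) x) \<le> C * g t" by blast
  show "\<exists>C. \<forall>t\<in>I. norm (app (G t) (k *\<^sub>R x)) \<le> C * g t" for k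
    by (intro exI[of _ "\<bar>k\<bar> * C"]) (simp add: app_simps mult.assoc mult_left_mono C)
  fix y assume "y \<in> {x. \<exists>C. \<forall>t\<in>I. norm (app (G t) x) \<le> C * g t}"
  then obtain D where D: "\<And>t. t \<in> I \<Longrightarrow> norm (app (G t) y) \<le> D * g t" by blast
  show "\<exists>C. \<forall>t\<in>I. norm (app (G t) (x + y)) \<le> C * g t"
    using C D by (intro exI[of _ "C + D"]) (auto simp: app_simps distrib_right intro!: norm_triangle_mono)
qed

text \<open>The abstract data of a decomposition of the space into invariant subspaces \<open>F \<xi>\<close> on which the flow
  grows like \<open>exp (\<xi> t)\<close> up to subexponential factors, for positive and negative times. That the sum is direct
  is a consequence.\<close>

locale spectral_splitting =
  fixes M :: "'a::euclidean_space endo" and \<Xi> :: "real set" and F :: "real \<Rightarrow> 'a set"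
  assumes finite_\<Xi>: "finite \<Xi>"
    and subspace_F: "subspace (F \<xi>)"
    and invariant_F: "x \<in> F \<xi> \<Longrightarrow> app M x \<in> F \<xi>"
    and growth_F: "x \<in> F \<xi> \<Longrightarrow> 0 < \<delta> \<Longrightarrow> \<exists>C. \<forall>t. norm (app (expm t M) x) \<le> C * exp (\<xi> * t + \<delta> * \<bar>t\<bar>)"
    and span_F: "span (\<Union>\<xi>\<in>\<Xi>. F \<xi>) = UNIV"
begin

text \<open>Sets of rates as index, so that \<open>V {\<xi>..}\<close> and \<open>V {..<\<xi>}\<close> are the fast and the slow subspace at level \<open>\<xi>\<close>.\<close>

definition V :: "real set \<Rightarrow> 'a set" where "V S = span (\<Union>\<xi>\<in>S \<inter> \<Xi>. F \<xi>)"

lemma subspace_V: "subspace (V S)"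
  by (simp add: V_def)

lemma V_mono: "S \<inter> \<Xi> \<subseteq> S' \<Longrightarrow> V S \<subseteq> V S'"
  unfolding V_def by (intro span_mono) auto

lemma V_app: "x \<in> V S \<Longrightarrow> app M x \<in> V S"
  unfolding V_def
proof (induction rule: span_induct)
  case base
  then show ?case by (simp add: subspace_def app_simps span_add span_scale span_zero)
next
  case (step y)
  then show ?case using invariant_F by (blast intro: span_base)
qed

lemma V_invariant: assumes "x \<in> V S" shows "app (expm t M) x \<in> V S"
proof -
  have Mn: "app (M ^ n) x \<in> V S" for n
    using assms V_app by (induction n) auto
  show ?thesis
  proof (rule closed_sequentially[OF closed_subspace[OF subspace_V[of S]]])
    show "(\<lambda>n. \<Sum>i<n. ((t ^ i) /\<^sub>R fact i) *\<^sub>R app (M ^ i) x) \<longlonglongrightarrow> app (expm t M) x"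
      using app_expm_sums unfolding sums_def .
    show "(\<Sum>i<n. ((t ^ i) /\<^sub>R fact i) *\<^sub>R app (M ^ i) x) \<in> V S" for n
      by (intro subspace_sum subspace_scale subspace_V Mn)
  qed
qed

text \<open>Finite dimension makes the constants uniform: expand along a basis and project onto \<open>W\<close>.\<close>

lemma uniform_growth:
  assumes W: "subspace W" and bound: "\<And>x. x \<in> W \<Longrightarrow> \<exists>C. \<forall>t\<in>I. norm (app (expm t M) x) \<le> C * g t"
    and g: "\<And>t. 0 \<le> g t"
  obtains C where "0 < C" "\<And>t x. t \<in> I \<Longrightarrow> x \<in> W \<Longrightarrow> norm (app (expm t M) x) \<le> C * g t * norm x"
proof -
  obtain h where h: "range h \<subseteq> W" "linear h" "\<And>x. x \<in> W \<Longrightarrow> h x = x"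
    using linear_exists_left_inverse_on[OF linear_id W] by auto
  have "\<forall>b. \<exists>C. \<forall>t\<in>I. norm (app (expm t M) (h b)) \<le> C * g t"
    using bound h(1) by blast
  then obtain c where c: "\<And>b t. t \<in> I \<Longrightarrow> norm (app (expm t M) (h b)) \<le> c b * g t" by metis
  define C where "C = (\<Sum>b\<in>Basis. \<bar>c b\<bar>) + 1"
  show thesis
  proof (rule that[of C])
    show "0 < C" unfolding C_def by (intro add_nonneg_pos sum_nonneg) auto
    fix t x assume t: "t \<in> I" and x: "x \<in> W"
    have "x = h (\<Sum>b\<in>Basis. (x \<bullet> b) *\<^sub>R b)" using h(3)[OF x] by (simp add: euclidean_representation)
    also have "\<dots> = (\<Sum>b\<in>Basis. (x \<bullet> b) *\<^sub>R h b)" using h(2) by (simp add: linear_sum linear_scale)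
    finally have "app (expm t M) x = app (expm t M) (\<Sum>b\<in>Basis. (x \<bullet> b) *\<^sub>R h b)" by simp
    also have "\<dots> = (\<Sum>b\<in>Basis. (x \<bullet> b) *\<^sub>R app (expm t M) (h b))" by (simp add: app.sum_right app_simps)
    also have "norm \<dots> \<le> (\<Sum>b\<in>Basis. norm x * (\<bar>c b\<bar> * g t))"
    proof (rule sum_norm_le)
      fix b :: 'a assume "b \<in> Basis"
      have "norm (app (expm t M) (h b)) \<le> \<bar>c b\<bar> * g t"
        by (rule order_trans[OF c[OF t]]) (intro mult_right_mono abs_ge_self g)
      then show "norm ((x \<bullet> b) *\<^sub>R app (expm t M) (h b)) \<le> norm x * (\<bar>c b\<bar> * g t)"
        using Basis_le_norm[OF \<open>b \<in> Basis\<close>, of x] by (simp add: mult_mono)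
    qed
    also have "\<dots> = (\<Sum>b\<in>Basis. \<bar>c b\<bar>) * g t * norm x" by (simp add: sum_distrib_left sum_distrib_right mult_ac)
    also have "\<dots> \<le> C * g t * norm x" unfolding C_def by (intro mult_right_mono g) auto
    finally show "norm (app (expm t M) x) \<le> C * g t * norm x" .
  qed
qed

lemma V_growth:
  assumes x: "x \<in> V S" and \<delta>: "0 < \<delta>" and r: "\<And>\<xi> t. \<xi> \<in> S \<Longrightarrow> \<xi> \<in> \<Xi> \<Longrightarrow> t \<in> I \<Longrightarrow> \<xi> * t \<le> r t"
  shows "\<exists>C. \<forall>t\<in>I. norm (app (expm t M) x) \<le> C * exp (r t + \<delta> * \<bar>t\<bar>)"
  using x unfolding V_def
proof (induction rule: span_induct)
  case base
  show ?case by (rule subspace_growth)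
next
  case (step x)
  then obtain \<xi> where \<xi>: "\<xi> \<in> S" "\<xi> \<in> \<Xi>" "x \<in> F \<xi>" by blast
  obtain C where C: "\<And>t. norm (app (expm t M) x) \<le> C * exp (\<xi> * t + \<delta> * \<bar>t\<bar>)"
    using growth_F[OF \<xi>(3) \<delta>] by blast
  have "norm (app (expm t M) x) \<le> \<bar>C\<bar> * exp (r t + \<delta> * \<bar>t\<bar>)" if "t \<in> I" for t
    by (rule order_trans[OF C]) (use r[OF \<xi>(1,2) that] in \<open>intro mult_mono; simp\<close>)
  then show ?case by blast
qed

lemma V_upper_growth:
  assumes \<delta>: "0 < \<delta>" and \<eta>: "\<And>\<zeta>. \<zeta> \<in> S \<Longrightarrow> \<zeta> \<in> \<Xi> \<Longrightarrow> \<zeta> \<le> \<eta>"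
  obtains C where "0 < C" "\<And>t x. 0 \<le> t \<Longrightarrow> x \<in> V S \<Longrightarrow> norm (app (expm t M) x) \<le> C * exp ((\<eta> + \<delta>) * t) * norm x"
proof -
  have "\<exists>C. \<forall>t\<in>{0..}. norm (app (expm t M) x) \<le> C * exp (\<eta> * t + \<delta> * \<bar>t\<bar>)" if "x \<in> V S" for x
    by (rule V_growth[OF that \<delta>]) (auto intro!: mult_right_mono \<eta>)
  then obtain C where "0 < C" and C: "\<And>t x. t \<in> {0..} \<Longrightarrow> x \<in> V S \<Longrightarrow> norm (app (expm t M) x) \<le> C * exp (\<eta> * t + \<delta> * \<bar>t\<bar>) * norm x"
    using uniform_growth[OF subspace_V[of S], of "{0..}" "\<lambda>t. exp (\<eta> * t + \<delta> * \<bar>t\<bar>)"] by auto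
  show thesis
    by (rule that[OF \<open>0 < C\<close>]) (use C in \<open>force simp: distrib_right\<close>)
qed

text \<open>The growth bound for negative times, applied to the image of \<open>x\<close> under the flow.\<close>

lemma V_lower_growth:
  assumes \<delta>: "0 < \<delta>" and \<xi>: "\<And>\<zeta>. \<zeta> \<in> S \<Longrightarrow> \<zeta> \<in> \<Xi> \<Longrightarrow> \<xi> \<le> \<zeta>"
  obtains C where "0 < C" "\<And>t x. 0 \<le> t \<Longrightarrow> x \<in> V S \<Longrightarrow> exp ((\<xi> - \<delta>) * t) * norm x \<le> C * norm (app (expm t M) x)"
proof -
  have "\<exists>C. \<forall>t\<in>{..0}. norm (app (expm t M) x) \<le> C * exp (\<xi> * t + \<delta> * \<bar>t\<bar>)" if "x \<in> V S" for x
    by (rule V_growth[OF that \<delta>]) (auto intro!: mult_right_mono_neg \<xi>)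
  then obtain C where "0 < C" and C: "\<And>t x. t \<in> {..0} \<Longrightarrow> x \<in> V S \<Longrightarrow> norm (app (expm t M) x) \<le> C * exp (\<xi> * t + \<delta> * \<bar>t\<bar>) * norm x"
    using uniform_growth[OF subspace_V[of S], of "{..0}" "\<lambda>t. exp (\<xi> * t + \<delta> * \<bar>t\<bar>)"] by auto
  show thesis
  proof (rule that[OF \<open>0 < C\<close>])
    fix t :: real and x assume t: "0 \<le> t" and x: "x \<in> V S"
    let ?y = "app (expm t M) x"
    have "norm x = norm (app (expm (- t) M) ?y)" by (simp only: expm_inverse)
    also have "\<dots> \<le> C * exp (- ((\<xi> - \<delta>) * t)) * norm ?y"
      using C[of "- t" ?y] V_invariant[OF x] t by (simp add: algebra_simps)
    finally have "norm x \<le> C * exp (- ((\<xi> - \<delta>) * t)) * norm ?y" .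
    then have "exp ((\<xi> - \<delta>) * t) * norm x \<le> exp ((\<xi> - \<delta>) * t) * (C * exp (- ((\<xi> - \<delta>) * t)) * norm ?y)"
      by (intro mult_left_mono) auto
    also have "\<dots> = (exp ((\<xi> - \<delta>) * t) * exp (- ((\<xi> - \<delta>) * t))) * (C * norm ?y)" by (simp only: mult_ac)
    also have "\<dots> = C * norm ?y" by (simp only: exp_add[symmetric]) simp
    finally show "exp ((\<xi> - \<delta>) * t) * norm x \<le> C * norm ?y" .
  qed
qed

text \<open>As the set of rates is finite, those below \<open>\<xi>\<close> stay away from it.\<close>

lemma gap: obtains \<eta> where "\<eta> < \<xi>" "\<And>\<zeta>. \<zeta> \<in> {..<\<xi>} \<Longrightarrow> \<zeta> \<in> \<Xi> \<Longrightarrow> \<zeta> \<le> \<eta>"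
proof
  let ?\<eta> = "Max (insert (\<xi> - 1) ({..<\<xi>} \<inter> \<Xi>))"
  show "?\<eta> < \<xi>" using finite_\<Xi> by (subst Max_less_iff) auto
  show "\<And>\<zeta>. \<zeta> \<in> {..<\<xi>} \<Longrightarrow> \<zeta> \<in> \<Xi> \<Longrightarrow> \<zeta> \<le> ?\<eta>" using finite_\<Xi> by (intro Max_ge) auto
qed

text \<open>A common vector would grow at two different rates.\<close>

lemma V_disjoint:
  assumes x: "x \<in> V {..<\<xi>}" "x \<in> V {\<xi>..}" shows "x = 0"
proof (rule ccontr)
  assume x0: "x \<noteq> 0"
  obtain \<eta> where \<eta>: "\<eta> < \<xi>" "\<And>\<zeta>. \<zeta> \<in> {..<\<xi>} \<Longrightarrow> \<zeta> \<in> \<Xi> \<Longrightarrow> \<zeta> \<le> \<eta>" using gap[of \<xi>] by blast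
  define \<delta> where "\<delta> = (\<xi> - \<eta>) / 3"
  have \<delta>: "0 < \<delta>" using \<eta> by (simp add: \<delta>_def)
  obtain C where C: "0 < C" "\<And>t x. 0 \<le> t \<Longrightarrow> x \<in> V {..<\<xi>} \<Longrightarrow> norm (app (expm t M) x) \<le> C * exp ((\<eta> + \<delta>) * t) * norm x"
    using V_upper_growth[OF \<delta> \<eta>(2), of "{..<\<xi>}"] by auto
  obtain D where D: "0 < D" "\<And>t x. 0 \<le> t \<Longrightarrow> x \<in> V {\<xi>..} \<Longrightarrow> exp ((\<xi> - \<delta>) * t) * norm x \<le> D * norm (app (expm t M) x)"
    using V_lower_growth[OF \<delta>, of "{\<xi>..}" \<xi>] by auto
  define t where "t = D * C / \<delta>"
  have t: "0 \<le> t" using C D \<delta> by (simp add: t_def)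
  have "exp (\<delta> * t) * exp ((\<eta> + \<delta>) * t) * norm x = exp ((\<xi> - \<delta>) * t) * norm x"
    by (simp add: \<delta>_def exp_add[symmetric] field_simps)
  also have "\<dots> \<le> D * norm (app (expm t M) x)" by (rule D(2)[OF t x(2)])
  also have "\<dots> \<le> D * (C * exp ((\<eta> + \<delta>) * t) * norm x)" using C(2)[OF t x(1)] D(1) by (intro mult_left_mono) auto
  finally have "exp (\<delta> * t) \<le> D * C" using x0 by (simp add: mult.commute mult.left_commute)
  moreover have "\<delta> * t = D * C" using \<delta> by (simp add: t_def)
  ultimately show False using exp_ge_add_one_self[of "\<delta> * t"] by linarith
qed

lemma V_union: "x \<in> V (S \<union> S') \<Longrightarrow> \<exists>u\<in>V S. \<exists>w\<in>V S'. x = u + w"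
  unfolding V_def by (auto simp: Int_Un_distrib2 UN_Un span_Un)

lemma splitting_ex1: "\<exists>!u. u \<in> V {\<xi>..} \<and> x - u \<in> V {..<\<xi>}"
proof -
  have "{\<xi>..} \<union> {..<\<xi>} = UNIV" by auto
  then have "x \<in> V ({\<xi>..} \<union> {..<\<xi>})" using span_F by (simp add: V_def)
  then obtain u w where u: "u \<in> V {\<xi>..}" "w \<in> V {..<\<xi>}" "x = u + w" using V_union by blast
  show ?thesis
  proof (rule ex1I[of _ u])
    show "u \<in> V {\<xi>..} \<and> x - u \<in> V {..<\<xi>}" using u by simp
    fix v assume v: "v \<in> V {\<xi>..} \<and> x - v \<in> V {..<\<xi>}"
    have "v - u \<in> V {\<xi>..}" using u v by (intro subspace_diff subspace_V) auto
    moreover have "w - (x - v) \<in> V {..<\<xi>}" by (rule subspace_diff[OF subspace_V]) (use u v in auto)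
    moreover have "w - (x - v) = v - u" using u(3) by simp
    ultimately have "v - u = 0" using V_disjoint by metis
    then show "v = u" by simp
  qed
qed

text \<open>The projection onto the fast subspace along the slow one.\<close>

definition Q :: "real \<Rightarrow> 'a endo" where
  "Q \<xi> = endo_of (\<lambda>x. THE u. u \<in> V {\<xi>..} \<and> x - u \<in> V {..<\<xi>})"

lemma
  shows Q_range: "app (Q \<xi>) x \<in> V {\<xi>..}" and Q_kernel: "x - app (Q \<xi>) x \<in> V {..<\<xi>}"
    and Q_unique: "u \<in> V {\<xi>..} \<Longrightarrow> x - u \<in> V {..<\<xi>} \<Longrightarrow> app (Q \<xi>) x = u"
proof -
  let ?f = "\<lambda>x. THE u. u \<in> V {\<xi>..} \<and> x - u \<in> V {..<\<xi>}"
  have f: "?f x \<in> V {\<xi>..} \<and> x - ?f x \<in> V {..<\<xi>}" for x by (rule theI'[OF splitting_ex1])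
  have eq: "?f x = u" if "u \<in> V {\<xi>..}" "x - u \<in> V {..<\<xi>}" for x u
    by (rule the1_equality[OF splitting_ex1]) (use that in simp)
  have "linear ?f"
  proof (rule linearI)
    show "?f (x + y) = ?f x + ?f y" for x y
    proof (rule eq)
      show "?f x + ?f y \<in> V {\<xi>..}" using f by (intro subspace_add subspace_V) auto
      have "(x - ?f x) + (y - ?f y) \<in> V {..<\<xi>}" using f by (intro subspace_add subspace_V) auto
      then show "(x + y) - (?f x + ?f y) \<in> V {..<\<xi>}" by (simp add: algebra_simps)
    qed
    show "?f (c *\<^sub>R x) = c *\<^sub>R ?f x" for c x
    proof (rule eq)
      show "c *\<^sub>R ?f x \<in> V {\<xi>..}" using f by (intro subspace_scale subspace_V) auto
      have "c *\<^sub>R (x - ?f x) \<in> V {..<\<xi>}" using f by (intro subspace_scale subspace_V) auto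
      then show "c *\<^sub>R x - c *\<^sub>R ?f x \<in> V {..<\<xi>}" by (simp add: algebra_simps)
    qed
  qed
  then have app: "app (Q \<xi>) = ?f" unfolding Q_def by (rule app_endo_of)
  show "app (Q \<xi>) x \<in> V {\<xi>..}" "x - app (Q \<xi>) x \<in> V {..<\<xi>}" using f[of x] unfolding app by auto
  show "u \<in> V {\<xi>..} \<Longrightarrow> x - u \<in> V {..<\<xi>} \<Longrightarrow> app (Q \<xi>) x = u" unfolding app by (rule eq)
qed

lemma Q_ident: "x \<in> V {\<xi>..} \<Longrightarrow> app (Q \<xi>) x = x"
  by (rule Q_unique) (auto simp: subspace_0 subspace_V)

lemma Q_zero_iff: "app (Q \<xi>) x = 0 \<longleftrightarrow> x \<in> V {..<\<xi>}"
  using Q_kernel[of x \<xi>] Q_unique[of 0 \<xi> x] by (auto simp: subspace_0 subspace_V)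

lemma Q_commute: "Q \<xi> * M = M * Q \<xi>"
proof (rule endo_eqI)
  fix x
  have "app (Q \<xi>) (app M x) = app M (app (Q \<xi>) x)"
    using V_app[OF Q_range[of \<xi> x]] V_app[OF Q_kernel[of x \<xi>]] by (intro Q_unique) (simp_all add: app_simps)
  then show "app (Q \<xi> * M) x = app (M * Q \<xi>) x" by simp
qed

text \<open>Half of the gap between the rates absorbs the subexponential factors, the rest gives the factor \<open>8\<close> after a
  sufficiently long time.\<close>

lemma Q_dominated:
  obtains \<beta> t0 where "\<And>t x. t0 \<le> t \<Longrightarrow> norm (app (expm t M) (x - app (Q \<xi>) x)) \<le> exp (\<beta> * t) * norm (x - app (Q \<xi>) x)"
    "\<And>t x. t0 \<le> t \<Longrightarrow> 8 * exp (\<beta> * t) * norm (app (Q \<xi>) x) \<le> norm (app (expm t M) (app (Q \<xi>) x))"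
proof -
  obtain \<eta> where \<eta>: "\<eta> < \<xi>" "\<And>\<zeta>. \<zeta> \<in> {..<\<xi>} \<Longrightarrow> \<zeta> \<in> \<Xi> \<Longrightarrow> \<zeta> \<le> \<eta>" using gap[of \<xi>] by blast
  define \<delta> where "\<delta> = (\<xi> - \<eta>) / 4"
  have \<delta>: "0 < \<delta>" using \<eta> by (simp add: \<delta>_def)
  obtain C where C: "0 < C" "\<And>t x. 0 \<le> t \<Longrightarrow> x \<in> V {..<\<xi>} \<Longrightarrow> norm (app (expm t M) x) \<le> C * exp ((\<eta> + \<delta>) * t) * norm x"
    using V_upper_growth[OF \<delta> \<eta>(2), of "{..<\<xi>}"] by auto
  obtain D where D: "0 < D" "\<And>t x. 0 \<le> t \<Longrightarrow> x \<in> V {\<xi>..} \<Longrightarrow> exp ((\<xi> - \<delta>) * t) * norm x \<le> D * norm (app (expm t M) x)"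
    using V_lower_growth[OF \<delta>, of "{\<xi>..}" \<xi>] by auto
  define t0 where "t0 = (C + 8 * D) / \<delta>"
  show thesis
  proof (rule that)
    fix t x assume "t0 \<le> t"
    then have "C + 8 * D \<le> \<delta> * t" using \<delta> by (simp add: t0_def pos_divide_le_eq mult.commute)
    then have e: "C + 8 * D \<le> exp (\<delta> * t)" using exp_ge_add_one_self[of "\<delta> * t"] by linarith
    have t: "0 \<le> t" using \<open>t0 \<le> t\<close> C D \<delta> by (auto simp: t0_def elim: order_trans[rotated])
    show "norm (app (expm t M) (x - app (Q \<xi>) x)) \<le> exp ((\<eta> + 2 * \<delta>) * t) * norm (x - app (Q \<xi>) x)"
    proof (rule order_trans[OF C(2)[OF t Q_kernel]], rule mult_right_mono)
      have "C * exp ((\<eta> + \<delta>) * t) \<le> exp (\<delta> * t) * exp ((\<eta> + \<delta>) * t)" using e D by (intro mult_right_mono) auto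
      also have "\<dots> = exp ((\<eta> + 2 * \<delta>) * t)" by (simp add: exp_add[symmetric] algebra_simps)
      finally show "C * exp ((\<eta> + \<delta>) * t) \<le> exp ((\<eta> + 2 * \<delta>) * t)" .
    qed simp
    have "D * (8 * exp ((\<eta> + 2 * \<delta>) * t) * norm (app (Q \<xi>) x)) = (8 * D) * exp ((\<eta> + 2 * \<delta>) * t) * norm (app (Q \<xi>) x)"
      by simp
    also have "\<dots> \<le> exp (\<delta> * t) * exp ((\<eta> + 2 * \<delta>) * t) * norm (app (Q \<xi>) x)"
      using e C by (intro mult_right_mono) auto
    also have "exp (\<delta> * t) * exp ((\<eta> + 2 * \<delta>) * t) = exp ((\<xi> - \<delta>) * t)"
      by (simp add: \<delta>_def exp_add[symmetric] field_simps)
    also have "\<dots> * norm (app (Q \<xi>) x) \<le> D * norm (app (expm t M) (app (Q \<xi>) x))" by (rule D(2)[OF t Q_range])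
    finally show "8 * exp ((\<eta> + 2 * \<delta>) * t) * norm (app (Q \<xi>) x) \<le> norm (app (expm t M) (app (Q \<xi>) x))"
      using D(1) by simp
  qed
qed

lemma Q_top_growth:
  assumes "0 < \<delta>"
  obtains t1 where "\<And>t x. t1 \<le> t \<Longrightarrow> k * exp ((\<xi> - \<delta>) * t) * norm (app (Q \<xi>) x) \<le> norm (app (expm t M) (app (Q \<xi>) x))"
proof -
  have \<delta>: "0 < \<delta> / 2" using assms by simp
  obtain D where D: "0 < D" "\<And>t x. 0 \<le> t \<Longrightarrow> x \<in> V {\<xi>..} \<Longrightarrow> exp ((\<xi> - \<delta> / 2) * t) * norm x \<le> D * norm (app (expm t M) x)"
    using V_lower_growth[OF \<delta>, of "{\<xi>..}" \<xi>] by auto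
  show thesis
  proof (rule that)
    fix t x assume t1: "max 0 (D * k / (\<delta> / 2)) \<le> t"
    then have "D * k \<le> \<delta> / 2 * t" using \<delta> by (simp add: pos_divide_le_eq mult.commute)
    then have e: "D * k \<le> exp (\<delta> / 2 * t)" using exp_ge_add_one_self[of "\<delta> / 2 * t"] by linarith
    have "D * (k * exp ((\<xi> - \<delta>) * t) * norm (app (Q \<xi>) x)) = (D * k) * exp ((\<xi> - \<delta>) * t) * norm (app (Q \<xi>) x)" by simp
    also have "\<dots> \<le> exp (\<delta> / 2 * t) * exp ((\<xi> - \<delta>) * t) * norm (app (Q \<xi>) x)"
      using e by (intro mult_right_mono) auto
    also have "exp (\<delta> / 2 * t) * exp ((\<xi> - \<delta>) * t) = exp ((\<xi> - \<delta> / 2) * t)"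
      by (simp add: exp_add[symmetric] field_simps)
    also have "\<dots> * norm (app (Q \<xi>) x) \<le> D * norm (app (expm t M) (app (Q \<xi>) x))" using t1 by (intro D(2) Q_range) auto
    finally show "k * exp ((\<xi> - \<delta>) * t) * norm (app (Q \<xi>) x) \<le> norm (app (expm t M) (app (Q \<xi>) x))"
      using D(1) by simp
  qed
qed

lemma total_growth:
  assumes "0 < \<delta>" and \<xi>: "\<And>\<zeta>. \<zeta> \<in> \<Xi> \<Longrightarrow> \<zeta> \<le> \<xi>"
  obtains t1 where "\<And>t x. t1 \<le> t \<Longrightarrow> norm (app (expm t M) x) \<le> exp ((\<xi> + \<delta>) * t) / 2 * norm x"
proof -
  have \<delta>: "0 < \<delta> / 2" using assms by simp
  have U: "V UNIV = UNIV" using span_F by (simp add: V_def)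
  obtain C where C: "0 < C" "\<And>t x. 0 \<le> t \<Longrightarrow> norm (app (expm t M) x) \<le> C * exp ((\<xi> + \<delta> / 2) * t) * norm x"
    using V_upper_growth[OF \<delta>, of UNIV \<xi>] \<xi> unfolding U by auto
  show thesis
  proof (rule that)
    fix t x assume t1: "max 0 (2 * C / (\<delta> / 2)) \<le> t"
    then have "2 * C \<le> \<delta> / 2 * t" using \<delta> by (simp add: pos_divide_le_eq mult.commute)
    then have e: "C \<le> exp (\<delta> / 2 * t) / 2" using exp_ge_add_one_self[of "\<delta> / 2 * t"] by linarith
    have "C * exp ((\<xi> + \<delta> / 2) * t) \<le> exp (\<delta> / 2 * t) / 2 * exp ((\<xi> + \<delta> / 2) * t)"
      using e by (intro mult_right_mono) auto
    also have "\<dots> = exp ((\<xi> + \<delta>) * t) / 2" by (simp add: exp_add[symmetric] field_simps)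
    finally show "norm (app (expm t M) x) \<le> exp ((\<xi> + \<delta>) * t) / 2 * norm x"
      using t1 by (intro order_trans[OF C(2)] mult_right_mono) auto
  qed
qed

text \<open>By compactness, \<open>Q \<xi> A\<close> is bounded from below on the level \<open>\<eta>\<close>. For consecutive levels, \<open>Q \<eta> x - Q \<xi> x\<close> is the
  component of \<open>x\<close> in that level, and the two other components of \<open>x\<close> appear as errors on the right-hand side.\<close>

lemma transversality:
  fixes A :: "'a endo"
  assumes \<eta>\<xi>: "\<eta> < \<xi>" and next_level: "\<And>\<zeta>. \<zeta> \<in> \<Xi> \<Longrightarrow> \<eta> < \<zeta> \<Longrightarrow> \<xi> \<le> \<zeta>"
    and trans: "\<And>\<theta>. \<theta> \<in> F \<eta> \<Longrightarrow> norm \<theta> = 1 \<Longrightarrow> app A \<theta> \<notin> V {..<\<xi>}"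
  obtains c B where "0 < c" "0 \<le> B"
    "\<And>x. c * norm x \<le> norm (app (Q \<xi>) (app A x)) + B * norm (app (Q \<xi>) x) + B * norm (x - app (Q \<eta>) x)"
proof -
  define N where "N = Q \<xi> * A"
  have ex: "\<exists>c>0. \<forall>y\<in>F \<eta>. c * norm y \<le> norm (app N y)"
  proof (cases "F \<eta> \<inter> sphere 0 1 = {}")
    case True
    have "y = 0" if "y \<in> F \<eta>" for y
    proof (rule ccontr)
      assume "y \<noteq> 0"
      then have "(1 / norm y) *\<^sub>R y \<in> F \<eta> \<inter> sphere 0 1" using subspace_scale[OF subspace_F that] by simp
      then show False using True by blast
    qed
    then show ?thesis by (intro exI[of _ 1]) (force simp: app_simps)
  next
    case False
    have "compact (F \<eta> \<inter> sphere 0 1)" by (intro closed_Int_compact closed_subspace subspace_F) simp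
    moreover have "continuous_on (F \<eta> \<inter> sphere 0 1) (\<lambda>y. norm (app N y))" by (intro continuous_intros)
    ultimately obtain y0 where y0: "y0 \<in> F \<eta>" "norm y0 = 1" "\<And>y. y \<in> F \<eta> \<Longrightarrow> norm y = 1 \<Longrightarrow> norm (app N y0) \<le> norm (app N y)"
      using continuous_attains_inf[of "F \<eta> \<inter> sphere 0 1" "\<lambda>y. norm (app N y)"] False
      by (metis IntE IntI mem_sphere_0)
    have "app N y0 \<noteq> 0" using trans[OF y0(1,2)] by (simp add: N_def Q_zero_iff)
    moreover have "norm (app N y0) * norm y \<le> norm (app N y)" if y: "y \<in> F \<eta>" for y
    proof (cases "y = 0")
      case False
      have "norm (app N y0) \<le> norm (app N ((1 / norm y) *\<^sub>R y))"
        using False by (intro y0(3) subspace_scale[OF subspace_F y]) simp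
      then show ?thesis using False by (simp add: app_simps field_simps)
    qed (simp add: app_simps)
    ultimately show ?thesis by (intro exI[of _ "norm (app N y0)"]) auto
  qed
  then obtain c where c: "0 < c" "\<And>y. y \<in> F \<eta> \<Longrightarrow> c * norm y \<le> norm (app N y)" by blast
  have level: "app (Q \<eta>) x - app (Q \<xi>) x \<in> F \<eta>" for x
  proof -
    have "app (Q \<eta>) x \<in> V ({\<eta>} \<union> {\<xi>..})"
      using Q_range[of \<eta> x] V_mono[of "{\<eta>..}" "{\<eta>} \<union> {\<xi>..}"] next_level by fastforce
    then obtain f u where fu: "f \<in> V {\<eta>}" "u \<in> V {\<xi>..}" "app (Q \<eta>) x = f + u" using V_union by blast
    have f: "f \<in> F \<eta>"
      using fu(1) span_minimal[of "\<Union>\<zeta>\<in>{\<eta>} \<inter> \<Xi>. F \<zeta>" "F \<eta>"] subspace_F[of \<eta>] unfolding V_def by auto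
    have "f \<in> V {..<\<xi>}" using fu(1) V_mono[of "{\<eta>}" "{..<\<xi>}"] \<eta>\<xi> by auto
    moreover have "V {..<\<eta>} \<subseteq> V {..<\<xi>}" using \<eta>\<xi> by (intro V_mono) auto
    then have "x - app (Q \<eta>) x \<in> V {..<\<xi>}" using Q_kernel by blast
    ultimately have "f + (x - app (Q \<eta>) x) \<in> V {..<\<xi>}" by (intro subspace_add subspace_V)
    then have "x - u \<in> V {..<\<xi>}" using fu(3) by simp
    then have "app (Q \<xi>) x = u" using fu(2) by (intro Q_unique)
    then show ?thesis using f fu(3) by simp
  qed
  define B where "B = c + norm N"
  show thesis
  proof (rule that[of c B])
    show "0 < c" "0 \<le> B" using c by (auto simp: B_def)
    fix x
    let ?y = "app (Q \<eta>) x - app (Q \<xi>) x" and ?q = "x - app (Q \<eta>) x" and ?u = "app (Q \<xi>) x"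
    have "c * norm x \<le> c * (norm ?y + norm ?q + norm ?u)"
    proof (rule mult_left_mono)
      have "norm x = norm (?y + ?q + ?u)" by simp
      then show "norm x \<le> norm ?y + norm ?q + norm ?u"
        using norm_triangle_ineq[of "?y + ?q" ?u] norm_triangle_ineq[of ?y ?q] by linarith
    qed (use c in simp)
    moreover have "c * norm ?y \<le> norm (app N ?y)" by (rule c(2)[OF level])
    moreover have "norm (app N ?y) \<le> norm (app N x) + norm N * norm ?q + norm N * norm ?u"
    proof -
      have "norm (app N ?y) = norm (app N x - app N ?q - app N ?u)" by (simp add: app_simps)
      then have "norm (app N ?y) \<le> norm (app N x) + norm (app N ?q) + norm (app N ?u)"
        using norm_triangle_ineq4[of "app N x - app N ?q" "app N ?u"] norm_triangle_ineq4[of "app N x" "app N ?q"] by linarith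
      then show ?thesis using norm_app[of N ?q] norm_app[of N ?u] by linarith
    qed
    ultimately show "c * norm x \<le> norm (app (Q \<xi>) (app A x)) + B * norm ?u + B * norm ?q"
      by (simp add: B_def N_def algebra_simps)
  qed
qed

lemma Q_bottom: assumes "\<And>\<zeta>. \<zeta> \<in> \<Xi> \<Longrightarrow> \<xi> \<le> \<zeta>" shows "Q \<xi> = 1"
proof (rule endo_eqI)
  fix x
  have "V {\<xi>..} = UNIV" using span_F assms by (auto simp: V_def Int_absorb1 subset_iff)
  then show "app (Q \<xi>) x = app 1 x" by (simp add: Q_ident)
qed

end

section \<open>Generalized eigenvectors of a complex matrix\<close>

lemma matrix_vector_mult_cscale: "C *v (c *s v) = c *s (C *v v)" for C :: "complex^'d^'d"
  by (simp add: vec_eq_iff matrix_vector_mult_def sum_distrib_left mult_ac)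

lemma scaleR_cscale: "r *\<^sub>R v = complex_of_real r *s v"
  unfolding vec_eq_iff vector_scaleR_component vector_smult_component
  by (simp add: scaleR_conv_of_real[where 'a = complex])

lemma linear_complex_matrix: "linear ((*v) C)" for C :: "complex^'d^'d"
  by (intro linearI) (simp_all add: matrix_vector_right_distrib scaleR_cscale matrix_vector_mult_cscale)

definition shifted :: "complex^'d^'d \<Rightarrow> complex \<Rightarrow> complex^'d \<Rightarrow> complex^'d" where
  "shifted C z v = C *v v - z *s v"

definition gen_space :: "complex^'d^'d \<Rightarrow> complex \<Rightarrow> (complex^'d) set" where
  "gen_space C z = {v. \<exists>k. (shifted C z ^^ k) v = 0}"

lemma shifted_add: "shifted C z (u + v) = shifted C z u + shifted C z v"
  by (simp add: shifted_def matrix_vector_right_distrib vector_add_ldistrib)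

lemma shifted_scale: "shifted C z (c *s v) = c *s shifted C z v"
  by (simp add: shifted_def matrix_vector_mult_cscale vec_eq_iff algebra_simps)

lemma shifted_0 [simp]: "shifted C z 0 = 0"
  using shifted_scale[of C z 0 0] by simp

lemma shifted_diff: "shifted C z (u - v) = shifted C z u - shifted C z v"
  using shifted_add[of C z "u - v" v] by simp

lemma linear_shifted: "linear (shifted C z)"
  by (intro linearI) (simp_all add: shifted_add shifted_scale scaleR_cscale)

lemma shifted_commute: "shifted C z (C *v v) = C *v shifted C z v"
  by (simp add: shifted_def matrix_vector_mult_diff_distrib matrix_vector_mult_cscale)

lemma shifted_power_add: "(shifted C z ^^ k) (u + v) = (shifted C z ^^ k) u + (shifted C z ^^ k) v"
  by (induction k) (simp_all add: shifted_add)

lemma shifted_power_scale: "(shifted C z ^^ k) (c *s v) = c *s (shifted C z ^^ k) v"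
  by (induction k) (simp_all add: shifted_scale)

lemma shifted_power_matrix: "(shifted C z ^^ k) (C *v v) = C *v (shifted C z ^^ k) v"
  by (induction k) (simp_all add: shifted_commute)

lemma shifted_power_mono: "(shifted C z ^^ k) v = 0 \<Longrightarrow> (shifted C z ^^ (l + k)) v = 0"
  by (induction l) simp_all

lemma gen_space_0 [simp]: "0 \<in> gen_space C z"
  unfolding gen_space_def by (auto intro: exI[of _ 0])

lemma gen_space_scale: "v \<in> gen_space C z \<Longrightarrow> c *s v \<in> gen_space C z"
  unfolding gen_space_def by (auto simp: shifted_power_scale)

lemma gen_space_add: assumes "u \<in> gen_space C z" "v \<in> gen_space C z" shows "u + v \<in> gen_space C z"
proof -
  obtain k l where "(shifted C z ^^ k) u = 0" "(shifted C z ^^ l) v = 0" using assms by (auto simp: gen_space_def)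
  then have "(shifted C z ^^ (l + k)) (u + v) = 0"
    using shifted_power_mono[of k C z u l] shifted_power_mono[of l C z v k] by (simp add: shifted_power_add add.commute)
  then show ?thesis unfolding gen_space_def by blast
qed

lemma subspace_gen_space: "subspace (gen_space C z)"
  by (simp add: subspace_def gen_space_add scaleR_cscale gen_space_scale)

lemma gen_space_matrix: "v \<in> gen_space C z \<Longrightarrow> C *v v \<in> gen_space C z"
  unfolding gen_space_def
proof safe
  fix k assume "(shifted C z ^^ k) v = 0"
  then show "\<exists>k. (shifted C z ^^ k) (C *v v) = 0" by (intro exI[of _ k]) (simp add: shifted_power_matrix)
qed

lemma gen_space_shiftedD: "shifted C z v \<in> gen_space C z \<Longrightarrow> v \<in> gen_space C z"
  unfolding gen_space_def
proof safe
  fix k assume "(shifted C z ^^ k) (shifted C z v) = 0"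
  then show "\<exists>k. (shifted C z ^^ k) v = 0" by (intro exI[of _ "Suc k"]) (simp add: funpow_swap1)
qed

text \<open>On the generalized eigenspace of another eigenvalue \<open>C - z\<close> is invertible: there it is \<open>z' - z\<close> plus a
  nilpotent operator.\<close>

lemma shifted_solvable:
  assumes z: "z \<noteq> z'" and v: "v \<in> gen_space C z'" shows "\<exists>u\<in>gen_space C z'. shifted C z u = v"
proof -
  obtain k where "(shifted C z' ^^ k) v = 0" using v by (auto simp: gen_space_def)
  then show ?thesis using v
  proof (induction k arbitrary: v)
    case 0
    then show ?case by (intro bexI[of _ 0]) auto
  next
    case (Suc k)
    have g: "shifted C z' v \<in> gen_space C z'"
      using Suc.prems(1) unfolding gen_space_def by (auto simp: funpow_swap1)
    then obtain u where u: "u \<in> gen_space C z'" "shifted C z u = shifted C z' v"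
      using Suc.IH[of "shifted C z' v"] Suc.prems(1) by (auto simp: funpow_swap1)
    have e: "shifted C z (v - u) = (z' - z) *s v"
      unfolding shifted_diff u(2) by (simp add: shifted_def vec_eq_iff algebra_simps)
    have "shifted C z ((1 / (z' - z)) *s (v - u)) = v"
      unfolding shifted_scale e vec.scale_scale using z by simp
    moreover have "v - u \<in> gen_space C z'"
      by (rule subspace_diff[OF subspace_gen_space Suc.prems(2) u(1)])
    ultimately show ?case using gen_space_scale by blast
  qed
qed

text \<open>The value \<open>p(C) v\<close>, by Horner's scheme.\<close>

definition poly_act :: "complex^'d^'d \<Rightarrow> complex^'d \<Rightarrow> complex poly \<Rightarrow> complex^'d" where
  "poly_act C v p = fold_coeffs (\<lambda>a w. a *s v + C *v w) p 0"

lemma poly_act_0 [simp]: "poly_act C v 0 = 0"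
  by (simp add: poly_act_def)

lemma poly_act_pCons: "poly_act C v (pCons a p) = a *s v + C *v poly_act C v p"
  by (cases "a = 0 \<and> p = 0") (auto simp: poly_act_def)

lemma poly_act_add: "poly_act C v (p + q) = poly_act C v p + poly_act C v q"
  by (induction p q rule: poly_induct2)
     (simp_all add: poly_act_pCons matrix_vector_right_distrib vec.scale_left_distrib)

lemma poly_act_smult: "poly_act C v (smult c p) = c *s poly_act C v p"
  by (induction p) (simp_all add: poly_act_pCons matrix_vector_mult_cscale vec.scale_right_distrib)

lemma poly_act_monom: "poly_act C v (monom c n) = c *s ((*v) C ^^ n) v"
  by (induction n) (simp_all add: monom_0 monom_Suc poly_act_pCons matrix_vector_mult_cscale)

lemma poly_act_sum: "poly_act C v (\<Sum>i\<in>I. f i) = (\<Sum>i\<in>I. poly_act C v (f i))"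
  by (induction I rule: infinite_finite_induct) (simp_all add: poly_act_add)

lemma poly_act_shifted: "poly_act C (shifted C z v) q = shifted C z (poly_act C v q)"
  by (induction q) (simp_all add: poly_act_pCons shifted_add shifted_scale shifted_commute)

lemma poly_act_factor: "poly_act C v ([:- z, 1:] * q) = shifted C z (poly_act C v q)"
proof -
  have "[:- z, 1:] * q = smult (- z) q + pCons 0 q" by simp
  then show ?thesis
    by (simp only: poly_act_add poly_act_smult poly_act_pCons shifted_def) (simp add: vec.scale_minus_left)
qed

text \<open>The vectors \<open>v, C v, C\<^sup>2 v, \<dots>\<close> are linearly dependent. If two of them coincide, they give the polynomial
  directly, since then the family is not a set of that many vectors.\<close>

lemma ex_annihilator: "\<exists>p. p \<noteq> 0 \<and> poly_act C v p = 0" for C :: "complex^'d^'d"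
proof -
  define x where "x n = ((*v) C ^^ n) v" for n
  let ?I = "{..CARD('d)}"
  show ?thesis
  proof (cases "inj_on x ?I")
    case False
    then obtain i j where ij: "i \<noteq> j" "x i = x j" by (auto simp: inj_on_def)
    have "coeff (monom (1 :: complex) i + monom (- 1) j) i = 1" using ij by simp
    then have "monom (1 :: complex) i + monom (- 1) j \<noteq> 0" by (metis coeff_0 zero_neq_one)
    moreover have "poly_act C v (monom 1 i + monom (- 1) j) = 0"
      using ij by (simp add: poly_act_add poly_act_monom x_def)
    ultimately show ?thesis by blast
  next
    case True
    have "vec.dependent (x ` ?I)"
    proof (rule ccontr)
      assume "\<not> vec.dependent (x ` ?I)"
      then have "card (x ` ?I) \<le> vec.dim (UNIV :: (complex^'d) set)" by (intro vec.independent_card_le_dim) auto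
      then show False using card_image[OF True] unfolding vec_dim_card by simp
    qed
    then obtain u where u: "\<exists>w\<in>x ` ?I. u w \<noteq> 0" "(\<Sum>w\<in>x ` ?I. u w *s w) = 0"
      by (subst (asm) vec.dependent_finite) auto
    define p where "p = (\<Sum>i\<in>?I. monom (u (x i)) i)"
    have "poly_act C v p = (\<Sum>i\<in>?I. u (x i) *s x i)"
      unfolding p_def poly_act_sum poly_act_monom x_def ..
    also have "\<dots> = (\<Sum>w\<in>x ` ?I. u w *s w)" by (simp add: sum.reindex[OF True])
    finally have "poly_act C v p = 0" using u(2) by simp
    moreover obtain i where i: "i \<in> ?I" "u (x i) \<noteq> 0" using u(1) by blast
    have "coeff p i = u (x i)" unfolding p_def coeff_sum using i by (simp add: sum.delta)
    then have "p \<noteq> 0" using i by auto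
    ultimately show ?thesis by blast
  qed
qed

abbreviation gen_span :: "complex^'d^'d \<Rightarrow> complex set \<Rightarrow> (complex^'d) set" where
  "gen_span C Z \<equiv> span (\<Union>z\<in>Z. gen_space C z)"

text \<open>On the generalized eigenspace of \<open>z\<close> itself the equation need not be solvable, which is why an error \<open>g\<close> in that
  space is allowed.\<close>

lemma gen_span_solve:
  assumes "v \<in> gen_span C Z"
  shows "\<exists>u\<in>gen_span C Z. \<exists>g\<in>gen_space C z. v = shifted C z u + g \<and> (z \<notin> Z \<longrightarrow> g = 0)"
  using assms
proof (induction rule: span_induct)
  case base
  show ?case unfolding subspace_def
  proof (intro conjI ballI allI CollectI)
    show "\<exists>u\<in>gen_span C Z. \<exists>g\<in>gen_space C z. 0 = shifted C z u + g \<and> (z \<notin> Z \<longrightarrow> g = 0)"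
      by (intro bexI[of _ 0]) (auto simp: span_zero)
    fix v assume "v \<in> {v. \<exists>u\<in>gen_span C Z. \<exists>g\<in>gen_space C z. v = shifted C z u + g \<and> (z \<notin> Z \<longrightarrow> g = 0)}"
    then obtain u g where ug: "u \<in> gen_span C Z" "g \<in> gen_space C z" "v = shifted C z u + g" "z \<notin> Z \<longrightarrow> g = 0" by blast
    show "\<exists>u\<in>gen_span C Z. \<exists>g\<in>gen_space C z. c *\<^sub>R v = shifted C z u + g \<and> (z \<notin> Z \<longrightarrow> g = 0)" for c
      by (rule bexI[of _ "c *\<^sub>R u"], rule bexI[of _ "c *\<^sub>R g"])
         (use ug in \<open>auto simp: span_scale subspace_scale[OF subspace_gen_space] linear_scale[OF linear_shifted] scaleR_right_distrib\<close>)
    fix v' assume "v' \<in> {v. \<exists>u\<in>gen_span C Z. \<exists>g\<in>gen_space C z. v = shifted C z u + g \<and> (z \<notin> Z \<longrightarrow> g = 0)}"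
    then obtain u' g' where ug': "u' \<in> gen_span C Z" "g' \<in> gen_space C z" "v' = shifted C z u' + g'" "z \<notin> Z \<longrightarrow> g' = 0" by blast
    show "\<exists>u\<in>gen_span C Z. \<exists>g\<in>gen_space C z. v + v' = shifted C z u + g \<and> (z \<notin> Z \<longrightarrow> g = 0)"
      by (rule bexI[of _ "u + u'"], rule bexI[of _ "g + g'"])
         (use ug ug' in \<open>auto simp: span_add gen_space_add shifted_add\<close>)
  qed
next
  case (step v)
  then obtain z' where z': "z' \<in> Z" "v \<in> gen_space C z'" by blast
  show ?case
  proof (cases "z = z'")
    case True
    then show ?thesis using z' by (intro bexI[of _ 0] bexI[of _ v]) (auto simp: span_zero)
  next
    case False
    obtain u where u: "u \<in> gen_space C z'" "shifted C z u = v" using shifted_solvable[OF False z'(2)] by blast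
    then show ?thesis using z' by (intro bexI[of _ u] bexI[of _ 0]) (auto intro: span_base)
  qed
qed

text \<open>Induction on the degree of a polynomial that annihilates \<open>v\<close>: a root \<open>z\<close> exists by the fundamental theorem of
  algebra, \<open>(C - z) v\<close> has an annihilator of smaller degree, and \<open>v\<close> can be recovered from it modulo the
  generalized eigenspace of \<open>z\<close>.\<close>

lemma gen_span_UNIV: "gen_span C UNIV = UNIV"
proof -
  have pull: "v \<in> gen_span C UNIV" if h: "shifted C z v \<in> gen_span C UNIV" for z v
  proof -
    obtain u g where ug: "u \<in> gen_span C UNIV" "g \<in> gen_space C z" "shifted C z v = shifted C z u + g"
      using gen_span_solve[OF h, of z] by (elim bexE conjE) (rule that)
    have "shifted C z (v - u) = g" using ug(3) by (simp add: shifted_diff)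
    then have "shifted C z (v - u) \<in> gen_space C z" using ug(2) by simp
    then have "v - u \<in> gen_space C z" by (rule gen_space_shiftedD)
    then have "v - u \<in> gen_span C UNIV" by (intro span_base) auto
    from span_add[OF this ug(1)] show ?thesis by simp
  qed
  have "v \<in> gen_span C UNIV" if "p \<noteq> 0" "poly_act C v p = 0" for p v
    using that
  proof (induction "degree p" arbitrary: p v rule: less_induct)
    case less
    show ?case
    proof (cases "degree p = 0")
      case True
      then obtain c where "p = [:c:]" by (rule degree_eq_zeroE)
      then have "v = 0" using less.prems by (simp add: poly_act_pCons)
      then show ?thesis by (simp add: span_zero)
    next
      case False
      then obtain z where "poly p z = 0"
        using fundamental_theorem_of_algebra[of p] by (auto simp: constant_degree)
      then obtain q where q: "p = [:- z, 1:] * q" by (auto simp: poly_eq_0_iff_dvd elim: dvdE)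
      then have q0: "q \<noteq> 0" using less.prems by auto
      then have "degree p = Suc (degree q)" unfolding q by (subst degree_mult_eq) auto
      then have "shifted C z v \<in> gen_span C UNIV"
        using less.prems q q0 by (intro less.hyps[of q]) (simp_all add: poly_act_shifted poly_act_factor del: mult_pCons_left)
      then show ?thesis by (rule pull)
    qed
  qed
  then show ?thesis using ex_annihilator by blast
qed

text \<open>Finitely many generalized eigenspaces already span. For any other \<open>z\<close>, the operator \<open>C - z\<close> is onto and
  hence injective.\<close>

lemma finite_eigenvalues: "finite {z. \<exists>v. v \<noteq> 0 \<and> C *v v = z *s v}" for C :: "complex^'d^'d"
proof -
  have "\<exists>Z. finite Z \<and> v \<in> gen_span C Z" for v
  proof -
    have "v \<in> gen_span C UNIV" by (simp add: gen_span_UNIV)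
    then obtain T r where T: "finite T" "T \<subseteq> (\<Union>z. gen_space C z)" "v = (\<Sum>a\<in>T. r a *\<^sub>R a)"
      unfolding span_explicit by blast
    then have "\<forall>a\<in>T. \<exists>z. a \<in> gen_space C z" by blast
    then obtain f where f: "\<And>a. a \<in> T \<Longrightarrow> a \<in> gen_space C (f a)" by metis
    have "v \<in> gen_span C (f ` T)"
      unfolding T(3) by (intro span_sum span_scale span_base) (use f in blast)
    then show ?thesis using T(1) by blast
  qed
  then obtain Z where Z: "\<And>v. finite (Z v)" "\<And>v. v \<in> gen_span C (Z v)" by metis
  define Y where "Y = (\<Union>b\<in>Basis. Z b)"
  have Y: "finite Y" using Z(1) by (simp add: Y_def)
  have "Basis \<subseteq> gen_span C Y"
  proof
    fix b :: "complex^'d" assume "b \<in> Basis"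
    then have "gen_span C (Z b) \<subseteq> gen_span C Y" unfolding Y_def by (intro span_mono) auto
    then show "b \<in> gen_span C Y" using Z(2) by blast
  qed
  then have "span Basis \<subseteq> gen_span C Y" by (rule span_minimal) simp
  then have U: "gen_span C Y = UNIV" unfolding span_Basis by blast
  have "z \<in> Y" if v: "v \<noteq> 0" "C *v v = z *s v" for z v
  proof (rule ccontr)
    assume "z \<notin> Y"
    then have "surj (shifted C z)" using gen_span_solve[of _ C Y z] unfolding U surj_def by (metis UNIV_I add.right_neutral)
    then have "inj (shifted C z)" using linear_surjective_imp_injective[OF linear_shifted] by blast
    moreover have "shifted C z v = shifted C z 0" using v by (simp add: shifted_def)
    ultimately have "v = 0" by (rule injD)
    then show False using v by simp
  qed
  then show ?thesis by (intro finite_subset[OF _ Y]) blast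
qed

lemma gen_space_eigenvalue:
  assumes "v \<in> gen_space C z" "v \<noteq> 0" shows "\<exists>w. w \<noteq> 0 \<and> C *v w = z *s w"
proof -
  obtain k where "(shifted C z ^^ k) v = 0" using assms(1) by (auto simp: gen_space_def)
  then show ?thesis using assms(2)
  proof (induction k arbitrary: v)
    case (Suc k)
    show ?case
    proof (cases "shifted C z v = 0")
      case True
      then show ?thesis using Suc.prems by (auto simp: shifted_def)
    next
      case False
      then show ?thesis using Suc.prems by (intro Suc.IH[of "shifted C z v"]) (simp_all add: funpow_swap1)
    qed
  qed simp
qed

section \<open>Spectral decomposition of a real matrix\<close>

definition real_vec :: "complex^'d \<Rightarrow> real^'d" where "real_vec v = (\<chi> i. Re (v $ i))"

lemma linear_real_vec: "linear real_vec"
  by (intro linearI) (simp_all add: real_vec_def vec_eq_iff)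

lemma real_vec_0 [simp]: "real_vec 0 = 0"
  by (rule linear_0[OF linear_real_vec])

lemma real_vec_imaginary: "(\<chi> i. Im (v $ i)) = real_vec (- \<i> *s v)"
  by (simp add: real_vec_def vec_eq_iff)

lemma real_vec_matrix: "real_vec (complexify M *v v) = M *v real_vec v"
  by (simp add: real_vec_def complexify_def matrix_vector_mult_def vec_eq_iff)

lemma norm_cscale: "norm (c *s v) = cmod c * norm v" for v :: "complex^'d"
  by (simp add: norm_vec_def L2_set_def norm_mult power_mult_distrib sum_distrib_left[symmetric] real_sqrt_mult)

text \<open>Imaginary parts are real parts of multiples by \<open>- \<i>\<close>, and the zero vector changes no span.\<close>

lemma real_part_space_eq:
  "real_part_space M \<xi> = span (\<Union>z\<in>{z. Re z = \<xi>}. real_vec ` gen_space (complexify M) z)" (is "_ = span ?G")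
proof -
  have gen: "generalized_eigenvector M z v \<longleftrightarrow> v \<noteq> 0 \<and> v \<in> gen_space (complexify M) z" for z v
    by (simp add: generalized_eigenvector_def gen_space_def shifted_def[abs_def])
  let ?H = "\<Union>v\<in>{v. \<exists>z. Re z = \<xi> \<and> generalized_eigenvector M z v}. {\<chi> i. Re (v $ i), \<chi> i. Im (v $ i)}"
  have "?H \<subseteq> ?G"
  proof
    fix x assume "x \<in> ?H"
    then obtain v z where v: "Re z = \<xi>" "v \<in> gen_space (complexify M) z" "x = (\<chi> i. Re (v $ i)) \<or> x = (\<chi> i. Im (v $ i))"
      by (auto simp: gen)
    then have "x = real_vec v \<or> x = real_vec (- \<i> *s v)" by (simp add: real_vec_imaginary real_vec_def[of v])
    then show "x \<in> ?G" using v(1,2) gen_space_scale by blast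
  qed
  moreover have "?G \<subseteq> insert 0 ?H"
  proof
    fix x assume "x \<in> ?G"
    then obtain z v where v: "Re z = \<xi>" "v \<in> gen_space (complexify M) z" "x = real_vec v" by blast
    show "x \<in> insert 0 ?H"
    proof (cases "v = 0")
      case True
      then show ?thesis using v(3) by simp
    next
      case False
      then have "v \<in> {v. \<exists>z. Re z = \<xi> \<and> generalized_eigenvector M z v}" using v gen by blast
      moreover have "x \<in> {\<chi> i. Re (v $ i), \<chi> i. Im (v $ i)}" using v(3) by (simp add: real_vec_def)
      ultimately show ?thesis by blast
    qed
  qed
  ultimately have "span ?H = span ?G"
    using span_mono[of ?H ?G] span_mono[of ?G "insert 0 ?H"] unfolding span_insert_0 by (intro subset_antisym)
  then show ?thesis by (simp add: real_part_space_def)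
qed

lemma finite_complex_spectrum: "finite (complex_spectrum M)"
  unfolding complex_spectrum_def by (rule finite_eigenvalues)

lemma gen_space_spectrum: "v \<in> gen_space (complexify M) z \<Longrightarrow> v \<noteq> 0 \<Longrightarrow> z \<in> complex_spectrum M"
  unfolding complex_spectrum_def using gen_space_eigenvalue by blast

lemma complex_spectrum_nonempty: "complex_spectrum M \<noteq> {}" for M :: "real^'d^'d"
proof
  assume "complex_spectrum M = {}"
  then have "gen_space (complexify M) z \<subseteq> {0}" for z using gen_space_spectrum by blast
  then have "gen_span (complexify M) UNIV \<subseteq> span {0}" by (intro span_mono) auto
  then have "(axis undefined 1 :: complex^'d) \<in> {0}" unfolding gen_span_UNIV by auto
  then show False by (simp add: axis_eq_0_iff)
qed

lemma span_real_part_spaces: "span (\<Union>\<xi>\<in>Re ` complex_spectrum M. real_part_space M \<xi>) = UNIV"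
proof -
  let ?W = "span (\<Union>\<xi>\<in>Re ` complex_spectrum M. real_part_space M \<xi>)"
  have "real_vec ` (\<Union>z. gen_space (complexify M) z) \<subseteq> ?W"
  proof clarify
    fix z v assume v: "v \<in> gen_space (complexify M) z"
    show "real_vec v \<in> ?W"
    proof (cases "v = 0")
      case True
      then show ?thesis by (simp add: span_zero)
    next
      case False
      have "real_vec v \<in> real_part_space M (Re z)" unfolding real_part_space_eq using v by (intro span_base) blast
      then show ?thesis using gen_space_spectrum[OF v False] by (intro span_base) blast
    qed
  qed
  then have "real_vec ` gen_span (complexify M) UNIV \<subseteq> ?W"
    unfolding linear_span_image[OF linear_real_vec, symmetric] by (rule span_minimal) simp
  moreover have "x = real_vec (\<chi> i. complex_of_real (x $ i))" for x by (simp add: real_vec_def vec_eq_iff)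
  ultimately show ?thesis unfolding gen_span_UNIV by blast
qed

text \<open>Induction on the order of nilpotency, integrating the derivative \<open>exp (t L) (L v)\<close>. The polynomial factors
  are hidden in \<open>exp (\<delta> \<bar>t\<bar>)\<close> at once.\<close>

lemma nilpotent_growth:
  fixes L :: "'a::euclidean_space endo"
  assumes "app (L ^ k) v = 0" "0 < \<delta>"
  shows "\<exists>C. \<forall>t. norm (app (expm t L) v) \<le> C * exp (\<delta> * \<bar>t\<bar>)"
  using assms
proof (induction k arbitrary: v \<delta>)
  case 0
  then show ?case by (intro exI[of _ 0]) (simp add: app_simps)
next
  case (Suc k)
  have "app (L ^ k) (app L v) = 0" using Suc.prems(1) by (simp add: power_Suc2 del: power_Suc)
  then obtain C where C: "\<And>t. norm (app (expm t L) (app L v)) \<le> C * exp (\<delta> / 2 * \<bar>t\<bar>)"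
    using Suc.IH[of "app L v" "\<delta> / 2"] Suc.prems(2) by auto
  have C0: "0 \<le> C" using order_trans[OF norm_ge_zero C[of 0]] by simp
  have "norm (app (expm t L) v) \<le> (norm v + 2 * C / \<delta>) * exp (\<delta> * \<bar>t\<bar>)" for t
  proof -
    let ?S = "cball (0::real) \<bar>t\<bar>"
    have "norm (app (expm t L) v - app (expm 0 L) v) \<le> (C * exp (\<delta> / 2 * \<bar>t\<bar>)) * norm (t - 0)"
    proof (rule differentiable_bound[where S = ?S and f' = "\<lambda>s h. h *\<^sub>R app L (app (expm s L) v)"])
      show "((\<lambda>s. app (expm s L) v) has_derivative (\<lambda>h. h *\<^sub>R app L (app (expm s L) v))) (at s within ?S)" for s
        using expm_has_vector_derivative[of L v s ?S] by (simp add: has_vector_derivative_def)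
      fix s assume s: "s \<in> ?S"
      have "norm (app L (app (expm s L) v)) \<le> C * exp (\<delta> / 2 * \<bar>s\<bar>)"
        using C[of s] by (simp add: expm_app_commute)
      also have "\<dots> \<le> C * exp (\<delta> / 2 * \<bar>t\<bar>)" using s C0 Suc.prems(2) by (intro mult_left_mono) auto
      finally show "onorm (\<lambda>h. h *\<^sub>R app L (app (expm s L) v)) \<le> C * exp (\<delta> / 2 * \<bar>t\<bar>)"
        by (intro onorm_le) (use mult_right_mono[OF _ abs_ge_zero] in \<open>force simp: mult.commute[of "\<bar>_\<bar>"]\<close>)
    qed auto
    then have "norm (app (expm t L) v - v) \<le> C * exp (\<delta> / 2 * \<bar>t\<bar>) * \<bar>t\<bar>" by simp
    also have "\<dots> \<le> C * exp (\<delta> / 2 * \<bar>t\<bar>) * (2 / \<delta> * exp (\<delta> / 2 * \<bar>t\<bar>))"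
    proof (rule mult_left_mono)
      have "\<delta> / 2 * \<bar>t\<bar> \<le> exp (\<delta> / 2 * \<bar>t\<bar>)" using exp_ge_add_one_self[of "\<delta> / 2 * \<bar>t\<bar>"] by linarith
      then show "\<bar>t\<bar> \<le> 2 / \<delta> * exp (\<delta> / 2 * \<bar>t\<bar>)" using Suc.prems(2) by (simp add: field_simps)
    qed (use C0 in simp)
    also have "\<dots> = 2 * C / \<delta> * (exp (\<delta> / 2 * \<bar>t\<bar>) * exp (\<delta> / 2 * \<bar>t\<bar>))" by simp
    also have "exp (\<delta> / 2 * \<bar>t\<bar>) * exp (\<delta> / 2 * \<bar>t\<bar>) = exp (\<delta> * \<bar>t\<bar>)" by (simp add: exp_add[symmetric])
    finally have 1: "norm (app (expm t L) v - v) \<le> 2 * C / \<delta> * exp (\<delta> * \<bar>t\<bar>)" .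
    have "norm v * 1 \<le> norm v * exp (\<delta> * \<bar>t\<bar>)" using Suc.prems(2) by (intro mult_left_mono) auto
    then show ?thesis using 1 norm_triangle_sub[of "app (expm t L) v" v] by (simp add: distrib_right)
  qed
  then show ?case by blast
qed

lemma linear_cscale: "linear ((*s) z :: complex^'d \<Rightarrow> complex^'d)"
  by (intro linearI) (simp_all add: scaleR_cscale vec.scale_right_distrib mult.commute)

lemma expm_cscale: "app (expm t (endo_of ((*s) z))) v = exp (of_real t * z) *s v" for v :: "complex^'d"
proof -
  let ?J = "endo_of ((*s) z :: complex^'d \<Rightarrow> complex^'d)"
  have J: "app ?J = (*s) z" by (rule app_endo_of[OF linear_cscale])
  have Jn: "app (?J ^ n) v = (z ^ n) *s v" for n
    by (induction n) (simp_all add: J)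
  have "linear (\<lambda>c :: complex. c *s v)"
    by (intro linearI) (simp_all add: scaleR_cscale vec.scale_left_distrib scaleR_conv_of_real[where 'a = complex])
  then have bl: "bounded_linear (\<lambda>c :: complex. c *s v)" by (simp add: linear_conv_bounded_linear)
  have "(\<lambda>n. ((of_real t * z) ^ n /\<^sub>R fact n) *s v) sums (exp (of_real t * z) *s v)"
    by (rule bounded_linear.sums[OF bl exp_converges])
  moreover have "(\<lambda>n. ((of_real t * z) ^ n /\<^sub>R fact n) *s v) = (\<lambda>n. ((t ^ n) /\<^sub>R fact n) *\<^sub>R app (?J ^ n) v)"
    unfolding Jn scaleR_cscale vec.scale_scale
    by (simp add: power_mult_distrib scaleR_conv_of_real[where 'a = complex] mult.assoc)
  ultimately have "(\<lambda>n. ((t ^ n) /\<^sub>R fact n) *\<^sub>R app (?J ^ n) v) sums (exp (of_real t * z) *s v)" by (simp only:)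
  then show ?thesis by (rule sums_unique2[OF app_expm_sums])
qed

text \<open>The scalar \<open>z\<close> and the nilpotent part \<open>C - z\<close> commute, so the exponential factorizes. Complex vectors are treated
  as a real space, on which multiplication by \<open>z\<close> is an endomorphism.\<close>

lemma gen_space_growth:
  assumes v: "v \<in> gen_space C z" and \<delta>: "0 < \<delta>"
  shows "\<exists>c. \<forall>t. norm (app (expm t (endo_of ((*v) C))) v) \<le> c * exp (Re z * t + \<delta> * \<bar>t\<bar>)"
proof -
  let ?J = "endo_of ((*s) z :: complex^'d \<Rightarrow> complex^'d)" and ?C = "endo_of ((*v) C)"
  have J: "app ?J = (*s) z" by (rule app_endo_of[OF linear_cscale])
  have C: "app ?C = (*v) C" by (rule app_endo_of[OF linear_complex_matrix])
  define L where "L = ?C - ?J"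
  have L: "app L w = shifted C z w" for w by (simp add: L_def app_simps C J shifted_def)
  have Ln: "app (L ^ k) w = (shifted C z ^^ k) w" for k w by (induction k) (simp_all add: L)
  obtain k where "app (L ^ k) v = 0" using v by (auto simp: gen_space_def Ln)
  then obtain c where c: "\<And>t. norm (app (expm t L) v) \<le> c * exp (\<delta> * \<bar>t\<bar>)" using nilpotent_growth[OF _ \<delta>] by blast
  have "norm (app (expm t ?C) v) \<le> c * exp (Re z * t + \<delta> * \<bar>t\<bar>)" for t
  proof -
    have "?J * L = L * ?J" by (rule endo_eqI) (simp add: J L shifted_scale)
    then have "exp (t *\<^sub>R ?J + t *\<^sub>R L) = expm t ?J * expm t L" by (intro exp_add_commuting) simp
    moreover have "t *\<^sub>R ?J + t *\<^sub>R L = t *\<^sub>R ?C" by (simp add: L_def scaleR_add_right[symmetric])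
    ultimately have "app (expm t ?C) v = exp (of_real t * z) *s app (expm t L) v" by (simp add: expm_cscale)
    then have "norm (app (expm t ?C) v) = exp (t * Re z) * norm (app (expm t L) v)" by (simp add: norm_cscale)
    also have "\<dots> \<le> exp (t * Re z) * (c * exp (\<delta> * \<bar>t\<bar>))" by (intro mult_left_mono c) simp
    also have "\<dots> = c * exp (Re z * t + \<delta> * \<bar>t\<bar>)" by (simp add: exp_add mult_ac)
    finally show ?thesis .
  qed
  then show ?thesis by blast
qed

text \<open>Real parts intertwine the flows of a real matrix on complex and on real vectors.\<close>

lemma real_vec_expm:
  "real_vec (app (expm t (endo_of ((*v) (complexify M)))) v) = app (expm t (endo_of ((*v) M))) (real_vec v)"
proof -
  let ?C = "endo_of ((*v) (complexify M))" and ?M = "endo_of ((*v) M)"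
  have C: "app ?C = (*v) (complexify M)" by (rule app_endo_of[OF linear_complex_matrix])
  have M: "app ?M = (*v) M" by (rule app_endo_of) simp
  have n: "real_vec (app (?C ^ n) v) = app (?M ^ n) (real_vec v)" for n
    by (induction n) (simp_all add: C M real_vec_matrix)
  have bl: "bounded_linear real_vec" using linear_real_vec by (simp add: linear_conv_bounded_linear)
  have "(\<lambda>n. ((t ^ n) /\<^sub>R fact n) *\<^sub>R app (?M ^ n) (real_vec v)) sums real_vec (app (expm t ?C) v)"
    using bounded_linear.sums[OF bl app_expm_sums[of t ?C v]] by (simp add: linear_scale[OF linear_real_vec] n)
  then show ?thesis by (rule sums_unique2[OF _ app_expm_sums])
qed

theorem matrix_spectral_splitting:
  "spectral_splitting (endo_of ((*v) M)) (Re ` complex_spectrum M) (real_part_space M)"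
proof
  let ?M = "endo_of ((*v) M)"
  have M: "app ?M = (*v) M" by (rule app_endo_of) simp
  show "finite (Re ` complex_spectrum M)" by (intro finite_imageI finite_complex_spectrum)
  show "subspace (real_part_space M \<xi>)" for \<xi> by (simp add: real_part_space_def)
  show "span (\<Union>\<xi>\<in>Re ` complex_spectrum M. real_part_space M \<xi>) = UNIV" by (rule span_real_part_spaces)
  show "app ?M x \<in> real_part_space M \<xi>" if "x \<in> real_part_space M \<xi>" for x \<xi>
    using that unfolding real_part_space_eq
  proof (induction rule: span_induct)
    case base
    then show ?case by (simp add: subspace_def app_simps span_add span_scale span_zero)
  next
    case (step x)
    then obtain z v where v: "Re z = \<xi>" "v \<in> gen_space (complexify M) z" "x = real_vec v" by blast
    then have "app ?M x = real_vec (complexify M *v v)" by (simp add: M real_vec_matrix)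
    moreover have "complexify M *v v \<in> gen_space (complexify M) z" by (rule gen_space_matrix[OF v(2)])
    ultimately show ?case using v(1) by (intro span_base) blast
  qed
  show "\<exists>C. \<forall>t. norm (app (expm t ?M) x) \<le> C * exp (\<xi> * t + \<delta> * \<bar>t\<bar>)"
    if x: "x \<in> real_part_space M \<xi>" and \<delta>: "0 < \<delta>" for x \<xi> \<delta>
    using x unfolding real_part_space_eq
  proof (induction rule: span_induct)
    case base
    show ?case using subspace_growth[where I = UNIV] by simp
  next
    case (step x)
    then obtain z v where v: "Re z = \<xi>" "v \<in> gen_space (complexify M) z" "x = real_vec v" by blast
    obtain c where c: "\<And>t. norm (app (expm t (endo_of ((*v) (complexify M)))) v) \<le> c * exp (\<xi> * t + \<delta> * \<bar>t\<bar>)"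
      using gen_space_growth[OF v(2) \<delta>] v(1) by blast
    obtain k where k: "0 < k" "\<And>w :: complex^'a. norm (real_vec w) \<le> norm w * k"
      using bounded_linear.pos_bounded[of real_vec] linear_real_vec by (auto simp: linear_conv_bounded_linear)
    have "norm (app (expm t ?M) x) \<le> c * k * exp (\<xi> * t + \<delta> * \<bar>t\<bar>)" for t
    proof -
      have "norm (app (expm t ?M) x) \<le> norm (app (expm t (endo_of ((*v) (complexify M)))) v) * k"
        unfolding v(3) real_vec_expm[symmetric] by (rule k)
      also have "\<dots> \<le> c * exp (\<xi> * t + \<delta> * \<bar>t\<bar>) * k" using k(1) by (intro mult_right_mono c) auto
      finally show ?thesis by (simp add: mult_ac)
    qed
    then show ?case by blast
  qed
qed

section \<open>The limit of fast switching\<close>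

context switching
begin

text \<open>The levels are climbed one by one. The block length \<open>\<tau>\<close> and the ratio \<open>\<rho>\<close> have to be common to all
  levels, which is possible because each step holds for all sufficiently large values.\<close>

lemma top_level_dominates:
  assumes splitting: "spectral_splitting M \<Xi> F" and \<Xi>: "\<Xi> \<noteq> {}" and \<delta>: "0 < \<delta>"
    and trans: "\<And>\<eta>. \<eta> \<in> \<Xi> \<Longrightarrow> \<eta> \<noteq> Max \<Xi> \<Longrightarrow>
      \<exists>j. 0 < p j \<and> (\<forall>\<theta>\<in>F \<eta>. norm \<theta> = 1 \<longrightarrow> app (A j) \<theta> \<notin> span (\<Union>\<zeta>\<in>{\<zeta> \<in> \<Xi>. \<zeta> \<le> \<eta>}. F \<zeta>))"
  shows "\<exists>\<tau>>0. \<forall>\<eta>>0. \<forall>\<^sub>F \<epsilon> in at_right 0. \<forall>m. \<tau> \<le> real m * \<epsilon> \<longrightarrow> real m * \<epsilon> \<le> \<tau> + 1 \<longrightarrow>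
    (\<exists>b0. \<forall>b\<ge>b0. \<forall>x. E \<epsilon> (b * m) (\<lambda>y. P \<epsilon> m {y'. norm y' < exp ((Max \<Xi> - \<delta>) * (real m * \<epsilon>)) * norm y} y) x \<le> ennreal \<eta>)"
proof -
  interpret S: spectral_splitting M \<Xi> F by (rule splitting)
  note fin = S.finite_\<Xi>
  have dom: "\<exists>\<beta> t0. dominated (S.Q \<xi>) \<beta> t0" for \<xi>
    unfolding dominated_def using S.Q_commute S.Q_dominated[of \<xi>] by metis
  define pred where "pred \<xi> = Max {\<zeta> \<in> \<Xi>. \<zeta> < \<xi>}" for \<xi>
  have pred: "pred \<xi> \<in> \<Xi>" "pred \<xi> < \<xi>" "\<And>\<zeta>. \<zeta> \<in> \<Xi> \<Longrightarrow> \<zeta> < \<xi> \<Longrightarrow> \<zeta> \<le> pred \<xi>" if "\<xi> \<in> \<Xi>" "\<xi> \<noteq> Min \<Xi>" for \<xi>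
  proof -
    have "Min \<Xi> \<in> {\<zeta> \<in> \<Xi>. \<zeta> < \<xi>}"
      using that(2) Min_in[OF fin \<Xi>] Min_le[OF fin that(1)] by (simp add: less_le)
    then have "pred \<xi> \<in> {\<zeta> \<in> \<Xi>. \<zeta> < \<xi>}" unfolding pred_def using fin by (intro Max_in) auto
    then show "pred \<xi> \<in> \<Xi>" "pred \<xi> < \<xi>" by auto
    show "\<zeta> \<le> pred \<xi>" if "\<zeta> \<in> \<Xi>" "\<zeta> < \<xi>" for \<zeta>
      unfolding pred_def using fin that by (intro Max_ge) auto
  qed
  have step: "\<exists>k>0. \<forall>\<tau>\<ge>k. \<forall>\<rho>\<ge>k. reaches \<tau> \<rho> (S.Q (pred \<xi>)) \<longrightarrow> reaches \<tau> \<rho> (S.Q \<xi>)" if \<xi>: "\<xi> \<in> \<Xi>" "\<xi> \<noteq> Min \<Xi>" for \<xi>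
  proof -
    note pred = pred[OF \<xi>]
    have "pred \<xi> \<noteq> Max \<Xi>" using pred(2) Max_ge[OF fin \<xi>(1)] by simp
    then obtain j where j: "0 < p j" "\<And>\<theta>. \<theta> \<in> F (pred \<xi>) \<Longrightarrow> norm \<theta> = 1 \<Longrightarrow> app (A j) \<theta> \<notin> span (\<Union>\<zeta>\<in>{\<zeta> \<in> \<Xi>. \<zeta> \<le> pred \<xi>}. F \<zeta>)"
      using trans[OF pred(1)] by blast
    have "{\<zeta> \<in> \<Xi>. \<zeta> \<le> pred \<xi>} = {..<\<xi>} \<inter> \<Xi>" using pred by force
    then have V: "span (\<Union>\<zeta>\<in>{\<zeta> \<in> \<Xi>. \<zeta> \<le> pred \<xi>}. F \<zeta>) = S.V {..<\<xi>}" by (simp add: S.V_def)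
    have next_level: "\<xi> \<le> \<zeta>" if "\<zeta> \<in> \<Xi>" "pred \<xi> < \<zeta>" for \<zeta>
      using pred(3)[of \<zeta>] that by linarith
    obtain c B where cB: "0 < c" "0 \<le> B"
      "\<And>x. c * norm x \<le> norm (app (S.Q \<xi>) (app (A j) x)) + B * norm (app (S.Q \<xi>) x) + B * norm (x - app (S.Q (pred \<xi>)) x)"
      using S.transversality[OF pred(2) next_level j(2)[unfolded V]] by blast
    obtain \<beta> t0 where d: "dominated (S.Q \<xi>) \<beta> t0" using dom by blast
    define k where "k = max 1 (max t0 (4 * B * norm (S.Q (pred \<xi>)) / c))"
    have "reaches \<tau> \<rho> (S.Q \<xi>)" if "k \<le> \<tau>" "k \<le> \<rho>" "reaches \<tau> \<rho> (S.Q (pred \<xi>))" for \<tau> \<rho>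
    proof (rule reaches_step[OF that(3) d _ _ j(1) cB])
      show "t0 \<le> \<tau>" "0 < \<tau>" "0 < \<rho>" using that by (auto simp: k_def)
      have "4 * B * norm (S.Q (pred \<xi>)) / c \<le> \<rho>" using that by (simp add: k_def)
      then show "4 * B * norm (S.Q (pred \<xi>)) \<le> c * \<rho>" using cB(1) by (simp add: pos_divide_le_eq mult.commute)
    qed
    moreover have "0 < k" by (simp add: k_def)
    ultimately show ?thesis by blast
  qed
  then have "\<forall>\<xi>. \<exists>k>0. \<xi> \<in> \<Xi> \<longrightarrow> \<xi> \<noteq> Min \<Xi> \<longrightarrow> (\<forall>\<tau>\<ge>k. \<forall>\<rho>\<ge>k. reaches \<tau> \<rho> (S.Q (pred \<xi>)) \<longrightarrow> reaches \<tau> \<rho> (S.Q \<xi>))"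
    by (meson zero_less_one)
  then obtain k where k: "\<And>\<xi>. 0 < k \<xi>" "\<And>\<xi> \<tau> \<rho>. \<xi> \<in> \<Xi> \<Longrightarrow> \<xi> \<noteq> Min \<Xi> \<Longrightarrow> k \<xi> \<le> \<tau> \<Longrightarrow> k \<xi> \<le> \<rho> \<Longrightarrow>
      reaches \<tau> \<rho> (S.Q (pred \<xi>)) \<Longrightarrow> reaches \<tau> \<rho> (S.Q \<xi>)" by metis
  define k0 where "k0 = Max (k ` \<Xi>)"
  have k0: "k \<xi> \<le> k0" if "\<xi> \<in> \<Xi>" for \<xi> unfolding k0_def using fin that by (intro Max_ge) auto
  have k0_pos: "0 < k0" using k(1) k0 \<Xi> by (meson equals0I less_le_trans)
  have all: "reaches \<tau> \<rho> (S.Q \<xi>)" if \<tau>: "k0 \<le> \<tau>" "k0 \<le> \<rho>" and "\<xi> \<in> \<Xi>" for \<tau> \<rho> \<xi>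
    using \<open>\<xi> \<in> \<Xi>\<close>
  proof (induction "card {\<zeta> \<in> \<Xi>. \<zeta> < \<xi>}" arbitrary: \<xi> rule: less_induct)
    case less
    show ?case
    proof (cases "\<xi> = Min \<Xi>")
      case True
      then have "S.Q \<xi> = 1" using fin by (intro S.Q_bottom) auto
      then show ?thesis using reaches_one by simp
    next
      case False
      note pred = pred[OF less.prems False]
      have "card {\<zeta> \<in> \<Xi>. \<zeta> < pred \<xi>} < card {\<zeta> \<in> \<Xi>. \<zeta> < \<xi>}"
        by (rule psubset_card_mono) (use fin pred in auto)
      then have "reaches \<tau> \<rho> (S.Q (pred \<xi>))" by (rule less.hyps) (rule pred(1))
      then show ?thesis using k0[OF less.prems] \<tau> by (intro k(2)[OF less.prems False]) auto
    qed
  qed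
  let ?L = "Max \<Xi>"
  let ?U = "S.Q ?L"
  have L: "?L \<in> \<Xi>" using fin \<Xi> by (rule Max_in)
  obtain t1 where t1: "\<And>t x. t1 \<le> t \<Longrightarrow> 2 * (1 + 1 / k0) * (1 + norm ?U) * exp ((?L - \<delta>) * t) * norm (app ?U x) \<le> norm (app (expm t M) (app ?U x))"
    using S.Q_top_growth[OF \<delta>] by metis
  obtain \<beta> t0 where d: "dominated ?U \<beta> t0" using dom by blast
  define \<tau> where "\<tau> = max k0 (max t0 t1)"
  have \<tau>: "k0 \<le> \<tau>" "t0 \<le> \<tau>" "t1 \<le> \<tau>" by (auto simp: \<tau>_def)
  have "\<forall>\<eta>>0. \<forall>\<^sub>F \<epsilon> in at_right 0. \<forall>m. \<tau> \<le> real m * \<epsilon> \<longrightarrow> real m * \<epsilon> \<le> \<tau> + 1 \<longrightarrow>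
    (\<exists>b0. \<forall>b\<ge>b0. \<forall>x. E \<epsilon> (b * m) (\<lambda>y. P \<epsilon> m {y'. norm y' < exp ((?L - \<delta>) * (real m * \<epsilon>)) * norm y} y) x \<le> ennreal \<eta>)"
  proof (intro allI impI)
    fix \<eta> :: real assume "0 < \<eta>"
    show "\<forall>\<^sub>F \<epsilon> in at_right 0. \<forall>m. \<tau> \<le> real m * \<epsilon> \<longrightarrow> real m * \<epsilon> \<le> \<tau> + 1 \<longrightarrow>
      (\<exists>b0. \<forall>b\<ge>b0. \<forall>x. E \<epsilon> (b * m) (\<lambda>y. P \<epsilon> m {y'. norm y' < exp ((?L - \<delta>) * (real m * \<epsilon>)) * norm y} y) x \<le> ennreal \<eta>)"
    proof (rule slow_growth_rare[OF _ _ k0_pos _ _ d])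
      show "?U * M = M * ?U" by (rule S.Q_commute)
      show "reaches \<tau> k0 ?U" using all[OF \<tau>(1) order_refl L] .
      show "2 * (1 + 1 / k0) * (1 + norm ?U) * exp ((?L - \<delta>) * t) * norm (app ?U x) \<le> norm (app (expm t M) (app ?U x))"
        if "\<tau> \<le> t" for t x using t1 \<tau>(3) that by (meson order_trans)
    qed (use \<tau> k0_pos \<open>0 < \<eta>\<close> in auto)
  qed
  then show ?thesis using \<tau>(1) k0_pos by (intro exI[of _ \<tau>]) auto
qed

lemma spectral_mean_growth:
  assumes splitting: "spectral_splitting M \<Xi> F" and \<delta>: "0 < \<delta>"
  shows "\<exists>\<tau>>0. \<forall>\<^sub>F \<epsilon> in at_right 0. \<forall>m b x. \<tau> \<le> real m * \<epsilon> \<longrightarrow> real m * \<epsilon> \<le> \<tau> + 1 \<longrightarrow>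
    E \<epsilon> (b * m) (\<lambda>y. ennreal (norm y)) x \<le> ennreal (exp ((Max \<Xi> + \<delta>) * (real (b * m) * \<epsilon>)) * norm x)"
proof -
  interpret S: spectral_splitting M \<Xi> F by (rule splitting)
  obtain t1 where t1: "\<And>t x. t1 \<le> t \<Longrightarrow> norm (app (expm t M) x) \<le> exp ((Max \<Xi> + \<delta>) * t) / 2 * norm x"
    using S.total_growth[OF \<delta>, of "Max \<Xi>"] S.finite_\<Xi> by (metis Max_ge)
  have "\<forall>\<^sub>F \<epsilon> in at_right 0. \<forall>m b x. max 1 t1 \<le> real m * \<epsilon> \<longrightarrow> real m * \<epsilon> \<le> max 1 t1 + 1 \<longrightarrow>
    E \<epsilon> (b * m) (\<lambda>y. ennreal (norm y)) x \<le> ennreal (exp ((Max \<Xi> + \<delta>) * (real (b * m) * \<epsilon>)) * norm x)"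
    by (rule mean_growth) (use t1 in auto)
  then show ?thesis by (intro exI[of _ "max 1 t1"]) auto
qed

end

lemma block_length:
  fixes \<tau> \<epsilon> :: real assumes "0 < \<tau>" "0 < \<epsilon>" "\<epsilon> \<le> 1"
  obtains m :: nat where "0 < m" "\<tau> \<le> real m * \<epsilon>" "real m * \<epsilon> \<le> \<tau> + 1"
proof (rule that[of "nat \<lceil>\<tau> / \<epsilon>\<rceil>"])
  have p: "0 < \<tau> / \<epsilon>" using assms by simp
  then show "0 < nat \<lceil>\<tau> / \<epsilon>\<rceil>" by simp
  have r: "real (nat \<lceil>\<tau> / \<epsilon>\<rceil>) = of_int \<lceil>\<tau> / \<epsilon>\<rceil>" using p by (intro of_nat_nat) simp
  have "\<tau> / \<epsilon> \<le> real (nat \<lceil>\<tau> / \<epsilon>\<rceil>)" "real (nat \<lceil>\<tau> / \<epsilon>\<rceil>) \<le> \<tau> / \<epsilon> + 1" unfolding r by linarith+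
  then have "\<tau> / \<epsilon> * \<epsilon> \<le> real (nat \<lceil>\<tau> / \<epsilon>\<rceil>) * \<epsilon>" "real (nat \<lceil>\<tau> / \<epsilon>\<rceil>) * \<epsilon> \<le> (\<tau> / \<epsilon> + 1) * \<epsilon>"
    using assms by (auto intro!: mult_right_mono simp del: times_divide_eq_left)
  then show "\<tau> \<le> real (nat \<lceil>\<tau> / \<epsilon>\<rceil>) * \<epsilon>" "real (nat \<lceil>\<tau> / \<epsilon>\<rceil>) * \<epsilon> \<le> \<tau> + 1"
    using assms by (auto simp: distrib_right)
qed

theorem proposition6p4:
  fixes \<nu> :: "real^'d \<Rightarrow> real"
    and A :: "'n::finite \<Rightarrow> real^'d^'d"
    and M :: "real^'d^'d"
    and \<pi> :: "real^'n"
    and P :: "real^'n^'n"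
    and \<mu> :: "nat \<Rightarrow> real"
    and \<Omega> :: "nat \<Rightarrow> 'w measure"
    and X :: "nat \<Rightarrow> nat \<Rightarrow> 'w \<Rightarrow> 'n"
    and T :: "nat \<Rightarrow> nat \<Rightarrow> 'w \<Rightarrow> real"
  assumes "is_norm \<nu>"
    and "\<And>i. 0 < \<pi> $ i \<and> \<pi> $ i \<le> 1"
    and "(\<Sum>i\<in>UNIV. \<pi> $ i) = 1"
    and "M = (\<Sum>j\<in>UNIV. (\<pi> $ j) *\<^sub>R A j)"
    and "\<And>i. row i P = \<pi>"
    and "\<And>n. \<mu> n > 0"
    and "filterlim \<mu> at_top sequentially"
    and "condition_C M A"
    and "\<And>n. markov_process (\<Omega> n) (X n) (T n) \<pi> (\<mu> n) P"
  shows "(\<lambda>n. lyapunov_exponent \<nu> A (\<Omega> n) (X n) (T n)) \<longlonglongrightarrow> ereal (spectral_abscissa M)"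
proof -
  define A' where "A' i = endo_of ((*v) (A i))" for i
  define a where "a = Max (insert 1 (range (\<lambda>i. norm (A' i))))"
  have A': "app (A' i) x = A i *v x" for i x by (simp add: A'_def app_endo_of)
  interpret sw: switching A' "\<lambda>i. \<pi> $ i" a
  proof
    show "0 \<le> \<pi> $ i" for i using assms(2)[of i] by simp
    show "(\<Sum>i\<in>UNIV. \<pi> $ i) = 1" by fact
    show "1 \<le> a" "norm (A' i) \<le> a" for i unfolding a_def by (rule Max_ge; simp)+
  qed
  have M: "sw.M = endo_of ((*v) M)"
  proof (rule endo_eqI)
    fix x
    have "(\<Sum>j\<in>UNIV. (\<pi> $ j) *\<^sub>R A j) *v x = (\<Sum>j\<in>UNIV. ((\<pi> $ j) *\<^sub>R A j) *v x)"
      by (rule linear_sum[OF linear_matrix_vector_left])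
    also have "\<dots> = (\<Sum>j\<in>UNIV. (\<pi> $ j) *\<^sub>R (A j *v x))"
      by (simp add: linear_scale[OF linear_matrix_vector_left])
    finally show "app sw.M x = app (endo_of ((*v) M)) x" by (simp add: sw.app_M A' app_endo_of assms(4))
  qed
  define \<epsilon> where "\<epsilon> n = 1 / \<mu> n" for n
  have \<epsilon>: "0 < \<epsilon> n" for n using assms(6) by (simp add: \<epsilon>_def)
  have lim: "filterlim \<epsilon> (at_right 0) sequentially"
    using filterlim_compose[OF filterlim_inverse_at_right_top assms(7)] by (simp add: \<epsilon>_def[abs_def] inverse_eq_divide)
  have \<epsilon>1: "\<forall>\<^sub>F n in sequentially. \<epsilon> n \<le> 1"
  proof -
    have "\<forall>\<^sub>F e in at_right (0 :: real). e < 1" by (rule order_tendstoD(2)[OF tendsto_ident_at]) simp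
    from eventually_compose_filterlim[OF this lim] show ?thesis by (rule eventually_mono) simp
  qed
  have process: "matrix_switched_process (\<Omega> n) (X n) (T n) \<pi> (\<mu> n) P A a" for n
  proof -
    interpret markov_process "\<Omega> n" "X n" "T n" \<pi> "\<mu> n" P by (rule assms(9))
    show ?thesis
    proof
      show "0 \<le> \<pi> $ i" for i by (rule sw.p_nonneg)
      show "(\<Sum>i\<in>UNIV. \<pi> $ i) = 1" by fact
      show "1 \<le> a" by (rule sw.a_ge)
      show "norm (endo_of ((*v) (A i))) \<le> a" for i using sw.norm_A[of i] by (simp add: A'_def)
      show "P $ i $ j = \<pi> $ j" for i j using assms(5)[of i] by (auto simp: row_def vec_eq_iff)
    qed
  qed
  have K_eq: "switching.K (\<lambda>i. endo_of ((*v) (A i))) (\<lambda>i. \<pi> $ i) = sw.K" by (simp add: A'_def[abs_def])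
  have \<epsilon>_eq: "switched_process.\<epsilon> (\<mu> n) = \<epsilon> n" for n
    using matrix_switched_process.axioms(1)[OF process[of n]] by (simp add: switched_process.\<epsilon>_def \<epsilon>_def)
  define \<Xi> where "\<Xi> = Re ` complex_spectrum M"
  define \<Lambda> where "\<Lambda> = spectral_abscissa M"
  have \<Lambda>: "Max \<Xi> = \<Lambda>" by (simp add: \<Xi>_def \<Lambda>_def spectral_abscissa_def)
  have splitting: "spectral_splitting sw.M \<Xi> (real_part_space M)"
    unfolding M \<Xi>_def by (rule matrix_spectral_splitting)
  have \<Xi>0: "\<Xi> \<noteq> {}" by (simp add: \<Xi>_def complex_spectrum_nonempty)
  have trans: "\<exists>j. 0 < \<pi> $ j \<and> (\<forall>\<theta>\<in>real_part_space M \<eta>. norm \<theta> = 1 \<longrightarrow>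
      app (A' j) \<theta> \<notin> span (\<Union>\<zeta>\<in>{\<zeta> \<in> \<Xi>. \<zeta> \<le> \<eta>}. real_part_space M \<zeta>))" if \<eta>: "\<eta> \<in> \<Xi>" "\<eta> \<noteq> Max \<Xi>" for \<eta>
  proof -
    let ?W = "span (\<Union>\<zeta>\<in>{\<zeta> \<in> \<Xi>. \<zeta> \<le> \<eta>}. real_part_space M \<zeta>)"
    obtain i where i: "\<And>\<theta>. \<theta> \<in> real_part_space M \<eta> \<Longrightarrow> norm \<theta> = 1 \<Longrightarrow> sphere_field (A i) \<theta> \<notin> ?W"
      using assms(8) \<eta> unfolding condition_C_def \<Xi>_def[symmetric] \<Lambda> \<Lambda>_def by fastforce
    have "app (A' i) \<theta> \<notin> ?W" if \<theta>: "\<theta> \<in> real_part_space M \<eta>" "norm \<theta> = 1" for \<theta>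
    proof
      assume "app (A' i) \<theta> \<in> ?W"
      moreover have "\<theta> \<in> ?W" using \<theta>(1) \<eta>(1) by (intro span_base) auto
      ultimately have "sphere_field (A i) \<theta> \<in> ?W"
        unfolding sphere_field_def A' by (intro span_diff span_scale)
      then show False using i[OF \<theta>] by blast
    qed
    then show ?thesis using assms(2) by blast
  qed
  have upper: "\<forall>\<^sub>F n in sequentially. lyapunov_exponent \<nu> A (\<Omega> n) (X n) (T n) \<le> ereal (\<Lambda> + \<delta>)" if \<delta>: "0 < \<delta>" for \<delta>
  proof -
    obtain \<tau> where \<tau>: "0 < \<tau>" and ev: "\<forall>\<^sub>F e in at_right 0. \<forall>m b x. \<tau> \<le> real m * e \<longrightarrow> real m * e \<le> \<tau> + 1 \<longrightarrow>
      sw.E e (b * m) (\<lambda>y. ennreal (norm y)) x \<le> ennreal (exp ((\<Lambda> + \<delta>) * (real (b * m) * e)) * norm x)"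
      using sw.spectral_mean_growth[OF splitting \<delta>] unfolding \<Lambda> by blast
    show ?thesis using eventually_compose_filterlim[OF ev lim] \<epsilon>1
    proof eventually_elim
      case (elim n)
      interpret matrix_switched_process "\<Omega> n" "X n" "T n" \<pi> "\<mu> n" P A a by (rule process)
      obtain m where m: "0 < m" "\<tau> \<le> real m * \<epsilon> n" "real m * \<epsilon> n \<le> \<tau> + 1"
        using block_length[OF \<tau> \<epsilon> elim(2)] by metis
      show ?case
        using lyapunov_exponent_le[OF assms(1) m(1), of "\<Lambda> + \<delta>"] elim(1) m unfolding K_eq \<epsilon>_eq by blast
    qed
  qed
  have lower: "\<forall>\<^sub>F n in sequentially. ereal (\<Lambda> - \<delta>) \<le> lyapunov_exponent \<nu> A (\<Omega> n) (X n) (T n)" if \<delta>: "0 < \<delta>" for \<delta>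
  proof -
    define \<gamma> where "\<gamma> = \<Lambda> - \<delta> / 2"
    have d2: "0 < \<delta> / 2" using \<delta> by simp
    obtain \<tau> where \<tau>: "0 < \<tau>" and ev: "\<And>\<eta>. 0 < \<eta> \<Longrightarrow> \<forall>\<^sub>F e in at_right 0. \<forall>m. \<tau> \<le> real m * e \<longrightarrow> real m * e \<le> \<tau> + 1 \<longrightarrow>
      (\<exists>b0. \<forall>b\<ge>b0. \<forall>x. sw.E e (b * m) (\<lambda>y. sw.P e m {y'. norm y' < exp (\<gamma> * (real m * e)) * norm y} y) x \<le> ennreal \<eta>)"
      using sw.top_level_dominates[OF splitting \<Xi>0 d2 trans] unfolding \<Lambda> \<gamma>_def by blast
    \<comment> \<open>Block lengths lie in \<open>{\<tau>..\<tau> + 1}\<close>, so the loss is bounded uniformly in \<open>n\<close>.\<close>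
    define W where "W = 2 * (\<bar>\<gamma>\<bar> * (\<tau> + 1))^2 + 4 * (a * (\<tau> + 1))^2 + 1"
    define \<eta> where "\<eta> = \<delta> / 2 * \<tau> / W"
    have W: "0 < W" unfolding W_def by (intro add_nonneg_pos add_nonneg_nonneg) auto
    have \<eta>: "0 < \<eta>" using \<delta> \<tau> W by (simp add: \<eta>_def)
    show ?thesis using eventually_compose_filterlim[OF ev lim, of "\<eta>^2", OF zero_less_power[OF \<eta>]] \<epsilon>1
    proof eventually_elim
      case (elim n)
      interpret matrix_switched_process "\<Omega> n" "X n" "T n" \<pi> "\<mu> n" P A a by (rule process)
      obtain m where m: "0 < m" "\<tau> \<le> real m * \<epsilon> n" "real m * \<epsilon> n \<le> \<tau> + 1"
        using block_length[OF \<tau> \<epsilon> elim(2)] by metis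
      obtain b0 where b0: "\<And>b x. b0 \<le> b \<Longrightarrow> sw.E (\<epsilon> n) (b * m) (\<lambda>y. sw.P (\<epsilon> n) m {y'. norm y' < exp (\<gamma> * (real m * \<epsilon> n)) * norm y} y) x \<le> ennreal (\<eta>^2)"
        using elim(1) m by blast
      define V where "V = 2 * (\<gamma> * (real m * \<epsilon> n))^2 + 4 * (a * (real m * \<epsilon> n))^2 + 1"
      have main: "ereal (\<gamma> - V * \<eta> / (real m * \<epsilon> n)) \<le> lyapunov_exponent \<nu> A (\<Omega> n) (X n) (T n)"
        using lyapunov_exponent_ge[OF assms(1) m(1) \<eta>, of b0 \<gamma>] b0 unfolding V_def K_eq \<epsilon>_eq by blast
      have "V \<le> W"
      proof -
        have "\<bar>\<gamma> * (real m * \<epsilon> n)\<bar> \<le> \<bar>\<gamma>\<bar> * (\<tau> + 1)" "\<bar>a * (real m * \<epsilon> n)\<bar> \<le> a * (\<tau> + 1)"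
          using m \<tau> sw.a_ge by (auto simp: abs_mult intro!: mult_left_mono)
        then have "(\<gamma> * (real m * \<epsilon> n))^2 \<le> (\<bar>\<gamma>\<bar> * (\<tau> + 1))^2" "(a * (real m * \<epsilon> n))^2 \<le> (a * (\<tau> + 1))^2"
          by (auto simp: abs_le_square_iff[symmetric])
        then show ?thesis unfolding V_def W_def by linarith
      qed
      then have "V * \<eta> / (real m * \<epsilon> n) \<le> W * \<eta> / \<tau>"
        using \<eta> \<tau> m W by (intro frac_le mult_right_mono) auto
      also have "\<dots> = \<delta> / 2" using W \<tau> by (simp add: \<eta>_def)
      finally have "\<Lambda> - \<delta> \<le> \<gamma> - V * \<eta> / (real m * \<epsilon> n)" by (simp add: \<gamma>_def)
      then show ?case using main by (meson ereal_less_eq(3) order_trans)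
    qed
  qed
  show ?thesis unfolding \<Lambda>_def[symmetric]
  proof (rule order_tendstoI)
    fix c assume "c < ereal \<Lambda>"
    then obtain r where r: "c < ereal r" "ereal r < ereal \<Lambda>" using ereal_dense2 by blast
    have "\<forall>\<^sub>F n in sequentially. ereal (\<Lambda> - (\<Lambda> - r)) \<le> lyapunov_exponent \<nu> A (\<Omega> n) (X n) (T n)"
      using r(2) by (intro lower) simp
    then show "\<forall>\<^sub>F n in sequentially. c < lyapunov_exponent \<nu> A (\<Omega> n) (X n) (T n)"
      by (rule eventually_mono) (use r(1) in \<open>simp add: less_le_trans\<close>)
  next
    fix c assume "ereal \<Lambda> < c"
    then obtain r where r: "ereal \<Lambda> < ereal r" "ereal r < c" using ereal_dense2 by blast
    have "\<forall>\<^sub>F n in sequentially. lyapunov_exponent \<nu> A (\<Omega> n) (X n) (T n) \<le> ereal (\<Lambda> + (r - \<Lambda>))"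
      using r(1) by (intro upper) simp
    then show "\<forall>\<^sub>F n in sequentially. lyapunov_exponent \<nu> A (\<Omega> n) (X n) (T n) < c"
      by (rule eventually_mono) (use r(2) in \<open>simp add: le_less_trans\<close>)
  qed
qed

end
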